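(* Let $k$ be a field, and let $\phi:X\dashrightarrow Y$ and $\psi:Y\dashrightarrow Z$ be birational maps of $k$-varieties. Then $$c(\psi\circ\phi)=c(\phi)+c(\psi).$$
   Context: A variety over $k$ is an irreducible and reduced separated scheme of finite type over $k$. A birational map $\phi:X\dashrightarrow Y$ is an isomorphism at a (not necessarily closed) point $x\in X$ if there is an open $U\ni x$ such that $\phi|_U$ is an open embedding into $Y$; $\mathrm{Ex}(\phi)\subset X$ is the closed set of points at which $\phi$ is not an isomorphism. $\mathrm{Bir}_m/k$ is the set of birational classes of $m$-dimensional $k$-varieties and $\mathbb{Z}[\mathrm{Bir}_m/k]$ the free abelian group on it. For a birational map $\phi:X\dashrightarrow Y$ of $n$-dimensional $k$-varieties, $$c(\phi)=\sum_{y\in \mathrm{Ex}(\phi^{-1}),\ \mathrm{codim}_Y y=1}[k(y)]-\sum_{x\in \mathrm{Ex}(\phi),\ \mathrm{codim}_X x=1}[k(x)]\in\mathbb{Z}[\mathrm{Bir}_{n-1}/k],$$ where the residue fields $k(x),k(y)$ are identified with the corresponding birational classes. *)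

theory Defs
  imports
    "HOL-Analysis.Abstract_Topology"
    "HOL-Library.Extended_Nat"
    "HOL-Algebra.QuotRing"
    "HOL-Algebra.Generated_Rings"
    "HOL-Algebra.Generated_Groups"
    "HOL-Algebra.Free_Abelian_Groups"
begin

section \<open>Locally ringed spaces\<close>

text \<open>A space carrying a presheaf of rings. The values of \<open>sect\<close> and \<open>restr\<close> are meaningful only
  on open sets and, for \<open>restr\<close>, on carriers. Accordingly morphisms are compared with \<open>mor_eq\<close>
  below and not with HOL equality.\<close>

record ('p, 'r) ringed_space =
  topo :: "'p topology"
  sect :: "'p set \<Rightarrow> 'r ring"
  restr :: "'p set \<Rightarrow> 'p set \<Rightarrow> 'r \<Rightarrow> 'r"

abbreviation points :: "('p, 'r, 'm) ringed_space_scheme \<Rightarrow> 'p set" where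
  "points X \<equiv> topspace (topo X)"

definition presheaf_of_rings :: "('p, 'r, 'm) ringed_space_scheme \<Rightarrow> bool" where
  "presheaf_of_rings X \<longleftrightarrow>
     (\<forall>U. openin (topo X) U \<longrightarrow> cring (sect X U)) \<and>
     (\<forall>U V. openin (topo X) U \<longrightarrow> openin (topo X) V \<longrightarrow> V \<subseteq> U \<longrightarrow>
        restr X U V \<in> ring_hom (sect X U) (sect X V)) \<and>
     (\<forall>U. openin (topo X) U \<longrightarrow> (\<forall>s\<in>carrier (sect X U). restr X U U s = s)) \<and>
     (\<forall>U V W. openin (topo X) U \<longrightarrow> openin (topo X) V \<longrightarrow> openin (topo X) W \<longrightarrow> V \<subseteq> U \<longrightarrow> W \<subseteq> V \<longrightarrow>
        (\<forall>s\<in>carrier (sect X U). restr X V W (restr X U V s) = restr X U W s))"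

definition sheaf_of_rings :: "('p, 'r, 'm) ringed_space_scheme \<Rightarrow> bool" where
  "sheaf_of_rings X \<longleftrightarrow> presheaf_of_rings X \<and>
     (\<forall>\<U>. (\<forall>V\<in>\<U>. openin (topo X) V) \<longrightarrow>
        (\<forall>s\<in>carrier (sect X (\<Union>\<U>)). \<forall>t\<in>carrier (sect X (\<Union>\<U>)).
           (\<forall>V\<in>\<U>. restr X (\<Union>\<U>) V s = restr X (\<Union>\<U>) V t) \<longrightarrow> s = t) \<and>
        (\<forall>\<sigma>. (\<forall>V\<in>\<U>. \<sigma> V \<in> carrier (sect X V)) \<longrightarrow>
             (\<forall>V\<in>\<U>. \<forall>W\<in>\<U>. restr X V (V \<inter> W) (\<sigma> V) = restr X W (V \<inter> W) (\<sigma> W)) \<longrightarrow>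
             (\<exists>s\<in>carrier (sect X (\<Union>\<U>)). \<forall>V\<in>\<U>. restr X (\<Union>\<U>) V s = \<sigma> V)))"

type_synonym ('p, 'r) germ = "('p set \<times> 'r) set"

text \<open>The germ at \<open>x\<close> of a section \<open>s\<close> over \<open>U\<close>, as the equivalence class of \<open>(U, s)\<close>.\<close>

definition germ :: "('p, 'r, 'm) ringed_space_scheme \<Rightarrow> 'p \<Rightarrow> 'p set \<Rightarrow> 'r \<Rightarrow> ('p, 'r) germ" where
  "germ X x U s = {(V, t). openin (topo X) V \<and> x \<in> V \<and> t \<in> carrier (sect X V) \<and>
     (\<exists>W. openin (topo X) W \<and> x \<in> W \<and> W \<subseteq> U \<inter> V \<and> restr X U W s = restr X V W t)}"

text \<open>In the ring operations the unions range over all representatives; every representative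
  contributes the same class.\<close>

definition stalk :: "('p, 'r, 'm) ringed_space_scheme \<Rightarrow> 'p \<Rightarrow> ('p, 'r) germ ring" where
  "stalk X x =
     \<lparr>carrier = {germ X x U s |U s. openin (topo X) U \<and> x \<in> U \<and> s \<in> carrier (sect X U)},
      mult = (\<lambda>a b. \<Union>(U, s)\<in>a. \<Union>(V, t)\<in>b. germ X x (U \<inter> V)
                (restr X U (U \<inter> V) s \<otimes>\<^bsub>sect X (U \<inter> V)\<^esub> restr X V (U \<inter> V) t)),
      one = germ X x (points X) \<one>\<^bsub>sect X (points X)\<^esub>,
      ring.zero = germ X x (points X) \<zero>\<^bsub>sect X (points X)\<^esub>,
      ring.add = (\<lambda>a b. \<Union>(U, s)\<in>a. \<Union>(V, t)\<in>b. germ X x (U \<inter> V)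
                (restr X U (U \<inter> V) s \<oplus>\<^bsub>sect X (U \<inter> V)\<^esub> restr X V (U \<inter> V) t))\<rparr>"

definition local_ring :: "'a ring \<Rightarrow> bool" where
  "local_ring R \<longleftrightarrow> cring R \<and> (\<exists>!M. maximalideal M R)"

definition max_ideal :: "'a ring \<Rightarrow> 'a set" where
  "max_ideal R = (THE M. maximalideal M R)"

definition locally_ringed_space :: "('p, 'r, 'm) ringed_space_scheme \<Rightarrow> bool" where
  "locally_ringed_space X \<longleftrightarrow> sheaf_of_rings X \<and> (\<forall>x\<in>points X. local_ring (stalk X x))"

definition residue_field ::
  "('p, 'r, 'm) ringed_space_scheme \<Rightarrow> 'p \<Rightarrow> ('p, 'r) germ set ring" where
  "residue_field X x = stalk X x Quot max_ideal (stalk X x)"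


subsection \<open>Morphisms\<close>

text \<open>For \<open>f : X \<rightarrow> Y\<close>, \<open>pull f V\<close> is the map on sections from \<open>V\<close> to its preimage.\<close>

record ('p, 'r, 'q, 's) rs_mor =
  base :: "'p \<Rightarrow> 'q"
  pull :: "'q set \<Rightarrow> 's \<Rightarrow> 'r"

definition preimg ::
  "('p, 'r, 'm) ringed_space_scheme \<Rightarrow> ('p, 'r, 'q, 's) rs_mor \<Rightarrow> 'q set \<Rightarrow> 'p set" where
  "preimg X f V = {x \<in> points X. base f x \<in> V}"

definition lrs_mor :: "('p, 'r, 'm) ringed_space_scheme \<Rightarrow> ('q, 's, 'n) ringed_space_scheme \<Rightarrow>
    ('p, 'r, 'q, 's) rs_mor \<Rightarrow> bool" where
  "lrs_mor X Y f \<longleftrightarrow>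
     continuous_map (topo X) (topo Y) (base f) \<and>
     (\<forall>V. openin (topo Y) V \<longrightarrow> pull f V \<in> ring_hom (sect Y V) (sect X (preimg X f V))) \<and>
     (\<forall>V W. openin (topo Y) V \<longrightarrow> openin (topo Y) W \<longrightarrow> W \<subseteq> V \<longrightarrow>
        (\<forall>s\<in>carrier (sect Y V).
           pull f W (restr Y V W s) = restr X (preimg X f V) (preimg X f W) (pull f V s))) \<and>
     (\<forall>x\<in>points X. \<forall>V. openin (topo Y) V \<longrightarrow> base f x \<in> V \<longrightarrow>
        (\<forall>s\<in>carrier (sect Y V).
           germ X x (preimg X f V) (pull f V s) \<in> max_ideal (stalk X x) \<longleftrightarrow>
           germ Y (base f x) V s \<in> max_ideal (stalk Y (base f x))))"

definition mor_eq :: "('p, 'r, 'm) ringed_space_scheme \<Rightarrow> ('q, 's, 'n) ringed_space_scheme \<Rightarrow>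
    ('p, 'r, 'q, 's) rs_mor \<Rightarrow> ('p, 'r, 'q, 's) rs_mor \<Rightarrow> bool" where
  "mor_eq X Y f g \<longleftrightarrow>
     (\<forall>x\<in>points X. base f x = base g x) \<and>
     (\<forall>V. openin (topo Y) V \<longrightarrow> (\<forall>s\<in>carrier (sect Y V). pull f V s = pull g V s))"

definition id_mor :: "('p, 'r, 'p, 'r) rs_mor" where
  "id_mor = \<lparr>base = (\<lambda>x. x), pull = (\<lambda>V s. s)\<rparr>"

text \<open>\<open>comp_mor Y g f\<close> is \<open>g \<circ> f\<close> for \<open>f : X \<rightarrow> Y\<close> and \<open>g : Y \<rightarrow> Z\<close>.\<close>

definition comp_mor :: "('q, 's, 'n) ringed_space_scheme \<Rightarrow> ('q, 's, 't, 'u) rs_mor \<Rightarrow>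
    ('p, 'r, 'q, 's) rs_mor \<Rightarrow> ('p, 'r, 't, 'u) rs_mor" where
  "comp_mor Y g f =
     \<lparr>base = base g \<circ> base f, pull = (\<lambda>W s. pull f (preimg Y g W) (pull g W s))\<rparr>"

definition lrs_iso :: "('p, 'r, 'm) ringed_space_scheme \<Rightarrow> ('q, 's, 'n) ringed_space_scheme \<Rightarrow>
    ('p, 'r, 'q, 's) rs_mor \<Rightarrow> bool" where
  "lrs_iso X Y f \<longleftrightarrow> lrs_mor X Y f \<and>
     (\<exists>g. lrs_mor Y X g \<and>
        mor_eq X X (comp_mor Y g f) id_mor \<and> mor_eq Y Y (comp_mor X f g) id_mor)"

definition open_subspace ::
  "('p, 'r, 'm) ringed_space_scheme \<Rightarrow> 'p set \<Rightarrow> ('p, 'r) ringed_space" where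
  "open_subspace X U = \<lparr>topo = subtopology (topo X) U, sect = sect X, restr = restr X\<rparr>"

definition restr_mor :: "('p, 'r, 'm) ringed_space_scheme \<Rightarrow> 'p set \<Rightarrow>
    ('p, 'r, 'q, 's) rs_mor \<Rightarrow> ('p, 'r, 'q, 's) rs_mor" where
  "restr_mor X U f =
     \<lparr>base = base f,
      pull = (\<lambda>V s. restr X (preimg X f V) (preimg X f V \<inter> U) (pull f V s))\<rparr>"

definition open_embedding :: "('p, 'r, 'm) ringed_space_scheme \<Rightarrow>
    ('q, 's, 'n) ringed_space_scheme \<Rightarrow> ('p, 'r, 'q, 's) rs_mor \<Rightarrow> bool" where
  "open_embedding X Y f \<longleftrightarrow> lrs_mor X Y f \<and>
     openin (topo Y) (base f ` points X) \<and>
     lrs_iso X (open_subspace Y (base f ` points X)) f"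

definition closed_immersion :: "('p, 'r, 'm) ringed_space_scheme \<Rightarrow>
    ('q, 's, 'n) ringed_space_scheme \<Rightarrow> ('p, 'r, 'q, 's) rs_mor \<Rightarrow> bool" where
  "closed_immersion X Y f \<longleftrightarrow> lrs_mor X Y f \<and>
     embedding_map (topo X) (topo Y) (base f) \<and>
     closedin (topo Y) (base f ` points X) \<and>
     (\<forall>V. openin (topo Y) V \<longrightarrow> (\<forall>s\<in>carrier (sect X (preimg X f V)). \<forall>y\<in>V.
        \<exists>W. openin (topo Y) W \<and> y \<in> W \<and> W \<subseteq> V \<and>
          (\<exists>t\<in>carrier (sect Y W). pull f W t = restr X (preimg X f V) (preimg X f W) s)))"


section \<open>Affine schemes and schemes\<close>

text \<open>The fraction \<open>a/b\<close> in the localization of \<open>R\<close> at the prime \<open>P\<close>, as an equivalence class.\<close>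

definition frac :: "'a ring \<Rightarrow> 'a set \<Rightarrow> 'a \<Rightarrow> 'a \<Rightarrow> ('a \<times> 'a) set" where
  "frac R P a b = {(c, d). c \<in> carrier R \<and> d \<in> carrier R - P \<and>
     (\<exists>u\<in>carrier R - P. u \<otimes>\<^bsub>R\<^esub> (a \<otimes>\<^bsub>R\<^esub> d) = u \<otimes>\<^bsub>R\<^esub> (c \<otimes>\<^bsub>R\<^esub> b))}"

definition localization :: "'a ring \<Rightarrow> 'a set \<Rightarrow> ('a \<times> 'a) set ring" where
  "localization R P =
     \<lparr>carrier = {frac R P a b |a b. a \<in> carrier R \<and> b \<in> carrier R - P},
      mult = (\<lambda>x y. \<Union>(a, b)\<in>x. \<Union>(c, d)\<in>y. frac R P (a \<otimes>\<^bsub>R\<^esub> c) (b \<otimes>\<^bsub>R\<^esub> d)),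
      one = frac R P \<one>\<^bsub>R\<^esub> \<one>\<^bsub>R\<^esub>,
      ring.zero = frac R P \<zero>\<^bsub>R\<^esub> \<one>\<^bsub>R\<^esub>,
      ring.add = (\<lambda>x y. \<Union>(a, b)\<in>x. \<Union>(c, d)\<in>y.
               frac R P (a \<otimes>\<^bsub>R\<^esub> d \<oplus>\<^bsub>R\<^esub> c \<otimes>\<^bsub>R\<^esub> b) (b \<otimes>\<^bsub>R\<^esub> d))\<rparr>"

text \<open>The ringed space on \<open>T\<close> whose sections over \<open>W\<close> are the functions sending \<open>p \<in> W\<close> into the
  ring \<open>L p\<close> that, near each point of \<open>W\<close>, agree with a member of \<open>G\<close>.\<close>

definition locally_in_space ::
  "'p topology \<Rightarrow> ('p \<Rightarrow> 'a ring) \<Rightarrow> ('p set \<Rightarrow> ('p \<Rightarrow> 'a) set) \<Rightarrow> ('p, 'p \<Rightarrow> 'a) ringed_space" where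
  "locally_in_space T L G =
     \<lparr>topo = T,
      sect = (\<lambda>W.
        \<lparr>carrier = {s \<in> (\<Pi>\<^sub>E p\<in>W. carrier (L p)).
           \<forall>p\<in>W. \<exists>N. openin T N \<and> p \<in> N \<and> N \<subseteq> W \<and> (\<exists>\<sigma>\<in>G N. \<forall>q\<in>N. s q = \<sigma> q)},
         mult = (\<lambda>s t. \<lambda>p\<in>W. s p \<otimes>\<^bsub>L p\<^esub> t p),
         one = (\<lambda>p\<in>W. \<one>\<^bsub>L p\<^esub>),
         ring.zero = (\<lambda>p\<in>W. \<zero>\<^bsub>L p\<^esub>),
         ring.add = (\<lambda>s t. \<lambda>p\<in>W. s p \<oplus>\<^bsub>L p\<^esub> t p)\<rparr>),
      restr = (\<lambda>U V s. restrict s V)\<rparr>"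

definition Spec :: "'a ring \<Rightarrow> ('a set, 'a set \<Rightarrow> ('a \<times> 'a) set) ringed_space" where
  "Spec A = locally_in_space
     (topology_generated_by {{P. primeideal P A \<and> a \<notin> P} |a. a \<in> carrier A})
     (localization A)
     (\<lambda>N. {\<lambda>P. frac A P a b |a b. a \<in> carrier A \<and> b \<in> carrier A \<and> (\<forall>P\<in>N. b \<notin> P)})"

text \<open>It is enough to let \<open>A\<close> range over rings whose elements have the type of the sections of
  \<open>X\<close>, because \<open>A\<close> is then isomorphic to the ring of sections over \<open>U\<close>.\<close>

definition affine_open :: "('p, 'r, 'm) ringed_space_scheme \<Rightarrow> 'p set \<Rightarrow> bool" where
  "affine_open X U \<longleftrightarrow> openin (topo X) U \<and>
     (\<exists>(A :: 'r ring) f. cring A \<and> lrs_iso (open_subspace X U) (Spec A) f)"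

definition is_scheme :: "('p, 'r, 'm) ringed_space_scheme \<Rightarrow> bool" where
  "is_scheme X \<longleftrightarrow> locally_ringed_space X \<and> (\<forall>x\<in>points X. \<exists>U. x \<in> U \<and> affine_open X U)"

definition reduced :: "('p, 'r, 'm) ringed_space_scheme \<Rightarrow> bool" where
  "reduced X \<longleftrightarrow> (\<forall>U. openin (topo X) U \<longrightarrow>
     (\<forall>s\<in>carrier (sect X U). \<forall>n::nat. s [^]\<^bsub>sect X U\<^esub> n = \<zero>\<^bsub>sect X U\<^esub> \<longrightarrow> s = \<zero>\<^bsub>sect X U\<^esub>))"


subsection \<open>Irreducibility, dimension and codimension\<close>

definition irreducible_subset :: "'p topology \<Rightarrow> 'p set \<Rightarrow> bool" where
  "irreducible_subset T S \<longleftrightarrow> S \<subseteq> topspace T \<and> S \<noteq> {} \<and>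
     (\<forall>A B. closedin T A \<longrightarrow> closedin T B \<longrightarrow> S \<subseteq> A \<union> B \<longrightarrow> S \<subseteq> A \<or> S \<subseteq> B)"

definition irr_chain :: "'p topology \<Rightarrow> nat \<Rightarrow> (nat \<Rightarrow> 'p set) \<Rightarrow> bool" where
  "irr_chain T n C \<longleftrightarrow>
     (\<forall>i\<le>n. closedin T (C i) \<and> irreducible_subset T (C i)) \<and> (\<forall>i<n. C i \<subset> C (Suc i))"

definition krull_dim :: "'p topology \<Rightarrow> enat" where
  "krull_dim T = Sup {enat n |n. \<exists>C. irr_chain T n C}"

text \<open>The codimension of a point is the codimension of its closure.\<close>

definition codim :: "'p topology \<Rightarrow> 'p \<Rightarrow> enat" where
  "codim T x = Sup {enat n |n. \<exists>C. irr_chain T n C \<and> C 0 = T closure_of {x}}"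

definition generic_point :: "'p topology \<Rightarrow> 'p" where
  "generic_point T = (THE x. x \<in> topspace T \<and> T closure_of {x} = topspace T)"


section \<open>Schemes over a field\<close>

record ('p, 'r, 'k) over_space = "('p, 'r) ringed_space" +
  str :: "('p, 'r, 'k set, 'k set \<Rightarrow> ('k \<times> 'k) set) rs_mor"

definition k_scheme :: "'k ring \<Rightarrow> ('p, 'r, 'k) over_space \<Rightarrow> bool" where
  "k_scheme k X \<longleftrightarrow> is_scheme X \<and> lrs_mor X (Spec k) (str X)"

definition k_mor :: "'k ring \<Rightarrow> ('p, 'r, 'k) over_space \<Rightarrow> ('q, 's, 'k) over_space \<Rightarrow>
    ('p, 'r, 'q, 's) rs_mor \<Rightarrow> bool" where
  "k_mor k X Y f \<longleftrightarrow> lrs_mor X Y f \<and> mor_eq X (Spec k) (comp_mor Y (str Y) f) (str X)"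

definition open_subscheme ::
  "('p, 'r, 'k) over_space \<Rightarrow> 'p set \<Rightarrow> ('p, 'r, 'k) over_space" where
  "open_subscheme X U =
     \<lparr>topo = subtopology (topo X) U, sect = sect X, restr = restr X,
      str = restr_mor X U (str X)\<rparr>"

text \<open>The maps from \<open>k\<close> to the sections over \<open>U\<close>, to the stalk and to the residue field at \<open>x\<close>
  that are induced by the structure morphism.\<close>

definition scalar :: "'k ring \<Rightarrow> ('p, 'r, 'k) over_space \<Rightarrow> 'p set \<Rightarrow> 'k \<Rightarrow> 'r" where
  "scalar k X U c = restr X (points X) U
     (pull (str X) (points (Spec k)) (\<lambda>P\<in>points (Spec k). frac k P c \<one>\<^bsub>k\<^esub>))"

definition scalar_stalk ::
  "'k ring \<Rightarrow> ('p, 'r, 'k) over_space \<Rightarrow> 'p \<Rightarrow> 'k \<Rightarrow> ('p, 'r) germ" where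
  "scalar_stalk k X x c = germ X x (points X) (scalar k X (points X) c)"

definition scalar_residue ::
  "'k ring \<Rightarrow> ('p, 'r, 'k) over_space \<Rightarrow> 'p \<Rightarrow> 'k \<Rightarrow> ('p, 'r) germ set" where
  "scalar_residue k X x c = max_ideal (stalk X x) +>\<^bsub>stalk X x\<^esub> scalar_stalk k X x c"

definition finite_type :: "'k ring \<Rightarrow> ('p, 'r, 'k) over_space \<Rightarrow> bool" where
  "finite_type k X \<longleftrightarrow> (\<exists>\<U>. finite \<U> \<and> \<Union>\<U> = points X \<and>
     (\<forall>U\<in>\<U>. affine_open X U \<and>
        (\<exists>S. finite S \<and> S \<subseteq> carrier (sect X U) \<and>
           generate_ring (sect X U) (scalar k X U ` carrier k \<union> S) = carrier (sect X U))))"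


subsection \<open>Tensor products and fibre products over a field\<close>

text \<open>The tensor product of two commutative \<open>k\<close>-algebras \<open>A\<close> and \<open>B\<close> with structure maps \<open>i\<close> and
  \<open>j\<close>: the free abelian group on pairs \<open>(a, b)\<close>, which stand for pure tensors, modulo bilinearity.\<close>

definition tensor_null :: "'k ring \<Rightarrow> 'a ring \<Rightarrow> ('k \<Rightarrow> 'a) \<Rightarrow> 'b ring \<Rightarrow> ('k \<Rightarrow> 'b) \<Rightarrow>
    (('a \<times> 'b) \<Rightarrow>\<^sub>0 int) set" where
  "tensor_null k A i B j = generate (free_Abelian_group (carrier A \<times> carrier B))
     ({frag_of (a \<oplus>\<^bsub>A\<^esub> a', b) - frag_of (a, b) - frag_of (a', b) |a a' b.
         a \<in> carrier A \<and> a' \<in> carrier A \<and> b \<in> carrier B} \<union>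
      {frag_of (a, b \<oplus>\<^bsub>B\<^esub> b') - frag_of (a, b) - frag_of (a, b') |a b b'.
         a \<in> carrier A \<and> b \<in> carrier B \<and> b' \<in> carrier B} \<union>
      {frag_of (i c \<otimes>\<^bsub>A\<^esub> a, b) - frag_of (a, j c \<otimes>\<^bsub>B\<^esub> b) |c a b.
         c \<in> carrier k \<and> a \<in> carrier A \<and> b \<in> carrier B})"

definition tensor_class :: "'k ring \<Rightarrow> 'a ring \<Rightarrow> ('k \<Rightarrow> 'a) \<Rightarrow> 'b ring \<Rightarrow> ('k \<Rightarrow> 'b) \<Rightarrow>
    (('a \<times> 'b) \<Rightarrow>\<^sub>0 int) \<Rightarrow> (('a \<times> 'b) \<Rightarrow>\<^sub>0 int) set" where
  "tensor_class k A i B j h =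
     tensor_null k A i B j #>\<^bsub>free_Abelian_group (carrier A \<times> carrier B)\<^esub> h"

definition tensor_mult ::
  "'a ring \<Rightarrow> 'b ring \<Rightarrow> (('a \<times> 'b) \<Rightarrow>\<^sub>0 int) \<Rightarrow> (('a \<times> 'b) \<Rightarrow>\<^sub>0 int) \<Rightarrow> (('a \<times> 'b) \<Rightarrow>\<^sub>0 int)" where
  "tensor_mult A B g h =
     frag_extend (\<lambda>(a, b). frag_extend (\<lambda>(a', b'). frag_of (a \<otimes>\<^bsub>A\<^esub> a', b \<otimes>\<^bsub>B\<^esub> b')) h) g"

definition tensor :: "'k ring \<Rightarrow> 'a ring \<Rightarrow> ('k \<Rightarrow> 'a) \<Rightarrow> 'b ring \<Rightarrow> ('k \<Rightarrow> 'b) \<Rightarrow>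
    (('a \<times> 'b) \<Rightarrow>\<^sub>0 int) set ring" where
  "tensor k A i B j =
     \<lparr>carrier = tensor_class k A i B j ` carrier (free_Abelian_group (carrier A \<times> carrier B)),
      mult = (\<lambda>C D. \<Union>g\<in>C. \<Union>h\<in>D. tensor_class k A i B j (tensor_mult A B g h)),
      one = tensor_class k A i B j (frag_of (\<one>\<^bsub>A\<^esub>, \<one>\<^bsub>B\<^esub>)),
      ring.zero = tensor_class k A i B j 0,
      ring.add = (\<lambda>C D. \<Union>g\<in>C. \<Union>h\<in>D. tensor_class k A i B j (g + h))\<rparr>"

abbreviation stalk_tensor where
  "stalk_tensor k X Y x y \<equiv>
     tensor k (stalk X x) (scalar_stalk k X x) (stalk Y y) (scalar_stalk k Y y)"

abbreviation stalk_tensor_class where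
  "stalk_tensor_class k X Y x y \<equiv>
     tensor_class k (stalk X x) (scalar_stalk k X x) (stalk Y y) (scalar_stalk k Y y)"

text \<open>The image in the tensor product of the stalks at \<open>(x, y)\<close> of a sum \<open>h\<close> of pure tensors of
  sections over \<open>U\<close> and \<open>V\<close>.\<close>

definition germ_tensor :: "'k ring \<Rightarrow> ('p, 'r, 'k) over_space \<Rightarrow> ('q, 's, 'k) over_space \<Rightarrow>
    'p set \<Rightarrow> 'q set \<Rightarrow> (('r \<times> 's) \<Rightarrow>\<^sub>0 int) \<Rightarrow> 'p \<Rightarrow> 'q \<Rightarrow>
    ((('p, 'r) germ \<times> ('q, 's) germ) \<Rightarrow>\<^sub>0 int) set" where
  "germ_tensor k X Y U V h x y = stalk_tensor_class k X Y x y
     (frag_extend (\<lambda>(s, t). frag_of (germ X x U s, germ Y y V t)) h)"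

text \<open>The fibre product of \<open>X\<close> and \<open>Y\<close> over \<open>Spec k\<close>, in its explicit description as a locally
  ringed space. Its points are the triples \<open>(x, y, Q)\<close> where \<open>Q\<close> is a prime ideal of the tensor
  product over \<open>k\<close> of the two stalks and lies over both maximal ideals; the local ring at such a
  point is the localization of that tensor product at \<open>Q\<close>. Topology and sections are those coming
  from tensors of sections.\<close>

type_synonym ('p, 'r, 'q, 's) prod_pt =
  "'p \<times> 'q \<times> ((('p, 'r) germ \<times> ('q, 's) germ) \<Rightarrow>\<^sub>0 int) set set"

type_synonym ('p, 'r, 'q, 's) prod_sec =
  "('p, 'r, 'q, 's) prod_pt \<Rightarrow>
     (((('p, 'r) germ \<times> ('q, 's) germ) \<Rightarrow>\<^sub>0 int) set \<times>
      ((('p, 'r) germ \<times> ('q, 's) germ) \<Rightarrow>\<^sub>0 int) set) set"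

definition prod_points :: "'k ring \<Rightarrow> ('p, 'r, 'k) over_space \<Rightarrow> ('q, 's, 'k) over_space \<Rightarrow>
    ('p, 'r, 'q, 's) prod_pt set" where
  "prod_points k X Y = {(x, y, Q). x \<in> points X \<and> y \<in> points Y \<and>
     primeideal Q (stalk_tensor k X Y x y) \<and>
     (\<forall>a\<in>carrier (stalk X x).
        stalk_tensor_class k X Y x y (frag_of (a, \<one>\<^bsub>stalk Y y\<^esub>)) \<in> Q \<longleftrightarrow> a \<in> max_ideal (stalk X x)) \<and>
     (\<forall>b\<in>carrier (stalk Y y).
        stalk_tensor_class k X Y x y (frag_of (\<one>\<^bsub>stalk X x\<^esub>, b)) \<in> Q \<longleftrightarrow> b \<in> max_ideal (stalk Y y))}"

definition prod_topology :: "'k ring \<Rightarrow> ('p, 'r, 'k) over_space \<Rightarrow> ('q, 's, 'k) over_space \<Rightarrow>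
    ('p, 'r, 'q, 's) prod_pt topology" where
  "prod_topology k X Y = topology_generated_by
     {{(x, y, Q) \<in> prod_points k X Y. x \<in> U \<and> y \<in> V \<and> germ_tensor k X Y U V h x y \<notin> Q} |U V h.
        openin (topo X) U \<and> openin (topo Y) V \<and>
        h \<in> carrier (free_Abelian_group (carrier (sect X U) \<times> carrier (sect Y V)))}"

definition fibre_prod :: "'k ring \<Rightarrow> ('p, 'r, 'k) over_space \<Rightarrow> ('q, 's, 'k) over_space \<Rightarrow>
    (('p, 'r, 'q, 's) prod_pt, ('p, 'r, 'q, 's) prod_sec) ringed_space" where
  "fibre_prod k X Y = locally_in_space (prod_topology k X Y)
     (\<lambda>(x, y, Q). localization (stalk_tensor k X Y x y) Q)
     (\<lambda>N. {\<lambda>(x, y, Q). frac (stalk_tensor k X Y x y) Q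
              (germ_tensor k X Y U V g x y) (germ_tensor k X Y U V h x y) |U V g h.
             openin (topo X) U \<and> openin (topo Y) V \<and>
             g \<in> carrier (free_Abelian_group (carrier (sect X U) \<times> carrier (sect Y V))) \<and>
             h \<in> carrier (free_Abelian_group (carrier (sect X U) \<times> carrier (sect Y V))) \<and>
             (\<forall>(x, y, Q)\<in>N. x \<in> U \<and> y \<in> V \<and> germ_tensor k X Y U V h x y \<notin> Q)})"

definition prod_fst :: "'k ring \<Rightarrow> ('p, 'r, 'k) over_space \<Rightarrow> ('q, 's, 'k) over_space \<Rightarrow>
    (('p, 'r, 'q, 's) prod_pt, ('p, 'r, 'q, 's) prod_sec, 'p, 'r) rs_mor" where
  "prod_fst k X Y =
     \<lparr>base = (\<lambda>(x, y, Q). x),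
      pull = (\<lambda>U s. \<lambda>(x, y, Q)\<in>{(x, y, Q) \<in> prod_points k X Y. x \<in> U}.
        frac (stalk_tensor k X Y x y) Q
          (stalk_tensor_class k X Y x y (frag_of (germ X x U s, \<one>\<^bsub>stalk Y y\<^esub>)))
          \<one>\<^bsub>stalk_tensor k X Y x y\<^esub>)\<rparr>"

definition prod_snd :: "'k ring \<Rightarrow> ('p, 'r, 'k) over_space \<Rightarrow> ('q, 's, 'k) over_space \<Rightarrow>
    (('p, 'r, 'q, 's) prod_pt, ('p, 'r, 'q, 's) prod_sec, 'q, 's) rs_mor" where
  "prod_snd k X Y =
     \<lparr>base = (\<lambda>(x, y, Q). y),
      pull = (\<lambda>V t. \<lambda>(x, y, Q)\<in>{(x, y, Q) \<in> prod_points k X Y. y \<in> V}.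
        frac (stalk_tensor k X Y x y) Q
          (stalk_tensor_class k X Y x y (frag_of (\<one>\<^bsub>stalk X x\<^esub>, germ Y y V t)))
          \<one>\<^bsub>stalk_tensor k X Y x y\<^esub>)\<rparr>"

text \<open>The diagonal is the morphism whose composites with both projections are the identity.\<close>

definition separated :: "'k ring \<Rightarrow> ('p, 'r, 'k) over_space \<Rightarrow> bool" where
  "separated k X \<longleftrightarrow> (\<exists>\<delta>. closed_immersion X (fibre_prod k X X) \<delta> \<and>
     mor_eq X X (comp_mor (fibre_prod k X X) (prod_fst k X X) \<delta>) id_mor \<and>
     mor_eq X X (comp_mor (fibre_prod k X X) (prod_snd k X X) \<delta>) id_mor)"


subsection \<open>Varieties\<close>

definition k_variety :: "'k ring \<Rightarrow> ('p, 'r, 'k) over_space \<Rightarrow> bool" where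
  "k_variety k X \<longleftrightarrow> k_scheme k X \<and> irreducible_subset (topo X) (points X) \<and> reduced X \<and>
     separated k X \<and> finite_type k X"


section \<open>Rational and birational maps\<close>

text \<open>A rational map is an equivalence class of morphisms defined on dense open subschemes.\<close>

definition dense_open :: "'p topology \<Rightarrow> 'p set \<Rightarrow> bool" where
  "dense_open T U \<longleftrightarrow> openin T U \<and> T closure_of U = topspace T"

definition partial_mors :: "'k ring \<Rightarrow> ('p, 'r, 'k) over_space \<Rightarrow> ('q, 's, 'k) over_space \<Rightarrow>
    ('p set \<times> ('p, 'r, 'q, 's) rs_mor) set" where
  "partial_mors k X Y = {(U, f). dense_open (topo X) U \<and> k_mor k (open_subscheme X U) Y f}"

definition rat_rel :: "'k ring \<Rightarrow> ('p, 'r, 'k) over_space \<Rightarrow> ('q, 's, 'k) over_space \<Rightarrow>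
    (('p set \<times> ('p, 'r, 'q, 's) rs_mor) \<times> ('p set \<times> ('p, 'r, 'q, 's) rs_mor)) set" where
  "rat_rel k X Y = {((U, f), (V, g)). (U, f) \<in> partial_mors k X Y \<and> (V, g) \<in> partial_mors k X Y \<and>
     (\<exists>W. dense_open (topo X) W \<and> W \<subseteq> U \<inter> V \<and>
        mor_eq (open_subscheme X W) Y
          (restr_mor (open_subscheme X U) W f) (restr_mor (open_subscheme X V) W g))}"

type_synonym ('p, 'r, 'q, 's) rat_map = "('p set \<times> ('p, 'r, 'q, 's) rs_mor) set"

definition rational_maps :: "'k ring \<Rightarrow> ('p, 'r, 'k) over_space \<Rightarrow> ('q, 's, 'k) over_space \<Rightarrow>
    ('p, 'r, 'q, 's) rat_map set" where
  "rational_maps k X Y = partial_mors k X Y // rat_rel k X Y"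

definition dominant :: "('q, 's, 'k) over_space \<Rightarrow> ('p, 'r, 'q, 's) rat_map \<Rightarrow> bool" where
  "dominant Y \<phi> \<longleftrightarrow> (\<forall>(U, f)\<in>\<phi>. topo Y closure_of (base f ` U) = points Y)"

definition rat_id :: "'k ring \<Rightarrow> ('p, 'r, 'k) over_space \<Rightarrow> ('p, 'r, 'p, 'r) rat_map" where
  "rat_id k X = rat_rel k X X `` {(points X, id_mor)}"

text \<open>\<open>rat_comp k X Y Z \<psi> \<phi>\<close> is \<open>\<psi> \<circ> \<phi>\<close> for dominant \<open>\<phi> : X \<dashrightarrow> Y\<close> and \<open>\<psi> : Y \<dashrightarrow> Z\<close>.\<close>

definition rat_comp :: "'k ring \<Rightarrow> ('p, 'r, 'k) over_space \<Rightarrow> ('q, 's, 'k) over_space \<Rightarrow>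
    ('t, 'u, 'k) over_space \<Rightarrow> ('q, 's, 't, 'u) rat_map \<Rightarrow> ('p, 'r, 'q, 's) rat_map \<Rightarrow>
    ('p, 'r, 't, 'u) rat_map" where
  "rat_comp k X Y Z \<psi> \<phi> = rat_rel k X Z ``
     {(preimg (open_subscheme X U) f V, comp_mor (open_subscheme Y V) g f) |U f V g.
        (U, f) \<in> \<phi> \<and> (V, g) \<in> \<psi>}"

definition rat_inverse_of :: "'k ring \<Rightarrow> ('p, 'r, 'k) over_space \<Rightarrow> ('q, 's, 'k) over_space \<Rightarrow>
    ('p, 'r, 'q, 's) rat_map \<Rightarrow> ('q, 's, 'p, 'r) rat_map \<Rightarrow> bool" where
  "rat_inverse_of k X Y \<phi> \<psi> \<longleftrightarrow> \<psi> \<in> rational_maps k Y X \<and> dominant X \<psi> \<and>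
     rat_comp k X Y X \<psi> \<phi> = rat_id k X \<and> rat_comp k Y X Y \<phi> \<psi> = rat_id k Y"

definition birational_map :: "'k ring \<Rightarrow> ('p, 'r, 'k) over_space \<Rightarrow> ('q, 's, 'k) over_space \<Rightarrow>
    ('p, 'r, 'q, 's) rat_map \<Rightarrow> bool" where
  "birational_map k X Y \<phi> \<longleftrightarrow> \<phi> \<in> rational_maps k X Y \<and> dominant Y \<phi> \<and>
     (\<exists>\<psi>. rat_inverse_of k X Y \<phi> \<psi>)"

definition rat_inv :: "'k ring \<Rightarrow> ('p, 'r, 'k) over_space \<Rightarrow> ('q, 's, 'k) over_space \<Rightarrow>
    ('p, 'r, 'q, 's) rat_map \<Rightarrow> ('q, 's, 'p, 'r) rat_map" where
  "rat_inv k X Y \<phi> = (THE \<psi>. rat_inverse_of k X Y \<phi> \<psi>)"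

definition iso_at :: "('p, 'r, 'k) over_space \<Rightarrow> ('q, 's, 'k) over_space \<Rightarrow>
    ('p, 'r, 'q, 's) rat_map \<Rightarrow> 'p \<Rightarrow> bool" where
  "iso_at X Y \<phi> x \<longleftrightarrow> (\<exists>(U, f)\<in>\<phi>. x \<in> U \<and> open_embedding (open_subscheme X U) Y f)"

definition Ex_locus :: "('p, 'r, 'k) over_space \<Rightarrow> ('q, 's, 'k) over_space \<Rightarrow>
    ('p, 'r, 'q, 's) rat_map \<Rightarrow> 'p set" where
  "Ex_locus X Y \<phi> = {x \<in> points X. \<not> iso_at X Y \<phi> x}"


section \<open>Birational classes and the invariant\<close>

text \<open>Every \<open>k\<close>-variety has at most \<open>max |k| \<aleph>\<^sub>0\<close> points and sections over a given open set, so it is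
  isomorphic to one whose points and sections have type \<open>'k list\<close>. Hence \<open>Bir k m\<close> contains all
  birational classes of \<open>m\<close>-dimensional \<open>k\<close>-varieties. The index \<open>m\<close> is an integer so that
  \<open>Bir k (- 1)\<close> is empty.\<close>

definition m_varieties :: "'k ring \<Rightarrow> int \<Rightarrow> ('k list, 'k list, 'k) over_space set" where
  "m_varieties k m = {V. k_variety k V \<and> (\<exists>d. krull_dim (topo V) = enat d \<and> int d = m)}"

definition Bir :: "'k ring \<Rightarrow> int \<Rightarrow> ('k list, 'k list, 'k) over_space set set" where
  "Bir k m = m_varieties k m //
     {(V, W) \<in> m_varieties k m \<times> m_varieties k m. \<exists>\<phi>. birational_map k V W \<phi>}"

definition k_isomorphic ::
  "'k ring \<Rightarrow> 'a ring \<Rightarrow> ('k \<Rightarrow> 'a) \<Rightarrow> 'b ring \<Rightarrow> ('k \<Rightarrow> 'b) \<Rightarrow> bool" where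
  "k_isomorphic k R i S j \<longleftrightarrow> (\<exists>h\<in>ring_iso R S. \<forall>c\<in>carrier k. h (i c) = j c)"

text \<open>The birational class of \<open>m\<close>-dimensional varieties identified with the field extension
  \<open>i : k \<rightarrow> L\<close>, namely the one whose members have a function field isomorphic to \<open>L\<close> over \<open>k\<close>.\<close>

definition bir_class_of_field :: "'k ring \<Rightarrow> int \<Rightarrow> 'a ring \<Rightarrow> ('k \<Rightarrow> 'a) \<Rightarrow>
    ('k list, 'k list, 'k) over_space set" where
  "bir_class_of_field k m L i = (THE C. C \<in> Bir k m \<and>
     (\<exists>V\<in>C. let \<eta> = generic_point (topo V) in
        k_isomorphic k (stalk V \<eta>) (scalar_stalk k V \<eta>) L i))"

definition residue_class :: "'k ring \<Rightarrow> int \<Rightarrow> ('p, 'r, 'k) over_space \<Rightarrow> 'p \<Rightarrow>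
    ('k list, 'k list, 'k) over_space set" where
  "residue_class k m X x = bir_class_of_field k m (residue_field X x) (scalar_residue k X x)"

text \<open>The invariant of a birational map between \<open>n\<close>-dimensional varieties, in the free abelian group
  on \<open>Bir k (n - 1)\<close>, whose elements are the finitely supported integer-valued functions.\<close>

definition c_inv :: "'k ring \<Rightarrow> nat \<Rightarrow> ('p, 'r, 'k) over_space \<Rightarrow> ('q, 's, 'k) over_space \<Rightarrow>
    ('p, 'r, 'q, 's) rat_map \<Rightarrow> ('k list, 'k list, 'k) over_space set \<Rightarrow>\<^sub>0 int" where
  "c_inv k n X Y \<phi> =
     (\<Sum>y\<in>{y \<in> Ex_locus Y X (rat_inv k X Y \<phi>). codim (topo Y) y = 1}.
        frag_of (residue_class k (int n - 1) Y y)) -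
     (\<Sum>x\<in>{x \<in> Ex_locus X Y \<phi>. codim (topo X) x = 1}.
        frag_of (residue_class k (int n - 1) X x))"

end

theory Submission
  imports Defs "HOL-Algebra.Ring_Divisibility"
begin

text \<open>A birational map \<open>X \<dashrightarrow> Y\<close> matches the points where it is an isomorphism with the points where its
  inverse is one. By separatedness this correspondence is single-valued, and it preserves codimension
  and residue fields. Call a codimension 1 point of one of the three varieties regular if it belongs
  to a triple \<open>(x, y, z)\<close> whose members correspond pairwise under \<open>\<phi>\<close>, \<open>\<psi>\<close> and \<open>\<psi> \<circ> \<phi>\<close>. The sets
  \<open>D\<^sub>1\<close>, \<open>D\<^sub>2\<close>, \<open>D\<^sub>3\<close> of the other codimension 1 points are finite: a codimension 1 point in a proper
  closed subset is generic in one of its components, and affine opens of finite type are noetherian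
  spaces. Points of \<open>D\<^sub>1\<close> at which \<open>\<phi>\<close> is an isomorphism cancel against points of \<open>D\<^sub>2\<close>, so
  \<open>c(\<phi>)\<close> is the sum of the residue classes over \<open>D\<^sub>2\<close> minus that over \<open>D\<^sub>1\<close>, and likewise for \<open>\<psi>\<close>
  and \<open>\<psi> \<circ> \<phi>\<close>. The sums telescope.\<close>

section \<open>Local rings\<close>

text \<open>The isomorphism locus of \<psi> \<circ> \<phi> is not determined by those of \<phi> and
  \<psi>: what one map breaks the other may repair. The bookkeeping rests on a two-out-of-three
  rule: each of the three maps is a composite of the other two or their inverses, so two
  correspondences within a triple force the third. A divisor outside all regular triples is
  therefore exceptional for one of the two maps that start or end at it. Finiteness carries real
  weight, because a HOL sum over an infinite set is zero and could not be split. The main obstacle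
  is single-valuedness: a rational map is a class of representatives, and two of them that are
  defined at a point agree a priori only on some dense open set. Separatedness enters through the
  explicit fibre product, whose points carry a prime of the tensor product of two stalks; it is
  enough to map continuously into it and to use that the diagonal is closed. Birational classes of
  residue fields are definite descriptions, so what counts is their invariance under isomorphism
  over the base field.\<close>

lemma (in cring) Units_memI:
  assumes "a \<in> carrier R" "b \<in> carrier R" "a \<otimes> b = \<one>"
  shows "a \<in> Units R"
  using unit_factor[of a b] assms by simp

text \<open>Zorn's lemma on the ideals that contain \<open>a\<close> but not the unit element; the
  principal ideal of \<open>a\<close> belongs to this family because \<open>a\<close> has no
  inverse.\<close>

lemma (in cring) nonunit_in_maximalideal:
  assumes a: "a \<in> carrier R" "a \<notin> Units R"
  obtains M where "maximalideal M R" "a \<in> M"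
proof -
  define A where "A = {J. ideal J R \<and> a \<in> J \<and> \<one> \<notin> J}"
  have pid: "PIdl a \<in> A"
  proof -
    have "\<one> \<notin> PIdl a"
    proof
      assume "\<one> \<in> PIdl a"
      then obtain b where "b \<in> carrier R" "\<one> = b \<otimes> a" unfolding cgenideal_def by auto
      then have "a \<in> Units R" using a m_comm unfolding Units_def by force
      then show False using a by simp
    qed
    then show ?thesis
      unfolding A_def using a cgenideal_ideal cgenideal_self by auto
  qed
  have "\<exists>M\<in>A. \<forall>X\<in>A. M \<subseteq> X \<longrightarrow> X = M"
  proof (rule subset_Zorn_nonempty)
    show "A \<noteq> {}" using pid by auto
    fix C assume C: "C \<noteq> {}" "subset.chain A C"
    have "subset.chain {I. ideal I R} C"
      using C unfolding A_def pred_on.chain_def by auto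
    then have "ideal (\<Union>C) R" using C chain_Union_is_ideal[of C] by auto
    then show "\<Union>C \<in> A" using C unfolding A_def pred_on.chain_def by auto
  qed
  then obtain M where M: "ideal M R" "a \<in> M" "\<one> \<notin> M"
    and mx: "\<And>X. ideal X R \<Longrightarrow> a \<in> X \<Longrightarrow> \<one> \<notin> X \<Longrightarrow> M \<subseteq> X \<Longrightarrow> X = M"
    unfolding A_def by blast
  have "maximalideal M R"
  proof (rule maximalidealI)
    show "ideal M R" by fact
    show "carrier R \<noteq> M" using M by auto
    fix J assume "ideal J R" "M \<subseteq> J" "J \<subseteq> carrier R"
    then show "J = M \<or> J = carrier R"
      using mx[of J] M ideal.one_imp_carrier[of J R] by blast
  qed
  then show thesis using that M by blast
qed

lemma local_ring_max_ideal:
  assumes "local_ring R"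
  shows "maximalideal (max_ideal R) R"
  using assms unfolding local_ring_def max_ideal_def by (metis theI')

lemma local_ring_max_ideal_eq:
  assumes "local_ring R" "maximalideal M R"
  shows "max_ideal R = M"
  using assms local_ring_max_ideal[OF assms(1)] unfolding local_ring_def by blast

text \<open>A nonunit lies in some maximal ideal, and there is only one. Membership in
  \<open>max_ideal\<close> thus becomes failure of invertibility, a condition that can be tested on
  sections.\<close>

lemma local_ring_max_ideal_iff:
  fixes R (structure)
  assumes l: "local_ring R" and a: "a \<in> carrier R"
  shows "a \<in> max_ideal R \<longleftrightarrow> a \<notin> Units R"
proof
  interpret cring R using l unfolding local_ring_def by auto
  interpret M: maximalideal "max_ideal R" R by (rule local_ring_max_ideal[OF l])
  show "a \<notin> Units R" if "a \<in> max_ideal R"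
  proof
    assume u: "a \<in> Units R"
    then have "\<one> \<in> max_ideal R"
      using M.I_l_closed[OF that Units_inv_closed[OF u]] Units_l_inv[OF u] by simp
    then show False using M.one_imp_carrier M.I_notcarr by auto
  qed
  show "a \<in> max_ideal R" if "a \<notin> Units R"
    using nonunit_in_maximalideal[OF a that] local_ring_max_ideal_eq[OF l] by metis
qed

lemma local_ring_one_not_zero:
  fixes R (structure)
  assumes l: "local_ring R"
  shows "\<one> \<noteq> \<zero>"
proof
  interpret cring R using l unfolding local_ring_def by auto
  interpret M: maximalideal "max_ideal R" R by (rule local_ring_max_ideal[OF l])
  assume "\<one> = \<zero>"
  then have "\<one> \<in> max_ideal R" using M.zero_closed by simp
  then show False using M.one_imp_carrier M.I_notcarr by auto
qed

text \<open>Dividing by a unit sum reduces closure of the nonunits under addition to the case where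
  the sum is one. The nonunits then form an ideal, and every proper ideal consists of nonunits, so
  this is the only maximal one.\<close>

lemma local_ringI:
  fixes R (structure)
  assumes cr: "cring R" and nz: "\<one>\<^bsub>R\<^esub> \<noteq> \<zero>\<^bsub>R\<^esub>"
    and loc: "\<And>a b. a \<in> carrier R \<Longrightarrow> b \<in> carrier R \<Longrightarrow> a \<oplus>\<^bsub>R\<^esub> b = \<one>\<^bsub>R\<^esub> \<Longrightarrow> a \<in> Units R \<or> b \<in> Units R"
  shows "local_ring R"
proof -
  interpret cring R by fact
  let ?M = "carrier R - Units R"
  have mult: "a \<otimes> b \<in> ?M" if "a \<in> ?M" "b \<in> carrier R" for a b
    using that unit_factor[of a b] by auto
  have mult': "b \<otimes> a \<in> ?M" if "a \<in> ?M" "b \<in> carrier R" for a b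
    using that mult m_comm by fastforce
  have add: "a \<oplus> b \<in> ?M" if ab: "a \<in> ?M" "b \<in> ?M" for a b
  proof (rule ccontr)
    assume "a \<oplus> b \<notin> ?M"
    then have u: "a \<oplus> b \<in> Units R" using ab by auto
    let ?c = "inv (a \<oplus> b)"
    have "?c \<otimes> a \<oplus> ?c \<otimes> b = \<one>"
      using ab u r_distr[of a b ?c] by (metis DiffD1 Units_inv_closed Units_l_inv)
    then have "?c \<otimes> a \<in> Units R \<or> ?c \<otimes> b \<in> Units R"
      using loc ab u by auto
    then show False using mult' ab u by blast
  qed
  have idl: "ideal ?M R"
  proof (rule idealI)
    show "ring R" by (rule ring_axioms)
    show "subgroup ?M (add_monoid R)"
    proof (rule add.subgroupI)
      \<comment> \<open>Zero is the nonunit: an inverse of it would make one equal to zero, against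
        \<open>nz\<close>.\<close>
      show "?M \<noteq> {}" using nz Units_l_inv[of \<zero>] by (metis Diff_iff Units_inv_closed empty_iff r_null zero_closed)
      show "\<ominus> a \<in> ?M" if "a \<in> ?M" for a
        using mult'[OF that, of "\<ominus> \<one>"] that by (simp add: l_minus)
    qed (use add in auto)
  qed (use mult mult' in auto)
  have max: "maximalideal ?M R"
  proof (rule maximalidealI[OF idl])
    show "carrier R \<noteq> ?M" by auto
    fix J assume J: "ideal J R" "?M \<subseteq> J" "J \<subseteq> carrier R"
    show "J = ?M \<or> J = carrier R"
    proof (cases "\<exists>a\<in>J. a \<in> Units R")
      case True
      then obtain a where "a \<in> J" "a \<in> Units R" by auto
      then have "\<one> \<in> J" using ideal.I_l_closed[OF J(1), of a "inv a"] by auto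
      then show ?thesis using ideal.one_imp_carrier[OF J(1)] by auto
    qed (use J in auto)
  qed
  have "N = ?M" if N: "maximalideal N R" for N
  proof -
    interpret N: maximalideal N R by fact
    have "N \<subseteq> ?M"
    proof
      fix a assume a: "a \<in> N"
      have "a \<notin> Units R"
      proof
        assume "a \<in> Units R"
        then have "\<one> \<in> N" using N.I_l_closed[of a "inv a"] a by auto
        then show False using N.one_imp_carrier N.I_notcarr by auto
      qed
      then show "a \<in> ?M" using N.Icarr a by auto
    qed
    then show ?thesis using N.I_maximal[OF idl] by auto
  qed
  then show ?thesis unfolding local_ring_def using cr max by blast
qed

lemma ring_iso_Units:
  assumes "cring R" "cring S" and h: "h \<in> ring_iso R S" and a: "a \<in> carrier R"
  shows "h a \<in> Units S \<longleftrightarrow> a \<in> Units R"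
proof
  interpret R: cring R by fact
  interpret S: cring S by fact
  have hom: "h \<in> ring_hom R S" and bij: "bij_betw h (carrier R) (carrier S)"
    using h unfolding ring_iso_def by auto
  show "h a \<in> Units S" if "a \<in> Units R"
  proof -
    obtain b where "b \<in> carrier R" "a \<otimes>\<^bsub>R\<^esub> b = \<one>\<^bsub>R\<^esub>" using \<open>a \<in> Units R\<close> unfolding Units_def by auto
    then have "h b \<in> carrier S" "h a \<otimes>\<^bsub>S\<^esub> h b = \<one>\<^bsub>S\<^esub>"
      using ring_hom_memE[OF hom] a by metis+
    then show ?thesis using S.Units_memI ring_hom_closed[OF hom a] by blast
  qed
  show "a \<in> Units R" if "h a \<in> Units S"
  proof -
    obtain c where "c \<in> carrier S" "h a \<otimes>\<^bsub>S\<^esub> c = \<one>\<^bsub>S\<^esub>" using \<open>h a \<in> Units S\<close> unfolding Units_def by auto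
    moreover then obtain b where b: "b \<in> carrier R" "h b = c"
      using bij_betw_imp_surj_on[OF bij] by (metis imageE)
    ultimately have "h (a \<otimes>\<^bsub>R\<^esub> b) = h \<one>\<^bsub>R\<^esub>"
      using ring_hom_memE[OF hom] a by metis
    then have "a \<otimes>\<^bsub>R\<^esub> b = \<one>\<^bsub>R\<^esub>"
      using bij a b unfolding bij_betw_def inj_on_def by blast
    then show ?thesis using R.Units_memI a b by blast
  qed
qed

text \<open>Units and sums correspond under an isomorphism, and these decide both locality and the
  maximal ideal.\<close>

lemma ring_iso_local_ring:
  assumes R: "local_ring R" and S: "cring S" and h: "h \<in> ring_iso R S"
  shows "local_ring S" and "h ` max_ideal R = max_ideal S"
proof -
  interpret R: cring R using R unfolding local_ring_def by auto
  interpret S: cring S by fact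
  interpret M: maximalideal "max_ideal R" R by (rule local_ring_max_ideal[OF R])
  have hom: "h \<in> ring_hom R S" and bij: "bij_betw h (carrier R) (carrier S)"
    using h unfolding ring_iso_def by auto
  have sur: "\<exists>a\<in>carrier R. h a = b" if "b \<in> carrier S" for b
    using bij_betw_imp_surj_on[OF bij] that by (metis imageE)
  have h0: "h \<zero>\<^bsub>R\<^esub> = \<zero>\<^bsub>S\<^esub>" "h \<one>\<^bsub>R\<^esub> = \<one>\<^bsub>S\<^esub>"
    using ring_hom_zero[OF hom R.ring_axioms S.ring_axioms] ring_hom_one[OF hom] by auto
  have inj: "inj_on h (carrier R)" using bij unfolding bij_betw_def by auto
  have un: "h a \<in> Units S \<longleftrightarrow> a \<in> Units R" if "a \<in> carrier R" for a
    using ring_iso_Units[OF R.is_cring S h that] .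
  show l: "local_ring S"
  proof (rule local_ringI[OF S])
    show "\<one>\<^bsub>S\<^esub> \<noteq> \<zero>\<^bsub>S\<^esub>"
      using local_ring_one_not_zero[OF R] h0 inj_onD[OF inj] by (metis R.one_closed R.zero_closed)
    fix a b assume ab: "a \<in> carrier S" "b \<in> carrier S" and 1: "a \<oplus>\<^bsub>S\<^esub> b = \<one>\<^bsub>S\<^esub>"
    from ab obtain c d where cd: "c \<in> carrier R" "h c = a" "d \<in> carrier R" "h d = b"
      using sur by metis
    then have "h (c \<oplus>\<^bsub>R\<^esub> d) = h \<one>\<^bsub>R\<^esub>" using ring_hom_add[OF hom] 1 h0 by metis
    then have "c \<oplus>\<^bsub>R\<^esub> d = \<one>\<^bsub>R\<^esub>" using inj_onD[OF inj] cd by blast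
    moreover have "c \<oplus>\<^bsub>R\<^esub> d \<in> max_ideal R" if "c \<in> max_ideal R" "d \<in> max_ideal R"
      using that M.a_closed by auto
    ultimately have "c \<in> Units R \<or> d \<in> Units R"
      using local_ring_max_ideal_iff[OF R] cd by (metis R.Units_one_closed R.one_closed)
    then show "a \<in> Units S \<or> b \<in> Units S" using un cd by auto
  qed
  show "h ` max_ideal R = max_ideal S"
  proof (rule equalityI; rule subsetI)
    fix b assume "b \<in> h ` max_ideal R"
    then obtain a where "a \<in> max_ideal R" "b = h a" by auto
    then show "b \<in> max_ideal S"
      using local_ring_max_ideal_iff[OF l] local_ring_max_ideal_iff[OF R] un M.Icarr
        ring_hom_closed[OF hom] by metis
  next
    fix b assume b: "b \<in> max_ideal S"
    then have bc: "b \<in> carrier S"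
      using local_ring_max_ideal[OF l] ideal.Icarr unfolding maximalideal_def by metis
    then obtain a where "a \<in> carrier R" "h a = b" using sur by auto
    then show "b \<in> h ` max_ideal R"
      using local_ring_max_ideal_iff[OF l bc] local_ring_max_ideal_iff[OF R] un b by blast
  qed
qed

section \<open>Presheaves and stalks\<close>

lemma presheaf_cring:
  assumes "presheaf_of_rings X" "openin (topo X) U"
  shows "cring (sect X U)"
  using assms by (simp add: presheaf_of_rings_def)

lemma restr_hom:
  assumes "presheaf_of_rings X" "openin (topo X) U" "openin (topo X) V" "V \<subseteq> U"
  shows "restr X U V \<in> ring_hom (sect X U) (sect X V)"
  using assms by (simp add: presheaf_of_rings_def)

lemma restr_closed:
  assumes "presheaf_of_rings X" "openin (topo X) U" "openin (topo X) V" "V \<subseteq> U" "s \<in> carrier (sect X U)"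
  shows "restr X U V s \<in> carrier (sect X V)"
  using ring_hom_closed[OF restr_hom] assms by metis

lemma restr_self:
  assumes "presheaf_of_rings X" "openin (topo X) U" "s \<in> carrier (sect X U)"
  shows "restr X U U s = s"
  using assms by (simp add: presheaf_of_rings_def)

lemma restr_restr:
  assumes "presheaf_of_rings X" "openin (topo X) U" "openin (topo X) V" "openin (topo X) W"
    "V \<subseteq> U" "W \<subseteq> V" "s \<in> carrier (sect X U)"
  shows "restr X V W (restr X U V s) = restr X U W s"
  using assms by (simp add: presheaf_of_rings_def)

text \<open>A germ is encoded as the full set of its representatives, so equality of germs is
  equality of sets. Each inclusion is transitivity of agreement near \<open>x\<close>, by
  intersecting two neighbourhoods on which sections agree.\<close>

lemma germ_eq_iff:
  assumes X: "presheaf_of_rings X"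
    and U: "openin (topo X) U" "x \<in> U" "s \<in> carrier (sect X U)"
    and V: "openin (topo X) V" "x \<in> V" "t \<in> carrier (sect X V)"
  shows "germ X x U s = germ X x V t \<longleftrightarrow>
    (\<exists>W. openin (topo X) W \<and> x \<in> W \<and> W \<subseteq> U \<inter> V \<and> restr X U W s = restr X V W t)"
    (is "?l \<longleftrightarrow> ?r")
proof
  assume ?l
  moreover have "(V, t) \<in> germ X x V t"
    unfolding germ_def using V by auto
  ultimately have "(V, t) \<in> germ X x U s" by simp
  then show ?r unfolding germ_def by simp
next
  assume ?r
  then obtain W where W: "openin (topo X) W" "x \<in> W" "W \<subseteq> U" "W \<subseteq> V"
    and eq: "restr X U W s = restr X V W t" by auto
  have *: "(O', r) \<in> germ X x B b"
    if A: "openin (topo X) A" "W \<subseteq> A" "a \<in> carrier (sect X A)"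
      and B: "openin (topo X) B" "W \<subseteq> B" "b \<in> carrier (sect X B)"
      and e: "restr X A W a = restr X B W b" and r: "(O', r) \<in> germ X x A a" for A B a b O' r
  proof -
    from r obtain W' where O': "openin (topo X) O'" "x \<in> O'" "r \<in> carrier (sect X O')"
      and W': "openin (topo X) W'" "x \<in> W'" "W' \<subseteq> A \<inter> O'" "restr X A W' a = restr X O' W' r"
      unfolding germ_def by auto
    have o: "openin (topo X) (W \<inter> W')" using W W' by auto
    have "restr X B (W \<inter> W') b = restr X W (W \<inter> W') (restr X B W b)"
      using restr_restr[OF X B(1) W(1) o] B by auto
    also have "\<dots> = restr X A (W \<inter> W') a"
      using restr_restr[OF X A(1) W(1) o] A e[symmetric] by auto
    also have "\<dots> = restr X W' (W \<inter> W') (restr X A W' a)"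
      using restr_restr[OF X A(1) W'(1) o _ _ A(3)] W' by simp
    also have "\<dots> = restr X O' (W \<inter> W') r"
      using restr_restr[OF X O'(1) W'(1) o _ _ O'(3)] W' by simp
    finally show ?thesis unfolding germ_def
      using O' W W' o B by (auto intro!: exI[of _ "W \<inter> W'"])
  qed
  show ?l
    using *[OF U(1) W(3) U(3) V(1) W(4) V(3) eq] *[OF V(1) W(4) V(3) U(1) W(3) U(3) eq[symmetric]] by auto
qed

lemma germ_self:
  assumes "presheaf_of_rings X" "openin (topo X) U" "x \<in> U" "s \<in> carrier (sect X U)"
  shows "(U, s) \<in> germ X x U s"
  unfolding germ_def using assms by auto

lemma germ_eq_mem:
  assumes X: "presheaf_of_rings X" and U: "openin (topo X) U" "x \<in> U" "s \<in> carrier (sect X U)"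
    and m: "(V, t) \<in> germ X x U s"
  shows "openin (topo X) V" "x \<in> V" "t \<in> carrier (sect X V)" "germ X x V t = germ X x U s"
proof -
  show V: "openin (topo X) V" "x \<in> V" "t \<in> carrier (sect X V)"
    using m unfolding germ_def by auto
  then show "germ X x V t = germ X x U s"
    using m germ_eq_iff[OF X U V] unfolding germ_def by auto
qed

lemma germ_restr:
  assumes X: "presheaf_of_rings X" and U: "openin (topo X) U" "s \<in> carrier (sect X U)"
    and V: "openin (topo X) V" "x \<in> V" "V \<subseteq> U"
  shows "germ X x V (restr X U V s) = germ X x U s"
proof -
  have c: "restr X U V s \<in> carrier (sect X V)" using restr_closed X U V by metis
  show ?thesis
    using germ_eq_iff[OF X V(1,2) c U(1) _ U(2)] V restr_self[OF X V(1) c] by auto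
qed

section \<open>Ring operations on germs\<close>

lemma in_stalkE:
  assumes "a \<in> carrier (stalk X x)"
  obtains U s where "openin (topo X) U" "x \<in> U" "s \<in> carrier (sect X U)" "a = germ X x U s"
  using assms unfolding stalk_def by auto

lemma germ_in_stalk:
  assumes "openin (topo X) U" "x \<in> U" "s \<in> carrier (sect X U)"
  shows "germ X x U s \<in> carrier (stalk X x)"
  using assms unfolding stalk_def by auto

text \<open>The union over all pairs of representatives collapses because each pair produces the
  same germ: shrink to a neighbourhood on which both choices agree with \<open>s\<close> and
  \<open>t\<close>. An arbitrary operation \<open>f\<close> that commutes with restriction is
  allowed, so that addition and multiplication are treated at once.\<close>

lemma germ_op:
  assumes X: "presheaf_of_rings X"
    and U: "openin (topo X) U" "x \<in> U" "s \<in> carrier (sect X U)" "t \<in> carrier (sect X U)"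
    and c: "\<And>V a b. openin (topo X) V \<Longrightarrow> a \<in> carrier (sect X V) \<Longrightarrow> b \<in> carrier (sect X V) \<Longrightarrow>
      f V a b \<in> carrier (sect X V)"
    and r: "\<And>V W a b. openin (topo X) V \<Longrightarrow> openin (topo X) W \<Longrightarrow> W \<subseteq> V \<Longrightarrow>
      a \<in> carrier (sect X V) \<Longrightarrow> b \<in> carrier (sect X V) \<Longrightarrow>
      restr X V W (f V a b) = f W (restr X V W a) (restr X V W b)"
  shows "(\<Union>(V, a)\<in>germ X x U s. \<Union>(W, b)\<in>germ X x U t.
      germ X x (V \<inter> W) (f (V \<inter> W) (restr X V (V \<inter> W) a) (restr X W (V \<inter> W) b))) = germ X x U (f U s t)"
proof -
  have eqE: "\<exists>A. openin (topo X) A \<and> x \<in> A \<and> A \<subseteq> U \<inter> V \<and> restr X U A s = restr X V A a"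
    if "(V, a) \<in> germ X x U s" for V a s
    using that unfolding germ_def by auto
  have *: "germ X x (V \<inter> W) (f (V \<inter> W) (restr X V (V \<inter> W) a) (restr X W (V \<inter> W) b)) = germ X x U (f U s t)"
    if "(V, a) \<in> germ X x U s" "(W, b) \<in> germ X x U t" for V a W b
  proof -
    note V = germ_eq_mem[OF X U(1-3) that(1)]
    note W = germ_eq_mem[OF X U(1,2,4) that(2)]
    obtain A where A: "openin (topo X) A" "x \<in> A" "A \<subseteq> U \<inter> V" "restr X U A s = restr X V A a"
      using eqE[OF \<open>(V, a) \<in> germ X x U s\<close>] by auto
    obtain B where B: "openin (topo X) B" "x \<in> B" "B \<subseteq> U \<inter> W" "restr X U B t = restr X W B b"
      using eqE[OF \<open>(W, b) \<in> germ X x U t\<close>] by auto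
    let ?C = "A \<inter> B"
    have C: "openin (topo X) ?C" "x \<in> ?C" "?C \<subseteq> U" "?C \<subseteq> V \<inter> W" "openin (topo X) (V \<inter> W)"
      using A B V W by auto
    have "restr X V ?C a = restr X A ?C (restr X V A a)"
      using restr_restr[OF X V(1) A(1) C(1) _ _ V(3)] A by simp
    also have "\<dots> = restr X U ?C s"
      using restr_restr[OF X U(1) A(1) C(1) _ _ U(3)] A by simp
    finally have e1: "restr X V ?C a = restr X U ?C s" .
    have "restr X W ?C b = restr X B ?C (restr X W B b)"
      using restr_restr[OF X W(1) B(1) C(1) _ _ W(3)] B by simp
    also have "\<dots> = restr X U ?C t"
      using restr_restr[OF X U(1) B(1) C(1) _ _ U(4)] B by simp
    finally have e2: "restr X W ?C b = restr X U ?C t" .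
    have ca: "restr X V (V \<inter> W) a \<in> carrier (sect X (V \<inter> W))"
      "restr X W (V \<inter> W) b \<in> carrier (sect X (V \<inter> W))"
      using restr_closed[OF X] V W C by auto
    have "restr X (V \<inter> W) ?C (f (V \<inter> W) (restr X V (V \<inter> W) a) (restr X W (V \<inter> W) b))
      = f ?C (restr X V ?C a) (restr X W ?C b)"
      using r[OF C(5,1) C(4) ca] restr_restr[OF X V(1) C(5) C(1)] restr_restr[OF X W(1) C(5) C(1)] V W C
      by auto
    also have "\<dots> = restr X U ?C (f U s t)" using r[OF U(1) C(1,3) U(3,4)] e1 e2 by simp
    finally show ?thesis
      using germ_eq_iff[OF X C(5) _ c[OF C(5) ca] U(1,2) c[OF U(1,3,4)]] C V W by blast
  qed
  show ?thesis
  proof (rule equalityI; rule subsetI)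
    fix z assume "z \<in> germ X x U (f U s t)"
    then show "z \<in> (\<Union>(V, a)\<in>germ X x U s. \<Union>(W, b)\<in>germ X x U t.
      germ X x (V \<inter> W) (f (V \<inter> W) (restr X V (V \<inter> W) a) (restr X W (V \<inter> W) b)))"
      using *[OF germ_self[OF X U(1,2,3)] germ_self[OF X U(1,2,4)]]
      apply (intro UN_I[OF germ_self[OF X U(1,2,3)]])
      apply (simp only: prod.case)
      apply (intro UN_I[OF germ_self[OF X U(1,2,4)]])
      by simp
  qed (clarsimp simp: *)
qed

lemma germ_hom:
  assumes X: "presheaf_of_rings X" and U: "openin (topo X) U" "x \<in> U"
  shows "germ X x U \<in> ring_hom (sect X U) (stalk X x)"
proof (rule ring_hom_memI)
  show "germ X x U s \<in> carrier (stalk X x)" if "s \<in> carrier (sect X U)" for s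
    using germ_in_stalk U that by metis
  have cr: "cring (sect X V)" if "openin (topo X) V" for V using presheaf_cring X that by metis
  fix s t assume st: "s \<in> carrier (sect X U)" "t \<in> carrier (sect X U)"
  show "germ X x U (s \<otimes>\<^bsub>sect X U\<^esub> t) = germ X x U s \<otimes>\<^bsub>stalk X x\<^esub> germ X x U t"
    using germ_op[OF X U st, of "\<lambda>V. monoid.mult (sect X V)"] ring_hom_mult[OF restr_hom[OF X]]
      cring.cring_simprules(5)[OF cr] unfolding stalk_def by simp
  show "germ X x U (s \<oplus>\<^bsub>sect X U\<^esub> t) = germ X x U s \<oplus>\<^bsub>stalk X x\<^esub> germ X x U t"
    using germ_op[OF X U st, of "\<lambda>V. ring.add (sect X V)"] ring_hom_add[OF restr_hom[OF X]]
      cring.cring_simprules(1)[OF cr] unfolding stalk_def by simp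
next
  have o: "openin (topo X) (points X)" by auto
  interpret P: cring "sect X (points X)" using presheaf_cring[OF X o] .
  have s: "U \<subseteq> points X" using U openin_subset by auto
  show "germ X x U \<one>\<^bsub>sect X U\<^esub> = \<one>\<^bsub>stalk X x\<^esub>"
    using germ_restr[OF X o P.one_closed U s] ring_hom_one[OF restr_hom[OF X o U(1) s]]
    unfolding stalk_def by simp
qed

lemma germ_zero:
  assumes X: "presheaf_of_rings X" and U: "openin (topo X) U" "x \<in> U"
  shows "germ X x U \<zero>\<^bsub>sect X U\<^esub> = \<zero>\<^bsub>stalk X x\<^esub>"
proof -
  have o: "openin (topo X) (points X)" by auto
  interpret P: cring "sect X (points X)" using presheaf_cring[OF X o] .
  interpret U: cring "sect X U" using presheaf_cring[OF X U(1)] .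
  have s: "U \<subseteq> points X" using U openin_subset by auto
  show ?thesis
    using germ_restr[OF X o P.zero_closed U s] ring_hom_zero[OF restr_hom[OF X o U(1) s] P.ring_axioms U.ring_axioms]
    unfolding stalk_def by simp
qed

text \<open>Restriction to an intersection puts two germs over one open set, where the stalk
  operations become operations of a single section ring.\<close>

lemma in_stalk2E:
  assumes X: "presheaf_of_rings X" and ab: "a \<in> carrier (stalk X x)" "b \<in> carrier (stalk X x)"
  obtains U s t where "openin (topo X) U" "x \<in> U" "s \<in> carrier (sect X U)" "t \<in> carrier (sect X U)"
    "a = germ X x U s" "b = germ X x U t"
proof -
  obtain U s where U: "openin (topo X) U" "x \<in> U" "s \<in> carrier (sect X U)" "a = germ X x U s"
    using ab in_stalkE by metis
  obtain V t where V: "openin (topo X) V" "x \<in> V" "t \<in> carrier (sect X V)" "b = germ X x V t"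
    using ab in_stalkE by metis
  have o: "openin (topo X) (U \<inter> V)" using U V by auto
  show thesis
    using that[OF o _ restr_closed[OF X U(1) o _ U(3)] restr_closed[OF X V(1) o _ V(3)]]
      germ_restr[OF X U(1,3) o] germ_restr[OF X V(1,3) o] U V by auto
qed

lemma in_stalk3E:
  assumes X: "presheaf_of_rings X"
    and abc: "a \<in> carrier (stalk X x)" "b \<in> carrier (stalk X x)" "c \<in> carrier (stalk X x)"
  obtains U s t u where "openin (topo X) U" "x \<in> U" "s \<in> carrier (sect X U)" "t \<in> carrier (sect X U)"
    "u \<in> carrier (sect X U)" "a = germ X x U s" "b = germ X x U t" "c = germ X x U u"
proof -
  obtain U s t where U: "openin (topo X) U" "x \<in> U" "s \<in> carrier (sect X U)" "t \<in> carrier (sect X U)"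
    "a = germ X x U s" "b = germ X x U t"
    using abc in_stalk2E[OF X] by metis
  obtain V u where V: "openin (topo X) V" "x \<in> V" "u \<in> carrier (sect X V)" "c = germ X x V u"
    using abc in_stalkE by metis
  have o: "openin (topo X) (U \<inter> V)" using U V by auto
  show thesis
    using that[OF o _ restr_closed[OF X U(1) o _ U(3)] restr_closed[OF X U(1) o _ U(4)]
          restr_closed[OF X V(1) o _ V(3)]]
      germ_restr[OF X U(1,3) o] germ_restr[OF X U(1,4) o] germ_restr[OF X V(1,3) o] U V by auto
qed

lemma stalk_cring:
  assumes X: "presheaf_of_rings X" and x: "x \<in> points X"
  shows "cring (stalk X x)"
proof -
  let ?S = "stalk X x"
  have cr: "cring (sect X V)" if "openin (topo X) V" for V using presheaf_cring X that by metis
  have mu: "germ X x U s \<otimes>\<^bsub>?S\<^esub> germ X x U t = germ X x U (s \<otimes>\<^bsub>sect X U\<^esub> t)"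
    and ad: "germ X x U s \<oplus>\<^bsub>?S\<^esub> germ X x U t = germ X x U (s \<oplus>\<^bsub>sect X U\<^esub> t)"
    if "openin (topo X) U" "x \<in> U" "s \<in> carrier (sect X U)" "t \<in> carrier (sect X U)" for U s t
    using ring_hom_mult[OF germ_hom[OF X that(1,2)] that(3,4)] ring_hom_add[OF germ_hom[OF X that(1,2)] that(3,4)]
    by simp_all
  have on: "\<one>\<^bsub>?S\<^esub> = germ X x U \<one>\<^bsub>sect X U\<^esub>" and ze: "\<zero>\<^bsub>?S\<^esub> = germ X x U \<zero>\<^bsub>sect X U\<^esub>"
    if "openin (topo X) U" "x \<in> U" for U
    using germ_hom[OF X that] ring_hom_one germ_zero[OF X that] by metis+
  note gi = germ_in_stalk[of X _ x]
  note r = cring.cring_simprules[OF cr]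
  have top: "openin (topo X) (points X)" by auto
  show ?thesis
  proof (rule cringI)
    show "abelian_group ?S"
    proof (rule abelian_groupI)
      show "\<zero>\<^bsub>?S\<^esub> \<in> carrier ?S" using ze[OF top x] gi[OF top x] r(2)[OF top] by simp
    next
      fix a b assume "a \<in> carrier ?S" "b \<in> carrier ?S"
      then obtain U s t where U: "openin (topo X) U" "x \<in> U" "s \<in> carrier (sect X U)" "t \<in> carrier (sect X U)"
        "a = germ X x U s" "b = germ X x U t" by (rule in_stalk2E[OF X])
      then show "a \<oplus>\<^bsub>?S\<^esub> b \<in> carrier ?S" "a \<oplus>\<^bsub>?S\<^esub> b = b \<oplus>\<^bsub>?S\<^esub> a"
        using ad gi r(1)[OF U(1)] r(10)[OF U(1)] by simp_all
    next
      fix a b c assume "a \<in> carrier ?S" "b \<in> carrier ?S" "c \<in> carrier ?S"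
      then obtain U s t u where U: "openin (topo X) U" "x \<in> U" "s \<in> carrier (sect X U)" "t \<in> carrier (sect X U)"
        "u \<in> carrier (sect X U)" "a = germ X x U s" "b = germ X x U t" "c = germ X x U u" by (rule in_stalk3E[OF X])
      then show "a \<oplus>\<^bsub>?S\<^esub> b \<oplus>\<^bsub>?S\<^esub> c = a \<oplus>\<^bsub>?S\<^esub> (b \<oplus>\<^bsub>?S\<^esub> c)"
        using ad r(1,7)[OF U(1)] by simp
    next
      fix a assume "a \<in> carrier ?S"
      then obtain U s where U: "openin (topo X) U" "x \<in> U" "s \<in> carrier (sect X U)" "a = germ X x U s"
        using in_stalkE by metis
      interpret cring "sect X U" using cr U by auto
      show "\<zero>\<^bsub>?S\<^esub> \<oplus>\<^bsub>?S\<^esub> a = a" using U ad ze[OF U(1,2)] by simp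
      have "germ X x U (\<ominus>\<^bsub>sect X U\<^esub> s) \<oplus>\<^bsub>?S\<^esub> a = \<zero>\<^bsub>?S\<^esub>" using U ad ze[OF U(1,2)] l_neg by simp
      then show "\<exists>y\<in>carrier ?S. y \<oplus>\<^bsub>?S\<^esub> a = \<zero>\<^bsub>?S\<^esub>"
        using gi[OF U(1,2) a_inv_closed[OF U(3)]] by blast
    qed
    show "comm_monoid ?S"
    proof (rule comm_monoidI)
      show "\<one>\<^bsub>?S\<^esub> \<in> carrier ?S" using on[OF top x] gi[OF top x] r(6)[OF top] by simp
    next
      fix a b assume "a \<in> carrier ?S" "b \<in> carrier ?S"
      then obtain U s t where U: "openin (topo X) U" "x \<in> U" "s \<in> carrier (sect X U)" "t \<in> carrier (sect X U)"
        "a = germ X x U s" "b = germ X x U t" by (rule in_stalk2E[OF X])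
      then show "a \<otimes>\<^bsub>?S\<^esub> b \<in> carrier ?S" "a \<otimes>\<^bsub>?S\<^esub> b = b \<otimes>\<^bsub>?S\<^esub> a"
        using mu gi r(5)[OF U(1)] r(14)[OF U(1)] by simp_all
    next
      fix a b c assume "a \<in> carrier ?S" "b \<in> carrier ?S" "c \<in> carrier ?S"
      then obtain U s t u where U: "openin (topo X) U" "x \<in> U" "s \<in> carrier (sect X U)" "t \<in> carrier (sect X U)"
        "u \<in> carrier (sect X U)" "a = germ X x U s" "b = germ X x U t" "c = germ X x U u" by (rule in_stalk3E[OF X])
      then show "a \<otimes>\<^bsub>?S\<^esub> b \<otimes>\<^bsub>?S\<^esub> c = a \<otimes>\<^bsub>?S\<^esub> (b \<otimes>\<^bsub>?S\<^esub> c)"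
        using mu r(5,11)[OF U(1)] by simp
    next
      fix a assume "a \<in> carrier ?S"
      then obtain U s where U: "openin (topo X) U" "x \<in> U" "s \<in> carrier (sect X U)" "a = germ X x U s"
        using in_stalkE by metis
      interpret cring "sect X U" using cr U by auto
      show "\<one>\<^bsub>?S\<^esub> \<otimes>\<^bsub>?S\<^esub> a = a" using U mu on[OF U(1,2)] by simp
    qed
    fix a b c assume "a \<in> carrier ?S" "b \<in> carrier ?S" "c \<in> carrier ?S"
    then obtain U s t u where U: "openin (topo X) U" "x \<in> U" "s \<in> carrier (sect X U)" "t \<in> carrier (sect X U)"
      "u \<in> carrier (sect X U)" "a = germ X x U s" "b = germ X x U t" "c = germ X x U u" by (rule in_stalk3E[OF X])
    then show "(a \<oplus>\<^bsub>?S\<^esub> b) \<otimes>\<^bsub>?S\<^esub> c = a \<otimes>\<^bsub>?S\<^esub> c \<oplus>\<^bsub>?S\<^esub> b \<otimes>\<^bsub>?S\<^esub> c"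
      using mu ad r(1,5,13)[OF U(1)] by simp
  qed
qed

text \<open>Invertibility in the stalk, stated without germs. The germs of a space and of an open
  subspace are different sets, whereas this condition is the same on both; locality is transported
  through it.\<close>

definition inv_near :: "('p, 'r, 'm) ringed_space_scheme \<Rightarrow> 'p \<Rightarrow> 'p set \<Rightarrow> 'r \<Rightarrow> bool" where
  "inv_near X x U s \<longleftrightarrow> (\<exists>N. openin (topo X) N \<and> x \<in> N \<and> N \<subseteq> U \<and> restr X U N s \<in> Units (sect X N))"

text \<open>An inverse germ has a representative, and the equation saying that the product is one
  already holds on some smaller neighbourhood.\<close>

lemma germ_Units_iff:
  assumes X: "presheaf_of_rings X" and U: "openin (topo X) U" "x \<in> U" "s \<in> carrier (sect X U)"
  shows "germ X x U s \<in> Units (stalk X x) \<longleftrightarrow> inv_near X x U s"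
proof
  let ?S = "stalk X x"
  have x: "x \<in> points X" using U openin_subset by auto
  interpret S: cring ?S by (rule stalk_cring[OF X x])
  assume "germ X x U s \<in> Units ?S"
  then obtain b where b: "b \<in> carrier ?S" "germ X x U s \<otimes>\<^bsub>?S\<^esub> b = \<one>\<^bsub>?S\<^esub>" unfolding Units_def by auto
  then obtain V t where V: "openin (topo X) V" "x \<in> V" "t \<in> carrier (sect X V)" "b = germ X x V t"
    using in_stalkE by metis
  define W where "W = U \<inter> V"
  have W: "openin (topo X) W" "x \<in> W" "W \<subseteq> U" "W \<subseteq> V" unfolding W_def using U V by auto
  let ?s = "restr X U W s" and ?t = "restr X V W t"
  have c: "?s \<in> carrier (sect X W)" "?t \<in> carrier (sect X W)"
    using restr_closed[OF X] U V W by auto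
  interpret W: cring "sect X W" using presheaf_cring[OF X W(1)] .
  have "germ X x W (?s \<otimes>\<^bsub>sect X W\<^esub> ?t) = germ X x W \<one>\<^bsub>sect X W\<^esub>"
    using ring_hom_mult[OF germ_hom[OF X W(1,2)] c] ring_hom_one[OF germ_hom[OF X W(1,2)]]
      germ_restr[OF X U(1,3) W(1,2,3)] germ_restr[OF X V(1,3) W(1,2,4)] b V by simp
  then obtain N where N: "openin (topo X) N" "x \<in> N" "N \<subseteq> W"
    and e: "restr X W N (?s \<otimes>\<^bsub>sect X W\<^esub> ?t) = restr X W N \<one>\<^bsub>sect X W\<^esub>"
    using germ_eq_iff[OF X W(1,2) _ W(1,2)] c W.one_closed W.m_closed by (metis inf.idem)
  interpret N: cring "sect X N" using presheaf_cring[OF X N(1)] .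
  note h = restr_hom[OF X W(1) N(1,3)]
  have "restr X W N ?s \<otimes>\<^bsub>sect X N\<^esub> restr X W N ?t = \<one>\<^bsub>sect X N\<^esub>"
    using e ring_hom_mult[OF h c] ring_hom_one[OF h] by simp
  then have "restr X W N ?s \<in> Units (sect X N)"
    using ring_hom_closed[OF h] c N.Units_memI by blast
  moreover have "restr X W N ?s = restr X U N s"
    using restr_restr[OF X U(1) W(1) N(1) W(3) N(3) U(3)] .
  ultimately show "inv_near X x U s" unfolding inv_near_def using N W by auto
next
  let ?S = "stalk X x"
  have x: "x \<in> points X" using U openin_subset by auto
  interpret S: cring ?S by (rule stalk_cring[OF X x])
  assume "inv_near X x U s"
  then obtain N where N: "openin (topo X) N" "x \<in> N" "N \<subseteq> U" "restr X U N s \<in> Units (sect X N)"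
    unfolding inv_near_def by auto
  then obtain t where t: "t \<in> carrier (sect X N)" "restr X U N s \<otimes>\<^bsub>sect X N\<^esub> t = \<one>\<^bsub>sect X N\<^esub>"
    unfolding Units_def by auto
  have "germ X x U s \<otimes>\<^bsub>?S\<^esub> germ X x N t = \<one>\<^bsub>?S\<^esub>"
    using germ_restr[OF X U(1,3) N(1-3)] ring_hom_one[OF germ_hom[OF X N(1,2)]] t
      ring_hom_mult[OF germ_hom[OF X N(1,2)] restr_closed[OF X U(1) N(1,3) U(3)] t(1)] by simp
  then show "germ X x U s \<in> Units ?S"
    using germ_in_stalk[OF U] germ_in_stalk[OF N(1,2) t(1)] S.Units_memI by blast
qed

lemma germ_max_ideal_iff:
  assumes X: "presheaf_of_rings X" "local_ring (stalk X x)"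
    and U: "openin (topo X) U" "x \<in> U" "s \<in> carrier (sect X U)"
  shows "germ X x U s \<in> max_ideal (stalk X x) \<longleftrightarrow> \<not> inv_near X x U s"
  using germ_Units_iff[OF X(1) U] local_ring_max_ideal_iff[OF X(2) germ_in_stalk[OF U]] by simp

section \<open>Morphisms and open subspaces\<close>

text \<open>\<open>lrs_mor\<close> without its condition on maximal ideals. That condition is
  replaced by \<open>reflects_inv\<close>, so that composition, restriction and base change can be
  checked without stalks.\<close>

definition ps_mor :: "('p, 'r, 'm) ringed_space_scheme \<Rightarrow> ('q, 's, 'n) ringed_space_scheme \<Rightarrow>
    ('p, 'r, 'q, 's) rs_mor \<Rightarrow> bool" where
  "ps_mor X Y f \<longleftrightarrow>
     continuous_map (topo X) (topo Y) (base f) \<and>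
     (\<forall>V. openin (topo Y) V \<longrightarrow> pull f V \<in> ring_hom (sect Y V) (sect X (preimg X f V))) \<and>
     (\<forall>V W. openin (topo Y) V \<longrightarrow> openin (topo Y) W \<longrightarrow> W \<subseteq> V \<longrightarrow>
        (\<forall>s\<in>carrier (sect Y V).
           pull f W (restr Y V W s) = restr X (preimg X f V) (preimg X f W) (pull f V s)))"

text \<open>One implication is enough: the converse, that sections invertible near a point pull back
  to such sections, holds for every \<open>ps_mor\<close>, because \<open>pull\<close> consists of
  ring homomorphisms compatible with restriction.\<close>

definition reflects_inv :: "('p, 'r, 'm) ringed_space_scheme \<Rightarrow> ('q, 's, 'n) ringed_space_scheme \<Rightarrow>
    ('p, 'r, 'q, 's) rs_mor \<Rightarrow> bool" where
  "reflects_inv X Y f \<longleftrightarrow> (\<forall>x\<in>points X. \<forall>V. openin (topo Y) V \<longrightarrow> base f x \<in> V \<longrightarrow>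
     (\<forall>s\<in>carrier (sect Y V). inv_near X x (preimg X f V) (pull f V s) \<longrightarrow> inv_near Y (base f x) V s))"

text \<open>Unlike \<open>locally_ringed_space\<close>, this omits the gluing axiom.\<close>

definition local_presheaf :: "('p, 'r, 'm) ringed_space_scheme \<Rightarrow> bool" where
  "local_presheaf X \<longleftrightarrow> presheaf_of_rings X \<and> (\<forall>x\<in>points X. local_ring (stalk X x))"

lemma local_presheafD:
  assumes "local_presheaf X"
  shows "presheaf_of_rings X" "x \<in> points X \<Longrightarrow> local_ring (stalk X x)"
  using assms unfolding local_presheaf_def by auto

lemma ps_morD:
  assumes "ps_mor X Y f"
  shows "continuous_map (topo X) (topo Y) (base f)"
    "openin (topo Y) V \<Longrightarrow> pull f V \<in> ring_hom (sect Y V) (sect X (preimg X f V))"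
    "openin (topo Y) V \<Longrightarrow> openin (topo Y) W \<Longrightarrow> W \<subseteq> V \<Longrightarrow> s \<in> carrier (sect Y V) \<Longrightarrow>
       pull f W (restr Y V W s) = restr X (preimg X f V) (preimg X f W) (pull f V s)"
  using assms by (simp_all add: ps_mor_def)

lemma ps_morI:
  assumes "continuous_map (topo X) (topo Y) (base f)"
    "\<And>V. openin (topo Y) V \<Longrightarrow> pull f V \<in> ring_hom (sect Y V) (sect X (preimg X f V))"
    "\<And>V W s. openin (topo Y) V \<Longrightarrow> openin (topo Y) W \<Longrightarrow> W \<subseteq> V \<Longrightarrow> s \<in> carrier (sect Y V) \<Longrightarrow>
       pull f W (restr Y V W s) = restr X (preimg X f V) (preimg X f W) (pull f V s)"
  shows "ps_mor X Y f"
  using assms by (simp add: ps_mor_def)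

lemma ps_mor_preimg:
  assumes "ps_mor X Y f" "openin (topo Y) V"
  shows "openin (topo X) (preimg X f V)"
  using openin_continuous_map_preimage[OF ps_morD(1)[OF assms(1)] assms(2)] unfolding preimg_def .

lemma ps_mor_base:
  assumes "ps_mor X Y f" "x \<in> points X"
  shows "base f x \<in> points Y"
  using ps_morD(1)[OF assms(1)] assms(2) by (simp add: continuous_map_def Pi_iff)

lemma ps_mor_pull:
  assumes "ps_mor X Y f" "openin (topo Y) V" "s \<in> carrier (sect Y V)"
  shows "pull f V s \<in> carrier (sect X (preimg X f V))"
  using ring_hom_closed[OF ps_morD(2)[OF assms(1,2)] assms(3)] .

lemma preimg_mono: "W \<subseteq> V \<Longrightarrow> preimg X f W \<subseteq> preimg X f V"
  unfolding preimg_def by auto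

lemma in_preimg: "x \<in> preimg X f V \<longleftrightarrow> x \<in> points X \<and> base f x \<in> V"
  unfolding preimg_def by auto

lemma ring_hom_Units:
  assumes "cring R" "cring S" and h: "h \<in> ring_hom R S" and a: "a \<in> Units R"
  shows "h a \<in> Units S"
proof -
  interpret R: cring R by fact
  interpret S: cring S by fact
  obtain b where b: "b \<in> carrier R" "a \<otimes>\<^bsub>R\<^esub> b = \<one>\<^bsub>R\<^esub>" using a unfolding Units_def by auto
  have "a \<in> carrier R" using a by auto
  then show ?thesis
    using S.Units_memI[of "h a" "h b"] ring_hom_closed[OF h] ring_hom_mult[OF h, of a b] ring_hom_one[OF h] b
    by simp
qed

lemma ps_mor_inv_near:
  assumes X: "presheaf_of_rings X" and Y: "presheaf_of_rings Y" and f: "ps_mor X Y f"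
    and x: "x \<in> points X" and V: "openin (topo Y) V" "s \<in> carrier (sect Y V)"
    and i: "inv_near Y (base f x) V s"
  shows "inv_near X x (preimg X f V) (pull f V s)"
proof -
  obtain N where N: "openin (topo Y) N" "base f x \<in> N" "N \<subseteq> V" "restr Y V N s \<in> Units (sect Y N)"
    using i unfolding inv_near_def by auto
  have "pull f N (restr Y V N s) \<in> Units (sect X (preimg X f N))"
    using ring_hom_Units[OF presheaf_cring[OF Y N(1)] presheaf_cring[OF X ps_mor_preimg[OF f N(1)]]
        ps_morD(2)[OF f N(1)] N(4)] .
  then show ?thesis
    unfolding inv_near_def using ps_morD(3)[OF f V(1) N(1,3) V(2)] ps_mor_preimg[OF f N(1)]
      preimg_mono[OF N(3)] in_preimg x N(2) by metis
qed

lemma lrs_mor_ps_mor: "lrs_mor X Y f \<Longrightarrow> ps_mor X Y f"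
  unfolding lrs_mor_def ps_mor_def by simp

text \<open>In a local stalk a germ lies outside the maximal ideal exactly when its section is
  invertible nearby, so the equivalence demanded by \<open>lrs_mor\<close> splits into
  \<open>ps_mor_inv_near\<close> and \<open>reflects_inv\<close>.\<close>

lemma lrs_mor_iff:
  assumes X: "local_presheaf X" and Y: "local_presheaf Y"
  shows "lrs_mor X Y f \<longleftrightarrow> ps_mor X Y f \<and> reflects_inv X Y f"
proof -
  have "(germ X x (preimg X f V) (pull f V s) \<in> max_ideal (stalk X x) \<longleftrightarrow>
       germ Y (base f x) V s \<in> max_ideal (stalk Y (base f x))) \<longleftrightarrow>
       (inv_near X x (preimg X f V) (pull f V s) \<longrightarrow> inv_near Y (base f x) V s)"
    if f: "ps_mor X Y f" and x: "x \<in> points X" and V: "openin (topo Y) V" "base f x \<in> V"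
      and s: "s \<in> carrier (sect Y V)" for x V s
    using germ_max_ideal_iff[OF local_presheafD(1)[OF X] local_presheafD(2)[OF X x] ps_mor_preimg[OF f V(1)]
        _ ps_mor_pull[OF f V(1) s]]
      germ_max_ideal_iff[OF local_presheafD(1)[OF Y] local_presheafD(2)[OF Y ps_mor_base[OF f x]] V s]
      ps_mor_inv_near[OF local_presheafD(1)[OF X] local_presheafD(1)[OF Y] f x V(1) s] in_preimg x V(2) by metis
  then show ?thesis
    unfolding lrs_mor_def reflects_inv_def ps_mor_def by (smt (verit))
qed

section \<open>Open subspaces and maps on stalks\<close>

lemma open_subspace_simps [simp]:
  "topo (open_subspace X U) = subtopology (topo X) U"
  "sect (open_subspace X U) = sect X" "restr (open_subspace X U) = restr X"
  unfolding open_subspace_def by auto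

lemma open_subspace_twice:
  "open_subspace (open_subspace X U) W = open_subspace X (U \<inter> W)"
  unfolding open_subspace_def by (simp add: subtopology_subtopology)

lemma openin_sub:
  assumes "openin (topo X) U"
  shows "openin (subtopology (topo X) U) W \<longleftrightarrow> openin (topo X) W \<and> W \<subseteq> U"
  using openin_open_subtopology[OF assms] .

lemma points_sub:
  assumes "openin (topo X) U"
  shows "points X \<inter> U = U"
  using openin_subset[OF assms] by auto

lemma presheaf_sub:
  assumes X: "presheaf_of_rings X" and U: "openin (topo X) U"
  shows "presheaf_of_rings (open_subspace X U)"
  using X unfolding presheaf_of_rings_def open_subspace_simps openin_sub[OF U] by simp

lemma inv_near_sub:
  assumes "openin (topo X) U" "openin (topo X) W" "W \<subseteq> U"
  shows "inv_near (open_subspace X U) x W s = inv_near X x W s"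
  unfolding inv_near_def open_subspace_simps openin_sub[OF assms(1)]
  using assms(3) by (meson subset_trans)

text \<open>The induced homomorphism of stalks, again written as a union over representatives that
  all contribute the same germ.\<close>

definition stalk_map :: "('p, 'r, 'm) ringed_space_scheme \<Rightarrow> ('p, 'r, 'q, 's) rs_mor \<Rightarrow> 'p \<Rightarrow>
    ('q, 's) germ \<Rightarrow> ('p, 'r) germ" where
  "stalk_map X f x C = (\<Union>(V, t)\<in>C. germ X x (preimg X f V) (pull f V t))"

lemma stalk_map_germ:
  assumes X: "presheaf_of_rings X" and Y: "presheaf_of_rings Y" and f: "ps_mor X Y f"
    and x: "x \<in> points X" and V: "openin (topo Y) V" "base f x \<in> V" "t \<in> carrier (sect Y V)"
  shows "stalk_map X f x (germ Y (base f x) V t) = germ X x (preimg X f V) (pull f V t)"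
proof -
  have *: "germ X x (preimg X f W) (pull f W u) = germ X x (preimg X f V) (pull f V t)"
    if "(W, u) \<in> germ Y (base f x) V t" for W u
  proof -
    note W = germ_eq_mem[OF Y V that]
    obtain N where N: "openin (topo Y) N" "base f x \<in> N" "N \<subseteq> V" "N \<subseteq> W" "restr Y V N t = restr Y W N u"
      using \<open>(W, u) \<in> germ Y (base f x) V t\<close> unfolding germ_def by auto
    have "germ X x (preimg X f A) (pull f A a) = germ X x (preimg X f N) (pull f N (restr Y A N a))"
      if A: "openin (topo Y) A" "a \<in> carrier (sect Y A)" "N \<subseteq> A" for A a
      using ps_morD(3)[OF f A(1) N(1) A(3) A(2)]
        germ_restr[OF X ps_mor_preimg[OF f A(1)] ps_mor_pull[OF f A(1,2)] ps_mor_preimg[OF f N(1)] _ preimg_mono[OF A(3)]]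
        in_preimg x N(2) by metis
    from this[OF V(1,3) N(3)] this[OF W(1,3) N(4)] N(5) show ?thesis by simp
  qed
  show ?thesis unfolding stalk_map_def
    using * germ_self[OF Y V] by (intro equalityI subsetI) (blast | fastforce)+
qed

lemma stalk_map_hom:
  assumes X: "presheaf_of_rings X" and Y: "presheaf_of_rings Y" and f: "ps_mor X Y f"
    and x: "x \<in> points X"
  shows "stalk_map X f x \<in> ring_hom (stalk Y (base f x)) (stalk X x)"
proof (rule ring_hom_memI)
  note sg = stalk_map_germ[OF X Y f x]
  have xp: "x \<in> preimg X f V" if "base f x \<in> V" for V using that x in_preimg by metis
  fix a assume "a \<in> carrier (stalk Y (base f x))"
  then obtain V t where "openin (topo Y) V" "base f x \<in> V" "t \<in> carrier (sect Y V)" "a = germ Y (base f x) V t"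
    by (rule in_stalkE)
  then show "stalk_map X f x a \<in> carrier (stalk X x)"
    using sg germ_in_stalk[OF ps_mor_preimg[OF f] xp ps_mor_pull[OF f]] by simp
next
  note sg = stalk_map_germ[OF X Y f x]
  have xp: "x \<in> preimg X f V" if "base f x \<in> V" for V using that x in_preimg by metis
  fix a b assume "a \<in> carrier (stalk Y (base f x))" "b \<in> carrier (stalk Y (base f x))"
  then obtain V s t where V: "openin (topo Y) V" "base f x \<in> V" and s: "s \<in> carrier (sect Y V)"
    and t: "t \<in> carrier (sect Y V)" and e: "a = germ Y (base f x) V s" "b = germ Y (base f x) V t"
    by (rule in_stalk2E[OF Y])
  interpret V: cring "sect Y V" using presheaf_cring[OF Y V(1)] .
  note gY = germ_hom[OF Y V] and gX = germ_hom[OF X ps_mor_preimg[OF f V(1)] xp[OF V(2)]]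
  note p = ps_morD(2)[OF f V(1)]
  show "stalk_map X f x (a \<otimes>\<^bsub>stalk Y (base f x)\<^esub> b) = stalk_map X f x a \<otimes>\<^bsub>stalk X x\<^esub> stalk_map X f x b"
    using ring_hom_mult[OF gY s t, symmetric] ring_hom_mult[OF gX ps_mor_pull[OF f V(1) s] ps_mor_pull[OF f V(1) t]]
      ring_hom_mult[OF p s t] sg[OF V s] sg[OF V t] sg[OF V V.m_closed[OF s t]] unfolding e by simp
  show "stalk_map X f x (a \<oplus>\<^bsub>stalk Y (base f x)\<^esub> b) = stalk_map X f x a \<oplus>\<^bsub>stalk X x\<^esub> stalk_map X f x b"
    using ring_hom_add[OF gY s t, symmetric] ring_hom_add[OF gX ps_mor_pull[OF f V(1) s] ps_mor_pull[OF f V(1) t]]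
      ring_hom_add[OF p s t] sg[OF V s] sg[OF V t] sg[OF V V.a_closed[OF s t]] unfolding e by simp
next
  note sg = stalk_map_germ[OF X Y f x]
  have xp: "x \<in> preimg X f V" if "base f x \<in> V" for V using that x in_preimg by metis
  have V: "openin (topo Y) (points Y)" "base f x \<in> points Y" using ps_mor_base[OF f x] by auto
  interpret V: cring "sect Y (points Y)" using presheaf_cring[OF Y V(1)] .
  show "stalk_map X f x \<one>\<^bsub>stalk Y (base f x)\<^esub> = \<one>\<^bsub>stalk X x\<^esub>"
    using ring_hom_one[OF germ_hom[OF Y V], symmetric] ring_hom_one[OF germ_hom[OF X ps_mor_preimg[OF f V(1)] xp[OF V(2)]]]
      sg[OF V V.one_closed] ring_hom_one[OF ps_morD(2)[OF f V(1)]] by simp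
qed

text \<open>\<open>lrs_iso\<close> hides the inverse behind a quantifier. Naming both maps makes the
  relation symmetric, so that facts proved in one direction can be reused in the other.\<close>

definition mutually_inverse :: "('p, 'r, 'm) ringed_space_scheme \<Rightarrow> ('q, 's, 'n) ringed_space_scheme \<Rightarrow>
    ('p, 'r, 'q, 's) rs_mor \<Rightarrow> ('q, 's, 'p, 'r) rs_mor \<Rightarrow> bool" where
  "mutually_inverse X Y f g \<longleftrightarrow>
     mor_eq X X (comp_mor Y g f) id_mor \<and> mor_eq Y Y (comp_mor X f g) id_mor"

lemma mutually_inverse_sym: "mutually_inverse X Y f g \<longleftrightarrow> mutually_inverse Y X g f"
  unfolding mutually_inverse_def by auto

lemma mutually_inverseD:
  assumes "mutually_inverse X Y f g"
  shows "x \<in> points X \<Longrightarrow> base g (base f x) = x"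
    "openin (topo X) V \<Longrightarrow> s \<in> carrier (sect X V) \<Longrightarrow> pull f (preimg Y g V) (pull g V s) = s"
  using assms unfolding mutually_inverse_def mor_eq_def comp_mor_def id_mor_def by auto

lemma mutually_inverse_preimg:
  assumes i: "mutually_inverse X Y f g" and f: "ps_mor X Y f" and V: "openin (topo X) V"
  shows "preimg X f (preimg Y g V) = V"
proof -
  have "V \<subseteq> points X" using V openin_subset by auto
  then show ?thesis
    using mutually_inverseD(1)[OF i] ps_mor_base[OF f] unfolding preimg_def by auto
qed

text \<open>Pulling back along \<open>g\<close> undoes \<open>pull f\<close>, also after
  restriction: sections whose pullbacks agree near \<open>x\<close> agree on the
  \<open>g\<close>-preimage of that neighbourhood, and a germ at \<open>x\<close> is the image of
  the germ of its pullback along \<open>g\<close>.\<close>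

lemma stalk_map_iso:
  assumes X: "presheaf_of_rings X" and Y: "presheaf_of_rings Y" and f: "ps_mor X Y f" and g: "ps_mor Y X g"
    and i: "mutually_inverse X Y f g" and x: "x \<in> points X"
  shows "stalk_map X f x \<in> ring_iso (stalk Y (base f x)) (stalk X x)"
proof -
  note i' = i[unfolded mutually_inverse_sym[of X]]
  note sg = stalk_map_germ[OF X Y f x]
  let ?y = "base f x"
  have y: "?y \<in> points Y" using ps_mor_base[OF f x] .
  have xp: "x \<in> preimg X f V" if "?y \<in> V" for V using that x in_preimg by metis
  have yp: "?y \<in> preimg Y g V" if "x \<in> V" for V
    using that y in_preimg mutually_inverseD(1)[OF i x] by metis
  have "inj_on (stalk_map X f x) (carrier (stalk Y ?y))"
  proof (rule inj_onI)
    fix a b assume ab: "a \<in> carrier (stalk Y ?y)" "b \<in> carrier (stalk Y ?y)"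
      and eq: "stalk_map X f x a = stalk_map X f x b"
    from ab obtain V s t where V: "openin (topo Y) V" "base f x \<in> V" and s: "s \<in> carrier (sect Y V)"
      and t: "t \<in> carrier (sect Y V)" and e: "a = germ Y (base f x) V s" "b = germ Y (base f x) V t"
      by (rule in_stalk2E[OF Y])
    note fV = ps_mor_preimg[OF f V(1)]
    note fs = ps_mor_pull[OF f V(1) s] and ft = ps_mor_pull[OF f V(1) t]
    have "germ X x (preimg X f V) (pull f V s) = germ X x (preimg X f V) (pull f V t)"
      using eq sg[OF V s] sg[OF V t] unfolding e by simp
    then obtain N where N: "openin (topo X) N" "x \<in> N" "N \<subseteq> preimg X f V"
      and r: "restr X (preimg X f V) N (pull f V s) = restr X (preimg X f V) N (pull f V t)"
      using germ_eq_iff[OF X fV xp[OF V(2)] fs fV xp[OF V(2)] ft] by auto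
    have bk: "pull g N (restr X (preimg X f V) N (pull f V u)) = restr Y V (preimg Y g N) u"
      if u: "u \<in> carrier (sect Y V)" for u
      using ps_morD(3)[OF g fV N(1,3) ps_mor_pull[OF f V(1) u]] mutually_inverseD(2)[OF i' V(1) u]
        mutually_inverse_preimg[OF i' g V(1)] by simp
    have "restr Y V (preimg Y g N) s = restr Y V (preimg Y g N) t"
      using bk[OF s] bk[OF t] r by simp
    moreover have "preimg Y g N \<subseteq> V"
      using preimg_mono[OF N(3), of Y g] mutually_inverse_preimg[OF i' g V(1)] by simp
    ultimately show "a = b"
      unfolding e using germ_eq_iff[OF Y V s V t] ps_mor_preimg[OF g N(1)] yp[OF N(2)] by blast
  qed
  moreover have "stalk_map X f x ` carrier (stalk Y ?y) = carrier (stalk X x)"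
  proof (rule equalityI; rule subsetI)
    fix b assume "b \<in> stalk_map X f x ` carrier (stalk Y ?y)"
    then show "b \<in> carrier (stalk X x)"
      using ring_hom_closed[OF stalk_map_hom[OF X Y f x]] by auto
  next
    fix b assume "b \<in> carrier (stalk X x)"
    then obtain N r where N: "openin (topo X) N" "x \<in> N" "r \<in> carrier (sect X N)" "b = germ X x N r"
      by (rule in_stalkE)
    have "stalk_map X f x (germ Y ?y (preimg Y g N) (pull g N r)) = b"
      using sg[OF ps_mor_preimg[OF g N(1)] yp[OF N(2)] ps_mor_pull[OF g N(1,3)]]
        mutually_inverseD(2)[OF i N(1,3)] mutually_inverse_preimg[OF i f N(1)] N(4) by simp
    then show "b \<in> stalk_map X f x ` carrier (stalk Y ?y)"
      using germ_in_stalk[OF ps_mor_preimg[OF g N(1)] yp[OF N(2)] ps_mor_pull[OF g N(1,3)]] by (metis imageI)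
  qed
  ultimately show ?thesis
    unfolding ring_iso_def bij_betw_def using stalk_map_hom[OF X Y f x] by auto
qed

section \<open>Restriction, base change and composition\<close>

lemma ps_mor_restr:
  assumes X: "presheaf_of_rings X" and f: "ps_mor X Y f" and W: "openin (topo X) W"
  shows "ps_mor (open_subspace X W) Y (restr_mor X W f)"
proof -
  have p: "preimg (open_subspace X W) (restr_mor X W f) V = preimg X f V \<inter> W" for V
    unfolding preimg_def restr_mor_def by auto
  have o: "openin (topo X) (preimg X f V \<inter> W)" if "openin (topo Y) V" for V
    using ps_mor_preimg[OF f that] W by auto
  show ?thesis
    unfolding ps_mor_def p open_subspace_simps
  proof (intro conjI allI impI ballI)
    show "continuous_map (subtopology (topo X) W) (topo Y) (base (restr_mor X W f))"
      unfolding restr_mor_def using continuous_map_from_subtopology[OF ps_morD(1)[OF f]] by simp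
  next
    fix V assume V: "openin (topo Y) V"
    show "pull (restr_mor X W f) V \<in> ring_hom (sect Y V) (sect X (preimg X f V \<inter> W))"
      using ring_hom_trans[OF ps_morD(2)[OF f V] restr_hom[OF X ps_mor_preimg[OF f V] o[OF V]]]
      unfolding restr_mor_def comp_def by simp
  next
    fix V V' s assume V: "openin (topo Y) V" "openin (topo Y) V'" "V' \<subseteq> V" and s: "s \<in> carrier (sect Y V)"
    note fV = ps_mor_preimg[OF f V(1)] and fV' = ps_mor_preimg[OF f V(2)]
    note sub = preimg_mono[OF V(3), of X f]
    note fs = ps_mor_pull[OF f V(1) s]
    have s2: "preimg X f V' \<inter> W \<subseteq> preimg X f V \<inter> W" using sub by auto
    show "pull (restr_mor X W f) V' (restr Y V V' s) =
      restr X (preimg X f V \<inter> W) (preimg X f V' \<inter> W) (pull (restr_mor X W f) V s)"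
      using ps_morD(3)[OF f V s] restr_restr[OF X fV fV' o[OF V(2)] sub _ fs]
        restr_restr[OF X fV o[OF V(1)] o[OF V(2)] _ s2 fs]
      unfolding restr_mor_def by simp
  qed
qed

lemma preimg_restr: "preimg (open_subspace X W) (restr_mor X W f) V = preimg X f V \<inter> W"
  unfolding preimg_def restr_mor_def by auto

lemma inv_near_restr:
  assumes X: "presheaf_of_rings X" and V: "openin (topo X) V" "openin (topo X) W" "W \<subseteq> V" "x \<in> W"
    and s: "s \<in> carrier (sect X V)"
  shows "inv_near X x W (restr X V W s) \<longleftrightarrow> inv_near X x V s"
proof
  assume "inv_near X x W (restr X V W s)"
  then show "inv_near X x V s" unfolding inv_near_def
    using restr_restr[OF X V(1,2) _ V(3) _ s] V(3) by (metis subset_trans)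
next
  assume "inv_near X x V s"
  then obtain N where N: "openin (topo X) N" "x \<in> N" "N \<subseteq> V" "restr X V N s \<in> Units (sect X N)"
    unfolding inv_near_def by auto
  have o: "openin (topo X) (N \<inter> W)" using N V by auto
  have "restr X N (N \<inter> W) (restr X V N s) \<in> Units (sect X (N \<inter> W))"
    using ring_hom_Units[OF presheaf_cring[OF X N(1)] presheaf_cring[OF X o] restr_hom[OF X N(1) o _] N(4)] by auto
  then have "restr X W (N \<inter> W) (restr X V W s) \<in> Units (sect X (N \<inter> W))"
    using restr_restr[OF X V(1) N(1) o N(3) _ s] restr_restr[OF X V(1,2) o V(3) _ s] by simp
  then show "inv_near X x W (restr X V W s)" unfolding inv_near_def using o N V by blast
qed

lemma reflects_inv_restr:
  assumes X: "presheaf_of_rings X" and f: "ps_mor X Y f" "reflects_inv X Y f" and W: "openin (topo X) W"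
  shows "reflects_inv (open_subspace X W) Y (restr_mor X W f)"
  unfolding reflects_inv_def preimg_restr
proof (intro ballI allI impI)
  fix x V s assume x: "x \<in> points (open_subspace X W)" and V: "openin (topo Y) V" "base (restr_mor X W f) x \<in> V"
    and s: "s \<in> carrier (sect Y V)"
    and i: "inv_near (open_subspace X W) x (preimg X f V \<inter> W) (pull (restr_mor X W f) V s)"
  have x': "x \<in> points X" "x \<in> W" "base f x \<in> V" using x V unfolding restr_mor_def by auto
  note fV = ps_mor_preimg[OF f(1) V(1)]
  have o: "openin (topo X) (preimg X f V \<inter> W)" using fV W by auto
  have "inv_near X x (preimg X f V) (pull f V s)"
    using i inv_near_sub[OF W o] inv_near_restr[OF X fV o _ _ ps_mor_pull[OF f(1) V(1) s]] x'
    unfolding restr_mor_def by (auto simp: in_preimg)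
  then show "inv_near Y (base (restr_mor X W f) x) V s"
    using f(2) x' V s unfolding reflects_inv_def restr_mor_def by simp
qed

text \<open>The data of \<open>f\<close> stay as they are: an open subset of \<open>V\<close> has
  the same preimage before and after, and the section rings of an open subspace are those of the
  whole space.\<close>

lemma ps_mor_base_change:
  assumes Y: "presheaf_of_rings Y" and f: "ps_mor X Y f" and V: "openin (topo Y) V"
  shows "ps_mor (open_subspace X (preimg X f V)) (open_subspace Y V) f"
proof -
  note fV = ps_mor_preimg[OF f V]
  have p: "preimg (open_subspace X (preimg X f V)) f W = preimg X f W" if "W \<subseteq> V" for W
    using that unfolding preimg_def by auto
  show ?thesis
    unfolding ps_mor_def open_subspace_simps openin_sub[OF V]
    using continuous_map_into_subtopology[OF continuous_map_from_subtopology[OF ps_morD(1)[OF f]], of "preimg X f V" V]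
      ps_morD(2,3)[OF f] p by (auto simp: in_preimg)
qed

lemma reflects_inv_base_change:
  assumes f: "ps_mor X Y f" "reflects_inv X Y f" and V: "openin (topo Y) V"
  shows "reflects_inv (open_subspace X (preimg X f V)) (open_subspace Y V) f"
proof -
  note fV = ps_mor_preimg[OF f(1) V]
  have p: "preimg (open_subspace X (preimg X f V)) f W = preimg X f W" if "W \<subseteq> V" for W
    using that unfolding preimg_def by auto
  show ?thesis
    unfolding reflects_inv_def open_subspace_simps openin_sub[OF V]
    using f(2) p inv_near_sub[OF fV ps_mor_preimg[OF f(1)] preimg_mono] inv_near_sub[OF V]
    unfolding reflects_inv_def by auto
qed

lemma preimg_comp:
  assumes "ps_mor X Y f"
  shows "preimg X (comp_mor Y g f) W = preimg X f (preimg Y g W)"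
  using ps_mor_base[OF assms] unfolding preimg_def comp_mor_def by auto

lemma comp_mor_simps:
  "base (comp_mor Y g f) = base g \<circ> base f"
  "pull (comp_mor Y g f) W s = pull f (preimg Y g W) (pull g W s)"
  unfolding comp_mor_def by auto

lemma ps_mor_comp:
  assumes f: "ps_mor X Y f" and g: "ps_mor Y Z g"
  shows "ps_mor X Z (comp_mor Y g f)"
proof (rule ps_morI, unfold preimg_comp[OF f] comp_mor_simps(1))
  show "continuous_map (topo X) (topo Z) (base g \<circ> base f)"
    using continuous_map_compose[OF ps_morD(1)[OF f] ps_morD(1)[OF g]] .
next
  fix V assume V: "openin (topo Z) V"
  have "pull (comp_mor Y g f) V = pull f (preimg Y g V) \<circ> pull g V"
    unfolding comp_mor_def by auto
  then show "pull (comp_mor Y g f) V \<in> ring_hom (sect Z V) (sect X (preimg X f (preimg Y g V)))"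
    using ring_hom_trans[OF ps_morD(2)[OF g V] ps_morD(2)[OF f ps_mor_preimg[OF g V]]] by simp
next
  fix V W s assume V: "openin (topo Z) V" "openin (topo Z) W" "W \<subseteq> V" "s \<in> carrier (sect Z V)"
  show "pull (comp_mor Y g f) W (restr Z V W s) =
    restr X (preimg X f (preimg Y g V)) (preimg X f (preimg Y g W)) (pull (comp_mor Y g f) V s)"
    unfolding comp_mor_simps
    using ps_morD(3)[OF g V] ps_morD(3)[OF f ps_mor_preimg[OF g V(1)] ps_mor_preimg[OF g V(2)]
        preimg_mono[OF V(3)] ps_mor_pull[OF g V(1,4)]] by simp
qed

lemma reflects_inv_comp:
  assumes f: "ps_mor X Y f" "reflects_inv X Y f" and g: "ps_mor Y Z g" "reflects_inv Y Z g"
  shows "reflects_inv X Z (comp_mor Y g f)"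
  unfolding reflects_inv_def preimg_comp[OF f(1)] comp_mor_simps
proof (intro ballI allI impI)
  fix x V s assume x: "x \<in> points X" and V: "openin (topo Z) V" "(base g \<circ> base f) x \<in> V"
    and s: "s \<in> carrier (sect Z V)"
    and i: "inv_near X x (preimg X f (preimg Y g V)) (pull f (preimg Y g V) (pull g V s))"
  have y: "base f x \<in> points Y" "base f x \<in> preimg Y g V"
    using ps_mor_base[OF f(1) x] V by (auto simp: in_preimg)
  then have "inv_near Y (base f x) (preimg Y g V) (pull g V s)"
    using f(2) x i ps_mor_preimg[OF g(1) V(1)] ps_mor_pull[OF g(1) V(1) s] unfolding reflects_inv_def by blast
  then show "inv_near Z ((base g \<circ> base f) x) V s"
    using g(2) y V s unfolding reflects_inv_def by auto
qed

lemma id_mor_simps [simp]: "base id_mor x = x" "pull id_mor V s = s"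
  unfolding id_mor_def by auto

lemma preimg_id: "preimg X id_mor V = points X \<inter> V"
  unfolding preimg_def by auto

lemma ps_mor_id: "presheaf_of_rings X \<Longrightarrow> ps_mor X X id_mor"
proof -
  assume X: "presheaf_of_rings X"
  have p: "preimg X id_mor V = V" if "openin (topo X) V" for V
    using openin_subset[OF that] unfolding preimg_id by auto
  show ?thesis unfolding ps_mor_def
    using p id_ring_hom by (auto simp: id_mor_def id_def)
qed

lemma reflects_inv_id: "reflects_inv X X id_mor"
  unfolding reflects_inv_def by (auto simp: preimg_id points_sub)

abbreviation incl_mor :: "('p, 'r, 'm) ringed_space_scheme \<Rightarrow> 'p set \<Rightarrow> ('p, 'r, 'p, 'r) rs_mor" where
  "incl_mor X U \<equiv> restr_mor X U id_mor"

text \<open>The stalk of an open subspace is not equal to the stalk of \<open>X\<close>, so units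
  are compared through \<open>inv_near\<close>. If a sum is one in the subspace stalk, the
  corresponding sum in the stalk of \<open>X\<close> is a unit, and one of its terms avoids the
  maximal ideal there.\<close>

lemma local_presheaf_sub:
  assumes X: "local_presheaf X" and U: "openin (topo X) U"
  shows "local_presheaf (open_subspace X U)"
  unfolding local_presheaf_def
proof (intro conjI ballI)
  note pX = local_presheafD(1)[OF X]
  show pU: "presheaf_of_rings (open_subspace X U)" using presheaf_sub[OF pX U] .
  fix x assume x: "x \<in> points (open_subspace X U)"
  then have x': "x \<in> U" "x \<in> points X" by auto
  show "local_ring (stalk (open_subspace X U) x)"
  proof (rule local_ringI[OF stalk_cring[OF pU x]])
    let ?S = "stalk X x" and ?T = "stalk (open_subspace X U) x"
    let ?i = "stalk_map (open_subspace X U) (incl_mor X U) x"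
    have b: "base (incl_mor X U) x = x" unfolding restr_mor_def by simp
    have h: "?i \<in> ring_hom ?S ?T"
      using stalk_map_hom[OF pU pX ps_mor_restr[OF pX ps_mor_id[OF pX] U] x] unfolding b .
    interpret S: cring ?S using stalk_cring[OF pX x'(2)] .
    interpret T: cring ?T using stalk_cring[OF pU x] .
    note lS = local_presheafD(2)[OF X x'(2)]
    have tr: "germ X x W s \<in> Units ?S \<longleftrightarrow> germ (open_subspace X U) x W s \<in> Units ?T"
      if W: "openin (topo X) W" "W \<subseteq> U" "x \<in> W" and s: "s \<in> carrier (sect X W)" for W s
      using germ_Units_iff[OF pX W(1,3) s] germ_Units_iff[OF pU _ W(3)] s W openin_sub[OF U] inv_near_sub[OF U W(1,2)]
      by (metis open_subspace_simps(1,2))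
    show "\<one>\<^bsub>?T\<^esub> \<noteq> \<zero>\<^bsub>?T\<^esub>"
    proof
      assume e: "\<one>\<^bsub>?T\<^esub> = \<zero>\<^bsub>?T\<^esub>"
      interpret U: cring "sect X U" using presheaf_cring[OF pX U] .
      have oU: "openin (topo (open_subspace X U)) U" using openin_sub[OF U] U by auto
      have "germ (open_subspace X U) x U \<zero>\<^bsub>sect X U\<^esub> \<in> Units ?T"
        using germ_zero[OF pU oU x'(1)] e T.Units_one_closed by simp
      then have "germ X x U \<zero>\<^bsub>sect X U\<^esub> \<in> Units ?S" using tr[OF U _ x'(1)] by auto
      then have "\<zero>\<^bsub>?S\<^esub> \<in> Units ?S" using germ_zero[OF pX U x'(1)] by simp
      then show False using local_ring_one_not_zero[OF lS] S.Units_l_inv S.Units_inv_closed S.r_null by metis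
    qed
    fix a b assume ab: "a \<in> carrier ?T" "b \<in> carrier ?T" and 1: "a \<oplus>\<^bsub>?T\<^esub> b = \<one>\<^bsub>?T\<^esub>"
    from ab obtain W s t where W': "openin (topo (open_subspace X U)) W" "x \<in> W"
      and st': "s \<in> carrier (sect (open_subspace X U) W)" "t \<in> carrier (sect (open_subspace X U) W)"
      and e: "a = germ (open_subspace X U) x W s" "b = germ (open_subspace X U) x W t"
      by (rule in_stalk2E[OF pU])
    have W: "openin (topo X) W" "W \<subseteq> U" using W' openin_sub[OF U] by auto
    have st: "s \<in> carrier (sect X W)" "t \<in> carrier (sect X W)" using st' by auto
    interpret W: cring "sect X W" using presheaf_cring[OF pX W(1)] .
    have "germ (open_subspace X U) x W (s \<oplus>\<^bsub>sect X W\<^esub> t) = \<one>\<^bsub>?T\<^esub>"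
      using ring_hom_add[OF germ_hom[OF pU W'] st'] 1 e by simp
    then have "germ X x W (s \<oplus>\<^bsub>sect X W\<^esub> t) \<in> Units ?S"
      using tr[OF W W'(2) W.a_closed[OF st]] by simp
    then have u: "germ X x W s \<oplus>\<^bsub>?S\<^esub> germ X x W t \<in> Units ?S"
      using ring_hom_add[OF germ_hom[OF pX W(1) W'(2)] st] by simp
    interpret M: maximalideal "max_ideal ?S" ?S by (rule local_ring_max_ideal[OF lS])
    have g: "germ X x W s \<in> carrier ?S" "germ X x W t \<in> carrier ?S"
      using germ_in_stalk W(1) W'(2) st by metis+
    have "germ X x W s \<in> Units ?S \<or> germ X x W t \<in> Units ?S"
      using u M.a_closed local_ring_max_ideal_iff[OF lS] g S.a_closed by metis
    then show "a \<in> Units ?T \<or> b \<in> Units ?T" unfolding e using tr[OF W W'(2)] st by auto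
  qed
qed

lemma local_presheaf_locally_ringed: "locally_ringed_space X \<Longrightarrow> local_presheaf X"
  unfolding locally_ringed_space_def sheaf_of_rings_def local_presheaf_def by auto

section \<open>Rational maps\<close>

lemma open_subscheme_simps [simp]:
  "topo (open_subscheme X U) = subtopology (topo X) U"
  "sect (open_subscheme X U) = sect X" "restr (open_subscheme X U) = restr X"
  "str (open_subscheme X U) = restr_mor X U (str X)"
  unfolding open_subscheme_def by auto

lemma germ_open_subscheme: "germ (open_subscheme X U) = germ (open_subspace X U)"
  by (intro ext) (simp add: germ_def)

lemma stalk_open_subscheme: "stalk (open_subscheme X U) = stalk (open_subspace X U)"
  by (intro ext) (simp add: stalk_def germ_open_subscheme)

lemma preimg_open_subscheme: "preimg (open_subscheme X U) = preimg (open_subspace X U)"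
  by (intro ext) (simp add: preimg_def)

lemma lrs_mor_open_subscheme:
  "lrs_mor (open_subscheme X U) Y f = lrs_mor (open_subspace X U) Y f"
  "lrs_mor Y (open_subscheme X U) g = lrs_mor Y (open_subspace X U) g"
  unfolding lrs_mor_def germ_open_subscheme stalk_open_subscheme preimg_open_subscheme by simp_all

lemma mor_eq_open_subscheme:
  "mor_eq (open_subscheme X U) Y = mor_eq (open_subspace X U) Y"
  "mor_eq Z (open_subscheme X U) = mor_eq Z (open_subspace X U)"
  by (intro ext; simp add: mor_eq_def)+

lemma comp_mor_open_subscheme: "comp_mor (open_subscheme X U) = comp_mor (open_subspace X U)"
  by (intro ext) (simp add: comp_mor_def preimg_open_subscheme)

lemma restr_mor_open_subscheme: "restr_mor (open_subscheme X U) = restr_mor (open_subspace X U)"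
  by (intro ext) (simp add: restr_mor_def preimg_open_subscheme)

lemmas open_subscheme_conv = lrs_mor_open_subscheme mor_eq_open_subscheme comp_mor_open_subscheme
  restr_mor_open_subscheme preimg_open_subscheme

text \<open>The part of a variety on which the calculus of rational maps rests: local stalks, a
  structure morphism, and nonempty open sets that always meet.\<close>

definition irr_space :: "'k ring \<Rightarrow> ('p, 'r, 'k) over_space \<Rightarrow> bool" where
  "irr_space k X \<longleftrightarrow> local_presheaf X \<and> ps_mor X (Spec k) (str X) \<and> irreducible_subset (topo X) (points X)"

lemma irr_spaceD:
  assumes "irr_space k X"
  shows "local_presheaf X" "presheaf_of_rings X" "ps_mor X (Spec k) (str X)"
  using assms local_presheafD(1) unfolding irr_space_def by auto

lemma k_variety_irr_space: "k_variety k X \<Longrightarrow> irr_space k X"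
  unfolding k_variety_def k_scheme_def is_scheme_def irr_space_def
  using local_presheaf_locally_ringed lrs_mor_ps_mor by auto

lemma irr_space_Int:
  assumes X: "irr_space k X" and U: "openin (topo X) U" "U \<noteq> {}" and V: "openin (topo X) V" "V \<noteq> {}"
  shows "U \<inter> V \<noteq> {}"
proof
  assume e: "U \<inter> V = {}"
  have c: "closedin (topo X) (points X - U)" "closedin (topo X) (points X - V)" using U V by auto
  have "points X \<subseteq> points X - U \<or> points X \<subseteq> points X - V"
    using X c e unfolding irr_space_def irreducible_subset_def by blast
  then show False using U V openin_subset by blast
qed

text \<open>In an irreducible space a nonempty open set meets every other one. Nonemptiness is
  easier than density to carry through intersections and preimages.\<close>

lemma irr_space_dense:
  assumes X: "irr_space k X"
  shows "dense_open (topo X) U \<longleftrightarrow> openin (topo X) U \<and> U \<noteq> {}"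
proof
  assume "dense_open (topo X) U"
  then show "openin (topo X) U \<and> U \<noteq> {}"
    using X unfolding dense_open_def irr_space_def irreducible_subset_def by (metis closure_of_empty)
next
  assume U: "openin (topo X) U \<and> U \<noteq> {}"
  have "x \<in> topo X closure_of U" if "x \<in> points X" for x
    unfolding in_closure_of using that irr_space_Int[OF X] U by blast
  then show "dense_open (topo X) U"
    unfolding dense_open_def using U closure_of_subset_topspace[of "topo X" U] by auto
qed

definition str_compat :: "'k ring \<Rightarrow> ('p, 'r, 'k) over_space \<Rightarrow> ('q, 's, 'k) over_space \<Rightarrow>
    'p set \<Rightarrow> ('p, 'r, 'q, 's) rs_mor \<Rightarrow> bool" where
  "str_compat k X Y U f \<longleftrightarrow> mor_eq (open_subspace X U) (Spec k) (comp_mor Y (str Y) f) (restr_mor X U (str X))"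

text \<open>A representative of a rational map, rewritten through \<open>ps_mor\<close> and
  \<open>reflects_inv\<close>; \<open>partial_mors_iff\<close> identifies it with membership in
  \<open>partial_mors\<close>. The functions in \<open>f\<close> are total in HOL, so the domain
  \<open>U\<close> is carried along explicitly.\<close>

definition pmor :: "'k ring \<Rightarrow> ('p, 'r, 'k) over_space \<Rightarrow> ('q, 's, 'k) over_space \<Rightarrow>
    'p set \<Rightarrow> ('p, 'r, 'q, 's) rs_mor \<Rightarrow> bool" where
  "pmor k X Y U f \<longleftrightarrow> openin (topo X) U \<and> U \<noteq> {} \<and> ps_mor (open_subspace X U) Y f \<and>
     reflects_inv (open_subspace X U) Y f \<and> str_compat k X Y U f"

lemma pmorD:
  assumes "pmor k X Y U f"
  shows "openin (topo X) U" "U \<noteq> {}" "ps_mor (open_subspace X U) Y f"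
    "reflects_inv (open_subspace X U) Y f" "str_compat k X Y U f" "U \<subseteq> points X"
  using assms openin_subset unfolding pmor_def by auto

lemma partial_mors_iff:
  assumes X: "irr_space k X" and Y: "irr_space k Y"
  shows "(U, f) \<in> partial_mors k X Y \<longleftrightarrow> pmor k X Y U f"
proof -
  have "k_mor k (open_subscheme X U) Y f \<longleftrightarrow>
      lrs_mor (open_subspace X U) Y f \<and> str_compat k X Y U f"
    unfolding k_mor_def str_compat_def open_subscheme_conv by simp
  then show ?thesis
    unfolding partial_mors_def pmor_def irr_space_dense[OF X]
    using lrs_mor_iff[OF local_presheaf_sub[OF irr_spaceD(1)[OF X]] irr_spaceD(1)[OF Y]] by auto
qed

section \<open>Agreement of representatives\<close>

definition agree :: "('p, 'r, 'k) over_space \<Rightarrow> ('q, 's, 'k) over_space \<Rightarrow> 'p set \<Rightarrow>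
    'p set \<Rightarrow> ('p, 'r, 'q, 's) rs_mor \<Rightarrow> 'p set \<Rightarrow> ('p, 'r, 'q, 's) rs_mor \<Rightarrow> bool" where
  "agree X Y W U f V g \<longleftrightarrow> mor_eq (open_subspace X W) Y
     (restr_mor (open_subspace X U) W f) (restr_mor (open_subspace X V) W g)"

lemma rat_rel_iff:
  assumes X: "irr_space k X" and Y: "irr_space k Y"
  shows "((U, f), (V, g)) \<in> rat_rel k X Y \<longleftrightarrow> pmor k X Y U f \<and> pmor k X Y V g \<and>
    (\<exists>W. openin (topo X) W \<and> W \<noteq> {} \<and> W \<subseteq> U \<inter> V \<and> agree X Y W U f V g)"
  unfolding rat_rel_def agree_def open_subscheme_conv using partial_mors_iff[OF X Y] irr_space_dense[OF X] by auto

abbreviation pre where "pre X U f A \<equiv> preimg (open_subspace X U) f A"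

lemma agree_iff:
  assumes "W \<subseteq> points X"
  shows "agree X Y W U f V g \<longleftrightarrow> (\<forall>x\<in>W. base f x = base g x) \<and>
    (\<forall>A. openin (topo Y) A \<longrightarrow> (\<forall>s\<in>carrier (sect Y A).
       restr X (pre X U f A) (pre X U f A \<inter> W) (pull f A s) =
       restr X (pre X V g A) (pre X V g A \<inter> W) (pull g A s)))"
  using assms unfolding agree_def mor_eq_def restr_mor_def by (auto simp: Int_absorb1)

lemma pmor_preimg:
  assumes f: "pmor k X Y U f" and A: "openin (topo Y) A"
  shows "openin (topo X) (pre X U f A)" "pre X U f A \<subseteq> U"
  using ps_mor_preimg[OF pmorD(3)[OF f] A] openin_sub[OF pmorD(1)[OF f]] by auto

lemma pmor_in_preimg:
  assumes f: "pmor k X Y U f"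
  shows "x \<in> pre X U f A \<longleftrightarrow> x \<in> U \<and> base f x \<in> A"
  using pmorD(6)[OF f] unfolding preimg_def by auto

lemma pmor_pull:
  assumes f: "pmor k X Y U f" and A: "openin (topo Y) A" "s \<in> carrier (sect Y A)"
  shows "pull f A s \<in> carrier (sect X (pre X U f A))"
  using ps_mor_pull[OF pmorD(3)[OF f] A] by simp

lemma pmor_restr:
  assumes f: "pmor k X Y U f" and A: "openin (topo Y) A" "openin (topo Y) B" "B \<subseteq> A" "s \<in> carrier (sect Y A)"
  shows "pull f B (restr Y A B s) =
    restr X (pre X U f A) (pre X U f B) (pull f A s)"
  using ps_morD(3)[OF pmorD(3)[OF f] A] by simp

lemma pmor_base:
  assumes f: "pmor k X Y U f" and x: "x \<in> U"
  shows "base f x \<in> points Y"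
  using ps_mor_base[OF pmorD(3)[OF f]] x pmorD(6)[OF f] by auto

lemma pre_Int_eq:
  assumes f: "pmor k X Y U f" and g: "pmor k X Y V g" and W: "W \<subseteq> U \<inter> V"
    and e: "\<And>x. x \<in> W \<Longrightarrow> base f x = base g x"
  shows "pre X U f A \<inter> W = pre X V g A \<inter> W"
  using W e by (auto simp: pmor_in_preimg[OF f] pmor_in_preimg[OF g])

lemma agree_base:
  assumes f: "pmor k X Y U f" and W: "W \<subseteq> U \<inter> V" and a: "agree X Y W U f V g" and x: "x \<in> W"
  shows "base f x = base g x"
proof -
  have "W \<subseteq> points X" using W pmorD(6)[OF f] by auto
  then show ?thesis using a x by (simp add: agree_iff)
qed

text \<open>The working form of agreement: the definition compares pullbacks on the whole trace of a
  preimage on \<open>W\<close>, and functoriality of restriction passes to any smaller open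
  \<open>B\<close>.\<close>

lemma agree_restr:
  assumes X: "presheaf_of_rings X" and f: "pmor k X Y U f" and g: "pmor k X Y V g"
    and W: "openin (topo X) W" "W \<subseteq> U \<inter> V" and a: "agree X Y W U f V g"
    and A: "openin (topo Y) A" "s \<in> carrier (sect Y A)"
    and B: "openin (topo X) B" "B \<subseteq> W" "B \<subseteq> pre X U f A"
  shows "restr X (pre X U f A) B (pull f A s) = restr X (pre X V g A) B (pull g A s)"
proof -
  have p: "W \<subseteq> points X" using W openin_subset by auto
  have e: "pre X U f A \<inter> W = pre X V g A \<inter> W"
    by (rule pre_Int_eq[OF f g W(2) agree_base[OF f W(2) a]])
  note fA = pmor_preimg(1)[OF f A(1)] and gA = pmor_preimg(1)[OF g A(1)]
  have o: "openin (topo X) (pre X U f A \<inter> W)" using fA W by auto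
  have "restr X (pre X U f A) B (pull f A s) =
    restr X (pre X U f A \<inter> W) B (restr X (pre X U f A) (pre X U f A \<inter> W) (pull f A s))"
    using restr_restr[OF X fA o B(1) _ _ pmor_pull[OF f A]] B by simp
  also have "\<dots> = restr X (pre X U f A \<inter> W) B (restr X (pre X V g A) (pre X U f A \<inter> W) (pull g A s))"
  proof -
    have "restr X (pre X U f A) (pre X U f A \<inter> W) (pull f A s) = restr X (pre X V g A) (pre X V g A \<inter> W) (pull g A s)"
      using a A unfolding agree_iff[OF p] by blast
    then show ?thesis using e by simp
  qed
  also have "\<dots> = restr X (pre X V g A) B (pull g A s)"
  proof -
    have "pre X U f A \<inter> W \<subseteq> pre X V g A" "B \<subseteq> pre X U f A \<inter> W" using e B by auto
    then show ?thesis using restr_restr[OF X gA o B(1) _ _ pmor_pull[OF g A]] by simp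
  qed
  finally show ?thesis .
qed

lemma agreeI:
  assumes f: "pmor k X Y U f" and g: "pmor k X Y V g" and W: "W \<subseteq> U \<inter> V"
    and b: "\<And>x. x \<in> W \<Longrightarrow> base f x = base g x"
    and r: "\<And>A s. openin (topo Y) A \<Longrightarrow> s \<in> carrier (sect Y A) \<Longrightarrow>
      restr X (pre X U f A) (pre X U f A \<inter> W) (pull f A s) = restr X (pre X V g A) (pre X U f A \<inter> W) (pull g A s)"
  shows "agree X Y W U f V g"
proof -
  have p: "W \<subseteq> points X" using W pmorD(6)[OF f] by auto
  show ?thesis unfolding agree_iff[OF p] using b r pre_Int_eq[OF f g W b] by simp
qed

lemma agree_refl: "agree X Y W U f U f"
  unfolding agree_def mor_eq_def by auto

lemma agree_sym: "agree X Y W U f V g \<Longrightarrow> agree X Y W V g U f"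
  unfolding agree_def mor_eq_def by auto

lemma agree_mono:
  assumes X: "presheaf_of_rings X" and f: "pmor k X Y U f" and g: "pmor k X Y V g"
    and W: "openin (topo X) W" "W \<subseteq> U \<inter> V" "openin (topo X) W'" "W' \<subseteq> W" and a: "agree X Y W U f V g"
  shows "agree X Y W' U f V g"
proof (rule agreeI[OF f g])
  show "W' \<subseteq> U \<inter> V" using W by auto
  show "base f x = base g x" if "x \<in> W'" for x
    using agree_base[OF f W(2) a] W(4) that by auto
  show "restr X (pre X U f A) (pre X U f A \<inter> W') (pull f A s) = restr X (pre X V g A) (pre X U f A \<inter> W') (pull g A s)"
    if A: "openin (topo Y) A" "s \<in> carrier (sect Y A)" for A s
  proof (rule agree_restr[OF X f g W(1,2) a A])
    show "openin (topo X) (pre X U f A \<inter> W')" using pmor_preimg(1)[OF f A(1)] W(3) by auto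
  qed (use W(4) in auto)
qed

lemma agree_trans:
  assumes a: "agree X Y W U f V g" "agree X Y W V g V' h"
  shows "agree X Y W U f V' h"
  using a unfolding agree_def mor_eq_def by auto

text \<open>Transitivity is where irreducibility enters: the sets on which the two pairs agree are
  nonempty and open, hence meet.\<close>

lemma rat_rel_equiv:
  assumes X: "irr_space k X" and Y: "irr_space k Y"
  shows "equiv (partial_mors k X Y) (rat_rel k X Y)"
proof -
  note r = rat_rel_iff[OF X Y]
  note pX = irr_spaceD(2)[OF X]
  have "refl_on (partial_mors k X Y) (rat_rel k X Y)"
  proof (rule refl_onI)
    fix p assume p: "p \<in> partial_mors k X Y"
    obtain U f where e: "p = (U, f)" by (cases p)
    then have m: "pmor k X Y U f" using p partial_mors_iff[OF X Y] by auto
    show "(p, p) \<in> rat_rel k X Y" unfolding e r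
      using m pmorD(1,2)[OF m] agree_refl[of X Y U U f] by (intro conjI exI[of _ U]) auto
  qed
  moreover have "sym (rat_rel k X Y)"
  proof (rule symI)
    fix p q assume pq: "(p, q) \<in> rat_rel k X Y"
    obtain U f V g where e: "p = (U, f)" "q = (V, g)" by (cases p; cases q)
    obtain W where "pmor k X Y U f" "pmor k X Y V g"
      "openin (topo X) W" "W \<noteq> {}" "W \<subseteq> U \<inter> V" "agree X Y W U f V g"
      using pq unfolding e r by auto
    then show "(q, p) \<in> rat_rel k X Y"
      using agree_sym[of X Y W U f V g] unfolding e r by (intro conjI exI[of _ W]) (simp_all add: Int_commute)
  qed
  moreover have "trans (rat_rel k X Y)"
  proof (rule transI)
    fix p q q' assume pq: "(p, q) \<in> rat_rel k X Y" "(q, q') \<in> rat_rel k X Y"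
    obtain U f V g U' f' where e: "p = (U, f)" "q = (V, g)" "q' = (U', f')" by (cases p; cases q; cases q')
    obtain W W' where m: "pmor k X Y U f" "pmor k X Y V g" "pmor k X Y U' f'"
      and W: "openin (topo X) W" "W \<noteq> {}" "W \<subseteq> U \<inter> V" "agree X Y W U f V g"
      and W': "openin (topo X) W'" "W' \<noteq> {}" "W' \<subseteq> V \<inter> U'" "agree X Y W' V g U' f'"
      using pq unfolding e r by auto
    have o: "openin (topo X) (W \<inter> W')" "W \<inter> W' \<noteq> {}"
      using W W' irr_space_Int[OF X] by auto
    have "agree X Y (W \<inter> W') U f U' f'"
      using agree_trans[OF agree_mono[OF pX m(1,2) W(1,3) o(1) _ W(4)] agree_mono[OF pX m(2,3) W'(1,3) o(1) _ W'(4)]]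
      by auto
    then show "(p, q') \<in> rat_rel k X Y" unfolding e r using m o W(3) W'(3) by blast
  qed
  moreover have "rat_rel k X Y \<subseteq> partial_mors k X Y \<times> partial_mors k X Y"
    unfolding rat_rel_def by auto
  ultimately show ?thesis unfolding equiv_def by auto
qed

section \<open>Representatives and dominance\<close>

lemma rational_mapE:
  assumes X: "irr_space k X" and Y: "irr_space k Y" and p: "\<phi> \<in> rational_maps k X Y"
  obtains U f where "(U, f) \<in> \<phi>"
  using p equiv_class_self[OF rat_rel_equiv[OF X Y]] unfolding rational_maps_def quotient_def by auto

lemma rational_map_mem:
  assumes X: "irr_space k X" and Y: "irr_space k Y" and p: "\<phi> \<in> rational_maps k X Y" "(U, f) \<in> \<phi>"
  shows "pmor k X Y U f" "\<phi> = rat_rel k X Y `` {(U, f)}"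
proof -
  obtain q where q: "q \<in> partial_mors k X Y" "\<phi> = rat_rel k X Y `` {q}"
    using p unfolding rational_maps_def quotient_def by auto
  then have r: "(q, (U, f)) \<in> rat_rel k X Y" using p by auto
  then show "\<phi> = rat_rel k X Y `` {(U, f)}" using q equiv_class_eq[OF rat_rel_equiv[OF X Y]] by auto
  show "pmor k X Y U f" using r by (cases q) (auto simp: rat_rel_iff[OF X Y])
qed

lemma rational_map_class:
  assumes X: "irr_space k X" and Y: "irr_space k Y" and p: "pmor k X Y U f"
  shows "rat_rel k X Y `` {(U, f)} \<in> rational_maps k X Y" "(U, f) \<in> rat_rel k X Y `` {(U, f)}"
  using p partial_mors_iff[OF X Y] equiv_class_self[OF rat_rel_equiv[OF X Y]]
  unfolding rational_maps_def quotient_def by auto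

text \<open>Density of the image, phrased by preimages. This is the form that composition uses,
  since it says that the domain \<open>pre X U f V\<close> of a composite is nonempty.\<close>

definition dom_mor :: "('p, 'r, 'k) over_space \<Rightarrow> ('q, 's, 'k) over_space \<Rightarrow> 'p set \<Rightarrow> ('p, 'r, 'q, 's) rs_mor \<Rightarrow> bool" where
  "dom_mor X Y U f \<longleftrightarrow> (\<forall>A. openin (topo Y) A \<longrightarrow> A \<noteq> {} \<longrightarrow> pre X U f A \<noteq> {})"

lemma dom_mor_iff:
  assumes f: "pmor k X Y U f"
  shows "dom_mor X Y U f \<longleftrightarrow> topo Y closure_of (base f ` U) = points Y"
proof
  assume d: "dom_mor X Y U f"
  have "y \<in> topo Y closure_of (base f ` U)" if "y \<in> points Y" for y
    unfolding in_closure_of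
  proof (intro conjI allI impI)
    fix A assume "y \<in> A \<and> openin (topo Y) A"
    then obtain x where "x \<in> pre X U f A" using d unfolding dom_mor_def by blast
    then show "\<exists>z. z \<in> base f ` U \<and> z \<in> A" unfolding pmor_in_preimg[OF f] by auto
  qed fact
  then show "topo Y closure_of (base f ` U) = points Y"
    using closure_of_subset_topspace[of "topo Y" "base f ` U"] by auto
next
  assume c: "topo Y closure_of (base f ` U) = points Y"
  show "dom_mor X Y U f" unfolding dom_mor_def
  proof (intro allI impI)
    fix A assume A: "openin (topo Y) A" "A \<noteq> {}"
    then obtain y where "y \<in> A" by auto
    then have "y \<in> topo Y closure_of (base f ` U)" using c A openin_subset by auto
    then have "\<exists>z. z \<in> base f ` U \<and> z \<in> A" using A \<open>y \<in> A\<close> unfolding in_closure_of by blast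
    then show "pre X U f A \<noteq> {}" by (auto simp: pmor_in_preimg[OF f])
  qed
qed

text \<open>The preimage of a nonempty open set is nonempty and open, so it meets the set where both
  representatives agree, and there the two preimages have the same trace.\<close>

lemma dom_mor_rat_rel:
  assumes X: "irr_space k X" and Y: "irr_space k Y" and r: "((U, f), (V, g)) \<in> rat_rel k X Y"
    and d: "dom_mor X Y U f"
  shows "dom_mor X Y V g"
  unfolding dom_mor_def
proof (intro allI impI)
  fix A assume A: "openin (topo Y) A" "A \<noteq> {}"
  obtain W where f: "pmor k X Y U f" and g: "pmor k X Y V g"
    and W: "openin (topo X) W" "W \<noteq> {}" "W \<subseteq> U \<inter> V" "agree X Y W U f V g"
    using r unfolding rat_rel_iff[OF X Y] by auto
  have "pre X U f A \<inter> W \<noteq> {}"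
    using irr_space_Int[OF X pmor_preimg(1)[OF f A(1)] _ W(1,2)] d A unfolding dom_mor_def by blast
  then show "pre X V g A \<noteq> {}" using pre_Int_eq[OF f g W(3) agree_base[OF f W(3,4)]] by auto
qed

lemma dominant_iff:
  assumes X: "irr_space k X" and Y: "irr_space k Y" and p: "\<phi> \<in> rational_maps k X Y" "(U, f) \<in> \<phi>"
  shows "dominant Y \<phi> \<longleftrightarrow> dom_mor X Y U f"
proof
  note m = rational_map_mem[OF X Y p(1)]
  show "dom_mor X Y U f" if "dominant Y \<phi>"
    using that p(2) dom_mor_iff[OF m(1)[OF p(2)]] unfolding dominant_def by auto
  show "dominant Y \<phi>" if d: "dom_mor X Y U f"
    unfolding dominant_def
  proof clarify
    fix V g assume "(V, g) \<in> \<phi>"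
    then have "((U, f), (V, g)) \<in> rat_rel k X Y" using m(2)[OF p(2)] by auto
    then show "topo Y closure_of (base g ` V) = points Y"
      using dom_mor_rat_rel[OF X Y _ d] dom_mor_iff m(1)[OF \<open>(V, g) \<in> \<phi>\<close>] by blast
  qed
qed

section \<open>Composition of representatives\<close>

lemma str_compat_iff:
  assumes U: "U \<subseteq> points X"
  shows "str_compat k X Y U f \<longleftrightarrow> (\<forall>x\<in>U. base (str Y) (base f x) = base (str X) x) \<and>
    (\<forall>A. openin (topo (Spec k)) A \<longrightarrow> (\<forall>s\<in>carrier (sect (Spec k) A).
      pull f (preimg Y (str Y) A) (pull (str Y) A s) =
      restr X (preimg X (str X) A) (preimg X (str X) A \<inter> U) (pull (str X) A s)))"
  using U unfolding str_compat_def mor_eq_def comp_mor_def restr_mor_def by (auto simp: Int_absorb1)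

lemma pmor_str:
  assumes f: "pmor k X Y U f"
  shows "x \<in> U \<Longrightarrow> base (str Y) (base f x) = base (str X) x"
    "openin (topo (Spec k)) A \<Longrightarrow> s \<in> carrier (sect (Spec k) A) \<Longrightarrow>
      pull f (preimg Y (str Y) A) (pull (str Y) A s) =
      restr X (preimg X (str X) A) (preimg X (str X) A \<inter> U) (pull (str X) A s)"
    "pre X U f (preimg Y (str Y) A) = preimg X (str X) A \<inter> U"
proof -
  note s = pmorD(5)[OF f, unfolded str_compat_iff[OF pmorD(6)[OF f]]]
  show "x \<in> U \<Longrightarrow> base (str Y) (base f x) = base (str X) x" using s by auto
  show "openin (topo (Spec k)) A \<Longrightarrow> s \<in> carrier (sect (Spec k) A) \<Longrightarrow>
      pull f (preimg Y (str Y) A) (pull (str Y) A s) =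
      restr X (preimg X (str X) A) (preimg X (str X) A \<inter> U) (pull (str X) A s)" using s by blast
  show "pre X U f (preimg Y (str Y) A) = preimg X (str X) A \<inter> U"
    using s pmorD(6)[OF f] pmor_base[OF f] by (auto simp: pmor_in_preimg[OF f] in_preimg)
qed

lemma pmor_comp:
  assumes X: "irr_space k X" and Y: "irr_space k Y"
    and f: "pmor k X Y U f" and g: "pmor k Y Z V g" and ne: "pre X U f V \<noteq> {}"
  shows "pmor k X Z (pre X U f V) (comp_mor (open_subspace Y V) g f)"
  unfolding pmor_def
proof (intro conjI)
  let ?P = "pre X U f V"
  note V = pmorD(1)[OF g]
  show P: "openin (topo X) ?P" using pmor_preimg(1)[OF f V] .
  show "?P \<noteq> {}" by fact
  have e: "open_subspace (open_subspace X U) ?P = open_subspace X ?P"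
    unfolding open_subspace_twice using pmor_preimg(2)[OF f V] by (simp add: Int_absorb1)
  note bc = ps_mor_base_change[OF irr_spaceD(2)[OF Y] pmorD(3)[OF f] V, unfolded e]
    and br = reflects_inv_base_change[OF pmorD(3,4)[OF f] V, unfolded e]
  show "ps_mor (open_subspace X ?P) Z (comp_mor (open_subspace Y V) g f)"
    using ps_mor_comp[OF bc pmorD(3)[OF g]] .
  show "reflects_inv (open_subspace X ?P) Z (comp_mor (open_subspace Y V) g f)"
    using reflects_inv_comp[OF bc br pmorD(3,4)[OF g]] .
  have Ps: "?P \<subseteq> points X" using P openin_subset by auto
  note pX = irr_spaceD(2)[OF X] and pY = irr_spaceD(2)[OF Y]
  show "str_compat k X Z ?P (comp_mor (open_subspace Y V) g f)"
    unfolding str_compat_iff[OF Ps]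
  proof (intro conjI ballI allI impI)
    fix x assume "x \<in> ?P"
    then show "base (str Z) (base (comp_mor (open_subspace Y V) g f) x) = base (str X) x"
      unfolding pmor_in_preimg[OF f] comp_mor_simps using pmor_str(1)[OF f] pmor_str(1)[OF g] by simp
  next
    fix A s assume A: "openin (topo (Spec k)) A" and s: "s \<in> carrier (sect (Spec k) A)"
    let ?a = "pull (str Y) A s" and ?B = "preimg Y (str Y) A"
    have B: "openin (topo Y) ?B" "?a \<in> carrier (sect Y ?B)"
      using ps_mor_preimg[OF irr_spaceD(3)[OF Y] A] ps_mor_pull[OF irr_spaceD(3)[OF Y] A s] by auto
    have C: "openin (topo X) (preimg X (str X) A)" "pull (str X) A s \<in> carrier (sect X (preimg X (str X) A))"
      using ps_mor_preimg[OF irr_spaceD(3)[OF X] A] ps_mor_pull[OF irr_spaceD(3)[OF X] A s] by auto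
    have BV: "openin (topo Y) (?B \<inter> V)" using B V by auto
    \<comment> \<open>The \<open>g\<close>-pullback of a function from the base is the corresponding
      function on \<open>Y\<close> restricted to \<open>V\<close>. Compatibility of \<open>f\<close>
      is therefore applied over \<open>?B \<inter> V\<close>, whose preimage is identified
      here.\<close>
    have fBV: "pre X U f (?B \<inter> V) = preimg X (str X) A \<inter> ?P"
    proof -
      have "pre X U f (?B \<inter> V) = pre X U f ?B \<inter> ?P" unfolding preimg_def by auto
      also have "\<dots> = preimg X (str X) A \<inter> U \<inter> ?P" by (simp only: pmor_str(3)[OF f])
      also have "\<dots> = preimg X (str X) A \<inter> ?P" using pmor_preimg(2)[OF f V] by blast
      finally show ?thesis .
    qed
    have CU: "openin (topo X) (preimg X (str X) A \<inter> U)" using C pmorD(1)[OF f] by auto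
    have CP: "openin (topo X) (preimg X (str X) A \<inter> ?P)" using C P by auto
    have sub: "preimg X (str X) A \<inter> ?P \<subseteq> preimg X (str X) A \<inter> U" using pmor_preimg(2)[OF f V] by auto
    have "pull (comp_mor (open_subspace Y V) g f) (preimg Z (str Z) A) (pull (str Z) A s) =
      pull f (?B \<inter> V) (restr Y ?B (?B \<inter> V) ?a)"
      unfolding comp_mor_simps using pmor_str(2,3)[OF g] A s by simp
    also have "\<dots> = restr X (pre X U f ?B) (pre X U f (?B \<inter> V)) (pull f ?B ?a)"
      using pmor_restr[OF f B(1) BV _ B(2)] by simp
    also have "\<dots> = restr X (preimg X (str X) A) (preimg X (str X) A \<inter> ?P) (pull (str X) A s)"
      unfolding pmor_str(2)[OF f A s] pmor_str(3)[OF f] fBV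
      using restr_restr[OF pX C(1) CU CP _ sub C(2)] by simp
    finally show "pull (comp_mor (open_subspace Y V) g f) (preimg Z (str Z) A) (pull (str Z) A s) =
      restr X (preimg X (str X) A) (preimg X (str X) A \<inter> ?P) (pull (str X) A s)" .
  qed
qed

lemma pre_comp:
  assumes f: "pmor k X Y U f" and g: "pmor k Y Z V g"
  shows "pre X (pre X U f V) (comp_mor (open_subspace Y V) g f) A = pre X U f (pre Y V g A)"
  using pmor_base[OF f] pmorD(6)[OF f] unfolding preimg_def comp_mor_simps by auto

lemma dom_mor_comp:
  assumes f: "pmor k X Y U f" and g: "pmor k Y Z V g" and df: "dom_mor X Y U f" and dg: "dom_mor Y Z V g"
  shows "dom_mor X Z (pre X U f V) (comp_mor (open_subspace Y V) g f)"
  unfolding dom_mor_def pre_comp[OF f g]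
proof (intro allI impI)
  fix A assume A: "openin (topo Z) A" "A \<noteq> {}"
  then have "pre Y V g A \<noteq> {}" using dg unfolding dom_mor_def by auto
  then show "pre X U f (pre Y V g A) \<noteq> {}"
    using df pmor_preimg(1)[OF g A(1)] unfolding dom_mor_def by auto
qed

lemma agree_comp:
  assumes X: "irr_space k X" and Y: "irr_space k Y"
    and f: "pmor k X Y U f" and f': "pmor k X Y U' f'" and g: "pmor k Y Z V g" and g': "pmor k Y Z V' g'"
    and W: "openin (topo X) W" "W \<subseteq> U \<inter> U'" and a: "agree X Y W U f U' f'"
    and W': "openin (topo Y) W'" "W' \<subseteq> V \<inter> V'" and b: "agree Y Z W' V g V' g'"
    and ne: "pre X U f V \<noteq> {}" "pre X U' f' V' \<noteq> {}"
  shows "agree X Z (W \<inter> pre X U f W') (pre X U f V) (comp_mor (open_subspace Y V) g f)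
    (pre X U' f' V') (comp_mor (open_subspace Y V') g' f')"
proof (rule agreeI[OF pmor_comp[OF X Y f g ne(1)] pmor_comp[OF X Y f' g' ne(2)]])
  note bf = agree_base[OF f W(2) a] and bg = agree_base[OF g W'(2) b]
  note pX = irr_spaceD(2)[OF X] and pY = irr_spaceD(2)[OF Y]
  show "W \<inter> pre X U f W' \<subseteq> pre X U f V \<inter> pre X U' f' V'"
    using W W' bf by (auto simp: pmor_in_preimg[OF f] pmor_in_preimg[OF f'])
  show "base (comp_mor (open_subspace Y V) g f) x = base (comp_mor (open_subspace Y V') g' f') x"
    if "x \<in> W \<inter> pre X U f W'" for x
    using that bf[of x] bg[of "base f x"] unfolding comp_mor_simps by (auto simp: pmor_in_preimg[OF f])
  fix A s assume A: "openin (topo Z) A" "s \<in> carrier (sect Z A)"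
  let ?P = "pre Y V g A" and ?P' = "pre Y V' g' A" and ?a = "pull g A s" and ?b = "pull g' A s"
  \<comment> \<open>On \<open>Q\<close> the sections pulled back by \<open>g\<close> and
    \<open>g'\<close> become one section \<open>c\<close>. Pulling \<open>c\<close> back by
    \<open>f\<close> and by \<open>f'\<close> gives the same result on \<open>B\<close>, which
    merges the two agreements into one.\<close>
  define Q where "Q = ?P \<inter> W'"
  have Q': "Q = ?P' \<inter> W'" unfolding Q_def using pre_Int_eq[OF g g' W'(2) bg] .
  note P = pmor_preimg(1)[OF g A(1)] and P' = pmor_preimg(1)[OF g' A(1)]
  note ca = pmor_pull[OF g A] and cb = pmor_pull[OF g' A]
  have oQ: "openin (topo Y) Q" unfolding Q_def using P W' by auto
  have QP: "Q \<subseteq> ?P" "Q \<subseteq> ?P'" unfolding Q_def using Q' Q_def by auto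
  have Qe: "restr Y ?P Q ?a = restr Y ?P' Q ?b"
    using agree_restr[OF pY g g' W' b A oQ] unfolding Q_def by auto
  define c where "c = restr Y ?P Q ?a"
  have c: "c \<in> carrier (sect Y Q)" unfolding c_def using restr_closed[OF pY P oQ QP(1) ca] .
  define B where "B = pre X U f Q \<inter> W"
  have B: "openin (topo X) B" "B \<subseteq> W" "B \<subseteq> pre X U f Q" "B \<subseteq> pre X U' f' Q"
    unfolding B_def using openin_Int[OF pmor_preimg(1)[OF f oQ] W(1)] pre_Int_eq[OF f f' W(2) bf, of Q] by blast+
  have BB: "pre X U f ?P \<inter> (W \<inter> pre X U f W') = B"
    unfolding B_def Q_def by (auto simp: pmor_in_preimg[OF f])
  note o = pmor_preimg(1)[OF f P] pmor_preimg(1)[OF f oQ]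
  note o' = pmor_preimg(1)[OF f' P'] pmor_preimg(1)[OF f' oQ]
  have "restr X (pre X U f ?P) B (pull f ?P ?a) = restr X (pre X U f Q) B (pull f Q c)"
    unfolding c_def pmor_restr[OF f P oQ QP(1) ca]
    using restr_restr[OF pX o B(1) preimg_mono[OF QP(1)] B(3) pmor_pull[OF f P ca]] by simp
  also have "\<dots> = restr X (pre X U' f' Q) B (pull f' Q c)"
    using agree_restr[OF pX f f' W a oQ c B(1,2,3)] .
  also have "\<dots> = restr X (pre X U' f' ?P') B (pull f' ?P' ?b)"
    unfolding c_def Qe pmor_restr[OF f' P' oQ QP(2) cb]
    using restr_restr[OF pX o' B(1) preimg_mono[OF QP(2)] B(4) pmor_pull[OF f' P' cb]] by simp
  finally show "restr X (pre X (pre X U f V) (comp_mor (open_subspace Y V) g f) A)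
      (pre X (pre X U f V) (comp_mor (open_subspace Y V) g f) A \<inter> (W \<inter> pre X U f W'))
      (pull (comp_mor (open_subspace Y V) g f) A s) =
    restr X (pre X (pre X U' f' V') (comp_mor (open_subspace Y V') g' f') A)
      (pre X (pre X U f V) (comp_mor (open_subspace Y V) g f) A \<inter> (W \<inter> pre X U f W'))
      (pull (comp_mor (open_subspace Y V') g' f') A s)"
    unfolding pre_comp[OF f g] pre_comp[OF f' g'] comp_mor_simps BB .
qed

text \<open>Dominance keeps the relevant preimages nonempty. The composites then agree where
  \<open>f\<close> and \<open>f'\<close> agree and land in the set where \<open>g\<close> and
  \<open>g'\<close> agree.\<close>

lemma rat_rel_comp:
  assumes X: "irr_space k X" and Y: "irr_space k Y" and Z: "irr_space k Z"
    and r: "((U, f), (U', f')) \<in> rat_rel k X Y" and r': "((V, g), (V', g')) \<in> rat_rel k Y Z"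
    and d: "dom_mor X Y U f"
  shows "((pre X U f V, comp_mor (open_subspace Y V) g f),
    (pre X U' f' V', comp_mor (open_subspace Y V') g' f')) \<in> rat_rel k X Z"
proof -
  obtain W where f: "pmor k X Y U f" and f': "pmor k X Y U' f'"
    and W: "openin (topo X) W" "W \<noteq> {}" "W \<subseteq> U \<inter> U'" "agree X Y W U f U' f'"
    using r unfolding rat_rel_iff[OF X Y] by auto
  obtain W' where g: "pmor k Y Z V g" and g': "pmor k Y Z V' g'"
    and W': "openin (topo Y) W'" "W' \<noteq> {}" "W' \<subseteq> V \<inter> V'" "agree Y Z W' V g V' g'"
    using r' unfolding rat_rel_iff[OF Y Z] by auto
  have d': "dom_mor X Y U' f'" using dom_mor_rat_rel[OF X Y r d] .
  have ne: "pre X U f V \<noteq> {}" "pre X U' f' V' \<noteq> {}" "pre X U f W' \<noteq> {}"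
    using d d' W' pmorD(1,2)[OF g] pmorD(1,2)[OF g'] unfolding dom_mor_def by auto
  have o: "openin (topo X) (W \<inter> pre X U f W')" using W pmor_preimg(1)[OF f W'(1)] by auto
  have n: "W \<inter> pre X U f W' \<noteq> {}" using irr_space_Int[OF X W(1,2) pmor_preimg(1)[OF f W'(1)] ne(3)] .
  have s: "W \<inter> pre X U f W' \<subseteq> pre X U f V \<inter> pre X U' f' V'"
    using W(3) W'(3) agree_base[OF f W(3,4)] by (auto simp: pmor_in_preimg[OF f] pmor_in_preimg[OF f'])
  show ?thesis
    unfolding rat_rel_iff[OF X Z]
    using pmor_comp[OF X Y f g ne(1)] pmor_comp[OF X Y f' g' ne(2)] o n s
      agree_comp[OF X Y f f' g g' W(1,3,4) W'(1,3,4) ne(1,2)]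
    by (intro conjI exI[of _ "W \<inter> pre X U f W'"])
qed

text \<open>\<open>rat_comp\<close> is the image under \<open>rat_rel\<close> of the composites of
  all representatives. These are related to each other, so the image is the class of any one of
  them.\<close>

lemma rat_comp_eq:
  assumes X: "irr_space k X" and Y: "irr_space k Y" and Z: "irr_space k Z"
    and p: "\<phi> \<in> rational_maps k X Y" "(U, f) \<in> \<phi>" and q: "\<psi> \<in> rational_maps k Y Z" "(V, g) \<in> \<psi>"
    and d: "dominant Y \<phi>"
  shows "rat_comp k X Y Z \<psi> \<phi> = rat_rel k X Z `` {(pre X U f V, comp_mor (open_subspace Y V) g f)}"
proof -
  let ?c = "(pre X U f V, comp_mor (open_subspace Y V) g f)"
  have dm: "dom_mor X Y U f" using d dominant_iff[OF X Y p] by auto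
  have rel: "(?c, (pre X U' f' V', comp_mor (open_subspace Y V') g' f')) \<in> rat_rel k X Z"
    if "(U', f') \<in> \<phi>" "(V', g') \<in> \<psi>" for U' f' V' g'
    using rat_rel_comp[OF X Y Z _ _ dm] that rational_map_mem(2)[OF X Y p] rational_map_mem(2)[OF Y Z q] by auto
  have c: "?c \<in> {(preimg (open_subscheme X U) f V, comp_mor (open_subscheme Y V) g f) |U f V g.
        (U, f) \<in> \<phi> \<and> (V, g) \<in> \<psi>}"
    unfolding open_subscheme_conv using p q by blast
  have eq: "rat_rel k X Z `` {e} = rat_rel k X Z `` {?c}"
    if "e \<in> {(preimg (open_subscheme X U) f V, comp_mor (open_subscheme Y V) g f) |U f V g.
        (U, f) \<in> \<phi> \<and> (V, g) \<in> \<psi>}" for e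
  proof -
    have "(?c, e) \<in> rat_rel k X Z" using that rel unfolding open_subscheme_conv by auto
    then show ?thesis using equiv_class_eq[OF rat_rel_equiv[OF X Z]] by auto
  qed
  show ?thesis unfolding rat_comp_def using c eq by blast
qed

lemma pmor_id:
  assumes X: "irr_space k X"
  shows "pmor k X X (points X) id_mor"
proof -
  note pX = irr_spaceD(2)[OF X]
  have e: "preimg (open_subspace X (points X)) id_mor V = V" if "openin (topo X) V" for V
    using openin_subset[OF that] unfolding preimg_def by auto
  have "ps_mor (open_subspace X (points X)) X id_mor"
    using e id_ring_hom by (auto simp: ps_mor_def id_mor_def id_def subtopology_topspace)
  moreover have "reflects_inv (open_subspace X (points X)) X id_mor"
    unfolding reflects_inv_def
    by (auto simp: subtopology_topspace e inv_near_sub[of X "points X"] openin_subset)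
  moreover have "str_compat k X X (points X) id_mor"
  proof -
    have "restr X (preimg X (str X) A) (preimg X (str X) A \<inter> points X) (pull (str X) A s) = pull (str X) A s"
      if "openin (topo (Spec k)) A" "s \<in> carrier (sect (Spec k) A)" for A s
    proof -
      have "preimg X (str X) A \<inter> points X = preimg X (str X) A" unfolding preimg_def by auto
      then show ?thesis
        using restr_self[OF pX ps_mor_preimg[OF irr_spaceD(3)[OF X] that(1)] ps_mor_pull[OF irr_spaceD(3)[OF X] that]]
        by simp
    qed
    then show ?thesis unfolding str_compat_iff[OF subset_refl] by simp
  qed
  ultimately show ?thesis
    using X unfolding pmor_def irr_space_def irreducible_subset_def by auto
qed

lemma dom_mor_id: "irr_space k X \<Longrightarrow> dom_mor X X (points X) id_mor"
  unfolding dom_mor_def preimg_def using openin_subset by fastforce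

lemma rat_id_rational:
  assumes X: "irr_space k X"
  shows "rat_id k X \<in> rational_maps k X X" "(points X, id_mor) \<in> rat_id k X" "dominant X (rat_id k X)"
proof -
  note r = rational_map_class[OF X X pmor_id[OF X]]
  show "rat_id k X \<in> rational_maps k X X" "(points X, id_mor) \<in> rat_id k X"
    using r unfolding rat_id_def by auto
  then show "dominant X (rat_id k X)" using dominant_iff[OF X X] dom_mor_id[OF X] by blast
qed

lemma rat_comp_rational:
  assumes X: "irr_space k X" and Y: "irr_space k Y" and Z: "irr_space k Z"
    and p: "\<phi> \<in> rational_maps k X Y" "dominant Y \<phi>" and q: "\<psi> \<in> rational_maps k Y Z"
  shows "rat_comp k X Y Z \<psi> \<phi> \<in> rational_maps k X Z"
    "(U, f) \<in> \<phi> \<Longrightarrow> (V, g) \<in> \<psi> \<Longrightarrow> (pre X U f V, comp_mor (open_subspace Y V) g f) \<in> rat_comp k X Y Z \<psi> \<phi>"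
    "dominant Z \<psi> \<Longrightarrow> dominant Z (rat_comp k X Y Z \<psi> \<phi>)"
proof -
  have *: "rat_comp k X Y Z \<psi> \<phi> \<in> rational_maps k X Z
    \<and> (pre X U f V, comp_mor (open_subspace Y V) g f) \<in> rat_comp k X Y Z \<psi> \<phi>"
    if m: "(U, f) \<in> \<phi>" "(V, g) \<in> \<psi>" for U f V g
  proof -
    note f = rational_map_mem(1)[OF X Y p(1) m(1)] and g = rational_map_mem(1)[OF Y Z q m(2)]
    have "dom_mor X Y U f" using p(2) dominant_iff[OF X Y p(1) m(1)] by auto
    then have "pre X U f V \<noteq> {}" using pmorD(1,2)[OF g] unfolding dom_mor_def by auto
    then show ?thesis
      using rational_map_class[OF X Z pmor_comp[OF X Y f g]] rat_comp_eq[OF X Y Z p(1) m(1) q m(2) p(2)] by auto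
  qed
  obtain U0 f0 where 0: "(U0, f0) \<in> \<phi>" using rational_mapE[OF X Y p(1)] .
  obtain V0 g0 where 1: "(V0, g0) \<in> \<psi>" using rational_mapE[OF Y Z q] .
  show c: "rat_comp k X Y Z \<psi> \<phi> \<in> rational_maps k X Z" using *[OF 0 1] by auto
  show "(U, f) \<in> \<phi> \<Longrightarrow> (V, g) \<in> \<psi> \<Longrightarrow> (pre X U f V, comp_mor (open_subspace Y V) g f) \<in> rat_comp k X Y Z \<psi> \<phi>"
    using * by auto
  show "dominant Z (rat_comp k X Y Z \<psi> \<phi>)" if "dominant Z \<psi>"
    using dominant_iff[OF X Z c] *[OF 0 1] dominant_iff[OF X Y p(1) 0] dominant_iff[OF Y Z q 1] that p(2)
      dom_mor_comp[OF rational_map_mem(1)[OF X Y p(1) 0] rational_map_mem(1)[OF Y Z q 1]] by blast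
qed

text \<open>Associativity already holds for representatives as an equality of records, because both
  bracketings pull sections through the same iterated preimages.\<close>

lemma rat_comp_assoc:
  assumes X: "irr_space k X" and Y: "irr_space k Y" and Z: "irr_space k Z" and W: "irr_space k W"
    and p: "\<phi> \<in> rational_maps k X Y" "dominant Y \<phi>" and q: "\<psi> \<in> rational_maps k Y Z" "dominant Z \<psi>"
    and r: "\<chi> \<in> rational_maps k Z W"
  shows "rat_comp k X Z W \<chi> (rat_comp k X Y Z \<psi> \<phi>) = rat_comp k X Y W (rat_comp k Y Z W \<chi> \<psi>) \<phi>"
proof -
  obtain U f where 0: "(U, f) \<in> \<phi>" using rational_mapE[OF X Y p(1)] .
  obtain V g where 1: "(V, g) \<in> \<psi>" using rational_mapE[OF Y Z q(1)] .
  obtain T h where 2: "(T, h) \<in> \<chi>" using rational_mapE[OF Z W r] .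
  note f = rational_map_mem(1)[OF X Y p(1) 0] and g = rational_map_mem(1)[OF Y Z q(1) 1]
    and h = rational_map_mem(1)[OF Z W r 2]
  note a = rat_comp_rational[OF X Y Z p q(1)] and b = rat_comp_rational[OF Y Z W q r]
  have e1: "pre X (pre X U f V) (comp_mor (open_subspace Y V) g f) T = pre X U f (pre Y V g T)"
    using pre_comp[OF f g] .
  have e2: "comp_mor (open_subspace Z T) h (comp_mor (open_subspace Y V) g f) =
    comp_mor (open_subspace Y (pre Y V g T)) (comp_mor (open_subspace Z T) h g) f"
    unfolding comp_mor_def[of "open_subspace Z T"] comp_mor_def[of "open_subspace Y V"]
      comp_mor_def[of "open_subspace Y (pre Y V g T)"]
    using pre_comp[OF g h] unfolding comp_mor_def[of "open_subspace Z T"] by (simp add: comp_assoc)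
  show ?thesis
    using rat_comp_eq[OF X Z W a(1) a(2)[OF 0 1] r 2 a(3)[OF q(2)]]
      rat_comp_eq[OF X Y W p(1) 0 b(1) b(2)[OF 1 2] p(2)] e1 e2 by simp
qed

lemma rat_comp_id_right:
  assumes X: "irr_space k X" and Y: "irr_space k Y" and p: "\<phi> \<in> rational_maps k X Y"
  shows "rat_comp k X X Y \<phi> (rat_id k X) = \<phi>"
proof -
  obtain U f where 0: "(U, f) \<in> \<phi>" using rational_mapE[OF X Y p(1)] .
  note f = rational_map_mem[OF X Y p 0]
  have "pre X (points X) id_mor U = U" using pmorD(6)[OF f(1)] unfolding preimg_def by auto
  moreover have "comp_mor (open_subspace X U) f id_mor = f"
    unfolding comp_mor_def id_mor_def by (simp add: comp_def)
  ultimately show ?thesis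
    using rat_comp_eq[OF X X Y rat_id_rational(1,2)[OF X] p 0 rat_id_rational(3)[OF X]] f(2) by simp
qed

text \<open>In contrast to \<open>rat_comp_id_right\<close>, the composite of representatives is
  only shown to be related to \<open>f\<close>: composing with \<open>id_mor\<close> intersects the
  index set with \<open>points Y\<close>, which may change \<open>pull\<close> on sets not contained
  in the space.\<close>

lemma rat_comp_id_left:
  assumes X: "irr_space k X" and Y: "irr_space k Y" and p: "\<phi> \<in> rational_maps k X Y" "dominant Y \<phi>"
  shows "rat_comp k X Y Y (rat_id k Y) \<phi> = \<phi>"
proof -
  obtain U f where 0: "(U, f) \<in> \<phi>" using rational_mapE[OF X Y p(1)] .
  note f = rational_map_mem[OF X Y p(1) 0]
  let ?c = "comp_mor (open_subspace Y (points Y)) id_mor f"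
  have e: "pre X U f (points Y) = U"
    using pmor_base[OF f(1)] by (auto simp: pmor_in_preimg[OF f(1)])
  have ye: "pre Y (points Y) id_mor A = A" if "openin (topo Y) A" for A
    using openin_subset[OF that] unfolding preimg_def by auto
  have c: "pmor k X Y U ?c" using pmor_comp[OF X Y f(1) pmor_id[OF Y]] e pmorD(2)[OF f(1)] by simp
  have "agree X Y U U f U ?c"
  proof (rule agreeI[OF f(1) c])
    fix A s assume A: "openin (topo Y) A" "s \<in> carrier (sect Y A)"
    have "pre X U ?c A = pre X U f A" using c f(1) by (auto simp: pmor_in_preimg comp_mor_simps)
    then show "restr X (pre X U f A) (pre X U f A \<inter> U) (pull f A s) =
      restr X (pre X U ?c A) (pre X U f A \<inter> U) (pull ?c A s)"
      unfolding comp_mor_simps using ye[OF A(1)] by simp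
  qed (auto simp: comp_mor_simps)
  then have "((U, f), (U, ?c)) \<in> rat_rel k X Y"
    unfolding rat_rel_iff[OF X Y] using f(1) c pmorD(1,2)[OF f(1)] by (intro conjI exI[of _ U]) auto
  then have "rat_rel k X Y `` {(U, ?c)} = \<phi>"
    using equiv_class_eq[OF rat_rel_equiv[OF X Y]] f(2) by metis
  then show ?thesis
    using rat_comp_eq[OF X Y Y p(1) 0 rat_id_rational(1,2)[OF Y] p(2)] e by simp
qed

section \<open>Inverses of birational maps\<close>

lemma rat_inverse_sym:
  assumes "\<phi> \<in> rational_maps k X Y" "dominant Y \<phi>" "rat_inverse_of k X Y \<phi> \<psi>"
  shows "rat_inverse_of k Y X \<psi> \<phi>"
  using assms unfolding rat_inverse_of_def by auto

text \<open>The usual argument for inverses in a category; it makes the definite description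
  \<open>rat_inv\<close> meaningful.\<close>

lemma rat_inverse_unique:
  assumes X: "irr_space k X" and Y: "irr_space k Y" and p: "\<phi> \<in> rational_maps k X Y" "dominant Y \<phi>"
    and i: "rat_inverse_of k X Y \<phi> \<psi>" and j: "rat_inverse_of k X Y \<phi> \<psi>'"
  shows "\<psi> = \<psi>'"
proof -
  have q: "\<psi> \<in> rational_maps k Y X" "dominant X \<psi>" "rat_comp k X Y X \<psi> \<phi> = rat_id k X"
    and q': "\<psi>' \<in> rational_maps k Y X" "dominant X \<psi>'" "rat_comp k Y X Y \<phi> \<psi>' = rat_id k Y"
    using i j unfolding rat_inverse_of_def by auto
  have "\<psi>' = rat_comp k Y X X (rat_comp k X Y X \<psi> \<phi>) \<psi>'"
    unfolding q(3) using rat_comp_id_left[OF Y X q'(1,2)] by simp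
  also have "\<dots> = rat_comp k Y Y X \<psi> (rat_comp k Y X Y \<phi> \<psi>')"
    using rat_comp_assoc[OF Y X Y X q'(1,2) p q(1)] by simp
  also have "\<dots> = \<psi>" unfolding q'(3) using rat_comp_id_right[OF Y X q(1)] .
  finally show ?thesis by simp
qed

lemma rat_inv_eq:
  assumes "irr_space k X" "irr_space k Y" "\<phi> \<in> rational_maps k X Y" "dominant Y \<phi>"
    "rat_inverse_of k X Y \<phi> \<psi>"
  shows "rat_inv k X Y \<phi> = \<psi>"
  unfolding rat_inv_def using assms(5) rat_inverse_unique[OF assms(1-4) _ assms(5)] by (rule the_equality)

lemma birational_mapD:
  assumes X: "irr_space k X" and Y: "irr_space k Y" and b: "birational_map k X Y \<phi>"
  shows "\<phi> \<in> rational_maps k X Y" "dominant Y \<phi>" "rat_inverse_of k X Y \<phi> (rat_inv k X Y \<phi>)"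
    "birational_map k Y X (rat_inv k X Y \<phi>)" "rat_inv k Y X (rat_inv k X Y \<phi>) = \<phi>"
proof -
  show p: "\<phi> \<in> rational_maps k X Y" "dominant Y \<phi>" using b unfolding birational_map_def by auto
  show i: "rat_inverse_of k X Y \<phi> (rat_inv k X Y \<phi>)"
    using b rat_inv_eq[OF X Y p] unfolding birational_map_def by auto
  have q: "rat_inv k X Y \<phi> \<in> rational_maps k Y X" "dominant X (rat_inv k X Y \<phi>)"
    using i unfolding rat_inverse_of_def by auto
  note j = rat_inverse_sym[OF p i]
  then show "birational_map k Y X (rat_inv k X Y \<phi>)" unfolding birational_map_def using q by blast
  show "rat_inv k Y X (rat_inv k X Y \<phi>) = \<phi>" using rat_inv_eq[OF Y X q j] .
qed

text \<open>Rebracketing brings \<phi> next to its inverse. This is one instance of the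
  two-out-of-three rule: it lets \<psi> be treated as a composite when the other two maps are known
  at a point.\<close>

lemma rat_comp_cancel:
  assumes X: "irr_space k X" and Y: "irr_space k Y" and Z: "irr_space k Z"
    and b: "birational_map k X Y \<phi>" and q: "\<psi> \<in> rational_maps k Y Z" "dominant Z \<psi>"
  shows "rat_comp k Y X Z (rat_comp k X Y Z \<psi> \<phi>) (rat_inv k X Y \<phi>) = \<psi>"
proof -
  note p = birational_mapD[OF X Y b]
  have i: "rat_inv k X Y \<phi> \<in> rational_maps k Y X" "dominant X (rat_inv k X Y \<phi>)"
    "rat_comp k Y X Y \<phi> (rat_inv k X Y \<phi>) = rat_id k Y"
    using p(3) unfolding rat_inverse_of_def by auto
  show ?thesis
    using rat_comp_assoc[OF Y X Y Z i(1,2) p(1,2) q(1)] rat_comp_id_right[OF Y Z q(1)] i(3) by simp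
qed

lemma birational_comp:
  assumes X: "irr_space k X" and Y: "irr_space k Y" and Z: "irr_space k Z"
    and b: "birational_map k X Y \<phi>" and c: "birational_map k Y Z \<psi>"
  shows "birational_map k X Z (rat_comp k X Y Z \<psi> \<phi>)"
    "rat_inv k X Z (rat_comp k X Y Z \<psi> \<phi>) = rat_comp k Z Y X (rat_inv k X Y \<phi>) (rat_inv k Y Z \<psi>)"
proof -
  note p = birational_mapD[OF X Y b] and q = birational_mapD[OF Y Z c]
  let ?i = "rat_inv k X Y \<phi>" and ?j = "rat_inv k Y Z \<psi>"
  have i: "?i \<in> rational_maps k Y X" "dominant X ?i" "rat_comp k X Y X ?i \<phi> = rat_id k X"
    using p(3) unfolding rat_inverse_of_def by auto
  have j: "?j \<in> rational_maps k Z Y" "dominant Y ?j" "rat_comp k Z Y Z \<psi> ?j = rat_id k Z"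
    using q(3) unfolding rat_inverse_of_def by auto
  note pq = rat_comp_rational[OF X Y Z p(1,2) q(1)] and ji = rat_comp_rational[OF Z Y X j(1,2) i(1)]
  have 1: "rat_comp k X Z X (rat_comp k Z Y X ?i ?j) (rat_comp k X Y Z \<psi> \<phi>) = rat_id k X"
  proof -
    have "rat_comp k X Z X (rat_comp k Z Y X ?i ?j) (rat_comp k X Y Z \<psi> \<phi>) =
      rat_comp k X Y X (rat_comp k Y Z X (rat_comp k Z Y X ?i ?j) \<psi>) \<phi>"
      using rat_comp_assoc[OF X Y Z X p(1,2) q(1,2) ji(1)] .
    \<comment> \<open>\<open>rat_comp_cancel\<close> is applied to the birational map
      \<open>?j\<close>; by \<open>q(5)\<close> its inverse is \<psi> again.\<close>
    also have "rat_comp k Y Z X (rat_comp k Z Y X ?i ?j) \<psi> = ?i"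
      using rat_comp_cancel[OF Z Y X q(4) i(1,2)] unfolding q(5) .
    finally show ?thesis using i(3) by simp
  qed
  have 2: "rat_comp k Z X Z (rat_comp k X Y Z \<psi> \<phi>) (rat_comp k Z Y X ?i ?j) = rat_id k Z"
  proof -
    have "rat_comp k Z X Z (rat_comp k X Y Z \<psi> \<phi>) (rat_comp k Z Y X ?i ?j) =
      rat_comp k Z Y Z (rat_comp k Y X Z (rat_comp k X Y Z \<psi> \<phi>) ?i) ?j"
      using rat_comp_assoc[OF Z Y X Z j(1,2) i(1,2) pq(1)] .
    also have "rat_comp k Y X Z (rat_comp k X Y Z \<psi> \<phi>) ?i = \<psi>"
      using rat_comp_cancel[OF X Y Z b q(1,2)] .
    finally show ?thesis using j(3) by simp
  qed
  have inv: "rat_inverse_of k X Z (rat_comp k X Y Z \<psi> \<phi>) (rat_comp k Z Y X ?i ?j)"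
    unfolding rat_inverse_of_def using 1 2 ji(1) ji(3)[OF i(2)] by auto
  then show "birational_map k X Z (rat_comp k X Y Z \<psi> \<phi>)"
    unfolding birational_map_def using pq(1) pq(3)[OF q(2)] by auto
  show "rat_inv k X Z (rat_comp k X Y Z \<psi> \<phi>) = rat_comp k Z Y X ?i ?j"
    using rat_inv_eq[OF X Z pq(1) pq(3)[OF q(2)] inv] .
qed

section \<open>The isomorphism locus\<close>

text \<open>An open embedding together with its inverse on the image. Unlike
  \<open>open_embedding\<close> this is symmetric in both sides, and each half is a representative
  of a rational map into the full space.\<close>

definition inv_pair :: "'k ring \<Rightarrow> ('p, 'r, 'k) over_space \<Rightarrow> ('q, 's, 'k) over_space \<Rightarrow>
    'p set \<Rightarrow> ('p, 'r, 'q, 's) rs_mor \<Rightarrow> 'q set \<Rightarrow> ('q, 's, 'p, 'r) rs_mor \<Rightarrow> bool" where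
  "inv_pair k X Y U f V g \<longleftrightarrow> pmor k X Y U f \<and> pmor k Y X V g \<and> base f ` U \<subseteq> V \<and> base g ` V \<subseteq> U \<and>
     mutually_inverse (open_subspace X U) (open_subspace Y V) f g"

lemma inv_pairD:
  assumes "inv_pair k X Y U f V g"
  shows "pmor k X Y U f" "pmor k Y X V g" "x \<in> U \<Longrightarrow> base f x \<in> V" "y \<in> V \<Longrightarrow> base g y \<in> U"
    "mutually_inverse (open_subspace X U) (open_subspace Y V) f g"
    "x \<in> U \<Longrightarrow> base g (base f x) = x" "y \<in> V \<Longrightarrow> base f (base g y) = y"
    "pre X U f V = U" "pre Y V g U = V" "base f ` U = V"
proof -
  show f: "pmor k X Y U f" and g: "pmor k Y X V g" and m: "mutually_inverse (open_subspace X U) (open_subspace Y V) f g"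
    using assms unfolding inv_pair_def by auto
  show fv: "x \<in> U \<Longrightarrow> base f x \<in> V" and gu: "y \<in> V \<Longrightarrow> base g y \<in> U" for x y
    using assms unfolding inv_pair_def by auto
  show "x \<in> U \<Longrightarrow> base g (base f x) = x"
    using mutually_inverseD(1)[OF m, of x] pmorD(6)[OF f] by auto
  show fg: "y \<in> V \<Longrightarrow> base f (base g y) = y" for y
    using mutually_inverseD(1)[OF m[unfolded mutually_inverse_sym[of "open_subspace X U"]], of y] pmorD(6)[OF g] by auto
  show "pre X U f V = U" "pre Y V g U = V"
    using fv gu by (auto simp: pmor_in_preimg[OF f] pmor_in_preimg[OF g])
  show "base f ` U = V" using fv gu fg by (metis image_subsetI subsetI subset_antisym imageI)
qed

lemma inv_pair_sym: "inv_pair k X Y U f V g \<Longrightarrow> inv_pair k Y X V g U f"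
  unfolding inv_pair_def using mutually_inverse_sym by auto

lemma inv_pair_pull:
  assumes i: "inv_pair k X Y U f V g" and A: "openin (topo X) A" "A \<subseteq> U" "s \<in> carrier (sect X A)"
  shows "pull f (pre Y V g A) (pull g A s) = s" "pre X U f (pre Y V g A) = A"
  using mutually_inverseD(2)[OF inv_pairD(5)[OF i], of A s] A openin_sub[OF pmorD(1)[OF inv_pairD(1)[OF i]]]
    inv_pairD(3,6)[OF i] pmor_in_preimg[OF inv_pairD(1)[OF i]] pmor_in_preimg[OF inv_pairD(2)[OF i]]
  by auto

lemma inv_pairI:
  assumes f: "pmor k X Y U f" and g: "pmor k Y X V g"
    and fV: "\<And>x. x \<in> U \<Longrightarrow> base f x \<in> V" and gU: "\<And>y. y \<in> V \<Longrightarrow> base g y \<in> U"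
    and gf: "\<And>x. x \<in> U \<Longrightarrow> base g (base f x) = x" and fg: "\<And>y. y \<in> V \<Longrightarrow> base f (base g y) = y"
    and p: "\<And>A s. openin (topo X) A \<Longrightarrow> A \<subseteq> U \<Longrightarrow> s \<in> carrier (sect X A) \<Longrightarrow> pull f (pre Y V g A) (pull g A s) = s"
    and q: "\<And>B s. openin (topo Y) B \<Longrightarrow> B \<subseteq> V \<Longrightarrow> s \<in> carrier (sect Y B) \<Longrightarrow> pull g (pre X U f B) (pull f B s) = s"
  shows "inv_pair k X Y U f V g"
  unfolding inv_pair_def mutually_inverse_def mor_eq_def comp_mor_simps open_subspace_simps
    openin_sub[OF pmorD(1)[OF f]] openin_sub[OF pmorD(1)[OF g]]
  using assms by auto

lemma inv_pair_ps_mor: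
  assumes Y: "irr_space k Y" and i: "inv_pair k X Y U f V g"
  shows "ps_mor (open_subspace X U) (open_subspace Y V) f"
    "reflects_inv (open_subspace X U) (open_subspace Y V) f"
proof -
  note f = inv_pairD(1)[OF i] and V = pmorD(1)[OF inv_pairD(2)[OF i]]
  have e: "open_subspace (open_subspace X U) (pre X U f V) = open_subspace X U"
    unfolding open_subspace_twice inv_pairD(8)[OF i] by simp
  show "ps_mor (open_subspace X U) (open_subspace Y V) f"
    using ps_mor_base_change[OF irr_spaceD(2)[OF Y] pmorD(3)[OF f] V] unfolding e .
  show "reflects_inv (open_subspace X U) (open_subspace Y V) f"
    using reflects_inv_base_change[OF pmorD(3,4)[OF f] V] unfolding e .
qed

lemma inv_pair_open_embedding:
  assumes X: "irr_space k X" and Y: "irr_space k Y" and i: "inv_pair k X Y U f V g"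
  shows "open_embedding (open_subscheme X U) Y f"
proof -
  note f = inv_pairD(1)[OF i] and g = inv_pairD(2)[OF i]
  note lX = local_presheaf_sub[OF irr_spaceD(1)[OF X] pmorD(1)[OF f]]
  note lY = local_presheaf_sub[OF irr_spaceD(1)[OF Y] pmorD(1)[OF g]]
  have im: "base f ` points (open_subscheme X U) = V"
    using inv_pairD(10)[OF i] pmorD(6)[OF f] by (simp add: Int_absorb1)
  show ?thesis
    unfolding open_embedding_def im lrs_iso_def open_subscheme_conv
    using lrs_mor_iff[OF lX irr_spaceD(1)[OF Y]] pmorD(3,4)[OF f] pmorD(1)[OF g]
      lrs_mor_iff[OF lX lY] lrs_mor_iff[OF lY lX] inv_pair_ps_mor[OF Y i] inv_pair_ps_mor[OF X inv_pair_sym[OF i]]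
      inv_pairD(5)[OF i] unfolding mutually_inverse_def by blast
qed

text \<open>The inverse supplied by \<open>lrs_iso\<close> maps into the open subspace on
  \<open>U\<close>. Composition with the inclusion makes it a partial map into \<open>X\<close>, and
  its compatibility with the structure morphisms is deduced from that of \<open>f\<close>.\<close>

lemma open_embedding_inv_pair:
  assumes X: "irr_space k X" and Y: "irr_space k Y" and f: "pmor k X Y U f"
    and e: "open_embedding (open_subscheme X U) Y f"
  shows "\<exists>V g. inv_pair k X Y U f V g"
proof -
  define V where "V = base f ` U"
  note U = pmorD(1,6)[OF f]
  have im: "base f ` points (open_subscheme X U) = V"
    unfolding V_def using U by (simp add: Int_absorb1)
  have V: "openin (topo Y) V" using e unfolding open_embedding_def im by auto
  obtain g0 where g0: "lrs_mor (open_subspace Y V) (open_subspace X U) g0"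
    and m: "mutually_inverse (open_subspace X U) (open_subspace Y V) f g0"
    using e unfolding open_embedding_def im lrs_iso_def open_subscheme_conv mutually_inverse_def by auto
  note pX = irr_spaceD(2)[OF X] and pY = irr_spaceD(2)[OF Y]
  note lX = local_presheaf_sub[OF irr_spaceD(1)[OF X] U(1)]
  note lY = local_presheaf_sub[OF irr_spaceD(1)[OF Y] V]
  have g0': "ps_mor (open_subspace Y V) (open_subspace X U) g0" "reflects_inv (open_subspace Y V) (open_subspace X U) g0"
    using g0 lrs_mor_iff[OF lY lX] by auto
  let ?i = "incl_mor X U"
  note ii = ps_mor_restr[OF pX ps_mor_id[OF pX] U(1)] reflects_inv_restr[OF pX ps_mor_id[OF pX] reflects_inv_id U(1)]
  define g where "g = comp_mor (open_subspace X U) ?i g0"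
  have ib: "base ?i x = x" and ip: "pull ?i A s = restr X (points X \<inter> A) (points X \<inter> A \<inter> U) s"
    and ipre: "pre X U ?i A = points X \<inter> U \<inter> A" for x A s
    unfolding restr_mor_def preimg_id by (auto simp: preimg_def)
  have bg: "base g y = base g0 y" for y unfolding g_def comp_mor_simps ib by simp
  \<comment> \<open>On a general open set the inclusion first restricts to \<open>U\<close>; on open
    sets inside \<open>U\<close> the pullbacks along \<open>g\<close> and \<open>g0\<close>
    coincide.\<close>
  have pg: "pull g A s = pull g0 (A \<inter> U) (restr X A (A \<inter> U) s)" if "openin (topo X) A" for A s
    unfolding g_def comp_mor_simps ip ipre using openin_subset[OF that] U(2)
    by (simp add: Int_absorb1 Int_assoc Int_absorb2 Int_commute)
  have gs: "pull g A s = pull g0 A s" if A: "openin (topo X) A" "A \<subseteq> U" "s \<in> carrier (sect X A)" for A s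
    unfolding pg[OF A(1)] using restr_self[OF pX A(1,3)] A(2) by (simp add: Int_absorb2)
  have fV: "base f x \<in> V" if "x \<in> U" for x using that unfolding V_def by auto
  have gf: "base g (base f x) = x" if "x \<in> U" for x
    using mutually_inverseD(1)[OF m, of x] that U(2) bg by auto
  have gU: "base g y \<in> U" if "y \<in> V" for y using that gf unfolding V_def by auto
  have fg: "base f (base g y) = y" if "y \<in> V" for y using that gf unfolding V_def by auto
  have Vp: "V \<subseteq> points Y" using V openin_subset by auto
  have g: "pmor k Y X V g" unfolding pmor_def
  proof (intro conjI)
    show "V \<noteq> {}" unfolding V_def using pmorD(2)[OF f] by auto
    show "ps_mor (open_subspace Y V) X g" unfolding g_def using ps_mor_comp[OF g0'(1) ii(1)] .
    show "reflects_inv (open_subspace Y V) X g" unfolding g_def using reflects_inv_comp[OF g0' ii] .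
    show "str_compat k Y X V g" unfolding str_compat_iff[OF Vp]
    proof (intro conjI ballI allI impI)
      show "base (str X) (base g y) = base (str Y) y" if "y \<in> V" for y
        using pmor_str(1)[OF f gU[OF that]] fg[OF that] by simp
      fix A s assume A: "openin (topo (Spec k)) A" and s: "s \<in> carrier (sect (Spec k) A)"
      let ?B = "preimg Y (str Y) A" and ?C = "preimg X (str X) A"
      let ?a = "pull (str Y) A s"
      have B: "openin (topo Y) ?B" "?a \<in> carrier (sect Y ?B)"
        using ps_mor_preimg[OF irr_spaceD(3)[OF Y] A] ps_mor_pull[OF irr_spaceD(3)[OF Y] A s] by auto
      have C: "openin (topo X) ?C"
        using ps_mor_preimg[OF irr_spaceD(3)[OF X] A] .
      have BV: "openin (topo Y) (?B \<inter> V)" using B V by auto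
      have c: "restr Y ?B (?B \<inter> V) ?a \<in> carrier (sect Y (?B \<inter> V))"
        using restr_closed[OF pY B(1) BV _ B(2)] by auto
      have fBV: "pre X U f (?B \<inter> V) = ?C \<inter> U" "pre X U f ?B = ?C \<inter> U"
      proof -
        show "pre X U f ?B = ?C \<inter> U" using pmor_str(3)[OF f] .
        then show "pre X U f (?B \<inter> V) = ?C \<inter> U"
          using fV by (auto simp: pmor_in_preimg[OF f])
      qed
      \<comment> \<open>Over \<open>U\<close>, a function coming from the base is the
        \<open>f\<close>-pullback of the corresponding function on \<open>Y\<close>, so
        \<open>g0\<close> returns the latter restricted to \<open>V\<close>.\<close>
      have "pull g ?C (pull (str X) A s) = pull g0 (?C \<inter> U) (pull f ?B ?a)"
        unfolding pg[OF C] pmor_str(2)[OF f A s] ..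
      also have "pull f ?B ?a = pull f (?B \<inter> V) (restr Y ?B (?B \<inter> V) ?a)"
        using pmor_restr[OF f B(1) BV _ B(2)] fBV restr_self[OF pX _ pmor_pull[OF f B]] openin_Int[OF C U(1)] by simp
      also have "pull g0 (?C \<inter> U) (pull f (?B \<inter> V) (restr Y ?B (?B \<inter> V) ?a)) = restr Y ?B (?B \<inter> V) ?a"
        using mutually_inverseD(2)[OF m[unfolded mutually_inverse_sym[of "open_subspace X U"]], of "?B \<inter> V"]
          openin_sub[OF V] BV c fBV by simp
      finally show "pull g ?C (pull (str X) A s) = restr Y ?B (?B \<inter> V) ?a" .
    qed
  qed (rule V)
  have pre0: "preimg (open_subspace Y V) g A = preimg (open_subspace Y V) g0 A" for A
    unfolding preimg_def bg ..
  have "inv_pair k X Y U f V g"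
  proof (rule inv_pairI[OF f g fV gU gf fg])
    show "pull f (pre Y V g A) (pull g A s) = s" if A: "openin (topo X) A" "A \<subseteq> U" "s \<in> carrier (sect X A)" for A s
      unfolding gs[OF A] pre0 using mutually_inverseD(2)[OF m] A openin_sub[OF U(1)] by simp
    fix B s assume B: "openin (topo Y) B" "B \<subseteq> V" "s \<in> carrier (sect Y B)"
    show "pull g (pre X U f B) (pull f B s) = s"
      using gs[OF pmor_preimg[OF f B(1)] pmor_pull[OF f B(1,3)]] B openin_sub[OF V]
        mutually_inverseD(2)[OF m[unfolded mutually_inverse_sym[of "open_subspace X U"]]] by simp
  qed
  then show ?thesis by blast
qed

text \<open>The graph of \<phi> over its isomorphism locus. It is a relation because different
  representatives might a priori send \<open>x\<close> to different points; separatedness of the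
  target will exclude this.\<close>

definition iso_corr :: "'k ring \<Rightarrow> ('p, 'r, 'k) over_space \<Rightarrow> ('q, 's, 'k) over_space \<Rightarrow>
    ('p, 'r, 'q, 's) rat_map \<Rightarrow> 'p \<Rightarrow> 'q \<Rightarrow> bool" where
  "iso_corr k X Y \<phi> x y \<longleftrightarrow>
     (\<exists>U f V g. (U, f) \<in> \<phi> \<and> x \<in> U \<and> base f x = y \<and> inv_pair k X Y U f V g)"

lemma iso_at_iff:
  assumes X: "irr_space k X" and Y: "irr_space k Y" and p: "\<phi> \<in> rational_maps k X Y"
  shows "iso_at X Y \<phi> x \<longleftrightarrow> (\<exists>y. iso_corr k X Y \<phi> x y)"
proof
  assume "iso_at X Y \<phi> x"
  then obtain U f where U: "(U, f) \<in> \<phi>" "x \<in> U" "open_embedding (open_subscheme X U) Y f"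
    unfolding iso_at_def by auto
  then show "\<exists>y. iso_corr k X Y \<phi> x y"
    unfolding iso_corr_def using open_embedding_inv_pair[OF X Y rational_map_mem(1)[OF X Y p U(1)] U(3)] by blast
next
  assume "\<exists>y. iso_corr k X Y \<phi> x y"
  then show "iso_at X Y \<phi> x"
    unfolding iso_corr_def iso_at_def using inv_pair_open_embedding[OF X Y] by blast
qed

lemma iso_corr_points:
  assumes "iso_corr k X Y \<phi> x y"
  shows "x \<in> points X" "y \<in> points Y"
proof -
  obtain U f V g where x: "x \<in> U" "base f x = y" and i: "inv_pair k X Y U f V g"
    using assms unfolding iso_corr_def by auto
  show "x \<in> points X" "y \<in> points Y"
    using pmorD(6)[OF inv_pairD(1)[OF i]] pmor_base[OF inv_pairD(1)[OF i] x(1)] x by auto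
qed

lemma inv_pair_comp_id:
  assumes X: "irr_space k X" and Y: "irr_space k Y" and i: "inv_pair k X Y U f V g"
  shows "rat_rel k X X `` {(pre X U f V, comp_mor (open_subspace Y V) g f)} = rat_id k X"
proof -
  note f = inv_pairD(1)[OF i] and g = inv_pairD(2)[OF i] and U = pmorD(1,2,6)[OF inv_pairD(1)[OF i]]
  let ?c = "comp_mor (open_subspace Y V) g f"
  have c: "pmor k X X U ?c"
    using pmor_comp[OF X Y f g] inv_pairD(8)[OF i] U(2) by simp
  have "agree X X U (points X) id_mor U ?c"
  proof (rule agreeI[OF pmor_id[OF X] c])
    show "U \<subseteq> points X \<inter> U" using U by auto
    show "base id_mor x = base ?c x" if "x \<in> U" for x
      using inv_pairD(6)[OF i that] by (simp add: comp_mor_simps)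
    fix A s assume A: "openin (topo X) A" "s \<in> carrier (sect X A)"
    note pX = irr_spaceD(2)[OF X]
    have Ap: "A \<subseteq> points X" using A openin_subset by auto
    have e1: "pre X (points X) id_mor A = A" unfolding preimg_def using Ap by auto
    have cp: "pre X U ?c A = A \<inter> U"
      using inv_pairD(6)[OF i] by (auto simp: pmor_in_preimg[OF c] comp_mor_simps)
    have AU: "openin (topo X) (A \<inter> U)" using A U by auto
    have s': "restr X A (A \<inter> U) s \<in> carrier (sect X (A \<inter> U))" using restr_closed[OF pX A(1) AU _ A(2)] by auto
    \<comment> \<open>As \<open>g\<close> maps into \<open>U\<close>, only the part of
      \<open>A\<close> inside \<open>U\<close> matters. This makes \<open>inv_pair_pull\<close>
      applicable to an arbitrary open \<open>A\<close>.\<close>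
    have ge: "pre Y V g (A \<inter> U) = pre Y V g A"
      using inv_pairD(4)[OF i] by (auto simp: pmor_in_preimg[OF g])
    have "pull g (A \<inter> U) (restr X A (A \<inter> U) s) = pull g A s"
      using pmor_restr[OF g A(1) AU _ A(2)] ge
        restr_self[OF irr_spaceD(2)[OF Y] pmor_preimg(1)[OF g A(1)] pmor_pull[OF g A]] by simp
    then have "pull ?c A s = restr X A (A \<inter> U) s"
      unfolding comp_mor_simps using inv_pair_pull(1)[OF i AU _ s'] ge by simp
    then show "restr X (pre X (points X) id_mor A) (pre X (points X) id_mor A \<inter> U) (pull id_mor A s) =
      restr X (pre X U ?c A) (pre X (points X) id_mor A \<inter> U) (pull ?c A s)"
      unfolding e1 cp using restr_self[OF pX AU s'] by simp
  qed
  then have "((points X, id_mor), (U, ?c)) \<in> rat_rel k X X"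
    unfolding rat_rel_iff[OF X X] using c pmor_id[OF X] U by (intro conjI exI[of _ U]) auto
  then show ?thesis
    unfolding rat_id_def inv_pairD(8)[OF i] using equiv_class_eq[OF rat_rel_equiv[OF X X]] by metis
qed

lemma inv_pair_dom:
  assumes i: "inv_pair k X Y U f V g" and X: "irr_space k X"
  shows "dom_mor Y X V g"
  unfolding dom_mor_def
proof (intro allI impI)
  fix A assume A: "openin (topo X) A" "A \<noteq> {}"
  obtain x where "x \<in> A" "x \<in> U"
    using irr_space_Int[OF X A pmorD(1,2)[OF inv_pairD(1)[OF i]]] by auto
  then have "base f x \<in> pre Y V g A"
    using inv_pairD(3,6)[OF i] by (auto simp: pmor_in_preimg[OF inv_pairD(2)[OF i]])
  then show "pre Y V g A \<noteq> {}" by auto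
qed

text \<open>Composites may be computed from any representatives, so the class of \<open>g\<close>
  composes with \<phi> to the identity on both sides; uniqueness of inverses identifies it with
  \<open>rat_inv\<close>.\<close>

lemma inv_pair_rat_inv:
  assumes X: "irr_space k X" and Y: "irr_space k Y" and b: "birational_map k X Y \<phi>"
    and m: "(U, f) \<in> \<phi>" and i: "inv_pair k X Y U f V g"
  shows "(V, g) \<in> rat_inv k X Y \<phi>"
proof -
  note p = birational_mapD(1,2)[OF X Y b]
  note g = inv_pairD(2)[OF i]
  let ?g = "rat_rel k Y X `` {(V, g)}"
  note c = rational_map_class[OF Y X g]
  have d: "dominant X ?g" using dominant_iff[OF Y X c] inv_pair_dom[OF i X] by auto
  have "rat_inverse_of k X Y \<phi> ?g"
    unfolding rat_inverse_of_def
    using c(1) d rat_comp_eq[OF X Y X p(1) m c p(2)] inv_pair_comp_id[OF X Y i]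
      rat_comp_eq[OF Y X Y c p(1) m d] inv_pair_comp_id[OF Y X inv_pair_sym[OF i]] by simp
  then show ?thesis using rat_inv_eq[OF X Y p] c(2) by simp
qed

lemma iso_corr_inv:
  assumes X: "irr_space k X" and Y: "irr_space k Y" and b: "birational_map k X Y \<phi>"
    and c: "iso_corr k X Y \<phi> x y"
  shows "iso_corr k Y X (rat_inv k X Y \<phi>) y x"
proof -
  obtain U f V g where m: "(U, f) \<in> \<phi>" "x \<in> U" "base f x = y" and i: "inv_pair k X Y U f V g"
    using c unfolding iso_corr_def by auto
  show ?thesis unfolding iso_corr_def
    using inv_pair_rat_inv[OF X Y b m(1) i] inv_pair_sym[OF i] inv_pairD(3,6)[OF i m(2)] m(3) by blast
qed

lemma inv_pair_comp_pull:
  assumes i: "inv_pair k X Y U f V g" and j: "inv_pair k Y Z V' g' W h"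
    and A: "openin (topo X) A" "A \<subseteq> pre X U f V'" "s \<in> carrier (sect X A)"
  shows "pull (comp_mor (open_subspace Y V') g' f) (pre Z (pre Z W h V) (comp_mor (open_subspace Y V) g h) A)
      (pull (comp_mor (open_subspace Y V) g h) A s) = s"
proof -
  note f = inv_pairD(1)[OF i] and g = inv_pairD(2)[OF i] and g' = inv_pairD(1)[OF j] and h = inv_pairD(2)[OF j]
  let ?B = "pre Y V g A" and ?b = "pull g A s"
  have AU: "A \<subseteq> U" using A(2) pmor_preimg(2)[OF f pmorD(1)[OF g']] by auto
  have B: "openin (topo Y) ?B" "?b \<in> carrier (sect Y ?B)" using pmor_preimg(1)[OF g A(1)] pmor_pull[OF g A(1,3)] by auto
  have BV: "?B \<subseteq> V'"
  proof
    fix z assume "z \<in> ?B"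
    then have z: "z \<in> V" "base g z \<in> A" unfolding pmor_in_preimg[OF g] by auto
    then have "base f (base g z) \<in> V'" using A(2) pmor_in_preimg[OF f] by blast
    then show "z \<in> V'" using inv_pairD(7)[OF i z(1)] by simp
  qed
  have "pull g' (pre Z W h ?B) (pull h ?B ?b) = ?b" "pre Y V' g' (pre Z W h ?B) = ?B"
    using inv_pair_pull[OF j B(1) BV B(2)] .
  moreover have "pull f ?B ?b = s" using inv_pair_pull(1)[OF i A(1) AU A(3)] .
  ultimately show ?thesis unfolding pre_comp[OF h g] comp_mor_simps by simp
qed

text \<open>Two isomorphisms between open sets compose over the overlap \<open>V \<inter> V'\<close>
  in \<open>Y\<close>, which corresponds to the \<open>f\<close>-preimage of \<open>V'\<close> in
  \<open>X\<close> and to the \<open>h\<close>-preimage of \<open>V\<close> in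
  \<open>Z\<close>.\<close>

lemma inv_pair_comp:
  assumes X: "irr_space k X" and Y: "irr_space k Y" and Z: "irr_space k Z"
    and i: "inv_pair k X Y U f V g" and j: "inv_pair k Y Z V' g' W h" and ne: "V \<inter> V' \<noteq> {}"
  shows "inv_pair k X Z (pre X U f V') (comp_mor (open_subspace Y V') g' f)
    (pre Z W h V) (comp_mor (open_subspace Y V) g h)"
proof -
  note f = inv_pairD(1)[OF i] and g = inv_pairD(2)[OF i] and g' = inv_pairD(1)[OF j] and h = inv_pairD(2)[OF j]
  obtain y where y: "y \<in> V" "y \<in> V'" using ne by auto
  have n1: "pre X U f V' \<noteq> {}"
  proof -
    have "base g y \<in> pre X U f V'" unfolding pmor_in_preimg[OF f] using inv_pairD(4,7)[OF i y(1)] y by auto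
    then show ?thesis by auto
  qed
  have n2: "pre Z W h V \<noteq> {}"
  proof -
    have "base g' y \<in> pre Z W h V" unfolding pmor_in_preimg[OF h] using inv_pairD(3,6)[OF j y(2)] y by auto
    then show ?thesis by auto
  qed
  show ?thesis
  proof (rule inv_pairI[OF pmor_comp[OF X Y f g' n1] pmor_comp[OF Z Y h g n2]])
    note a = inv_pairD(3,4,6,7)[OF i] and b = inv_pairD(3,4,6,7)[OF j]
    show "base (comp_mor (open_subspace Y V') g' f) x \<in> pre Z W h V" if "x \<in> pre X U f V'" for x
      using that a b unfolding pmor_in_preimg[OF f] pmor_in_preimg[OF h] comp_mor_simps by auto
    show "base (comp_mor (open_subspace Y V) g h) z \<in> pre X U f V'" if "z \<in> pre Z W h V" for z
      using that a b unfolding pmor_in_preimg[OF f] pmor_in_preimg[OF h] comp_mor_simps by auto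
    show "base (comp_mor (open_subspace Y V) g h) (base (comp_mor (open_subspace Y V') g' f) x) = x"
      if "x \<in> pre X U f V'" for x
      using that a b unfolding pmor_in_preimg[OF f] comp_mor_simps by auto
    show "base (comp_mor (open_subspace Y V') g' f) (base (comp_mor (open_subspace Y V) g h) z) = z"
      if "z \<in> pre Z W h V" for z
      using that a b unfolding pmor_in_preimg[OF h] comp_mor_simps by auto
    show "pull (comp_mor (open_subspace Y V') g' f) (pre Z (pre Z W h V) (comp_mor (open_subspace Y V) g h) A)
      (pull (comp_mor (open_subspace Y V) g h) A s) = s"
      if "openin (topo X) A" "A \<subseteq> pre X U f V'" "s \<in> carrier (sect X A)" for A s
      using inv_pair_comp_pull[OF i j that] .
    show "pull (comp_mor (open_subspace Y V) g h) (pre X (pre X U f V') (comp_mor (open_subspace Y V') g' f) B)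
      (pull (comp_mor (open_subspace Y V') g' f) B s) = s"
      if "openin (topo Z) B" "B \<subseteq> pre Z W h V" "s \<in> carrier (sect Z B)" for B s
      using inv_pair_comp_pull[OF inv_pair_sym[OF j] inv_pair_sym[OF i] that] .
  qed
qed

lemma iso_corr_comp:
  assumes X: "irr_space k X" and Y: "irr_space k Y" and Z: "irr_space k Z"
    and p: "\<phi> \<in> rational_maps k X Y" "dominant Y \<phi>" and q: "\<psi> \<in> rational_maps k Y Z"
    and c: "iso_corr k X Y \<phi> x y" "iso_corr k Y Z \<psi> y z"
  shows "iso_corr k X Z (rat_comp k X Y Z \<psi> \<phi>) x z"
proof -
  obtain U f V g where m: "(U, f) \<in> \<phi>" "x \<in> U" "base f x = y" and i: "inv_pair k X Y U f V g"
    using c unfolding iso_corr_def by auto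
  obtain V' g' W h where n: "(V', g') \<in> \<psi>" "y \<in> V'" "base g' y = z" and j: "inv_pair k Y Z V' g' W h"
    using c unfolding iso_corr_def by auto
  have "V \<inter> V' \<noteq> {}" using inv_pairD(3)[OF i m(2)] m(3) n(2) by auto
  note k = inv_pair_comp[OF X Y Z i j this]
  have "x \<in> pre X U f V'" unfolding pmor_in_preimg[OF inv_pairD(1)[OF i]] using m n by auto
  moreover have "base (comp_mor (open_subspace Y V') g' f) x = z" unfolding comp_mor_simps using m n by auto
  ultimately show ?thesis
    unfolding iso_corr_def using rat_comp_rational(2)[OF X Y Z p q m(1) n(1)] k by blast
qed

section \<open>A birational map is an isomorphism somewhere\<close>

lemma pmor_restrict:
  assumes X: "irr_space k X" and Y: "irr_space k Y" and f: "pmor k X Y U f"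
    and U1: "openin (topo X) U1" "U1 \<subseteq> U" "U1 \<noteq> {}"
  shows "pmor k X Y U1 (restr_mor (open_subspace X U) U1 f)
      \<and> ((U, f), (U1, restr_mor (open_subspace X U) U1 f)) \<in> rat_rel k X Y"
proof -
  note pX = irr_spaceD(2)[OF X]
  note psU = presheaf_sub[OF pX pmorD(1)[OF f]]
  have oU1: "openin (topo (open_subspace X U)) U1" using openin_sub[OF pmorD(1)[OF f]] U1 by simp
  have e: "open_subspace (open_subspace X U) U1 = open_subspace X U1"
    unfolding open_subspace_twice using U1(2) by (simp add: Int_absorb1)
  have U1p: "U1 \<subseteq> points X" using U1 openin_subset by auto
  let ?f = "restr_mor (open_subspace X U) U1 f"
  have pl: "pull ?f A s = restr X (pre X U f A) (pre X U f A \<inter> U1) (pull f A s)" and bs: "base ?f = base f" for A s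
    unfolding restr_mor_def by auto
  have "str_compat k X Y U1 ?f" unfolding str_compat_iff[OF U1p]
  proof (intro conjI ballI allI impI)
    show "base (str Y) (base ?f x) = base (str X) x" if "x \<in> U1" for x
      unfolding bs using pmor_str(1)[OF f] that U1(2) by auto
    fix A s assume A: "openin (topo (Spec k)) A" and s: "s \<in> carrier (sect (Spec k) A)"
    let ?C = "preimg X (str X) A"
    have C: "openin (topo X) ?C" "pull (str X) A s \<in> carrier (sect X ?C)"
      using ps_mor_preimg[OF irr_spaceD(3)[OF X] A] ps_mor_pull[OF irr_spaceD(3)[OF X] A s] by auto
    have "restr X (?C \<inter> U) (?C \<inter> U \<inter> U1) (restr X ?C (?C \<inter> U) (pull (str X) A s)) =
      restr X ?C (?C \<inter> U1) (pull (str X) A s)"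
      using restr_restr[OF pX C(1) openin_Int[OF C(1) pmorD(1)[OF f]] openin_Int[OF C(1) U1(1)] _ _ C(2)] U1(2)
      by (simp add: Int_assoc Int_absorb1 le_infI2)
    then show "pull ?f (preimg Y (str Y) A) (pull (str Y) A s) = restr X ?C (?C \<inter> U1) (pull (str X) A s)"
      unfolding pl pmor_str(3)[OF f] pmor_str(2)[OF f A s] .
  qed
  then have p1: "pmor k X Y U1 ?f"
    unfolding pmor_def
    using U1 ps_mor_restr[OF psU pmorD(3)[OF f] oU1, unfolded e] reflects_inv_restr[OF psU pmorD(3,4)[OF f] oU1, unfolded e]
    by auto
  moreover have "agree X Y U1 U f U1 ?f"
  proof (rule agreeI[OF f p1])
    fix A s assume A: "openin (topo Y) A" "s \<in> carrier (sect Y A)"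
    have e: "pre X U1 ?f A = pre X U f A \<inter> U1"
      using U1(2) by (auto simp: pmor_in_preimg[OF p1] pmor_in_preimg[OF f] bs)
    have "openin (topo X) (pre X U f A \<inter> U1)" using pmor_preimg(1)[OF f A(1)] U1 by auto
    then show "restr X (pre X U f A) (pre X U f A \<inter> U1) (pull f A s) =
      restr X (pre X U1 ?f A) (pre X U f A \<inter> U1) (pull ?f A s)"
      unfolding e pl using restr_self[OF pX _ restr_closed[OF pX pmor_preimg(1)[OF f A(1)] _ _ pmor_pull[OF f A]]] by simp
  qed (use U1 bs in auto)
  ultimately show ?thesis
    unfolding rat_rel_iff[OF X Y] using f U1 by auto
qed

text \<open>The double pullback is a restriction of the pullback along the composite, which agrees
  with the identity on \<open>W\<close>. This is one of the two identities that make the restricted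
  maps mutually inverse, stated so that it also applies with \<open>X\<close> and \<open>Y\<close>
  exchanged.\<close>

lemma restr_mor_inverse_pull:
  assumes X: "irr_space k X" and Y: "irr_space k Y" and f: "pmor k X Y U f" and g: "pmor k Y X V g"
    and gf: "pmor k X X (pre X U f V) (comp_mor (open_subspace Y V) g f)"
    and W: "openin (topo X) W" "W \<subseteq> points X \<inter> pre X U f V"
      "agree X X W (points X) id_mor (pre X U f V) (comp_mor (open_subspace Y V) g f)"
    and U1: "openin (topo X) U1" "U1 \<subseteq> U" "U1 \<subseteq> W" and V1: "openin (topo Y) V1" "V1 \<subseteq> V"
    and fU1: "\<And>x. x \<in> U1 \<Longrightarrow> base f x \<in> V1"
    and A: "openin (topo X) A" "A \<subseteq> U1" "s \<in> carrier (sect X A)"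
  shows "pull (restr_mor (open_subspace X U) U1 f) (pre Y V1 (restr_mor (open_subspace Y V) V1 g) A)
      (pull (restr_mor (open_subspace Y V) V1 g) A s) = s"
proof -
  note pX = irr_spaceD(2)[OF X] and pY = irr_spaceD(2)[OF Y]
  let ?gf = "comp_mor (open_subspace Y V) g f"
  let ?f1 = "restr_mor (open_subspace X U) U1 f" and ?g1 = "restr_mor (open_subspace Y V) V1 g"
  let ?P = "pre Y V g A"
  note P = pmor_preimg(1)[OF g A(1)] and a = pmor_pull[OF g A(1,3)]
  have PV: "openin (topo Y) (?P \<inter> V1)" using P V1 by auto
  have p1: "pre Y V1 ?g1 A = ?P \<inter> V1"
    using V1(2) pmorD(6)[OF g] unfolding restr_mor_def preimg_def by auto
  have gfx: "base g (base f x) = x" if "x \<in> W" for x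
    using agree_base[OF pmor_id[OF X] W(2,3) that] by (simp add: comp_mor_simps)
  have AW: "A \<subseteq> W" using A(2) U1(3) by auto
  have fA: "pre X U f (?P \<inter> V1) \<inter> U1 = A"
  proof
    show "pre X U f (?P \<inter> V1) \<inter> U1 \<subseteq> A"
      using gfx U1(3) by (auto simp: pmor_in_preimg[OF f] pmor_in_preimg[OF g])
    show "A \<subseteq> pre X U f (?P \<inter> V1) \<inter> U1"
    proof
      fix x assume x: "x \<in> A"
      then have "x \<in> U1" "x \<in> U" "x \<in> W" using A(2) U1 by auto
      then show "x \<in> pre X U f (?P \<inter> V1) \<inter> U1"
        using gfx[of x] fU1[of x] V1(2) x by (auto simp: pmor_in_preimg[OF f] pmor_in_preimg[OF g])
    qed
  qed
  note fP = pmor_preimg(1)[OF f P] and fPV = pmor_preimg(1)[OF f PV]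
  have sub: "A \<subseteq> pre X U f (?P \<inter> V1)" "pre X U f (?P \<inter> V1) \<subseteq> pre X U f ?P"
    using fA by (auto simp: preimg_def)
  have pid: "pre X (points X) id_mor A = A" using openin_subset[OF A(1)] unfolding preimg_def by auto
  have "pull ?f1 (pre Y V1 ?g1 A) (pull ?g1 A s) =
    restr X (pre X U f (?P \<inter> V1)) A (pull f (?P \<inter> V1) (restr Y ?P (?P \<inter> V1) (pull g A s)))"
    unfolding p1 using fA unfolding restr_mor_def by simp
  also have "\<dots> = restr X (pre X U f ?P) A (pull f ?P (pull g A s))"
    unfolding pmor_restr[OF f P PV inf_le1 a]
    using restr_restr[OF pX fP fPV A(1) sub(2,1) pmor_pull[OF f P a]] .
  also have "\<dots> = restr X (pre X (pre X U f V) ?gf A) A (pull ?gf A s)"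
    unfolding pre_comp[OF f g] comp_mor_simps ..
  also have "\<dots> = restr X A A s"
    using agree_restr[OF pX pmor_id[OF X] gf W A(1,3) A(1) AW] unfolding pid by simp
  also have "\<dots> = s" using restr_self[OF pX A(1,3)] .
  finally show ?thesis .
qed

text \<open>This keeps the exceptional locus from being the whole space. Birationality gives
  equalities of classes only, so a pair of inverse isomorphisms has to be cut out of
  representatives.\<close>

lemma birational_iso_somewhere:
  assumes X: "irr_space k X" and Y: "irr_space k Y" and b: "birational_map k X Y \<phi>"
  shows "\<exists>x y. iso_corr k X Y \<phi> x y"
proof -
  let ?\<psi> = "rat_inv k X Y \<phi>"
  note bd = birational_mapD[OF X Y b]
  note p = bd(1,2)
  have q: "?\<psi> \<in> rational_maps k Y X" "dominant X ?\<psi>" "rat_comp k X Y X ?\<psi> \<phi> = rat_id k X"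
    "rat_comp k Y X Y \<phi> ?\<psi> = rat_id k Y"
    using bd(3) unfolding rat_inverse_of_def by auto
  obtain U f where 0: "(U, f) \<in> \<phi>" using rational_mapE[OF X Y p(1)] .
  obtain V g where 1: "(V, g) \<in> ?\<psi>" using rational_mapE[OF Y X q(1)] .
  note f = rational_map_mem[OF X Y p(1) 0] and g = rational_map_mem[OF Y X q(1) 1]
  note pX = irr_spaceD(2)[OF X] and pY = irr_spaceD(2)[OF Y]
  let ?gf = "comp_mor (open_subspace Y V) g f" and ?fg = "comp_mor (open_subspace X U) f g"
  have "((points X, id_mor), (pre X U f V, ?gf)) \<in> rat_rel k X X"
    using rat_comp_rational(2)[OF X Y X p q(1) 0 1] unfolding q(3) rat_id_def by auto
  then obtain W where gf: "pmor k X X (pre X U f V) ?gf"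
    and W: "openin (topo X) W" "W \<noteq> {}" "W \<subseteq> points X \<inter> pre X U f V"
      "agree X X W (points X) id_mor (pre X U f V) ?gf"
    unfolding rat_rel_iff[OF X X] by auto
  have "((points Y, id_mor), (pre Y V g U, ?fg)) \<in> rat_rel k Y Y"
    using rat_comp_rational(2)[OF Y X Y q(1,2) p(1) 1 0] unfolding q(4) rat_id_def by auto
  then obtain W' where fg: "pmor k Y Y (pre Y V g U) ?fg"
    and W': "openin (topo Y) W'" "W' \<noteq> {}" "W' \<subseteq> points Y \<inter> pre Y V g U"
      "agree Y Y W' (points Y) id_mor (pre Y V g U) ?fg"
    unfolding rat_rel_iff[OF Y Y] by auto
  have gfx: "x \<in> U" "base f x \<in> V" "base g (base f x) = x" if "x \<in> W" for x
    using agree_base[OF pmor_id[OF X] W(3,4) that] that W(3) by (auto simp: comp_mor_simps pmor_in_preimg[OF f(1)])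
  have fgy: "y \<in> V" "base g y \<in> U" "base f (base g y) = y" if "y \<in> W'" for y
    using agree_base[OF pmor_id[OF Y] W'(3,4) that] that W'(3) by (auto simp: comp_mor_simps pmor_in_preimg[OF g(1)])
  \<comment> \<open>On \<open>W\<close> and \<open>W'\<close> the two composites are the identity.
    The smaller sets are carried into each other: for \<open>x\<close> in \<open>U1\<close> the
    point \<open>base f x\<close> lies in \<open>W'\<close>, and \<open>g\<close> sends it back to
    \<open>x\<close>, which lies in \<open>W\<close>.\<close>
  define U1 where "U1 = W \<inter> pre X U f W'"
  define V1 where "V1 = W' \<inter> pre Y V g W"
  have U1: "openin (topo X) U1" "U1 \<subseteq> U" unfolding U1_def using W pmor_preimg[OF f(1) W'(1)] by auto
  have V1: "openin (topo Y) V1" "V1 \<subseteq> V" unfolding V1_def using W' pmor_preimg[OF g(1) W(1)] by auto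
  have "dom_mor X Y U f" using dominant_iff[OF X Y p(1) 0] p(2) by auto
  then have "pre X U f W' \<noteq> {}" using W' unfolding dom_mor_def by auto
  then have U1n: "U1 \<noteq> {}" unfolding U1_def using irr_space_Int[OF X W(1,2) pmor_preimg(1)[OF f(1) W'(1)]] by auto
  have fU1: "base f x \<in> V1" if "x \<in> U1" for x
    using that gfx[of x] unfolding U1_def V1_def Int_iff pmor_in_preimg[OF f(1)] pmor_in_preimg[OF g(1)] by simp
  have gV1: "base g y \<in> U1" if "y \<in> V1" for y
    using that fgy[of y] unfolding U1_def V1_def Int_iff pmor_in_preimg[OF f(1)] pmor_in_preimg[OF g(1)] by simp
  have V1n: "V1 \<noteq> {}" using U1n fU1 by auto
  define f1 where "f1 = restr_mor (open_subspace X U) U1 f"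
  define g1 where "g1 = restr_mor (open_subspace Y V) V1 g"
  note r1 = pmor_restrict[OF X Y f(1) U1 U1n, folded f1_def] and r2 = pmor_restrict[OF Y X g(1) V1 V1n, folded g1_def]
  have "inv_pair k X Y U1 f1 V1 g1"
  proof (rule inv_pairI[OF conjunct1[OF r1] conjunct1[OF r2]])
    have bs: "base f1 = base f" "base g1 = base g" unfolding f1_def g1_def restr_mor_def by auto
    show "base f1 x \<in> V1" "base g1 (base f1 x) = x" if "x \<in> U1" for x
      unfolding bs using fU1[OF that] gfx(3)[of x] that unfolding U1_def by auto
    show "base g1 y \<in> U1" "base f1 (base g1 y) = y" if "y \<in> V1" for y
      unfolding bs using gV1[OF that] fgy(3)[of y] that unfolding V1_def by auto
    show "pull f1 (pre Y V1 g1 A) (pull g1 A s) = s"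
      if "openin (topo X) A" "A \<subseteq> U1" "s \<in> carrier (sect X A)" for A s
      unfolding f1_def g1_def
      using restr_mor_inverse_pull[OF X Y f(1) g(1) gf W(1,3,4) U1 _ V1 fU1 that] U1_def by auto
    show "pull g1 (pre X U1 f1 B) (pull f1 B s) = s"
      if "openin (topo Y) B" "B \<subseteq> V1" "s \<in> carrier (sect Y B)" for B s
      unfolding f1_def g1_def
      using restr_mor_inverse_pull[OF Y X g(1) f(1) fg W'(1,3,4) V1 _ U1 gV1 that] V1_def by auto
  qed
  moreover have "(U1, f1) \<in> \<phi>" using r1 f(2) by auto
  ultimately show ?thesis unfolding iso_corr_def using U1n by blast
qed

section \<open>Invariance of codimension and residue field\<close>

lemma irreducible_subset_subtopology:
  "irreducible_subset (subtopology T U) S \<longleftrightarrow> irreducible_subset T S \<and> S \<subseteq> U"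
proof
  assume i: "irreducible_subset (subtopology T U) S"
  then have S: "S \<subseteq> topspace T" "S \<subseteq> U" "S \<noteq> {}" unfolding irreducible_subset_def by auto
  have "S \<subseteq> A \<or> S \<subseteq> B" if "closedin T A" "closedin T B" "S \<subseteq> A \<union> B" for A B
  proof -
    have "closedin (subtopology T U) (A \<inter> U)" "closedin (subtopology T U) (B \<inter> U)"
      using that closedin_subtopology by blast+
    moreover have "S \<subseteq> A \<inter> U \<union> B \<inter> U" using that S by auto
    ultimately show ?thesis using i unfolding irreducible_subset_def by (metis le_inf_iff)
  qed
  then show "irreducible_subset T S \<and> S \<subseteq> U" using S unfolding irreducible_subset_def by auto
next
  assume i: "irreducible_subset T S \<and> S \<subseteq> U"
  have "S \<subseteq> A \<or> S \<subseteq> B" if AB: "closedin (subtopology T U) A" "closedin (subtopology T U) B" "S \<subseteq> A \<union> B" for A B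
  proof -
    obtain A' B' where "closedin T A'" "A = A' \<inter> U" "closedin T B'" "B = B' \<inter> U"
      using AB(1,2) unfolding closedin_subtopology by auto
    moreover then have "S \<subseteq> A' \<union> B'" using AB(3) by auto
    ultimately show ?thesis using i unfolding irreducible_subset_def by (metis le_inf_iff)
  qed
  then show "irreducible_subset (subtopology T U) S" using i unfolding irreducible_subset_def by auto
qed

lemma irreducible_subset_closure:
  assumes "irreducible_subset T S"
  shows "irreducible_subset T (T closure_of S)"
proof -
  have S: "S \<subseteq> topspace T" "S \<noteq> {}" using assms unfolding irreducible_subset_def by auto
  have "T closure_of S \<subseteq> A \<or> T closure_of S \<subseteq> B"
    if "closedin T A" "closedin T B" "T closure_of S \<subseteq> A \<union> B" for A B
  proof -
    have "S \<subseteq> A \<or> S \<subseteq> B"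
      using that assms closure_of_subset[OF S(1)] unfolding irreducible_subset_def by blast
    then show ?thesis using that closure_of_minimal by metis
  qed
  then show ?thesis
    using S closure_of_subset[OF S(1)] closure_of_subset_topspace[of T S] unfolding irreducible_subset_def by blast
qed

text \<open>\<open>C\<close> is covered by the closure of \<open>C \<inter> U\<close> and the
  complement of \<open>U\<close>, and it is not inside the latter.\<close>

lemma irreducible_subset_open:
  assumes C: "irreducible_subset T C" and U: "openin T U" and ne: "C \<inter> U \<noteq> {}"
  shows "C \<subseteq> T closure_of (C \<inter> U)" "irreducible_subset T (C \<inter> U)"
proof -
  have Cs: "C \<subseteq> topspace T" using C unfolding irreducible_subset_def by auto
  have cl: "closedin T (topspace T - U)" using U by auto
  have "C \<inter> U \<subseteq> T closure_of (C \<inter> U)" by (rule closure_of_subset) (use Cs in auto)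
  then have "C \<subseteq> T closure_of (C \<inter> U) \<union> (topspace T - U)" using Cs by auto
  then show 1: "C \<subseteq> T closure_of (C \<inter> U)"
    using C cl closedin_closure_of[of T "C \<inter> U"] ne unfolding irreducible_subset_def by blast
  have "C \<inter> U \<subseteq> A \<or> C \<inter> U \<subseteq> B" if AB: "closedin T A" "closedin T B" "C \<inter> U \<subseteq> A \<union> B" for A B
  proof -
    have "C \<subseteq> A \<union> B" using 1 closure_of_minimal[OF AB(3)] AB(1,2) by auto
    then show ?thesis using C AB unfolding irreducible_subset_def by blast
  qed
  then show "irreducible_subset T (C \<inter> U)" using Cs ne unfolding irreducible_subset_def by auto
qed

lemma irr_chain_mono:
  assumes "irr_chain T n C" "i \<le> j" "j \<le> n"
  shows "C i \<subseteq> C j"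
  using assms(2,3)
proof (induction j rule: dec_induct)
  case (step m)
  then have "C m \<subset> C (Suc m)" using assms(1) unfolding irr_chain_def by auto
  then show ?case using step by auto
qed simp

text \<open>Closure in \<open>T\<close> and intersection with \<open>U\<close> are inverse to each
  other on irreducible closed sets that meet \<open>U\<close>. Every member of a chain starting at
  the closure of \<open>x\<close> contains \<open>x\<close>, so strict inclusions survive both
  passages.\<close>

lemma codim_open_subspace:
  assumes U: "openin T U" and x: "x \<in> U"
  shows "codim (subtopology T U) x = codim T x"
proof -
  have xT: "x \<in> topspace T" using U x openin_subset by auto
  have "(\<exists>D. irr_chain (subtopology T U) n D \<and> D 0 = subtopology T U closure_of {x}) \<longleftrightarrow>
    (\<exists>C. irr_chain T n C \<and> C 0 = T closure_of {x})" for n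
  proof
    assume "\<exists>D. irr_chain (subtopology T U) n D \<and> D 0 = subtopology T U closure_of {x}"
    then obtain D where D: "irr_chain (subtopology T U) n D" "D 0 = subtopology T U closure_of {x}" by auto
    have Di: "closedin (subtopology T U) (D i)" "irreducible_subset T (D i)" "D i \<subseteq> U" if "i \<le> n" for i
      using D(1) that irreducible_subset_subtopology unfolding irr_chain_def by metis+
    have bk: "T closure_of (D i) \<inter> U = D i" if "i \<le> n" for i
      using closure_of_subtopology[of T U "D i"] closure_of_closedin[OF Di(1)[OF that]] Di(3)[OF that]
      by (simp add: Int_absorb1 Int_commute)
    have "irr_chain T n (\<lambda>i. T closure_of D i)"
      unfolding irr_chain_def
    proof (intro conjI allI impI)
      show "closedin T (T closure_of D i)" for i by simp
      show "irreducible_subset T (T closure_of D i)" if "i \<le> n" for i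
        using irreducible_subset_closure Di(2)[OF that] .
      show "T closure_of D i \<subset> T closure_of D (Suc i)" if "i < n" for i
      proof -
        have "D i \<subset> D (Suc i)" using D(1) that unfolding irr_chain_def by auto
        have "T closure_of D i \<subseteq> T closure_of D (Suc i)" using closure_of_mono \<open>D i \<subset> D (Suc i)\<close> by blast
        moreover have "T closure_of D i \<noteq> T closure_of D (Suc i)"
        proof
          assume e: "T closure_of D i = T closure_of D (Suc i)"
          have "D i = T closure_of D i \<inter> U" by (rule bk[OF less_imp_le_nat[OF that], symmetric])
          also have "\<dots> = D (Suc i)" unfolding e by (rule bk[OF Suc_leI[OF that]])
          finally have "D i = D (Suc i)" .
          then show False using \<open>D i \<subset> D (Suc i)\<close> by simp
        qed
        ultimately show ?thesis by auto
      qed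
    qed
    moreover have "T closure_of D 0 = T closure_of {x}"
    proof
      have "D 0 \<subseteq> T closure_of {x}" unfolding D(2) closure_of_subtopology using x by auto
      then show "T closure_of D 0 \<subseteq> T closure_of {x}" using closure_of_minimal closedin_closure_of by metis
      have "{x} \<subseteq> D 0" unfolding D(2) using x xT closure_of_subset[of "{x}" "subtopology T U"] by auto
      then show "T closure_of {x} \<subseteq> T closure_of D 0" by (rule closure_of_mono)
    qed
    ultimately show "\<exists>C. irr_chain T n C \<and> C 0 = T closure_of {x}" by blast
  next
    assume "\<exists>C. irr_chain T n C \<and> C 0 = T closure_of {x}"
    then obtain C where C: "irr_chain T n C" "C 0 = T closure_of {x}" by auto
    have x0: "x \<in> C 0" unfolding C(2) using xT closure_of_subset[of "{x}" T] by auto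
    have Ci: "closedin T (C i)" "irreducible_subset T (C i)" "x \<in> C i" if "i \<le> n" for i
      using C(1) that irr_chain_mono[OF C(1), of 0 i] x0 unfolding irr_chain_def by auto
    have cl: "C i = T closure_of (C i \<inter> U)" if "i \<le> n" for i
      using irreducible_subset_open(1)[OF Ci(2)[OF that] U] Ci(3)[OF that] x
        closure_of_minimal[OF inf_le1 Ci(1)[OF that], of U] by blast
    have "irr_chain (subtopology T U) n (\<lambda>i. C i \<inter> U)"
      unfolding irr_chain_def irreducible_subset_subtopology
    proof (intro conjI allI impI)
      show "closedin (subtopology T U) (C i \<inter> U)" if "i \<le> n" for i
        using Ci(1)[OF that] closedin_subtopology by blast
      show "irreducible_subset T (C i \<inter> U)" if "i \<le> n" for i
        using irreducible_subset_open(2)[OF Ci(2)[OF that] U] Ci(3)[OF that] x by auto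
      show "C i \<inter> U \<subset> C (Suc i) \<inter> U" if "i < n" for i
      proof -
        have "C i \<subset> C (Suc i)" using C(1) that unfolding irr_chain_def by auto
        then have "C i \<inter> U \<subseteq> C (Suc i) \<inter> U" by auto
        moreover have "C i \<inter> U \<noteq> C (Suc i) \<inter> U"
        proof
          assume "C i \<inter> U = C (Suc i) \<inter> U"
          then have "C i = C (Suc i)" using cl[of i] cl[of "Suc i"] that by simp
          then show False using \<open>C i \<subset> C (Suc i)\<close> by simp
        qed
        ultimately show ?thesis by auto
      qed
    qed auto
    moreover have "C 0 \<inter> U = subtopology T U closure_of {x}"
      unfolding C(2) closure_of_subtopology using x by auto
    ultimately show "\<exists>D. irr_chain (subtopology T U) n D \<and> D 0 = subtopology T U closure_of {x}" by blast
  qed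
  then show ?thesis unfolding codim_def by simp
qed

lemma irreducible_subset_image:
  assumes f: "continuous_map T T' f" and S: "irreducible_subset T S"
  shows "irreducible_subset T' (f ` S)"
proof -
  have Ss: "S \<subseteq> topspace T" "S \<noteq> {}" using S unfolding irreducible_subset_def by auto
  have "f ` S \<subseteq> A \<or> f ` S \<subseteq> B" if AB: "closedin T' A" "closedin T' B" "f ` S \<subseteq> A \<union> B" for A B
  proof -
    have "S \<subseteq> {x \<in> topspace T. f x \<in> A} \<union> {x \<in> topspace T. f x \<in> B}" using AB(3) Ss by auto
    then have "S \<subseteq> {x \<in> topspace T. f x \<in> A} \<or> S \<subseteq> {x \<in> topspace T. f x \<in> B}"
      using S closedin_continuous_map_preimage[OF f AB(1)] closedin_continuous_map_preimage[OF f AB(2)]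
      unfolding irreducible_subset_def by blast
    then show ?thesis by auto
  qed
  moreover have "f ` S \<subseteq> topspace T'" using Ss f continuous_map_image_subset_topspace by blast
  ultimately show ?thesis using Ss unfolding irreducible_subset_def by auto
qed

lemma irr_chain_image:
  assumes h: "homeomorphic_map T T' f" and x: "x \<in> topspace T"
    and C: "irr_chain T n C" "C 0 = T closure_of {x}"
  shows "irr_chain T' n (\<lambda>i. f ` C i)" "f ` C 0 = T' closure_of {f x}"
proof -
  have Ci: "closedin T (C i)" "irreducible_subset T (C i)" "C i \<subseteq> topspace T" if "i \<le> n" for i
    using C(1) that closedin_subset unfolding irr_chain_def by auto
  have inj: "inj_on f (topspace T)" using homeomorphic_imp_injective_map[OF h] .
  show "irr_chain T' n (\<lambda>i. f ` C i)" unfolding irr_chain_def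
  proof (intro conjI allI impI)
    show "closedin T' (f ` C i)" if "i \<le> n" for i
      using homeomorphic_map_closedness[OF h Ci(3)[OF that]] Ci(1)[OF that] by auto
    show "irreducible_subset T' (f ` C i)" if "i \<le> n" for i
      using irreducible_subset_image[OF homeomorphic_imp_continuous_map[OF h] Ci(2)[OF that]] .
    show "f ` C i \<subset> f ` C (Suc i)" if "i < n" for i
    proof -
      have "C i \<subset> C (Suc i)" using C(1) that unfolding irr_chain_def by auto
      then show ?thesis using inj_on_subset[OF inj Ci(3)[of "Suc i"]] that
        by (metis Suc_leI image_strict_mono)
    qed
  qed
  show "f ` C 0 = T' closure_of {f x}"
    unfolding C(2) using homeomorphic_map_closure_of[OF h, of "{x}"] x by auto
qed

lemma codim_homeomorphic_maps:
  assumes h: "homeomorphic_maps T T' f g" and x: "x \<in> topspace T"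
  shows "codim T' (f x) = codim T x"
proof -
  have hf: "homeomorphic_map T T' f" and hg: "homeomorphic_map T' T g"
    using h homeomorphic_maps_map by blast+
  have fx: "f x \<in> topspace T'" "g (f x) = x"
    using h x continuous_map_image_subset_topspace unfolding homeomorphic_maps_def by blast+
  have "(\<exists>D. irr_chain T' n D \<and> D 0 = T' closure_of {f x}) \<longleftrightarrow> (\<exists>C. irr_chain T n C \<and> C 0 = T closure_of {x})" for n
  proof
    show "\<exists>D. irr_chain T' n D \<and> D 0 = T' closure_of {f x}" if "\<exists>C. irr_chain T n C \<and> C 0 = T closure_of {x}"
      using that irr_chain_image[OF hf x] by blast
    show "\<exists>C. irr_chain T n C \<and> C 0 = T closure_of {x}" if "\<exists>D. irr_chain T' n D \<and> D 0 = T' closure_of {f x}"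
      using that irr_chain_image[OF hg fx(1)] unfolding fx(2) by blast
  qed
  then show ?thesis unfolding codim_def by simp
qed

lemma iso_corr_codim:
  assumes X: "irr_space k X" and Y: "irr_space k Y" and c: "iso_corr k X Y \<phi> x y"
  shows "codim (topo Y) y = codim (topo X) x"
proof -
  obtain U f V g where x: "x \<in> U" "base f x = y" and i: "inv_pair k X Y U f V g"
    using c unfolding iso_corr_def by auto
  note f = inv_pairD(1)[OF i] and g = inv_pairD(2)[OF i]
  have h: "homeomorphic_maps (subtopology (topo X) U) (subtopology (topo Y) V) (base f) (base g)"
    unfolding homeomorphic_maps_def
    using ps_morD(1)[OF inv_pair_ps_mor(1)[OF Y i]] ps_morD(1)[OF inv_pair_ps_mor(1)[OF X inv_pair_sym[OF i]]]
      inv_pairD(6,7)[OF i] by auto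
  have y: "y \<in> V" using inv_pairD(3)[OF i x(1)] x(2) by simp
  show ?thesis
    using codim_homeomorphic_maps[OF h, of x] codim_open_subspace[OF pmorD(1)[OF f] x(1)]
      codim_open_subspace[OF pmorD(1)[OF g] y] x pmorD(6)[OF f] by auto
qed

text \<open>Every germ has a representative inside \<open>U\<close>. The inclusion need not be
  invertible, so this is proved apart from \<open>stalk_map_iso\<close>; it links the stalks of
  \<open>X\<close> with those of \<open>open_subspace X U\<close>.\<close>

lemma stalk_map_incl_iso:
  assumes X: "presheaf_of_rings X" and U: "openin (topo X) U" and x: "x \<in> U"
  shows "stalk_map (open_subspace X U) (incl_mor X U) x \<in> ring_iso (stalk X x) (stalk (open_subspace X U) x)"
    and "openin (topo X) A \<Longrightarrow> x \<in> A \<Longrightarrow> s \<in> carrier (sect X A) \<Longrightarrow>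
      stalk_map (open_subspace X U) (incl_mor X U) x (germ X x A s) =
      germ (open_subspace X U) x (A \<inter> U) (restr X A (A \<inter> U) s)"
proof -
  let ?i = "incl_mor X U" and ?U = "open_subspace X U"
  have ib: "base ?i x = x" and ip: "pull ?i A s = restr X A (A \<inter> U) s"
    and ipre: "pre X U ?i A = A \<inter> U" if "openin (topo X) A" for A s
    using openin_subset[OF that] unfolding restr_mor_def preimg_id by (auto simp: preimg_def Int_absorb1)
  have top: "openin (topo X) (points X)" by auto
  note pU = presheaf_sub[OF X U]
  have xU: "x \<in> points ?U" using U x openin_subset by auto
  note m = ps_mor_restr[OF X ps_mor_id[OF X] U]
  have g: "stalk_map ?U ?i x (germ X x A s) = germ ?U x (A \<inter> U) (restr X A (A \<inter> U) s)"
    if "openin (topo X) A" "x \<in> A" "s \<in> carrier (sect X A)" for A s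
    using stalk_map_germ[OF pU X m xU that(1) _ that(3)] that(2) unfolding ib[OF top] ip[OF that(1)] ipre[OF that(1)] by simp
  then show "openin (topo X) A \<Longrightarrow> x \<in> A \<Longrightarrow> s \<in> carrier (sect X A) \<Longrightarrow>
      stalk_map ?U ?i x (germ X x A s) = germ ?U x (A \<inter> U) (restr X A (A \<inter> U) s)" .
  have inj: "inj_on (stalk_map ?U ?i x) (carrier (stalk X x))"
  proof (rule inj_onI)
    fix a b assume ab: "a \<in> carrier (stalk X x)" "b \<in> carrier (stalk X x)" and e: "stalk_map ?U ?i x a = stalk_map ?U ?i x b"
    from ab obtain A s t where A: "openin (topo X) A" "x \<in> A" and s: "s \<in> carrier (sect X A)"
      and t: "t \<in> carrier (sect X A)" and ab': "a = germ X x A s" "b = germ X x A t" by (rule in_stalk2E[OF X])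
    have AU: "openin (topo X) (A \<inter> U)" "openin (topo ?U) (A \<inter> U)" "x \<in> A \<inter> U"
      using A U x openin_sub[OF U] by auto
    note c = restr_closed[OF X A(1) AU(1) inf_le1 s] restr_closed[OF X A(1) AU(1) inf_le1 t]
    have "germ ?U x (A \<inter> U) (restr X A (A \<inter> U) s) = germ ?U x (A \<inter> U) (restr X A (A \<inter> U) t)"
      using e g[OF A s] g[OF A t] unfolding ab' by simp
    then obtain N where "openin (topo X) N" "x \<in> N" "N \<subseteq> A \<inter> U"
      "restr X (A \<inter> U) N (restr X A (A \<inter> U) s) = restr X (A \<inter> U) N (restr X A (A \<inter> U) t)"
      using germ_eq_iff[OF pU AU(2,3) _ AU(2,3)] c openin_sub[OF U] by auto
    then have "germ X x (A \<inter> U) (restr X A (A \<inter> U) s) = germ X x (A \<inter> U) (restr X A (A \<inter> U) t)"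
      using germ_eq_iff[OF X AU(1,3) c(1) AU(1,3) c(2)] by auto
    then show "a = b" unfolding ab' using germ_restr[OF X A(1) s AU(1,3)] germ_restr[OF X A(1) t AU(1,3)] by simp
  qed
  have surj: "stalk_map ?U ?i x ` carrier (stalk X x) = carrier (stalk ?U x)"
  proof (rule equalityI; rule subsetI)
    fix b assume "b \<in> stalk_map ?U ?i x ` carrier (stalk X x)"
    then show "b \<in> carrier (stalk ?U x)"
      using ring_hom_closed[OF stalk_map_hom[OF pU X m xU]] unfolding ib[OF top] by auto
  next
    fix b assume "b \<in> carrier (stalk ?U x)"
    then obtain A s where A': "openin (topo ?U) A" "x \<in> A" "s \<in> carrier (sect ?U A)" "b = germ ?U x A s"
      by (rule in_stalkE)
    then have A: "openin (topo X) A" "A \<subseteq> U" "s \<in> carrier (sect X A)" using openin_sub[OF U] by auto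
    have "stalk_map ?U ?i x (germ X x A s) = b"
      using g[OF A(1) A'(2) A(3)] A'(4) A(2) restr_self[OF X A(1,3)] by (simp add: Int_absorb2)
    then show "b \<in> stalk_map ?U ?i x ` carrier (stalk X x)"
      using germ_in_stalk[OF A(1) A'(2) A(3)] by blast
  qed
  show "stalk_map ?U ?i x \<in> ring_iso (stalk X x) (stalk ?U x)"
    unfolding ring_iso_def bij_betw_def using inj surj stalk_map_hom[OF pU X m xU] unfolding ib[OF top] by auto
qed

text \<open>First isomorphism theorem for \<open>h\<close> followed by the projection of
  \<open>S\<close> modulo \<open>J\<close>. The kernel is \<open>I\<close> because \<open>h\<close>
  is injective and maps \<open>I\<close> onto \<open>J\<close>.\<close>

lemma ring_iso_Quot:
  assumes R: "ring R" and S: "ring S" and h: "h \<in> ring_iso R S" and I: "ideal I R" and J: "ideal J S" "h ` I = J"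
  shows "\<exists>H\<in>ring_iso (R Quot I) (S Quot J). \<forall>a\<in>carrier R. H (I +>\<^bsub>R\<^esub> a) = J +>\<^bsub>S\<^esub> h a"
proof -
  interpret R: ring R by fact
  interpret S: ring S by fact
  interpret I: ideal I R by fact
  interpret J: ideal J S by fact
  have hom: "h \<in> ring_hom R S" and bij: "bij_betw h (carrier R) (carrier S)"
    using h unfolding ring_iso_def by auto
  define g where "g = (\<lambda>a. J +>\<^bsub>S\<^esub> h a)"
  have "g \<in> ring_hom R (S Quot J)"
    using ring_hom_trans[OF hom J.rcos_ring_hom] unfolding g_def comp_def .
  then interpret g: ring_hom_ring R "S Quot J" g
    using ring_hom_ringI2[OF R J.quotient_is_ring] by auto
  have ker: "a_kernel R (S Quot J) g = I"
  proof -
    have "g a = \<zero>\<^bsub>S Quot J\<^esub> \<longleftrightarrow> a \<in> I" if a: "a \<in> carrier R" for a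
    proof -
      have ha: "h a \<in> carrier S" using ring_hom_closed[OF hom a] .
      have "g a = \<zero>\<^bsub>S Quot J\<^esub> \<longleftrightarrow> h a \<in> J"
        unfolding g_def FactRing_def using J.rcos_const_imp_mem[OF ha] J.a_rcos_const by auto
      also have "\<dots> \<longleftrightarrow> a \<in> I"
        unfolding J(2)[symmetric] using bij a I.Icarr unfolding bij_betw_def inj_on_def by blast
      finally show ?thesis .
    qed
    then show ?thesis unfolding a_kernel_def' using I.Icarr by blast
  qed
  have surj: "g ` carrier R = carrier (S Quot J)"
  proof -
    have "carrier (S Quot J) = (\<lambda>b. J +>\<^bsub>S\<^esub> b) ` carrier S"
      unfolding FactRing_def A_RCOSETS_def' by auto
    also have "\<dots> = (\<lambda>b. J +>\<^bsub>S\<^esub> b) ` h ` carrier R" using bij_betw_imp_surj_on[OF bij] by simp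
    finally show ?thesis unfolding g_def by (simp add: image_image)
  qed
  show ?thesis
    using g.FactRing_iso_set[OF surj] g.the_elem_simp unfolding ker
    by (intro bexI[of _ "\<lambda>X. the_elem (g ` X)"]) (auto simp: g_def)
qed

lemma k_isomorphic_sym:
  assumes R: "ring R" and i: "\<And>c. c \<in> carrier k \<Longrightarrow> i c \<in> carrier R" and e: "k_isomorphic k R i S j"
  shows "k_isomorphic k S j R i"
proof -
  obtain h where h: "h \<in> ring_iso R S" "\<forall>c\<in>carrier k. h (i c) = j c" using e unfolding k_isomorphic_def by auto
  have "inj_on h (carrier R)" using h(1) unfolding ring_iso_def bij_betw_def by auto
  then have "inv_into (carrier R) h (j c) = i c" if "c \<in> carrier k" for c
    using h(2) i[OF that] that by (metis inv_into_f_f)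
  then show ?thesis unfolding k_isomorphic_def using ring_iso_set_sym[OF R h(1)] by blast
qed

lemma k_isomorphic_trans:
  assumes "k_isomorphic k R i S j" "k_isomorphic k S j T l"
  shows "k_isomorphic k R i T l"
proof -
  obtain h g where h: "h \<in> ring_iso R S" "\<forall>c\<in>carrier k. h (i c) = j c"
    and g: "g \<in> ring_iso S T" "\<forall>c\<in>carrier k. g (j c) = l c" using assms unfolding k_isomorphic_def by auto
  then show ?thesis unfolding k_isomorphic_def using ring_iso_set_trans[OF h(1) g(1)] by (intro bexI[of _ "g \<circ> h"]) auto
qed

text \<open>The predicate under the definite description depends on the field only up to isomorphism
  over \<open>k\<close>, so the two descriptions are equal whatever they denote.\<close>

lemma bir_class_of_field_cong:
  fixes k :: "'k ring"
  assumes R: "ring R" and i: "\<And>c. c \<in> carrier k \<Longrightarrow> i c \<in> carrier R" and e: "k_isomorphic k R i S j"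
  shows "bir_class_of_field k m R i = bir_class_of_field k m S j"
proof -
  note e' = k_isomorphic_sym[OF R i e]
  have "k_isomorphic k T l R i \<longleftrightarrow> k_isomorphic k T l S j" for T :: "('k list, 'k list) germ ring" and l
    using k_isomorphic_trans[OF _ e] k_isomorphic_trans[OF _ e'] by blast
  then show ?thesis unfolding bir_class_of_field_def by simp
qed

section \<open>Constant functions from the base field\<close>

lemma points_Spec:
  "points (Spec A) = {P. primeideal P A}"
proof -
  have "\<one>\<^bsub>A\<^esub> \<in> carrier A \<and> \<one>\<^bsub>A\<^esub> \<notin> P" if "primeideal P A" for P
  proof -
    interpret primeideal P A by fact
    show ?thesis using one_imp_carrier I_notcarr by auto
  qed
  then show ?thesis unfolding Spec_def locally_in_space_def by auto
qed

lemma locally_in_space_section: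
  assumes W: "openin T W" and c: "\<And>p. p \<in> W \<Longrightarrow> \<sigma> p \<in> carrier (L p)" and G: "\<sigma> \<in> G W"
  shows "(\<lambda>p\<in>W. \<sigma> p) \<in> carrier (sect (locally_in_space T L G) W)"
proof -
  have "\<exists>N. openin T N \<and> p \<in> N \<and> N \<subseteq> W \<and> (\<exists>\<tau>\<in>G N. \<forall>q\<in>N. (\<lambda>p\<in>W. \<sigma> p) q = \<tau> q)" if "p \<in> W" for p
    using that W G by (intro exI[of _ W] conjI bexI[of _ \<sigma>]) auto
  then show ?thesis unfolding locally_in_space_def using c by auto
qed

lemma primeideal_one:
  assumes "primeideal P A"
  shows "\<one>\<^bsub>A\<^esub> \<in> carrier A - P"
proof -
  interpret primeideal P A by fact
  show ?thesis using one_imp_carrier I_notcarr by auto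
qed

lemma Spec_const:
  assumes "a \<in> carrier A"
  shows "(\<lambda>P\<in>points (Spec A). frac A P a \<one>\<^bsub>A\<^esub>) \<in> carrier (sect (Spec A) (points (Spec A)))"
proof -
  have *: "\<one>\<^bsub>A\<^esub> \<in> carrier A - P" if "P \<in> points (Spec A)" for P
    using that primeideal_one unfolding points_Spec by auto
  show ?thesis
  \<comment> \<open>\<open>A\<close> is an arbitrary record here. Without primes the section lives
    on the empty set; otherwise a prime supplies the fact that one lies in the carrier.\<close>
  proof (cases "points (Spec A) = {}")
    case True
    then show ?thesis unfolding Spec_def locally_in_space_def by auto
  next
    case False
    then have "\<one>\<^bsub>A\<^esub> \<in> carrier A" using * by (metis Diff_iff equals0I)
    then have m: "(\<lambda>P. frac A P a \<one>\<^bsub>A\<^esub>) \<in>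
        {\<lambda>P. frac A P a b |a b. a \<in> carrier A \<and> b \<in> carrier A \<and> (\<forall>P\<in>points (Spec A). b \<notin> P)}"
      using assms * by blast
    have t: "topo (Spec A) = topology_generated_by {{P. primeideal P A \<and> a \<notin> P} |a. a \<in> carrier A}"
      unfolding Spec_def locally_in_space_def by simp
    have c: "frac A P a \<one>\<^bsub>A\<^esub> \<in> carrier (localization A P)" if "P \<in> points (Spec A)" for P
      using assms *[OF that] unfolding localization_def by auto
    show ?thesis
      unfolding Spec_def[of A, THEN arg_cong[of _ _ sect]]
      by (rule locally_in_space_section) (use m c openin_topspace[of "topo (Spec A)"] t in auto)
  qed
qed

lemma scalar_facts:
  assumes X: "irr_space k X" and c: "c \<in> carrier k"
  shows "scalar k X (points X) c = pull (str X) (points (Spec k)) (\<lambda>P\<in>points (Spec k). frac k P c \<one>\<^bsub>k\<^esub>)"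
    "scalar k X (points X) c \<in> carrier (sect X (points X))"
    "preimg X (str X) (points (Spec k)) = points X"
proof -
  show e: "preimg X (str X) (points (Spec k)) = points X"
    using ps_mor_base[OF irr_spaceD(3)[OF X]] unfolding preimg_def by auto
  have o: "openin (topo (Spec k)) (points (Spec k))" "openin (topo X) (points X)" by auto
  note p = ps_mor_pull[OF irr_spaceD(3)[OF X] o(1) Spec_const[OF c], unfolded e]
  show s: "scalar k X (points X) c = pull (str X) (points (Spec k)) (\<lambda>P\<in>points (Spec k). frac k P c \<one>\<^bsub>k\<^esub>)"
    unfolding scalar_def using restr_self[OF irr_spaceD(2)[OF X] o(2) p] .
  show "scalar k X (points X) c \<in> carrier (sect X (points X))" unfolding s using p .
qed

lemma pmor_scalar:
  assumes X: "irr_space k X" and Y: "irr_space k Y" and f: "pmor k X Y U f" and c: "c \<in> carrier k"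
  shows "pull f (points Y) (scalar k Y (points Y) c) = restr X (points X) U (scalar k X (points X) c)"
    "pre X U f (points Y) = U"
proof -
  have o: "openin (topo (Spec k)) (points (Spec k))" by auto
  show "pull f (points Y) (scalar k Y (points Y) c) = restr X (points X) U (scalar k X (points X) c)"
    using pmor_str(2)[OF f o Spec_const[OF c]] pmorD(6)[OF f]
    unfolding scalar_facts(1)[OF X c] scalar_facts(1)[OF Y c] scalar_facts(3)[OF X c] scalar_facts(3)[OF Y c]
    by (simp add: Int_absorb1)
  show "pre X U f (points Y) = U" using pmor_base[OF f] by (auto simp: pmor_in_preimg[OF f])
qed

text \<open>The isomorphism factors through the stalks of \<open>open_subspace Y V\<close> and
  \<open>open_subspace X U\<close>. Constants are traced through each factor, using that
  \<open>f\<close> respects the structure morphisms.\<close>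

lemma iso_corr_stalk_iso:
  assumes X: "irr_space k X" and Y: "irr_space k Y" and c: "iso_corr k X Y \<phi> x y"
  shows "\<exists>H\<in>ring_iso (stalk Y y) (stalk X x). \<forall>c\<in>carrier k. H (scalar_stalk k Y y c) = scalar_stalk k X x c"
proof -
  obtain U f V g where x: "x \<in> U" "base f x = y" and i: "inv_pair k X Y U f V g"
    using c unfolding iso_corr_def by auto
  note f = inv_pairD(1)[OF i] and g = inv_pairD(2)[OF i]
  note pX = irr_spaceD(2)[OF X] and pY = irr_spaceD(2)[OF Y]
  note U = pmorD(1,6)[OF f] and V = pmorD(1,6)[OF g]
  have y: "y \<in> V" using inv_pairD(3)[OF i x(1)] x(2) by simp
  have xp: "x \<in> points X" "y \<in> points Y" using x y U V by auto
  let ?U = "open_subspace X U" and ?V = "open_subspace Y V"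
  note pU = presheaf_sub[OF pX U(1)] and pV = presheaf_sub[OF pY V(1)]
  let ?iX = "stalk_map ?U (incl_mor X U) x" and ?iY = "stalk_map ?V (incl_mor Y V) y" and ?a = "stalk_map ?U f x"
  note iX = stalk_map_incl_iso[OF pX U(1) x(1)] and iY = stalk_map_incl_iso[OF pY V(1) y]
  have xU: "x \<in> points ?U" using x U by auto
  note psf = inv_pair_ps_mor(1)[OF Y i] and psg = inv_pair_ps_mor(1)[OF X inv_pair_sym[OF i]]
  have a: "?a \<in> ring_iso (stalk ?V y) (stalk ?U x)"
    using stalk_map_iso[OF pU pV psf psg inv_pairD(5)[OF i] xU] unfolding x(2) .
  let ?H = "inv_into (carrier (stalk X x)) ?iX \<circ> (?a \<circ> ?iY)"
  have rX: "ring (stalk X x)" using stalk_cring[OF pX xp(1)] cring.axioms(1) by auto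
  have H: "?H \<in> ring_iso (stalk Y y) (stalk X x)"
    using ring_iso_set_trans[OF ring_iso_set_trans[OF iY(1) a] ring_iso_set_sym[OF rX iX(1)]] .
  have "?H (scalar_stalk k Y y c) = scalar_stalk k X x c" if c: "c \<in> carrier k" for c
  proof -
    have oX: "openin (topo X) (points X)" and oY: "openin (topo Y) (points Y)" by auto
    let ?sX = "scalar k X (points X) c" and ?sY = "scalar k Y (points Y) c"
    note sX = scalar_facts(2)[OF X c] and sY = scalar_facts(2)[OF Y c]
    have rV: "restr Y (points Y) V ?sY \<in> carrier (sect Y V)" using restr_closed[OF pY oY V sY] .
    have oV: "openin (topo ?V) V" using V openin_sub[OF V(1)] by simp
    have pe: "preimg ?U f V = U" using inv_pairD(8)[OF i] .
    have "?iY (scalar_stalk k Y y c) = germ ?V y V (restr Y (points Y) V ?sY)"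
      unfolding scalar_stalk_def using iY(2)[OF oY xp(2) sY] V(2) by (simp add: Int_absorb1)
    moreover have "?a (germ ?V y V (restr Y (points Y) V ?sY)) = germ ?U x U (pull f V (restr Y (points Y) V ?sY))"
      using stalk_map_germ[OF pU pV psf xU oV, of "restr Y (points Y) V ?sY"] rV y x(2) pe by simp
    moreover have "pull f V (restr Y (points Y) V ?sY) = restr X (points X) U ?sX"
      using pmor_restr[OF f oY V sY] pmor_scalar[OF X Y f c] pe restr_self[OF pX U(1) restr_closed[OF pX oX U sX]] by simp
    moreover have "?iX (scalar_stalk k X x c) = germ ?U x U (restr X (points X) U ?sX)"
      unfolding scalar_stalk_def using iX(2)[OF oX xp(1) sX] U(2) by (simp add: Int_absorb1)
    ultimately have "(?a \<circ> ?iY) (scalar_stalk k Y y c) = ?iX (scalar_stalk k X x c)" by simp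
    moreover have "inj_on ?iX (carrier (stalk X x))" using iX(1) unfolding ring_iso_def bij_betw_def by auto
    moreover have "scalar_stalk k X x c \<in> carrier (stalk X x)"
      unfolding scalar_stalk_def using germ_in_stalk[OF oX xp(1) sX] .
    ultimately show ?thesis by (simp add: inv_into_f_f)
  qed
  then show ?thesis using H by blast
qed

lemma iso_corr_residue_class:
  assumes X: "irr_space k X" and Y: "irr_space k Y" and c: "iso_corr k X Y \<phi> x y"
  shows "residue_class k m Y y = residue_class k m X x"
proof -
  note xp = iso_corr_points[OF c]
  note pX = irr_spaceD(2)[OF X] and pY = irr_spaceD(2)[OF Y]
  note lX = local_presheafD(2)[OF irr_spaceD(1)[OF X] xp(1)] and lY = local_presheafD(2)[OF irr_spaceD(1)[OF Y] xp(2)]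
  have cX: "cring (stalk X x)" and cY: "cring (stalk Y y)" using stalk_cring[OF pX xp(1)] stalk_cring[OF pY xp(2)] .
  have rX: "ring (stalk X x)" and rY: "ring (stalk Y y)" using cX cY cring.axioms(1) by auto
  obtain H where H: "H \<in> ring_iso (stalk Y y) (stalk X x)"
    and Hs: "\<And>c. c \<in> carrier k \<Longrightarrow> H (scalar_stalk k Y y c) = scalar_stalk k X x c"
    using iso_corr_stalk_iso[OF X Y c] by blast
  let ?I = "max_ideal (stalk Y y)" and ?J = "max_ideal (stalk X x)"
  have I: "ideal ?I (stalk Y y)" and J: "ideal ?J (stalk X x)"
    using local_ring_max_ideal[OF lX] local_ring_max_ideal[OF lY] maximalideal.axioms(1) by auto
  obtain G where G: "G \<in> ring_iso (residue_field Y y) (residue_field X x)"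
    and Ge: "\<And>a. a \<in> carrier (stalk Y y) \<Longrightarrow> G (?I +>\<^bsub>stalk Y y\<^esub> a) = ?J +>\<^bsub>stalk X x\<^esub> H a"
    using ring_iso_Quot[OF rY rX H I J ring_iso_local_ring(2)[OF lY cX H]] unfolding residue_field_def by blast
  have sc: "scalar_stalk k Y y c \<in> carrier (stalk Y y)" if "c \<in> carrier k" for c
    unfolding scalar_stalk_def using germ_in_stalk[OF openin_topspace xp(2) scalar_facts(2)[OF Y that]] .
  have "k_isomorphic k (residue_field Y y) (scalar_residue k Y y) (residue_field X x) (scalar_residue k X x)"
    unfolding k_isomorphic_def scalar_residue_def using G Ge sc Hs by (intro bexI[of _ G]) auto
  moreover have "ring (residue_field Y y)" unfolding residue_field_def using ideal.quotient_is_ring[OF I] .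
  moreover have "scalar_residue k Y y c \<in> carrier (residue_field Y y)" if "c \<in> carrier k" for c
    unfolding scalar_residue_def residue_field_def using ring_hom_closed[OF ideal.rcos_ring_hom[OF I] sc[OF that]] .
  ultimately show ?thesis unfolding residue_class_def by (intro bir_class_of_field_cong)
qed

section \<open>Tensor products\<close>

text \<open>Carrying the support along in the induction lets the case of a difference use that both
  parts are supported in \<open>S\<close>.\<close>

lemma frag_keys_induct [consumes 1, case_names zero one diff]:
  assumes "Poly_Mapping.keys c \<subseteq> S" and "P 0" and "\<And>x. x \<in> S \<Longrightarrow> P (frag_of x)"
    and "\<And>a b. Poly_Mapping.keys a \<subseteq> S \<Longrightarrow> Poly_Mapping.keys b \<subseteq> S \<Longrightarrow> P a \<Longrightarrow> P b \<Longrightarrow> P (a - b)"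
  shows "P c"
proof -
  have "Poly_Mapping.keys c \<subseteq> S \<and> P c"
    using assms(1)
  proof (induction rule: frag_induction)
    case (diff a b)
    then show ?case using assms(4) keys_diff[of a b] by auto
  qed (use assms in \<open>auto simp: keys_frag_of\<close>)
  then show ?thesis by simp
qed

lemma frag_extend_add_fun: "frag_extend (\<lambda>x. f x + g x) c = frag_extend f c + frag_extend g c"
  unfolding frag_extend_def by (simp add: frag_cmul_distrib2 sum.distrib)

lemma frag_extend_minus_fun: "frag_extend (\<lambda>x. f x - g x) c = frag_extend f c - frag_extend g c"
  using frag_extend_add_fun[of "\<lambda>x. f x - g x" g c] by (simp add: algebra_simps)

lemma tensor_mult_simps:
  "tensor_mult A B (g + g') h = tensor_mult A B g h + tensor_mult A B g' h"
  "tensor_mult A B (g - g') h = tensor_mult A B g h - tensor_mult A B g' h"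
  "tensor_mult A B 0 h = 0"
  "tensor_mult A B g (h + h') = tensor_mult A B g h + tensor_mult A B g h'"
  "tensor_mult A B g (h - h') = tensor_mult A B g h - tensor_mult A B g h'"
  "tensor_mult A B g 0 = 0"
  "tensor_mult A B (frag_of (a, b)) (frag_of (c, d)) = frag_of (a \<otimes>\<^bsub>A\<^esub> c, b \<otimes>\<^bsub>B\<^esub> d)"
  unfolding tensor_mult_def
  by (simp_all add: frag_extend_add frag_extend_diff case_prod_unfold frag_extend_add_fun frag_extend_minus_fun)
    (simp add: frag_extend_eq_0)

text \<open>The monoid ring, over the integers, of the product of the multiplicative monoids of
  \<open>A\<close> and \<open>B\<close>. The tensor product is its quotient by
  \<open>tensor_null\<close>, so the ring axioms come from the quotient construction.\<close>

definition pair_ring :: "'a ring \<Rightarrow> 'b ring \<Rightarrow> (('a \<times> 'b) \<Rightarrow>\<^sub>0 int) ring" where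
  "pair_ring A B = \<lparr>carrier = carrier (free_Abelian_group (carrier A \<times> carrier B)),
     monoid.mult = tensor_mult A B, one = frag_of (\<one>\<^bsub>A\<^esub>, \<one>\<^bsub>B\<^esub>), ring.zero = 0, ring.add = (+)\<rparr>"

lemma pair_ring_simps [simp]:
  "x \<in> carrier (pair_ring A B) \<longleftrightarrow> Poly_Mapping.keys x \<subseteq> carrier A \<times> carrier B"
  "x \<otimes>\<^bsub>pair_ring A B\<^esub> y = tensor_mult A B x y" "\<one>\<^bsub>pair_ring A B\<^esub> = frag_of (\<one>\<^bsub>A\<^esub>, \<one>\<^bsub>B\<^esub>)"
  "\<zero>\<^bsub>pair_ring A B\<^esub> = 0" "x \<oplus>\<^bsub>pair_ring A B\<^esub> y = x + y"
  unfolding pair_ring_def by simp_all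

lemma add_monoid_pair_ring: "add_monoid (pair_ring A B) = free_Abelian_group (carrier A \<times> carrier B)"
  unfolding pair_ring_def free_Abelian_group_def by simp

text \<open>\<open>tensor_mult\<close> is additive in each argument, which reduces every
  multiplicative law to basis elements, that is, to the laws of \<open>A\<close> and
  \<open>B\<close> in each coordinate.\<close>

lemma pair_ring_cring:
  assumes "cring A" "cring B"
  shows "cring (pair_ring A B)"
proof -
  interpret A: cring A by fact
  interpret B: cring B by fact
  let ?S = "carrier A \<times> carrier B" and ?m = "tensor_mult A B"
  have cl: "Poly_Mapping.keys (?m g h) \<subseteq> ?S"
    if g: "Poly_Mapping.keys g \<subseteq> ?S" and h: "Poly_Mapping.keys h \<subseteq> ?S" for g h
    using g
  proof (induction rule: frag_keys_induct)
    case (one x)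
    obtain a b where x: "x = (a, b)" "a \<in> carrier A" "b \<in> carrier B" using one by auto
    show ?case using h unfolding x(1)
      by (induction rule: frag_keys_induct) (use x in \<open>auto simp: tensor_mult_simps keys_frag_of dest!: subsetD[OF keys_diff]\<close>)
  qed (auto simp: tensor_mult_simps dest!: subsetD[OF keys_diff])
  have comm: "?m g h = ?m h g" if g: "Poly_Mapping.keys g \<subseteq> ?S" and h: "Poly_Mapping.keys h \<subseteq> ?S" for g h
    using g
  proof (induction rule: frag_keys_induct)
    case (one x)
    obtain a b where x: "x = (a, b)" "a \<in> carrier A" "b \<in> carrier B" using one by auto
    show ?case using h unfolding x(1)
      by (induction rule: frag_keys_induct) (use x in \<open>auto simp: tensor_mult_simps A.m_comm B.m_comm\<close>)
  qed (auto simp: tensor_mult_simps)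
  have assoc: "?m (?m g h) l = ?m g (?m h l)"
    if g: "Poly_Mapping.keys g \<subseteq> ?S" and h: "Poly_Mapping.keys h \<subseteq> ?S" and l: "Poly_Mapping.keys l \<subseteq> ?S" for g h l
    using g
  proof (induction rule: frag_keys_induct)
    case (one x)
    obtain a b where x: "x = (a, b)" "a \<in> carrier A" "b \<in> carrier B" using one by auto
    show ?case using h unfolding x(1)
    proof (induction rule: frag_keys_induct)
      case (one y)
      obtain c d where y: "y = (c, d)" "c \<in> carrier A" "d \<in> carrier B" using one by auto
      show ?case using l unfolding y(1)
        by (induction rule: frag_keys_induct) (use x y in \<open>auto simp: tensor_mult_simps A.m_assoc B.m_assoc\<close>)
    qed (auto simp: tensor_mult_simps)
  qed (auto simp: tensor_mult_simps)
  have one: "?m (frag_of (\<one>\<^bsub>A\<^esub>, \<one>\<^bsub>B\<^esub>)) h = h" if h: "Poly_Mapping.keys h \<subseteq> ?S" for h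
    using h by (induction rule: frag_keys_induct) (auto simp: tensor_mult_simps)
  have "comm_monoid (pair_ring A B)"
    by (rule comm_monoidI) (use cl comm assoc one in \<open>simp_all add: keys_frag_of\<close>)
  moreover have "abelian_group (pair_ring A B)"
  proof (rule abelian_groupI)
    fix x assume "x \<in> carrier (pair_ring A B)"
    then show "\<exists>y\<in>carrier (pair_ring A B). y \<oplus>\<^bsub>pair_ring A B\<^esub> x = \<zero>\<^bsub>pair_ring A B\<^esub>"
      by (intro bexI[of _ "- x"]) simp_all
  qed (auto simp: add.assoc dest!: subsetD[OF keys_add])
  ultimately show ?thesis
    by (intro cringI) (simp_all add: tensor_mult_simps)
qed

locale tensor_data =
  fixes k :: "'k ring" and A :: "'a ring" and i :: "'k \<Rightarrow> 'a" and B :: "'b ring" and j :: "'k \<Rightarrow> 'b"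
  assumes A: "cring A" and B: "cring B"
    and i: "\<And>c. c \<in> carrier k \<Longrightarrow> i c \<in> carrier A" and j: "\<And>c. c \<in> carrier k \<Longrightarrow> j c \<in> carrier B"
begin

abbreviation "cls \<equiv> tensor_class k A i B j"
abbreviation "T \<equiv> tensor k A i B j"
abbreviation "N \<equiv> tensor_null k A i B j"
abbreviation "P \<equiv> pair_ring A B"
abbreviation "F \<equiv> free_Abelian_group (carrier A \<times> carrier B)"

sublocale A: cring A by (rule A)
sublocale B: cring B by (rule B)
sublocale P: cring P by (rule pair_ring_cring[OF A B])

definition gens where
  "gens = {frag_of (a \<oplus>\<^bsub>A\<^esub> a', b) - frag_of (a, b) - frag_of (a', b) |a a' b.
         a \<in> carrier A \<and> a' \<in> carrier A \<and> b \<in> carrier B} \<union>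
      {frag_of (a, b \<oplus>\<^bsub>B\<^esub> b') - frag_of (a, b) - frag_of (a, b') |a b b'.
         a \<in> carrier A \<and> b \<in> carrier B \<and> b' \<in> carrier B} \<union>
      {frag_of (i c \<otimes>\<^bsub>A\<^esub> a, b) - frag_of (a, j c \<otimes>\<^bsub>B\<^esub> b) |c a b.
         c \<in> carrier k \<and> a \<in> carrier A \<and> b \<in> carrier B}"

lemma N_eq: "N = generate F gens"
  unfolding tensor_null_def gens_def ..

lemma gens_subset: "gens \<subseteq> carrier F"
proof -
  show ?thesis unfolding gens_def using i j by (auto simp: keys_frag_of dest!: subsetD[OF keys_diff])
qed

text \<open>A pure tensor times a defining relation is a relation of the same kind. For this reason
  the subgroup generated by the relations is an ideal of \<open>P\<close>.\<close>

lemma gens_mult: "g \<in> gens \<Longrightarrow> a \<in> carrier A \<Longrightarrow> b \<in> carrier B \<Longrightarrow> tensor_mult A B (frag_of (a, b)) g \<in> gens"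
proof -
  assume g: "g \<in> gens" and a: "a \<in> carrier A" "b \<in> carrier B"
  from g consider
    (1) c c' d where "g = frag_of (c \<oplus>\<^bsub>A\<^esub> c', d) - frag_of (c, d) - frag_of (c', d)"
      "c \<in> carrier A" "c' \<in> carrier A" "d \<in> carrier B"
    | (2) c d d' where "g = frag_of (c, d \<oplus>\<^bsub>B\<^esub> d') - frag_of (c, d) - frag_of (c, d')"
      "c \<in> carrier A" "d \<in> carrier B" "d' \<in> carrier B"
    | (3) e c d where "g = frag_of (i e \<otimes>\<^bsub>A\<^esub> c, d) - frag_of (c, j e \<otimes>\<^bsub>B\<^esub> d)"
      "e \<in> carrier k" "c \<in> carrier A" "d \<in> carrier B"
    unfolding gens_def by blast
  then show "tensor_mult A B (frag_of (a, b)) g \<in> gens"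
  proof cases
    case 1
    then show ?thesis
      using a unfolding gens_def by (simp add: tensor_mult_simps A.r_distr) (metis A.m_closed B.m_closed)
  next
    case 2
    then show ?thesis
      using a unfolding gens_def by (simp add: tensor_mult_simps B.r_distr) (metis A.m_closed B.m_closed)
  next
    case 3
    then have "a \<otimes>\<^bsub>A\<^esub> (i e \<otimes>\<^bsub>A\<^esub> c) = i e \<otimes>\<^bsub>A\<^esub> (a \<otimes>\<^bsub>A\<^esub> c)" "b \<otimes>\<^bsub>B\<^esub> (j e \<otimes>\<^bsub>B\<^esub> d) = j e \<otimes>\<^bsub>B\<^esub> (b \<otimes>\<^bsub>B\<^esub> d)"
      using a i j A.m_lcomm B.m_lcomm by auto
    then show ?thesis
      using a 3 unfolding gens_def by (simp add: tensor_mult_simps) (metis A.m_closed B.m_closed)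
  qed
qed

lemma N_subgroup: "subgroup N F"
  unfolding N_eq using group.generate_is_subgroup[OF group_free_Abelian_group gens_subset] .

lemma N_minus: "x \<in> N \<Longrightarrow> y \<in> N \<Longrightarrow> x - y \<in> N"
  using subgroup.m_closed[OF N_subgroup, of x "- y"] subgroup.m_inv_closed[OF N_subgroup, of y]
    subgroup.mem_carrier[OF N_subgroup, of y] by simp

lemma N_mult:
  assumes n: "n \<in> N" and h: "h \<in> carrier F"
  shows "tensor_mult A B h n \<in> N"
proof -
  have z: "0 \<in> N" using subgroup.one_closed[OF N_subgroup] by simp
  have *: "tensor_mult A B (frag_of (a, b)) n \<in> N" if ab: "a \<in> carrier A" "b \<in> carrier B" for a b
    using n unfolding N_eq
  proof (induction rule: generate.induct)
    case one
    then show ?case using z by (simp add: tensor_mult_simps N_eq[symmetric])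
  next
    case (incl h)
    then show ?case using gens_mult[OF _ ab] generate.incl by metis
  next
    case (inv h)
    then have "inv\<^bsub>F\<^esub> h = 0 - h" using gens_subset by auto
    show ?case
      unfolding \<open>inv\<^bsub>F\<^esub> h = 0 - h\<close> tensor_mult_simps N_eq[symmetric]
      by (rule N_minus[OF z]) (unfold N_eq, rule generate.incl[OF gens_mult[OF inv ab]])
  next
    case (eng h1 h2)
    then show ?case
      using subgroup.m_closed[OF N_subgroup] by (simp add: tensor_mult_simps N_eq[symmetric])
  qed
  have "Poly_Mapping.keys h \<subseteq> carrier A \<times> carrier B" using h by simp
  then show ?thesis
    by (induction rule: frag_keys_induct) (use z * N_minus in \<open>auto simp: tensor_mult_simps\<close>)
qed

lemma N_ideal: "ideal N P"
proof (rule idealI)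
  show "ring P" by (rule P.ring_axioms)
  show "subgroup N (add_monoid P)" unfolding add_monoid_pair_ring using N_subgroup .
  fix a x assume a: "a \<in> N" and x: "x \<in> carrier P"
  show 1: "x \<otimes>\<^bsub>P\<^esub> a \<in> N" using N_mult[OF a] x by simp
  have "a \<in> carrier P" using subgroup.mem_carrier[OF N_subgroup a] by simp
  then show "a \<otimes>\<^bsub>P\<^esub> x \<in> N" using 1 P.m_comm[OF x] by simp
qed

sublocale N: ideal N P by (rule N_ideal)

lemma cls_coset: "cls h = N +>\<^bsub>P\<^esub> h"
  unfolding tensor_class_def a_r_coset_def add_monoid_pair_ring ..

text \<open>The tensor product is the quotient of \<open>P\<close> by \<open>N\<close>, but its
  addition is a union over representatives and is compared with that of the quotient on the carrier
  only. The identity map is a ring isomorphism and carries the axioms over.\<close>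

lemma T_cring: "cring T"
  and cls_hom: "cls \<in> ring_hom P T"
  and T_carrier: "carrier T = cls ` carrier P"
proof -
  let ?Q = "P Quot N"
  interpret Q: cring ?Q using N.quotient_is_cring[OF P.cring_axioms] .
  have car: "carrier T = carrier ?Q"
    unfolding tensor_def FactRing_def A_RCOSETS_def' by (auto simp: cls_coset)
  \<comment> \<open>The quotient adds cosets as sets, while \<open>T\<close> takes a union of
    cosets; both are the coset of a sum of representatives.\<close>
  have add_eq: "x \<oplus>\<^bsub>T\<^esub> y = x \<oplus>\<^bsub>?Q\<^esub> y" if xy: "x \<in> carrier ?Q" "y \<in> carrier ?Q" for x y
  proof -
    obtain g h where gh: "g \<in> carrier P" "h \<in> carrier P" "x = N +>\<^bsub>P\<^esub> g" "y = N +>\<^bsub>P\<^esub> h"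
      using xy unfolding FactRing_def A_RCOSETS_def' by auto
    have sum: "x \<oplus>\<^bsub>?Q\<^esub> y = N +>\<^bsub>P\<^esub> (g \<oplus>\<^bsub>P\<^esub> h)"
      unfolding FactRing_def gh using N.a_rcos_sum[OF gh(1,2)] by simp
    have "cls (g' + h') = N +>\<^bsub>P\<^esub> (g \<oplus>\<^bsub>P\<^esub> h)" if "g' \<in> x" "h' \<in> y" for g' h'
    proof -
      have c: "g' \<in> carrier P" "h' \<in> carrier P"
        using that gh N.a_elemrcos_carrier by auto
      have "N +>\<^bsub>P\<^esub> g' = x" "N +>\<^bsub>P\<^esub> h' = y"
        using P.a_repr_independence[OF _ gh(1) N.a_subgroup, of g'] P.a_repr_independence[OF _ gh(2) N.a_subgroup, of h']
          that gh(3,4) by auto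
      then show ?thesis
        using N.a_rcos_sum[OF c] sum unfolding cls_coset FactRing_def by simp
    qed
    moreover have "g \<in> x" "h \<in> y" using gh N.a_rcos_self by auto
    ultimately show ?thesis unfolding sum unfolding tensor_def by auto
  qed
  have ops: "x \<otimes>\<^bsub>T\<^esub> y = x \<otimes>\<^bsub>?Q\<^esub> y" "\<one>\<^bsub>T\<^esub> = \<one>\<^bsub>?Q\<^esub>" "\<zero>\<^bsub>T\<^esub> = \<zero>\<^bsub>?Q\<^esub>" for x y
    unfolding tensor_def FactRing_def rcoset_mult_def using P.a_rcos_zero[OF N_ideal N.zero_closed]
    by (simp_all add: cls_coset)
  have "id \<in> ring_iso ?Q T"
    by (rule ring_iso_memI) (auto simp: car add_eq ops)
  then have "cring (T\<lparr>zero := id \<zero>\<^bsub>?Q\<^esub>\<rparr>)" using Q.ring_iso_imp_img_cring by blast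
  moreover have "T\<lparr>zero := id \<zero>\<^bsub>?Q\<^esub>\<rparr> = T"
    by (rule ring.equality) (simp_all add: ops(3))
  ultimately show "cring T" by simp
  show "carrier T = cls ` carrier P" unfolding tensor_def by auto
  show "cls \<in> ring_hom P T"
  proof (rule ring_hom_memI)
    note q = N.rcos_ring_hom
    show "cls x \<in> carrier T" if "x \<in> carrier P" for x
      unfolding cls_coset car using ring_hom_closed[OF q that] .
    show "cls \<one>\<^bsub>P\<^esub> = \<one>\<^bsub>T\<^esub>" unfolding cls_coset ops(2) using ring_hom_one[OF q] .
    fix x y assume x: "x \<in> carrier P" and y: "y \<in> carrier P"
    show "cls (x \<otimes>\<^bsub>P\<^esub> y) = cls x \<otimes>\<^bsub>T\<^esub> cls y" unfolding cls_coset ops(1) using ring_hom_mult[OF q x y] .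
    show "cls (x \<oplus>\<^bsub>P\<^esub> y) = cls x \<oplus>\<^bsub>T\<^esub> cls y"
      unfolding cls_coset add_eq[OF ring_hom_closed[OF q x] ring_hom_closed[OF q y]] using ring_hom_add[OF q x y] .
  qed
qed

sublocale T: cring T by (rule T_cring)

lemma cls_simps:
  assumes "g \<in> carrier P" "h \<in> carrier P"
  shows "cls g \<in> carrier T" "cls g \<oplus>\<^bsub>T\<^esub> cls h = cls (g + h)" "cls g \<otimes>\<^bsub>T\<^esub> cls h = cls (tensor_mult A B g h)"
    "\<one>\<^bsub>T\<^esub> = cls (frag_of (\<one>\<^bsub>A\<^esub>, \<one>\<^bsub>B\<^esub>))" "\<zero>\<^bsub>T\<^esub> = cls 0"
  using ring_hom_closed[OF cls_hom] ring_hom_add[OF cls_hom assms] ring_hom_mult[OF cls_hom assms] ring_hom_one[OF cls_hom]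
    ring_hom_zero[OF cls_hom P.ring_axioms T.ring_axioms] assms by auto

lemma cls_diff:
  assumes "g \<in> carrier P" "h \<in> carrier P"
  shows "cls (g - h) = cls g \<ominus>\<^bsub>T\<^esub> cls h"
proof -
  have d: "g - h \<in> carrier P" using assms keys_diff[of g h] by auto
  have "cls (g - h) \<oplus>\<^bsub>T\<^esub> cls h = cls g" using cls_simps(2)[OF d assms(2)] by simp
  then show ?thesis using cls_simps(1)[OF assms(1,1)] cls_simps(1)[OF assms(2,2)] cls_simps(1)[OF d d]
    by (metis T.add.inv_solve_right a_minus_def)
qed

lemma cls_eq_iff:
  assumes "g \<in> carrier P" "h \<in> carrier P"
  shows "cls g = cls h \<longleftrightarrow> g - h \<in> N"
proof -
  have e: "g \<ominus>\<^bsub>P\<^esub> h = g - h"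
    using assms P.minus_eq P.minus_equality[of "- h" h] by simp
  show ?thesis unfolding cls_coset e[symmetric]
    using P.quotient_eq_iff_same_a_r_cos[OF N_ideal assms] by simp
qed

lemma frag_in_P: "a \<in> carrier A \<Longrightarrow> b \<in> carrier B \<Longrightarrow> frag_of (a, b) \<in> carrier P"
  by (simp add: keys_frag_of)

lemma cls_add_left:
  assumes "a \<in> carrier A" "a' \<in> carrier A" "b \<in> carrier B"
  shows "cls (frag_of (a \<oplus>\<^bsub>A\<^esub> a', b)) = cls (frag_of (a, b)) \<oplus>\<^bsub>T\<^esub> cls (frag_of (a', b))"
proof -
  have "frag_of (a \<oplus>\<^bsub>A\<^esub> a', b) - (frag_of (a, b) + frag_of (a', b)) \<in> N"
    unfolding N_eq using assms by (intro generate.incl) (auto simp: gens_def diff_diff_eq[symmetric])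
  moreover have "frag_of (a, b) + frag_of (a', b) \<in> carrier P"
    using P.a_closed[OF frag_in_P[OF assms(1,3)] frag_in_P[OF assms(2,3)]] by simp
  ultimately have "cls (frag_of (a \<oplus>\<^bsub>A\<^esub> a', b)) = cls (frag_of (a, b) + frag_of (a', b))"
    using cls_eq_iff[OF frag_in_P[OF A.a_closed[OF assms(1,2)] assms(3)]] by blast
  then show ?thesis using cls_simps(2)[OF frag_in_P[OF assms(1,3)] frag_in_P[OF assms(2,3)]] by simp
qed

lemma inl_hom: "(\<lambda>a. cls (frag_of (a, \<one>\<^bsub>B\<^esub>))) \<in> ring_hom A T"
proof (rule ring_hom_memI)
  note f = frag_in_P[OF _ B.one_closed]
  show "cls (frag_of (a, \<one>\<^bsub>B\<^esub>)) \<in> carrier T" if "a \<in> carrier A" for a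
    using cls_simps(1)[OF f f] that by blast
  show "cls (frag_of (\<one>\<^bsub>A\<^esub>, \<one>\<^bsub>B\<^esub>)) = \<one>\<^bsub>T\<^esub>" using cls_simps(4)[OF f f] by auto
  fix a a' assume a: "a \<in> carrier A" "a' \<in> carrier A"
  show "cls (frag_of (a \<oplus>\<^bsub>A\<^esub> a', \<one>\<^bsub>B\<^esub>)) = cls (frag_of (a, \<one>\<^bsub>B\<^esub>)) \<oplus>\<^bsub>T\<^esub> cls (frag_of (a', \<one>\<^bsub>B\<^esub>))"
    using cls_add_left[OF a B.one_closed] .
  show "cls (frag_of (a \<otimes>\<^bsub>A\<^esub> a', \<one>\<^bsub>B\<^esub>)) = cls (frag_of (a, \<one>\<^bsub>B\<^esub>)) \<otimes>\<^bsub>T\<^esub> cls (frag_of (a', \<one>\<^bsub>B\<^esub>))"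
    using cls_simps(3)[OF f[OF a(1)] f[OF a(2)]] by (simp add: tensor_mult_simps)
qed

text \<open>Freeness gives an additive map \<sigma> on \<open>P\<close>. It is multiplicative by
  bilinearity and kills the defining relations, hence all of \<open>N\<close>.\<close>

lemma tensor_universal:
  assumes S: "cring S" and u: "u \<in> ring_hom A S" and v: "v \<in> ring_hom B S"
    and uv: "\<And>c. c \<in> carrier k \<Longrightarrow> u (i c) = v (j c)"
  obtains \<tau> where "\<tau> \<in> ring_hom T S"
    "\<And>a b. a \<in> carrier A \<Longrightarrow> b \<in> carrier B \<Longrightarrow> \<tau> (cls (frag_of (a, b))) = u a \<otimes>\<^bsub>S\<^esub> v b"
proof -
  interpret S: cring S by fact
  note uc = ring_hom_closed[OF u] and vc = ring_hom_closed[OF v]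
  have "(\<lambda>(a, b). u a \<otimes>\<^bsub>S\<^esub> v b) ` (carrier A \<times> carrier B) \<subseteq> carrier (add_monoid S)" using uc vc by auto
  then obtain \<sigma> where \<sigma>: "\<sigma> \<in> hom F (add_monoid S)"
    and \<sigma>': "\<And>x. x \<in> carrier A \<times> carrier B \<Longrightarrow> \<sigma> (frag_of x) = (\<lambda>(a, b). u a \<otimes>\<^bsub>S\<^esub> v b) x"
    using comm_group.free_Abelian_group_universal[OF S.a_comm_group] by blast
  interpret \<sigma>: group_hom F "add_monoid S" \<sigma>
    using \<sigma> by (intro group_hom.intro) (auto simp: group_hom_axioms_def S.a_group)
  have gen: "\<sigma> (frag_of (a, b)) = u a \<otimes>\<^bsub>S\<^esub> v b" if "a \<in> carrier A" "b \<in> carrier B" for a b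
    using \<sigma>'[of "(a, b)"] that by simp
  have cl: "\<sigma> g \<in> carrier S" if "g \<in> carrier P" for g
    using \<sigma>.hom_closed[of g] that by simp
  have add: "\<sigma> (g + h) = \<sigma> g \<oplus>\<^bsub>S\<^esub> \<sigma> h" if "g \<in> carrier P" "h \<in> carrier P" for g h
    using \<sigma>.hom_mult[of g h] that by simp
  have neg: "\<sigma> (- h) = \<ominus>\<^bsub>S\<^esub> \<sigma> h" if "h \<in> carrier P" for h
    using \<sigma>.hom_inv[of h] that by (simp add: a_inv_def)
  have diff: "\<sigma> (g - h) = \<sigma> g \<ominus>\<^bsub>S\<^esub> \<sigma> h" if "g \<in> carrier P" "h \<in> carrier P" for g h
    using add[of g "- h"] neg[OF that(2)] that by (simp add: S.minus_eq)
  have zero: "\<sigma> 0 = \<zero>\<^bsub>S\<^esub>" using \<sigma>.hom_one by simp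
  \<comment> \<open>Both sides are additive in each argument, so the identity is checked on pairs of
    pure tensors, where commutativity of \<open>S\<close> rearranges the factors.\<close>
  have mult: "\<sigma> (tensor_mult A B g h) = \<sigma> g \<otimes>\<^bsub>S\<^esub> \<sigma> h" if g: "g \<in> carrier P" and h: "h \<in> carrier P" for g h
    using g[simplified]
  proof (induction rule: frag_keys_induct)
    case zero
    then show ?case using h cl \<open>\<sigma> 0 = \<zero>\<^bsub>S\<^esub>\<close> by (simp add: tensor_mult_simps)
  next
    case (one x)
    obtain a b where x: "x = (a, b)" "a \<in> carrier A" "b \<in> carrier B" using one by auto
    show ?case using h[simplified] unfolding x(1)
    proof (induction rule: frag_keys_induct)
      case zero
      then show ?case using x gen uc vc \<open>\<sigma> 0 = \<zero>\<^bsub>S\<^esub>\<close> by (simp add: tensor_mult_simps)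
    next
      case (one y)
      obtain c d where y: "y = (c, d)" "c \<in> carrier A" "d \<in> carrier B" using one by auto
      show ?case
        unfolding y(1) tensor_mult_simps
        using x y gen ring_hom_mult[OF u] ring_hom_mult[OF v] uc vc by (simp add: S.m_ac)
    next
      case (diff g' h')
      have c: "frag_of (a, b) \<in> carrier P" "g' \<in> carrier P" "h' \<in> carrier P" using diff x frag_in_P by auto
      have "\<sigma> (tensor_mult A B (frag_of (a, b)) g' - tensor_mult A B (frag_of (a, b)) h') =
        \<sigma> (tensor_mult A B (frag_of (a, b)) g') \<ominus>\<^bsub>S\<^esub> \<sigma> (tensor_mult A B (frag_of (a, b)) h')"
        using \<open>\<And>h g. g \<in> carrier P \<Longrightarrow> h \<in> carrier P \<Longrightarrow> \<sigma> (g - h) = \<sigma> g \<ominus>\<^bsub>S\<^esub> \<sigma> h\<close>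
          P.m_closed[OF c(1,2)] P.m_closed[OF c(1,3)] by simp
      then show ?case
        using diff \<open>\<And>h g. g \<in> carrier P \<Longrightarrow> h \<in> carrier P \<Longrightarrow> \<sigma> (g - h) = \<sigma> g \<ominus>\<^bsub>S\<^esub> \<sigma> h\<close> c cl
        by (simp add: tensor_mult_simps S.minus_eq S.r_distr S.r_minus)
    qed
  next
    case (diff g' h')
    have c: "g' \<in> carrier P" "h' \<in> carrier P" using diff by auto
    have "\<sigma> (tensor_mult A B g' h - tensor_mult A B h' h) =
      \<sigma> (tensor_mult A B g' h) \<ominus>\<^bsub>S\<^esub> \<sigma> (tensor_mult A B h' h)"
      using \<open>\<And>h g. g \<in> carrier P \<Longrightarrow> h \<in> carrier P \<Longrightarrow> \<sigma> (g - h) = \<sigma> g \<ominus>\<^bsub>S\<^esub> \<sigma> h\<close>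
        P.m_closed[OF c(1) h] P.m_closed[OF c(2) h] by simp
    then show ?case
      using diff \<open>\<And>h g. g \<in> carrier P \<Longrightarrow> h \<in> carrier P \<Longrightarrow> \<sigma> (g - h) = \<sigma> g \<ominus>\<^bsub>S\<^esub> \<sigma> h\<close> c cl h
      by (simp add: tensor_mult_simps S.minus_eq S.l_distr S.l_minus)
  qed
  have gens0: "\<sigma> g = \<zero>\<^bsub>S\<^esub>" if "g \<in> gens" for g
  proof -
    from that consider
    (1) c c' d where "g = frag_of (c \<oplus>\<^bsub>A\<^esub> c', d) - (frag_of (c, d) + frag_of (c', d))"
      "c \<in> carrier A" "c' \<in> carrier A" "d \<in> carrier B"
    | (2) c d d' where "g = frag_of (c, d \<oplus>\<^bsub>B\<^esub> d') - (frag_of (c, d) + frag_of (c, d'))"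
      "c \<in> carrier A" "d \<in> carrier B" "d' \<in> carrier B"
    | (3) e c d where "g = frag_of (i e \<otimes>\<^bsub>A\<^esub> c, d) - frag_of (c, j e \<otimes>\<^bsub>B\<^esub> d)"
      "e \<in> carrier k" "c \<in> carrier A" "d \<in> carrier B"
      unfolding gens_def diff_diff_eq by blast
    then show ?thesis
    proof cases
      case 1
      have "\<sigma> g = \<sigma> (frag_of (c \<oplus>\<^bsub>A\<^esub> c', d)) \<ominus>\<^bsub>S\<^esub> (\<sigma> (frag_of (c, d)) \<oplus>\<^bsub>S\<^esub> \<sigma> (frag_of (c', d)))"
        unfolding 1(1) using 1 diff add frag_in_P P.a_closed[OF frag_in_P frag_in_P, of c d c' d] by simp
      also have "\<dots> = \<zero>\<^bsub>S\<^esub>" using 1 gen ring_hom_add[OF u] uc vc by (simp add: S.l_distr S.minus_eq S.r_neg)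
      finally show ?thesis .
    next
      case 2
      have "\<sigma> g = \<sigma> (frag_of (c, d \<oplus>\<^bsub>B\<^esub> d')) \<ominus>\<^bsub>S\<^esub> (\<sigma> (frag_of (c, d)) \<oplus>\<^bsub>S\<^esub> \<sigma> (frag_of (c, d')))"
        unfolding 2(1) using 2 diff add frag_in_P P.a_closed[OF frag_in_P frag_in_P, of c d c d'] by simp
      also have "\<dots> = \<zero>\<^bsub>S\<^esub>" using 2 gen ring_hom_add[OF v] uc vc by (simp add: S.r_distr S.minus_eq S.r_neg)
      finally show ?thesis .
    next
      case 3
      have "\<sigma> g = \<sigma> (frag_of (i e \<otimes>\<^bsub>A\<^esub> c, d)) \<ominus>\<^bsub>S\<^esub> \<sigma> (frag_of (c, j e \<otimes>\<^bsub>B\<^esub> d))"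
        unfolding 3(1) using 3 i j by (intro diff frag_in_P) auto
      also have "\<dots> = \<zero>\<^bsub>S\<^esub>"
        using 3 gen ring_hom_mult[OF u] ring_hom_mult[OF v] uc vc i j uv by (simp add: S.m_ac S.minus_eq S.r_neg)
      finally show ?thesis .
    qed
  qed
  have N0: "\<sigma> n = \<zero>\<^bsub>S\<^esub>" if "n \<in> N" for n
    using that unfolding N_eq
  proof (induction rule: generate.induct)
    case one
    then show ?case using zero by simp
  next
    case (incl h)
    then show ?case using gens0 by simp
  next
    case (inv h)
    have "h \<in> carrier F" using inv gens_subset by blast
    then have "h \<in> carrier P" "inv\<^bsub>F\<^esub> h = - h" by simp_all
    then show ?case using neg gens0[OF inv] by simp
  next
    case (eng h1 h2)
    have "h1 \<in> carrier P" "h2 \<in> carrier P"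
      using eng(1,2) N_eq subgroup.mem_carrier[OF N_subgroup] by auto
    then show ?case using eng add by simp
  qed
  \<comment> \<open>A class is evaluated at a chosen representative; the choice is immaterial
    because \<sigma> vanishes on \<open>N\<close>.\<close>
  define \<tau> where "\<tau> C = \<sigma> (SOME h. h \<in> carrier P \<and> cls h = C)" for C
  have \<tau>: "\<tau> (cls h) = \<sigma> h" if h: "h \<in> carrier P" for h
  proof -
    have "(SOME h'. h' \<in> carrier P \<and> cls h' = cls h) \<in> carrier P \<and> cls (SOME h'. h' \<in> carrier P \<and> cls h' = cls h) = cls h"
      by (rule someI[of _ h]) (use h in auto)
    then obtain h' where h': "h' \<in> carrier P" "cls h' = cls h" "\<tau> (cls h) = \<sigma> h'" unfolding \<tau>_def by blast
    have "\<sigma> (h' - h) = \<zero>\<^bsub>S\<^esub>" using N0 cls_eq_iff[OF h'(1) h] h'(2) by simp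
    then have "\<sigma> h' = \<sigma> h" using diff[OF h'(1) h] cl h' h S.r_right_minus_eq by simp
    then show ?thesis using h'(3) by simp
  qed
  have "\<tau> \<in> ring_hom T S"
  proof (rule ring_hom_memI)
    show "\<tau> x \<in> carrier S" if "x \<in> carrier T" for x
      using that \<tau> cl unfolding T_carrier by auto
    show "\<tau> \<one>\<^bsub>T\<^esub> = \<one>\<^bsub>S\<^esub>"
      using \<tau>[OF frag_in_P[OF A.one_closed B.one_closed]] gen[OF A.one_closed B.one_closed]
        ring_hom_one[OF u] ring_hom_one[OF v] ring_hom_one[OF cls_hom] by simp
    fix x y assume "x \<in> carrier T" "y \<in> carrier T"
    then obtain g h where gh: "g \<in> carrier P" "h \<in> carrier P" "x = cls g" "y = cls h" unfolding T_carrier by auto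
    show "\<tau> (x \<otimes>\<^bsub>T\<^esub> y) = \<tau> x \<otimes>\<^bsub>S\<^esub> \<tau> y"
      using \<tau> gh cls_simps(3)[OF gh(1,2)] mult[OF gh(1,2)] P.m_closed[OF gh(1,2)] by simp
    show "\<tau> (x \<oplus>\<^bsub>T\<^esub> y) = \<tau> x \<oplus>\<^bsub>S\<^esub> \<tau> y"
      using \<tau> gh cls_simps(2)[OF gh(1,2)] add[OF gh(1,2)] P.a_closed[OF gh(1,2)] by simp
  qed
  then show thesis using that \<tau> gen frag_in_P by simp
qed

end

section \<open>Localization at a prime\<close>

locale prime_localization = primeideal I R for I and R :: "'a ring" (structure)
begin

text \<open>Transitivity of equality of fractions: if \<open>u\<close> witnesses
  \<open>a/b = c/d\<close> and \<open>v\<close> witnesses \<open>c/d = e/f\<close>, then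
  \<open>u \<otimes> v \<otimes> d\<close> witnesses \<open>a/b = e/f\<close>, and it avoids the
  prime because its factors do.\<close>

lemma frac_eqI:
  assumes "a \<in> carrier R" "c \<in> carrier R" "b \<in> carrier R - I" "d \<in> carrier R - I"
    and u: "u \<in> carrier R - I" "u \<otimes> (a \<otimes> d) = u \<otimes> (c \<otimes> b)"
  shows "frac R I a b = frac R I c d"
proof -
  have *: "frac R I c d \<subseteq> frac R I a b"
    if "a \<in> carrier R" "c \<in> carrier R" "b \<in> carrier R - I" "d \<in> carrier R - I"
      "u \<in> carrier R - I" "u \<otimes> (a \<otimes> d) = u \<otimes> (c \<otimes> b)" for a b c d u
  proof
    fix z assume "z \<in> frac R I c d"
    then obtain e f v where z: "z = (e, f)" "e \<in> carrier R" "f \<in> carrier R - I" "v \<in> carrier R - I"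
      "v \<otimes> (c \<otimes> f) = v \<otimes> (e \<otimes> d)" unfolding frac_def by auto
    have cr: "a \<in> carrier R" "b \<in> carrier R" "c \<in> carrier R" "d \<in> carrier R" "e \<in> carrier R" "f \<in> carrier R"
      "u \<in> carrier R" "v \<in> carrier R" using that z by auto
    have "(u \<otimes> v \<otimes> d) \<otimes> (a \<otimes> f) = (v \<otimes> f) \<otimes> (u \<otimes> (a \<otimes> d))" using cr by (simp add: m_ac)
    also have "\<dots> = (u \<otimes> b) \<otimes> (v \<otimes> (c \<otimes> f))" using cr that(6) by (simp add: m_ac)
    also have "\<dots> = (u \<otimes> v \<otimes> d) \<otimes> (e \<otimes> b)" using cr z(5) by (simp add: m_ac)
    finally have "(u \<otimes> v \<otimes> d) \<otimes> (a \<otimes> f) = (u \<otimes> v \<otimes> d) \<otimes> (e \<otimes> b)" .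
    moreover have "u \<otimes> v \<otimes> d \<in> carrier R - I"
      using I_prime[of "u \<otimes> v" d] I_prime[of u v] that z by auto
    ultimately show "z \<in> frac R I a b" unfolding frac_def using z by auto
  qed
  show ?thesis using *[OF assms] *[OF assms(2,1,4,3) u(1) u(2)[symmetric]] by auto
qed

lemma frac_memD:
  assumes "(c, d) \<in> frac R I a b"
  shows "c \<in> carrier R" "d \<in> carrier R - I" "\<exists>u\<in>carrier R - I. u \<otimes> (a \<otimes> d) = u \<otimes> (c \<otimes> b)"
  using assms unfolding frac_def by auto

lemma frac_self:
  assumes "a \<in> carrier R" "b \<in> carrier R - I"
  shows "(a, b) \<in> frac R I a b"
  unfolding frac_def using assms by auto

lemma one_notin: "\<one> \<in> carrier R - I"
  using one_imp_carrier I_notcarr by auto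

lemma frac_mult:
  assumes a: "a \<in> carrier R" "b \<in> carrier R - I" and c: "c \<in> carrier R" "d \<in> carrier R - I"
  shows "frac R I a b \<otimes>\<^bsub>localization R I\<^esub> frac R I c d = frac R I (a \<otimes> c) (b \<otimes> d)"
proof -
  have bd: "b \<otimes> d \<in> carrier R - I" if "b \<in> carrier R - I" "d \<in> carrier R - I" for b d
    using that I_prime by auto
  have *: "frac R I (a' \<otimes> c') (b' \<otimes> d') = frac R I (a \<otimes> c) (b \<otimes> d)"
    if m: "(a', b') \<in> frac R I a b" "(c', d') \<in> frac R I c d" for a' b' c' d'
  proof -
    note x = frac_memD[OF m(1)] and y = frac_memD[OF m(2)]
    obtain u v where u: "u \<in> carrier R - I" "u \<otimes> (a \<otimes> b') = u \<otimes> (a' \<otimes> b)"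
      and v: "v \<in> carrier R - I" "v \<otimes> (c \<otimes> d') = v \<otimes> (c' \<otimes> d)" using x(3) y(3) by auto
    have cr: "a \<in> carrier R" "b \<in> carrier R" "c \<in> carrier R" "d \<in> carrier R" "a' \<in> carrier R" "b' \<in> carrier R"
      "c' \<in> carrier R" "d' \<in> carrier R" "u \<in> carrier R" "v \<in> carrier R" using a c u v x y by auto
    have "(u \<otimes> v) \<otimes> (a' \<otimes> c' \<otimes> (b \<otimes> d)) = (u \<otimes> (a' \<otimes> b)) \<otimes> (v \<otimes> (c' \<otimes> d))" using cr by (simp add: m_ac)
    also have "\<dots> = (u \<otimes> (a \<otimes> b')) \<otimes> (v \<otimes> (c \<otimes> d'))" using u v by simp
    also have "\<dots> = (u \<otimes> v) \<otimes> (a \<otimes> c \<otimes> (b' \<otimes> d'))" using cr by (simp add: m_ac)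
    finally show ?thesis
      using frac_eqI[of "a' \<otimes> c'" "a \<otimes> c" "b' \<otimes> d'" "b \<otimes> d" "u \<otimes> v"] cr bd a c x y u v by auto
  qed
  have "frac R I a b \<otimes>\<^bsub>localization R I\<^esub> frac R I c d =
    (\<Union>(a', b')\<in>frac R I a b. \<Union>(c', d')\<in>frac R I c d. frac R I (a' \<otimes> c') (b' \<otimes> d'))"
    unfolding localization_def by simp
  also have "\<dots> = frac R I (a \<otimes> c) (b \<otimes> d)"
  proof (rule equalityI; rule subsetI)
    fix z assume "z \<in> frac R I (a \<otimes> c) (b \<otimes> d)"
    then show "z \<in> (\<Union>(a', b')\<in>frac R I a b. \<Union>(c', d')\<in>frac R I c d. frac R I (a' \<otimes> c') (b' \<otimes> d'))"
      apply (intro UN_I[OF frac_self[OF a]])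
      apply (simp only: prod.case)
      apply (intro UN_I[OF frac_self[OF c]])
      by simp
  qed (clarsimp simp: *)
  finally show ?thesis .
qed

text \<open>Sums are taken only of images of ring elements; fractions with other denominators are
  only multiplied.\<close>

lemma frac_add_one:
  assumes a: "a \<in> carrier R" and c: "c \<in> carrier R"
  shows "frac R I a \<one> \<oplus>\<^bsub>localization R I\<^esub> frac R I c \<one> = frac R I (a \<oplus> c) \<one>"
proof -
  have *: "frac R I (a' \<otimes> d' \<oplus> c' \<otimes> b') (b' \<otimes> d') = frac R I (a \<oplus> c) \<one>"
    if m: "(a', b') \<in> frac R I a \<one>" "(c', d') \<in> frac R I c \<one>" for a' b' c' d'
  proof -
    note x = frac_memD[OF m(1)] and y = frac_memD[OF m(2)]
    obtain u v where u: "u \<in> carrier R - I" "u \<otimes> (a \<otimes> b') = u \<otimes> (a' \<otimes> \<one>)"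
      and v: "v \<in> carrier R - I" "v \<otimes> (c \<otimes> d') = v \<otimes> (c' \<otimes> \<one>)" using x(3) y(3) by auto
    have cr: "a \<in> carrier R" "c \<in> carrier R" "a' \<in> carrier R" "b' \<in> carrier R"
      "c' \<in> carrier R" "d' \<in> carrier R" "u \<in> carrier R" "v \<in> carrier R" using a c u v x y by auto
    have "(u \<otimes> v) \<otimes> ((a' \<otimes> d' \<oplus> c' \<otimes> b') \<otimes> \<one>) = (u \<otimes> (a' \<otimes> \<one>)) \<otimes> (v \<otimes> d') \<oplus> (v \<otimes> (c' \<otimes> \<one>)) \<otimes> (u \<otimes> b')"
      using cr by (simp add: m_ac r_distr)
    also have "\<dots> = (u \<otimes> (a \<otimes> b')) \<otimes> (v \<otimes> d') \<oplus> (v \<otimes> (c \<otimes> d')) \<otimes> (u \<otimes> b')" using u v by simp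
    also have "\<dots> = (u \<otimes> v) \<otimes> ((a \<oplus> c) \<otimes> (b' \<otimes> d'))" using cr by (simp add: m_ac l_distr r_distr)
    finally show ?thesis
      using frac_eqI[of "a' \<otimes> d' \<oplus> c' \<otimes> b'" "a \<oplus> c" "b' \<otimes> d'" \<one> "u \<otimes> v"] cr a c x y u v one_notin
        I_prime[of b' d'] I_prime[of u v] by auto
  qed
  have "frac R I a \<one> \<oplus>\<^bsub>localization R I\<^esub> frac R I c \<one> =
    (\<Union>(a', b')\<in>frac R I a \<one>. \<Union>(c', d')\<in>frac R I c \<one>. frac R I (a' \<otimes> d' \<oplus> c' \<otimes> b') (b' \<otimes> d'))"
    unfolding localization_def by simp
  also have "\<dots> = frac R I (a \<oplus> c) \<one>"
  proof (rule equalityI; rule subsetI)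
    fix z assume "z \<in> frac R I (a \<oplus> c) \<one>"
    then show "z \<in> (\<Union>(a', b')\<in>frac R I a \<one>. \<Union>(c', d')\<in>frac R I c \<one>. frac R I (a' \<otimes> d' \<oplus> c' \<otimes> b') (b' \<otimes> d'))"
      using *[OF frac_self[OF a one_notin] frac_self[OF c one_notin]]
      apply (intro UN_I[OF frac_self[OF a one_notin]])
      apply (simp only: prod.case)
      apply (intro UN_I[OF frac_self[OF c one_notin]])
      by simp
  qed (clarsimp simp: *)
  finally show ?thesis .
qed

lemma frac_inverse:
  assumes a: "a \<in> carrier R - I"
  shows "frac R I a \<one> \<otimes>\<^bsub>localization R I\<^esub> frac R I \<one> a = \<one>\<^bsub>localization R I\<^esub>"
proof -
  have "frac R I a \<one> \<otimes>\<^bsub>localization R I\<^esub> frac R I \<one> a = frac R I a a"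
    using frac_mult[of a \<one> \<one> a] a one_notin by simp
  also have "\<dots> = frac R I \<one> \<one>"
    using frac_eqI[of a \<one> a \<one> \<one>] a one_notin by simp
  finally show ?thesis unfolding localization_def by simp
qed

text \<open>If \<open>a\<close> were in the prime, clearing denominators would place a product of
  two elements outside the prime inside it.\<close>

lemma frac_unit_notin:
  assumes a: "a \<in> carrier R" and t: "t \<in> carrier (localization R I)"
    and e: "frac R I a \<one> \<otimes>\<^bsub>localization R I\<^esub> t = \<one>\<^bsub>localization R I\<^esub>"
  shows "a \<notin> I"
proof
  assume aI: "a \<in> I"
  obtain c d where cd: "c \<in> carrier R" "d \<in> carrier R - I" "t = frac R I c d"
    using t unfolding localization_def by auto
  have "frac R I (a \<otimes> c) d = frac R I \<one> \<one>"
    using frac_mult[OF a one_notin cd(1,2)] e cd unfolding localization_def by simp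
  then have "(\<one>, \<one>) \<in> frac R I (a \<otimes> c) d" using frac_self[OF one_closed one_notin] by simp
  then obtain u where u: "u \<in> carrier R - I" "u \<otimes> (a \<otimes> c \<otimes> \<one>) = u \<otimes> (\<one> \<otimes> d)"
    using frac_memD(3) by blast
  have "u \<otimes> (a \<otimes> c \<otimes> \<one>) \<in> I" using I_l_closed[of "a \<otimes> c" u] I_r_closed[OF aI cd(1)] a cd u(1) by simp
  then have "u \<otimes> d \<in> I" unfolding u(2) using u(1) cd by simp
  then show False using I_prime[of u d] u cd by auto
qed

end

section \<open>Morphisms into a separated space\<close>

text \<open>Modulo the differences of \<open>a\<close> tensor one and one tensor \<open>a\<close>,
  every tensor is congruent to \<mu> tensor one, where \<mu> is its image under the multiplication
  of \<open>A\<close>. Whether such an element lies in either prime is prescribed by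
  \<open>M\<close>.\<close>

lemma diag_prime_eq:
  assumes td: "tensor_data k A i A i"
    and Q: "primeideal Q (tensor k A i A i)" and Q': "primeideal Q' (tensor k A i A i)"
    and d: "\<And>a. a \<in> carrier A \<Longrightarrow> tensor_class k A i A i (frag_of (a, \<one>\<^bsub>A\<^esub>) - frag_of (\<one>\<^bsub>A\<^esub>, a)) \<in> Q"
      "\<And>a. a \<in> carrier A \<Longrightarrow> tensor_class k A i A i (frag_of (a, \<one>\<^bsub>A\<^esub>) - frag_of (\<one>\<^bsub>A\<^esub>, a)) \<in> Q'"
    and m: "\<And>a. a \<in> carrier A \<Longrightarrow> tensor_class k A i A i (frag_of (a, \<one>\<^bsub>A\<^esub>)) \<in> Q \<longleftrightarrow> a \<in> M"
      "\<And>a. a \<in> carrier A \<Longrightarrow> tensor_class k A i A i (frag_of (a, \<one>\<^bsub>A\<^esub>)) \<in> Q' \<longleftrightarrow> a \<in> M"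
  shows "Q = Q'"
proof -
  interpret tensor_data k A i A i by fact
  note one = A.one_closed
  interpret inl: ring_hom_cring A T "\<lambda>a. cls (frag_of (a, \<one>\<^bsub>A\<^esub>))"
    using inl_hom by (intro ring_hom_cring.intro A T_cring ring_hom_cring_axioms.intro)
  have dc: "x - y \<in> carrier P" if "x \<in> carrier P" "y \<in> carrier P" for x y
    using that keys_diff[of x y] by auto
  \<comment> \<open>The element \<mu> is found before the ideal is fixed, so that it serves for
    \<open>Q\<close> and \<open>Q'\<close> alike.\<close>
  have key: "\<exists>\<mu>\<in>carrier A. \<forall>Q. ideal Q T \<longrightarrow> (\<forall>a\<in>carrier A. cls (frag_of (a, \<one>\<^bsub>A\<^esub>) - frag_of (\<one>\<^bsub>A\<^esub>, a)) \<in> Q) \<longrightarrow>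
      cls (g - frag_of (\<mu>, \<one>\<^bsub>A\<^esub>)) \<in> Q" if g: "Poly_Mapping.keys g \<subseteq> carrier A \<times> carrier A" for g
    using g
  proof (induction rule: frag_keys_induct)
    case zero
    have "cls (0 - frag_of (\<zero>\<^bsub>A\<^esub>, \<one>\<^bsub>A\<^esub>)) = \<zero>\<^bsub>T\<^esub>"
      using cls_diff[OF P.zero_closed frag_in_P[OF A.zero_closed one]] inl.hom_zero
        cls_simps(5)[OF P.zero_closed P.zero_closed, symmetric]
      by (simp add: T.minus_eq)
    then show ?case using additive_subgroup.zero_closed[OF ideal.axioms(1)] A.zero_closed by (intro bexI[of _ "\<zero>\<^bsub>A\<^esub>"]) auto
  next
    case (one x)
    obtain a b where x: "x = (a, b)" and a: "a \<in> carrier A" and b: "b \<in> carrier A" using one by auto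
    note 1 = A.one_closed
    let ?d = "frag_of (\<one>\<^bsub>A\<^esub>, b) - frag_of (b, \<one>\<^bsub>A\<^esub>)" and ?e = "frag_of (b, \<one>\<^bsub>A\<^esub>) - frag_of (\<one>\<^bsub>A\<^esub>, b)"
    have dP: "?d \<in> carrier P" "?e \<in> carrier P" using dc frag_in_P 1 b by auto
    have "frag_of x - frag_of (a \<otimes>\<^bsub>A\<^esub> b, \<one>\<^bsub>A\<^esub>) = tensor_mult A A (frag_of (a, \<one>\<^bsub>A\<^esub>)) ?d"
      using a b by (simp add: x tensor_mult_simps)
    then have e1: "cls (frag_of x - frag_of (a \<otimes>\<^bsub>A\<^esub> b, \<one>\<^bsub>A\<^esub>)) = cls (frag_of (a, \<one>\<^bsub>A\<^esub>)) \<otimes>\<^bsub>T\<^esub> cls ?d"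
      using cls_simps(3)[OF frag_in_P[OF a 1] dP(1)] by simp
    have "cls ?d = cls 0 \<ominus>\<^bsub>T\<^esub> cls ?e"
      using cls_diff[OF P.zero_closed dP(2)] by simp
    then have e2: "cls ?d = \<ominus>\<^bsub>T\<^esub> cls ?e"
      using cls_simps(5)[OF dP(2) dP(2), symmetric] cls_simps(1)[OF dP(2) dP(2)] by (simp add: T.minus_eq)
    have "cls (frag_of x - frag_of (a \<otimes>\<^bsub>A\<^esub> b, \<one>\<^bsub>A\<^esub>)) \<in> Q"
      if Q: "ideal Q T" "\<forall>a\<in>carrier A. cls (frag_of (a, \<one>\<^bsub>A\<^esub>) - frag_of (\<one>\<^bsub>A\<^esub>, a)) \<in> Q" for Q
      unfolding e1 e2
      using ideal.I_l_closed[OF Q(1) _ inl.hom_closed[OF a]] additive_subgroup.a_inv_closed[OF ideal.axioms(1)[OF Q(1)]] Q(2) b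
      by blast
    then show ?case using a b by (intro bexI[of _ "a \<otimes>\<^bsub>A\<^esub> b"]) auto
  next
    case (diff g h)
    then obtain \<mu> \<nu> where \<mu>: "\<mu> \<in> carrier A" "\<And>Q. ideal Q T \<Longrightarrow> (\<forall>a\<in>carrier A. cls (frag_of (a, \<one>\<^bsub>A\<^esub>) - frag_of (\<one>\<^bsub>A\<^esub>, a)) \<in> Q) \<Longrightarrow>
      cls (g - frag_of (\<mu>, \<one>\<^bsub>A\<^esub>)) \<in> Q"
      and \<nu>: "\<nu> \<in> carrier A" "\<And>Q. ideal Q T \<Longrightarrow> (\<forall>a\<in>carrier A. cls (frag_of (a, \<one>\<^bsub>A\<^esub>) - frag_of (\<one>\<^bsub>A\<^esub>, a)) \<in> Q) \<Longrightarrow>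
      cls (h - frag_of (\<nu>, \<one>\<^bsub>A\<^esub>)) \<in> Q" by blast
    have gh: "g \<in> carrier P" "h \<in> carrier P" using diff by auto
    note fP = frag_in_P[OF _ A.one_closed]
    have "cls ((g - h) - frag_of (\<mu> \<ominus>\<^bsub>A\<^esub> \<nu>, \<one>\<^bsub>A\<^esub>)) = (cls g \<ominus>\<^bsub>T\<^esub> cls h) \<ominus>\<^bsub>T\<^esub> cls (frag_of (\<mu> \<ominus>\<^bsub>A\<^esub> \<nu>, \<one>\<^bsub>A\<^esub>))"
      using cls_diff[OF dc[OF gh] fP] cls_diff[OF gh] \<mu>(1) \<nu>(1) by simp
    also have "cls (frag_of (\<mu> \<ominus>\<^bsub>A\<^esub> \<nu>, \<one>\<^bsub>A\<^esub>)) = cls (frag_of (\<mu>, \<one>\<^bsub>A\<^esub>)) \<ominus>\<^bsub>T\<^esub> cls (frag_of (\<nu>, \<one>\<^bsub>A\<^esub>))"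
      using \<mu>(1) \<nu>(1) by (simp add: A.minus_eq T.minus_eq)
    also have "(cls g \<ominus>\<^bsub>T\<^esub> cls h) \<ominus>\<^bsub>T\<^esub> (cls (frag_of (\<mu>, \<one>\<^bsub>A\<^esub>)) \<ominus>\<^bsub>T\<^esub> cls (frag_of (\<nu>, \<one>\<^bsub>A\<^esub>))) =
        (cls g \<ominus>\<^bsub>T\<^esub> cls (frag_of (\<mu>, \<one>\<^bsub>A\<^esub>))) \<ominus>\<^bsub>T\<^esub> (cls h \<ominus>\<^bsub>T\<^esub> cls (frag_of (\<nu>, \<one>\<^bsub>A\<^esub>)))"
      using cls_simps(1)[OF gh] cls_simps(1)[OF gh(2,1)] inl.hom_closed[OF \<mu>(1)] inl.hom_closed[OF \<nu>(1)]
      by (simp add: T.minus_eq T.minus_add T.a_ac)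
    also have "\<dots> = cls (g - frag_of (\<mu>, \<one>\<^bsub>A\<^esub>)) \<ominus>\<^bsub>T\<^esub> cls (h - frag_of (\<nu>, \<one>\<^bsub>A\<^esub>))"
      using cls_diff[OF gh(1) fP[OF \<mu>(1)]] cls_diff[OF gh(2) fP[OF \<nu>(1)]] by simp
    finally have e: "cls ((g - h) - frag_of (\<mu> \<ominus>\<^bsub>A\<^esub> \<nu>, \<one>\<^bsub>A\<^esub>)) =
      cls (g - frag_of (\<mu>, \<one>\<^bsub>A\<^esub>)) \<ominus>\<^bsub>T\<^esub> cls (h - frag_of (\<nu>, \<one>\<^bsub>A\<^esub>))" .
    have "cls ((g - h) - frag_of (\<mu> \<ominus>\<^bsub>A\<^esub> \<nu>, \<one>\<^bsub>A\<^esub>)) \<in> Q"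
      if Q: "ideal Q T" "\<forall>a\<in>carrier A. cls (frag_of (a, \<one>\<^bsub>A\<^esub>) - frag_of (\<one>\<^bsub>A\<^esub>, a)) \<in> Q" for Q
      unfolding e T.minus_eq
      using additive_subgroup.a_closed[OF ideal.axioms(1)[OF Q(1)] \<mu>(2)[OF Q]
          additive_subgroup.a_inv_closed[OF ideal.axioms(1)[OF Q(1)] \<nu>(2)[OF Q]]] .
    then show ?case using \<mu>(1) \<nu>(1) by (intro bexI[of _ "\<mu> \<ominus>\<^bsub>A\<^esub> \<nu>"]) auto
  qed
  have iff: "cls g \<in> Q \<longleftrightarrow> cls g \<in> Q'" if g: "g \<in> carrier P" for g
  proof -
    obtain \<mu> where \<mu>: "\<mu> \<in> carrier A" and k: "\<And>Q. ideal Q T \<Longrightarrow> (\<forall>a\<in>carrier A. cls (frag_of (a, \<one>\<^bsub>A\<^esub>) - frag_of (\<one>\<^bsub>A\<^esub>, a)) \<in> Q) \<Longrightarrow>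
      cls (g - frag_of (\<mu>, \<one>\<^bsub>A\<^esub>)) \<in> Q" using key[of g] g by auto
    have "cls g \<in> Q \<longleftrightarrow> cls (frag_of (\<mu>, \<one>\<^bsub>A\<^esub>)) \<in> Q"
      if Q: "ideal Q T" and d: "\<forall>a\<in>carrier A. cls (frag_of (a, \<one>\<^bsub>A\<^esub>) - frag_of (\<one>\<^bsub>A\<^esub>, a)) \<in> Q" for Q
    proof -
      interpret Q: ideal Q T by fact
      let ?x = "cls g" and ?y = "cls (frag_of (\<mu>, \<one>\<^bsub>A\<^esub>))"
      have c: "?x \<in> carrier T" "?y \<in> carrier T" using cls_simps(1)[OF g g] inl.hom_closed[OF \<mu>] .
      have "?x \<ominus>\<^bsub>T\<^esub> ?y \<in> Q" using k[OF Q d] cls_diff[OF g frag_in_P[OF \<mu> A.one_closed]] by simp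
      then show ?thesis
        using T.quotient_eq_iff_same_a_r_cos[OF Q c] Q.a_rcos_const[of ?x] Q.a_rcos_const[of ?y]
          Q.rcos_const_imp_mem[OF c(1)] Q.rcos_const_imp_mem[OF c(2)] by (metis (no_types))
    qed
    then show ?thesis
      using d m \<mu> primeideal.axioms(1)[OF Q] primeideal.axioms(1)[OF Q'] by simp
  qed
  have "Q \<subseteq> carrier T" "Q' \<subseteq> carrier T"
    using additive_subgroup.a_subset[OF ideal.axioms(1)[OF primeideal.axioms(1)[OF Q]]]
      additive_subgroup.a_subset[OF ideal.axioms(1)[OF primeideal.axioms(1)[OF Q']]] by auto
  then show ?thesis using iff unfolding T_carrier by blast
qed

section \<open>Open sets and sections of the product with itself\<close>

locale fibre_square =
  fixes k :: "'k ring" and Y :: "('q, 's, 'k) over_space"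
  assumes Y: "irr_space k Y"
begin

abbreviation "TT x y \<equiv> stalk_tensor k Y Y x y"
abbreviation "cl x y \<equiv> stalk_tensor_class k Y Y x y"
abbreviation "G U V x y h \<equiv> frag_extend (\<lambda>(s, t). frag_of (germ Y x U s, germ Y y V t)) h"

lemma pY: "presheaf_of_rings Y" using irr_spaceD(2)[OF Y] .

lemma scalar_stalk_closed:
  assumes "x \<in> points Y" "c \<in> carrier k"
  shows "scalar_stalk k Y x c \<in> carrier (stalk Y x)"
  unfolding scalar_stalk_def using germ_in_stalk[OF openin_topspace assms(1) scalar_facts(2)[OF Y assms(2)]] .

lemma td:
  assumes "x \<in> points Y" "y \<in> points Y"
  shows "tensor_data k (stalk Y x) (scalar_stalk k Y x) (stalk Y y) (scalar_stalk k Y y)"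
  using assms stalk_cring[OF pY] scalar_stalk_closed by (simp add: tensor_data_def)

lemma G_closed:
  assumes "openin (topo Y) U" "openin (topo Y) V" "x \<in> U" "y \<in> V"
    and h: "h \<in> carrier (free_Abelian_group (carrier (sect Y U) \<times> carrier (sect Y V)))"
  shows "G U V x y h \<in> carrier (pair_ring (stalk Y x) (stalk Y y))"
proof -
  have "Poly_Mapping.keys h \<subseteq> carrier (sect Y U) \<times> carrier (sect Y V)" using h by simp
  then show ?thesis
    by (induction rule: frag_keys_induct)
      (use assms germ_in_stalk in \<open>auto simp: frag_extend_diff keys_frag_of dest!: subsetD[OF keys_diff]\<close>)
qed

lemma germ_one:
  assumes "openin (topo Y) U" "x \<in> U"
  shows "germ Y x U \<one>\<^bsub>sect Y U\<^esub> = \<one>\<^bsub>stalk Y x\<^esub>"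
  using ring_hom_one[OF germ_hom[OF pY assms]] .

lemma germ_tensor_one:
  assumes "openin (topo Y) U" "openin (topo Y) V" "x \<in> U" "y \<in> V"
  shows "germ_tensor k Y Y U V (frag_of (\<one>\<^bsub>sect Y U\<^esub>, \<one>\<^bsub>sect Y V\<^esub>)) x y = \<one>\<^bsub>TT x y\<^esub>"
proof -
  have p: "x \<in> points Y" "y \<in> points Y" using assms openin_subset by blast+
  interpret tensor_data k "stalk Y x" "scalar_stalk k Y x" "stalk Y y" "scalar_stalk k Y y" using td[OF p] .
  show ?thesis
    unfolding germ_tensor_def using germ_one assms cls_simps(4)[OF P.zero_closed P.zero_closed] by simp
qed

lemma prime_not_one: "(x, y, Q) \<in> prod_points k Y Y \<Longrightarrow> \<one>\<^bsub>TT x y\<^esub> \<in> carrier (TT x y) - Q"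
  unfolding prod_points_def using primeideal_one by blast

lemma prod_basic_open:
  assumes "openin (topo Y) U" "openin (topo Y) V"
    and "h \<in> carrier (free_Abelian_group (carrier (sect Y U) \<times> carrier (sect Y V)))"
  shows "openin (prod_topology k Y Y) {(x, y, Q) \<in> prod_points k Y Y. x \<in> U \<and> y \<in> V \<and> germ_tensor k Y Y U V h x y \<notin> Q}"
  unfolding prod_topology_def using assms by (intro topology_generated_by_Basis) blast

lemma one_pair:
  assumes "openin (topo Y) U" "openin (topo Y) V"
  shows "frag_of (\<one>\<^bsub>sect Y U\<^esub>, \<one>\<^bsub>sect Y V\<^esub>) \<in> carrier (free_Abelian_group (carrier (sect Y U) \<times> carrier (sect Y V)))"
  using presheaf_cring[OF pY assms(1)] presheaf_cring[OF pY assms(2)] by (simp add: keys_frag_of cring.cring_simprules(6))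

text \<open>A rectangle is the basic open set of one tensor one, which lies in no prime.\<close>

lemma prod_rect_open:
  assumes "openin (topo Y) U" "openin (topo Y) V"
  shows "openin (prod_topology k Y Y) {(x, y, Q) \<in> prod_points k Y Y. x \<in> U \<and> y \<in> V}"
proof -
  have "{(x, y, Q) \<in> prod_points k Y Y. x \<in> U \<and> y \<in> V} = {(x, y, Q) \<in> prod_points k Y Y. x \<in> U \<and> y \<in> V \<and>
      germ_tensor k Y Y U V (frag_of (\<one>\<^bsub>sect Y U\<^esub>, \<one>\<^bsub>sect Y V\<^esub>)) x y \<notin> Q}"
    using germ_tensor_one[OF assms] prime_not_one by fastforce
  then show ?thesis using prod_basic_open[OF assms one_pair[OF assms]] by simp
qed

lemma points_prod: "topspace (prod_topology k Y Y) = prod_points k Y Y"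
proof
  show "topspace (prod_topology k Y Y) \<subseteq> prod_points k Y Y"
    unfolding prod_topology_def topology_generated_by_topspace by auto
  have "{(x, y, Q) \<in> prod_points k Y Y. x \<in> points Y \<and> y \<in> points Y} = prod_points k Y Y"
    unfolding prod_points_def by auto
  then show "prod_points k Y Y \<subseteq> topspace (prod_topology k Y Y)"
    using openin_subset[OF prod_rect_open[OF openin_topspace openin_topspace]] by simp
qed

lemma topo_fibre: "topo (fibre_prod k Y Y) = prod_topology k Y Y"
  unfolding fibre_prod_def locally_in_space_def by simp

text \<open>A single fraction valid on all of \<open>N\<close> meets the local condition with
  \<open>N\<close> itself as neighbourhood. All sections of the product that are built below have
  this form.\<close>

lemma fibre_section:
  assumes N: "openin (prod_topology k Y Y) N"
    and UV: "openin (topo Y) U" "openin (topo Y) V"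
    and g: "g \<in> carrier (free_Abelian_group (carrier (sect Y U) \<times> carrier (sect Y V)))"
    and h: "h \<in> carrier (free_Abelian_group (carrier (sect Y U) \<times> carrier (sect Y V)))"
    and d: "\<And>x y Q. (x, y, Q) \<in> N \<Longrightarrow> x \<in> U \<and> y \<in> V \<and> germ_tensor k Y Y U V h x y \<notin> Q"
    and \<sigma>: "\<And>x y Q. (x, y, Q) \<in> N \<Longrightarrow> \<sigma> (x, y, Q) = frac (TT x y) Q (germ_tensor k Y Y U V g x y) (germ_tensor k Y Y U V h x y)"
  shows "(\<lambda>p\<in>N. \<sigma> p) \<in> carrier (sect (fibre_prod k Y Y) N)"
proof -
  let ?\<sigma> = "\<lambda>(x, y, Q). frac (TT x y) Q (germ_tensor k Y Y U V g x y) (germ_tensor k Y Y U V h x y)"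
  have e: "(\<lambda>p\<in>N. \<sigma> p) = (\<lambda>p\<in>N. ?\<sigma> p)"
    by (rule restrict_ext) (use \<sigma> in auto)
  show ?thesis
    unfolding e fibre_prod_def
  proof (rule locally_in_space_section[OF N])
    fix p assume p: "p \<in> N"
    obtain x y Q where xy: "p = (x, y, Q)" by (cases p)
    have "p \<in> prod_points k Y Y" using p openin_subset[OF N] points_prod by auto
    then have pt: "x \<in> points Y" "y \<in> points Y" unfolding xy prod_points_def by auto
    interpret tensor_data k "stalk Y x" "scalar_stalk k Y x" "stalk Y y" "scalar_stalk k Y y" using td[OF pt] .
    have "germ_tensor k Y Y U V g x y \<in> carrier T" "germ_tensor k Y Y U V h x y \<in> carrier T"
      unfolding germ_tensor_def using cls_simps(1)[OF G_closed[OF UV _ _ g] G_closed[OF UV _ _ g]]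
        cls_simps(1)[OF G_closed[OF UV _ _ h] G_closed[OF UV _ _ h]] d p xy by auto
    then show "?\<sigma> p \<in> carrier ((\<lambda>(x, y, Q). localization (stalk_tensor k Y Y x y) Q) p)"
      using d[of x y Q] p unfolding xy localization_def prod.case partial_object.simps by blast
  next
    show "?\<sigma> \<in> {\<lambda>(x, y, Q). frac (stalk_tensor k Y Y x y) Q
              (germ_tensor k Y Y U V g x y) (germ_tensor k Y Y U V h x y) |U V g h.
             openin (topo Y) U \<and> openin (topo Y) V \<and>
             g \<in> carrier (free_Abelian_group (carrier (sect Y U) \<times> carrier (sect Y V))) \<and>
             h \<in> carrier (free_Abelian_group (carrier (sect Y U) \<times> carrier (sect Y V))) \<and>
             (\<forall>(x, y, Q)\<in>N. x \<in> U \<and> y \<in> V \<and> germ_tensor k Y Y U V h x y \<notin> Q)}"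
      using UV g h d by blast
  qed
qed

lemma fibre_ops:
  "s \<otimes>\<^bsub>sect (fibre_prod k Y Y) N\<^esub> t = (\<lambda>p\<in>N. s p \<otimes>\<^bsub>(\<lambda>(x, y, Q). localization (TT x y) Q) p\<^esub> t p)"
  "s \<oplus>\<^bsub>sect (fibre_prod k Y Y) N\<^esub> t = (\<lambda>p\<in>N. s p \<oplus>\<^bsub>(\<lambda>(x, y, Q). localization (TT x y) Q) p\<^esub> t p)"
  "\<one>\<^bsub>sect (fibre_prod k Y Y) N\<^esub> = (\<lambda>p\<in>N. \<one>\<^bsub>(\<lambda>(x, y, Q). localization (TT x y) Q) p\<^esub>)"
  "restr (fibre_prod k Y Y) N N' s = restrict s N'"
  unfolding fibre_prod_def locally_in_space_def by auto

text \<open>The function \<open>s \<otimes> 1 - 1 \<otimes> s\<close> pulls back to \<open>0\<close> along the diagonal, hence is nowhere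
  invertible on it.\<close>

lemma diagonal_point:
  assumes \<delta>: "ps_mor Y (fibre_prod k Y Y) \<delta>"
    and 1: "mor_eq Y Y (comp_mor (fibre_prod k Y Y) (prod_fst k Y Y) \<delta>) id_mor"
    and 2: "mor_eq Y Y (comp_mor (fibre_prod k Y Y) (prod_snd k Y Y) \<delta>) id_mor"
    and y: "y \<in> points Y"
  obtains Q where "base \<delta> y = (y, y, Q)" "(y, y, Q) \<in> prod_points k Y Y"
    "\<And>a. a \<in> carrier (stalk Y y) \<Longrightarrow> cl y y (frag_of (a, \<one>\<^bsub>stalk Y y\<^esub>) - frag_of (\<one>\<^bsub>stalk Y y\<^esub>, a)) \<in> Q"
proof -
  let ?F = "fibre_prod k Y Y"
  have bas: "fst (base \<delta> y) = y" "fst (snd (base \<delta> y)) = y" if "y \<in> points Y" for y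
    using 1 2 that unfolding mor_eq_def comp_mor_def prod_fst_def prod_snd_def by (auto simp: case_prod_unfold)
  have inp: "base \<delta> y \<in> prod_points k Y Y" if "y \<in> points Y" for y
    using ps_mor_base[OF \<delta> that] unfolding topo_fibre points_prod .
  have rep: "base \<delta> y = (y, y, snd (snd (base \<delta> y)))" if "y \<in> points Y" for y
    using bas[OF that] by (metis prod.collapse)
  define Q where "Q = snd (snd (base \<delta> y))"
  have \<delta>y: "base \<delta> y = (y, y, Q)" unfolding Q_def using rep[OF y] .
  have Qp: "(y, y, Q) \<in> prod_points k Y Y" using inp[OF y] \<delta>y by simp
  have "cl y y (frag_of (a, \<one>\<^bsub>stalk Y y\<^esub>) - frag_of (\<one>\<^bsub>stalk Y y\<^esub>, a)) \<in> Q" if a: "a \<in> carrier (stalk Y y)" for a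
  proof (rule ccontr)
    assume notin: "cl y y (frag_of (a, \<one>\<^bsub>stalk Y y\<^esub>) - frag_of (\<one>\<^bsub>stalk Y y\<^esub>, a)) \<notin> Q"
    obtain V s where V: "openin (topo Y) V" "y \<in> V" and s: "s \<in> carrier (sect Y V)" and ags: "a = germ Y y V s"
      using a by (rule in_stalkE)
    interpret V: cring "sect Y V" using presheaf_cring[OF pY V(1)] .
    let ?o = "\<one>\<^bsub>sect Y V\<^esub>"
    \<comment> \<open>A lift of the diagonal element to sections. By \<open>notin\<close> it is
      outside the prime at \<open>base \<delta> y\<close>, so the open set \<open>M\<close> below
      contains that point.\<close>
    define h where "h = frag_of (s, ?o) - frag_of (?o, s)"
    have h: "h \<in> carrier (free_Abelian_group (carrier (sect Y V) \<times> carrier (sect Y V)))"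
      unfolding h_def using s by (auto simp: keys_frag_of dest!: subsetD[OF keys_diff])
    have so: "frag_of (s, ?o) \<in> carrier (free_Abelian_group (carrier (sect Y V) \<times> carrier (sect Y V)))"
      "frag_of (?o, s) \<in> carrier (free_Abelian_group (carrier (sect Y V) \<times> carrier (sect Y V)))"
      "frag_of (?o, ?o) \<in> carrier (free_Abelian_group (carrier (sect Y V) \<times> carrier (sect Y V)))"
      using s by (auto simp: keys_frag_of)
    define D where "D = {(x, y, Q) \<in> prod_points k Y Y. x \<in> V \<and> y \<in> V}"
    define M where "M = {(x, y, Q) \<in> prod_points k Y Y. x \<in> V \<and> y \<in> V \<and> germ_tensor k Y Y V V h x y \<notin> Q}"
    have D: "openin (topo ?F) D" unfolding topo_fibre D_def using prod_rect_open[OF V(1) V(1)] .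
    have M: "openin (topo ?F) M" "M \<subseteq> D" unfolding topo_fibre M_def D_def using prod_basic_open[OF V(1) V(1) h] by auto
    \<comment> \<open>The two projections pull \<open>s\<close> back to functions on the strips
      \<open>D1\<close> and \<open>D2\<close>, which have to be restricted to the square
      \<open>D\<close> before they can be compared.\<close>
    define D1 where "D1 = {(x, y, Q) \<in> prod_points k Y Y. x \<in> V}"
    define D2 where "D2 = {(x, y, Q) \<in> prod_points k Y Y. y \<in> V}"
    have "D1 = {(x, y, Q) \<in> prod_points k Y Y. x \<in> V \<and> y \<in> points Y}" "D2 = {(x, y, Q) \<in> prod_points k Y Y. x \<in> points Y \<and> y \<in> V}"
      unfolding D1_def D2_def prod_points_def by auto
    then have D12: "openin (topo ?F) D1" "openin (topo ?F) D2" "D \<subseteq> D1" "D \<subseteq> D2"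
      unfolding topo_fibre using prod_rect_open[OF V(1) openin_topspace] prod_rect_open[OF openin_topspace V(1)]
      by (simp, simp) (auto simp: D_def D1_def D2_def)
    have gt: "germ_tensor k Y Y V V (frag_of (s, ?o)) x z = cl x z (frag_of (germ Y x V s, \<one>\<^bsub>stalk Y z\<^esub>))"
      "germ_tensor k Y Y V V (frag_of (?o, s)) x z = cl x z (frag_of (\<one>\<^bsub>stalk Y x\<^esub>, germ Y z V s))"
      if "x \<in> V" "z \<in> V" for x z
      unfolding germ_tensor_def using germ_one[OF V(1)] that by auto
    define p1 where "p1 = (\<lambda>(x, y, Q)\<in>D1. frac (TT x y) Q (cl x y (frag_of (germ Y x V s, \<one>\<^bsub>stalk Y y\<^esub>))) \<one>\<^bsub>TT x y\<^esub>)"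
    define p2 where "p2 = (\<lambda>(x, y, Q)\<in>D2. frac (TT x y) Q (cl x y (frag_of (\<one>\<^bsub>stalk Y x\<^esub>, germ Y y V s))) \<one>\<^bsub>TT x y\<^esub>)"
    have pf: "pull (prod_fst k Y Y) V s = p1" "pull (prod_snd k Y Y) V s = p2"
      unfolding prod_fst_def prod_snd_def p1_def p2_def D1_def D2_def by simp_all
    have pre1: "preimg ?F (prod_fst k Y Y) V = D1" "preimg ?F (prod_snd k Y Y) V = D2"
      unfolding preimg_def prod_fst_def prod_snd_def D1_def D2_def topo_fibre points_prod by auto
    have d1: "pull \<delta> D1 p1 = s" and d2: "pull \<delta> D2 p2 = s"
      using 1 2 V s unfolding mor_eq_def comp_mor_simps id_mor_simps pf pre1
      by (metis pf(1) pre1(1), metis pf(2) pre1(2))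
    \<comment> \<open>A point in the image of \<delta> has equal coordinates, so the square and both
      strips have the same preimage.\<close>
    have preD: "preimg Y \<delta> D = V" "preimg Y \<delta> D1 = V" "preimg Y \<delta> D2 = V"
    proof -
      have "base \<delta> z \<in> D \<longleftrightarrow> z \<in> V" "base \<delta> z \<in> D1 \<longleftrightarrow> z \<in> V" "base \<delta> z \<in> D2 \<longleftrightarrow> z \<in> V" if z: "z \<in> points Y" for z
        using inp[OF z] rep[OF z] unfolding D_def D1_def D2_def by (metis (mono_tags, lifting) case_prod_conv mem_Collect_eq)+
      then show "preimg Y \<delta> D = V" "preimg Y \<delta> D1 = V" "preimg Y \<delta> D2 = V"
        unfolding preimg_def using openin_subset[OF V(1)] by blast+
    qed
    note pr1 = one_pair[OF V(1) openin_topspace] and pr2 = one_pair[OF openin_topspace V(1)]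
    interpret O: cring "sect Y (points Y)" using presheaf_cring[OF pY openin_topspace] .
    let ?op = "\<one>\<^bsub>sect Y (points Y)\<^esub>"
    have p1c: "p1 \<in> carrier (sect ?F D1)"
      unfolding p1_def
    proof (rule fibre_section[of D1 V "points Y" "frag_of (s, ?op)" "frag_of (?o, ?op)"])
      show "openin (prod_topology k Y Y) D1" using D12(1) unfolding topo_fibre .
      fix x y Q assume "(x, y, Q) \<in> D1"
      then have q: "x \<in> V" "y \<in> points Y" "(x, y, Q) \<in> prod_points k Y Y" unfolding D1_def prod_points_def by auto
      show "x \<in> V \<and> y \<in> points Y \<and> germ_tensor k Y Y V (points Y) (frag_of (?o, ?op)) x y \<notin> Q"
        using q germ_tensor_one[OF V(1) openin_topspace q(1,2)] prime_not_one by auto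
      show "(case (x, y, Q) of (x, y, Q) \<Rightarrow> frac (TT x y) Q (cl x y (frag_of (germ Y x V s, \<one>\<^bsub>stalk Y y\<^esub>))) \<one>\<^bsub>TT x y\<^esub>) =
        frac (TT x y) Q (germ_tensor k Y Y V (points Y) (frag_of (s, ?op)) x y)
          (germ_tensor k Y Y V (points Y) (frag_of (?o, ?op)) x y)"
        using germ_tensor_one[OF V(1) openin_topspace q(1,2)] germ_one[OF openin_topspace q(2)] by (simp add: germ_tensor_def)
    qed (use V s pr1 in \<open>auto simp: keys_frag_of\<close>)
    have p2c: "p2 \<in> carrier (sect ?F D2)"
      unfolding p2_def
    proof (rule fibre_section[of D2 "points Y" V "frag_of (?op, s)" "frag_of (?op, ?o)"])
      show "openin (prod_topology k Y Y) D2" using D12(2) unfolding topo_fibre .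
      fix x y Q assume "(x, y, Q) \<in> D2"
      then have q: "x \<in> points Y" "y \<in> V" "(x, y, Q) \<in> prod_points k Y Y" unfolding D2_def prod_points_def by auto
      show "x \<in> points Y \<and> y \<in> V \<and> germ_tensor k Y Y (points Y) V (frag_of (?op, ?o)) x y \<notin> Q"
        using q germ_tensor_one[OF openin_topspace V(1) q(1,2)] prime_not_one by auto
      show "(case (x, y, Q) of (x, y, Q) \<Rightarrow> frac (TT x y) Q (cl x y (frag_of (\<one>\<^bsub>stalk Y x\<^esub>, germ Y y V s))) \<one>\<^bsub>TT x y\<^esub>) =
        frac (TT x y) Q (germ_tensor k Y Y (points Y) V (frag_of (?op, s)) x y)
          (germ_tensor k Y Y (points Y) V (frag_of (?op, ?o)) x y)"
        using germ_tensor_one[OF openin_topspace V(1) q(1,2)] germ_one[OF openin_topspace q(1)] by (simp add: germ_tensor_def)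
    qed (use V s pr2 in \<open>auto simp: keys_frag_of\<close>)
    define S where "S = (\<lambda>(x, y, Q)\<in>D. frac (TT x y) Q (germ_tensor k Y Y V V h x y) \<one>\<^bsub>TT x y\<^esub>)"
    have DV: "x \<in> V" "z \<in> V" "(x, z, Q) \<in> prod_points k Y Y" if "(x, z, Q) \<in> D" for x z Q
      using that unfolding D_def by auto
    have Sc: "S \<in> carrier (sect ?F D)"
      unfolding S_def
    proof (rule fibre_section[of D V V h "frag_of (?o, ?o)"])
      show "openin (prod_topology k Y Y) D" using D unfolding topo_fibre .
      fix x y Q assume "(x, y, Q) \<in> D"
      note q = DV[OF this]
      show "x \<in> V \<and> y \<in> V \<and> germ_tensor k Y Y V V (frag_of (?o, ?o)) x y \<notin> Q"
        using q germ_tensor_one[OF V(1) V(1) q(1,2)] prime_not_one by auto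
      show "(case (x, y, Q) of (x, y, Q) \<Rightarrow> frac (TT x y) Q (germ_tensor k Y Y V V h x y) \<one>\<^bsub>TT x y\<^esub>) =
        frac (TT x y) Q (germ_tensor k Y Y V V h x y) (germ_tensor k Y Y V V (frag_of (?o, ?o)) x y)"
        using germ_tensor_one[OF V(1) V(1) q(1,2)] by simp
    qed (use V h so in auto)
    have prm: "prime_localization Q (TT x z)" if "(x, z, Q) \<in> D" for x z Q
      using DV(3)[OF that] unfolding prod_points_def prime_localization_def by auto
    have gtc: "germ_tensor k Y Y V V g x z \<in> carrier (TT x z)"
      if "g \<in> carrier (free_Abelian_group (carrier (sect Y V) \<times> carrier (sect Y V)))" "x \<in> V" "z \<in> V" for g x z
    proof -
      have p: "x \<in> points Y" "z \<in> points Y" using that V openin_subset by blast+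
      interpret tensor_data k "stalk Y x" "scalar_stalk k Y x" "stalk Y z" "scalar_stalk k Y z" using td[OF p] .
      note c = G_closed[OF V(1) V(1) that(2,3,1)]
      show ?thesis unfolding germ_tensor_def using cls_simps(1)[OF c c] .
    qed
    \<comment> \<open>The relation is a sum instead of a difference: \<open>frac_add_one\<close>
      proves it pointwise, additivity of \<open>pull \<delta>\<close> transports it, and
      cancellation takes place in the section ring of \<open>Y\<close>.\<close>
    have sum: "S \<oplus>\<^bsub>sect ?F D\<^esub> restr ?F D2 D p2 = restr ?F D1 D p1"
      unfolding fibre_ops
    proof (rule ext)
      fix p show "(\<lambda>p\<in>D. S p \<oplus>\<^bsub>(\<lambda>(x, y, Q). localization (TT x y) Q) p\<^esub> restrict p2 D p) p = restrict p1 D p"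
      proof (cases "p \<in> D")
        case True
        obtain x z Q where p: "p = (x, z, Q)" by (cases p)
        note q = DV[OF True[unfolded p]]
        have pp: "x \<in> points Y" "z \<in> points Y" using q V openin_subset by blast+
        interpret tensor_data k "stalk Y x" "scalar_stalk k Y x" "stalk Y z" "scalar_stalk k Y z" using td[OF pp] .
        interpret prime_localization Q "TT x z" using prm True p by simp
        note gc = G_closed[OF V(1) V(1) q(1,2) h] G_closed[OF V(1) V(1) q(1,2) so(2)]
        have "G V V x z h + G V V x z (frag_of (?o, s)) = G V V x z (frag_of (s, ?o))"
          unfolding frag_extend_add[symmetric] h_def by simp
        then have "germ_tensor k Y Y V V h x z \<oplus>\<^bsub>TT x z\<^esub> germ_tensor k Y Y V V (frag_of (?o, s)) x z =
            germ_tensor k Y Y V V (frag_of (s, ?o)) x z"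
          unfolding germ_tensor_def cls_simps(2)[OF gc] by simp
        then have "frac (TT x z) Q (germ_tensor k Y Y V V h x z) \<one>\<^bsub>TT x z\<^esub> \<oplus>\<^bsub>localization (TT x z) Q\<^esub>
            frac (TT x z) Q (germ_tensor k Y Y V V (frag_of (?o, s)) x z) \<one>\<^bsub>TT x z\<^esub> =
            frac (TT x z) Q (germ_tensor k Y Y V V (frag_of (s, ?o)) x z) \<one>\<^bsub>TT x z\<^esub>"
          using frac_add_one[OF gtc[OF h q(1,2)] gtc[OF so(2) q(1,2)]] by simp
        then show ?thesis
          using True D12(3,4) unfolding p S_def p1_def p2_def gt[OF q(1,2)] by (auto simp: subset_iff)
      qed simp
    qed
    have rc: "restr ?F D2 D p2 \<in> carrier (sect ?F D)"
    proof -
      have "restr ?F D2 D p2 = (\<lambda>(x, y, Q)\<in>D. frac (TT x y) Q (cl x y (frag_of (\<one>\<^bsub>stalk Y x\<^esub>, germ Y y V s))) \<one>\<^bsub>TT x y\<^esub>)"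
        unfolding fibre_ops p2_def using D12(4) by (intro ext) (auto simp: restrict_def)
      also have "\<dots> \<in> carrier (sect ?F D)"
      proof (rule fibre_section[of D V V "frag_of (?o, s)" "frag_of (?o, ?o)"])
        show "openin (prod_topology k Y Y) D" using D unfolding topo_fibre .
        fix x y Q assume "(x, y, Q) \<in> D"
        note q = DV[OF this]
        show "x \<in> V \<and> y \<in> V \<and> germ_tensor k Y Y V V (frag_of (?o, ?o)) x y \<notin> Q"
          using q germ_tensor_one[OF V(1) V(1) q(1,2)] prime_not_one by auto
        show "(case (x, y, Q) of (x, y, Q) \<Rightarrow> frac (TT x y) Q (cl x y (frag_of (\<one>\<^bsub>stalk Y x\<^esub>, germ Y y V s))) \<one>\<^bsub>TT x y\<^esub>) =
          frac (TT x y) Q (germ_tensor k Y Y V V (frag_of (?o, s)) x y) (germ_tensor k Y Y V V (frag_of (?o, ?o)) x y)"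
          using germ_tensor_one[OF V(1) V(1) q(1,2)] gt[OF q(1,2)] by simp
      qed (use V so in auto)
      finally show ?thesis .
    qed
    have dr: "pull \<delta> D (restr ?F D1 D p1) = s" "pull \<delta> D (restr ?F D2 D p2) = s"
      using ps_morD(3)[OF \<delta> D12(1) D D12(3) p1c] ps_morD(3)[OF \<delta> D12(2) D D12(4) p2c] d1 d2
        restr_self[OF pY V(1) s] unfolding preD by auto
    note hD = ps_morD(2)[OF \<delta> D, unfolded preD]
    have dS: "pull \<delta> D S \<in> carrier (sect Y V)" using ring_hom_closed[OF hD Sc] .
    have "pull \<delta> D S \<oplus>\<^bsub>sect Y V\<^esub> s = s"
      using ring_hom_add[OF hD Sc rc] dr sum by simp
    then have S0: "pull \<delta> D S = \<zero>\<^bsub>sect Y V\<^esub>"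
      using dS s V.add.r_cancel_one' by simp
    \<comment> \<open>The inverse of \<open>S\<close> on \<open>M\<close>. Pulled back to
      \<open>Y\<close> it becomes an inverse of zero near \<open>y\<close>, so the stalk at
      \<open>y\<close> would be trivial.\<close>
    define R where "R = (\<lambda>(x, y, Q)\<in>M. frac (TT x y) Q \<one>\<^bsub>TT x y\<^esub> (germ_tensor k Y Y V V h x y))"
    have MV: "x \<in> V" "z \<in> V" "(x, z, Q) \<in> D" "germ_tensor k Y Y V V h x z \<notin> Q" if "(x, z, Q) \<in> M" for x z Q
      using that unfolding M_def D_def by auto
    have Rc: "R \<in> carrier (sect ?F M)"
      unfolding R_def
    proof (rule fibre_section[of M V V "frag_of (?o, ?o)" h])
      show "openin (prod_topology k Y Y) M" using M unfolding topo_fibre by simp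
      fix x y Q assume "(x, y, Q) \<in> M"
      note q = MV[OF this]
      show "x \<in> V \<and> y \<in> V \<and> germ_tensor k Y Y V V h x y \<notin> Q" using q by auto
      show "(case (x, y, Q) of (x, y, Q) \<Rightarrow> frac (TT x y) Q \<one>\<^bsub>TT x y\<^esub> (germ_tensor k Y Y V V h x y)) =
        frac (TT x y) Q (germ_tensor k Y Y V V (frag_of (?o, ?o)) x y) (germ_tensor k Y Y V V h x y)"
        using germ_tensor_one[OF V(1) V(1) q(1,2)] by simp
    qed (use V h so in auto)
    have SMc: "restr ?F D M S \<in> carrier (sect ?F M)"
    proof -
      have "restr ?F D M S = (\<lambda>(x, y, Q)\<in>M. frac (TT x y) Q (germ_tensor k Y Y V V h x y) \<one>\<^bsub>TT x y\<^esub>)"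
        unfolding fibre_ops S_def using M(2) by (intro ext) (auto simp: restrict_def)
      also have "\<dots> \<in> carrier (sect ?F M)"
      proof (rule fibre_section[of M V V h "frag_of (?o, ?o)"])
        show "openin (prod_topology k Y Y) M" using M unfolding topo_fibre by simp
        fix x y Q assume m: "(x, y, Q) \<in> M"
        note q = MV[OF m]
        show "x \<in> V \<and> y \<in> V \<and> germ_tensor k Y Y V V (frag_of (?o, ?o)) x y \<notin> Q"
          using q germ_tensor_one[OF V(1) V(1) q(1,2)] prime_not_one DV(3)[OF q(3)] by auto
        show "(case (x, y, Q) of (x, y, Q) \<Rightarrow> frac (TT x y) Q (germ_tensor k Y Y V V h x y) \<one>\<^bsub>TT x y\<^esub>) =
          frac (TT x y) Q (germ_tensor k Y Y V V h x y) (germ_tensor k Y Y V V (frag_of (?o, ?o)) x y)"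
          using germ_tensor_one[OF V(1) V(1) q(1,2)] by simp
      qed (use V h so in auto)
      finally show ?thesis .
    qed
    have prod1: "restr ?F D M S \<otimes>\<^bsub>sect ?F M\<^esub> R = \<one>\<^bsub>sect ?F M\<^esub>"
      unfolding fibre_ops
    proof (rule restrict_ext)
      fix p assume pM: "p \<in> M"
      obtain x z Q where p: "p = (x, z, Q)" by (cases p)
      note q = MV[OF pM[unfolded p]]
      interpret prime_localization Q "TT x z" using prm[OF q(3)] .
      have "frac (TT x z) Q (germ_tensor k Y Y V V h x z) \<one>\<^bsub>TT x z\<^esub> \<otimes>\<^bsub>localization (TT x z) Q\<^esub>
        frac (TT x z) Q \<one>\<^bsub>TT x z\<^esub> (germ_tensor k Y Y V V h x z) = \<one>\<^bsub>localization (TT x z) Q\<^esub>"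
        using frac_inverse[of "germ_tensor k Y Y V V h x z"] gtc[OF h q(1,2)] q(4) by simp
      then show "restrict S M p \<otimes>\<^bsub>(\<lambda>(x, y, Q). localization (TT x y) Q) p\<^esub> R p = \<one>\<^bsub>(\<lambda>(x, y, Q). localization (TT x y) Q) p\<^esub>"
        using pM q(3) unfolding p S_def R_def by simp
    qed
    let ?M = "preimg Y \<delta> M"
    have oM: "openin (topo Y) ?M" using ps_mor_preimg[OF \<delta> M(1)] .
    have yM: "y \<in> ?M"
    proof -
      have pp: "y \<in> points Y" using y .
      have "germ_tensor k Y Y V V h y y = cl y y (frag_of (a, \<one>\<^bsub>stalk Y y\<^esub>) - frag_of (\<one>\<^bsub>stalk Y y\<^esub>, a))"
        unfolding germ_tensor_def h_def frag_extend_diff using germ_one[OF V] ags by simp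
      then show ?thesis unfolding in_preimg \<delta>y M_def using notin Qp V y by simp
    qed
    interpret M: cring "sect Y ?M" using presheaf_cring[OF pY oM] .
    note hM = ps_morD(2)[OF \<delta> M(1)]
    have MV': "?M \<subseteq> V" using preimg_mono[OF M(2), of Y \<delta>] preD by simp
    have "pull \<delta> M (restr ?F D M S) = restr Y V ?M \<zero>\<^bsub>sect Y V\<^esub>"
      using ps_morD(3)[OF \<delta> D M(1,2) Sc] S0 preD by simp
    also have "\<dots> = \<zero>\<^bsub>sect Y ?M\<^esub>"
      using ring_hom_zero[OF restr_hom[OF pY V(1) oM MV'] V.ring_axioms M.ring_axioms] .
    finally have z: "pull \<delta> M (restr ?F D M S) = \<zero>\<^bsub>sect Y ?M\<^esub>" .
    have "\<zero>\<^bsub>sect Y ?M\<^esub> \<otimes>\<^bsub>sect Y ?M\<^esub> pull \<delta> M R = \<one>\<^bsub>sect Y ?M\<^esub>"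
      using ring_hom_mult[OF hM SMc Rc] ring_hom_one[OF hM] prod1 z by simp
    then have "\<one>\<^bsub>sect Y ?M\<^esub> = \<zero>\<^bsub>sect Y ?M\<^esub>"
      using ring_hom_closed[OF hM Rc] by simp
    then have "\<one>\<^bsub>stalk Y y\<^esub> = \<zero>\<^bsub>stalk Y y\<^esub>"
      using germ_one[OF oM yM] germ_zero[OF pY oM yM] by simp
    then show False using local_ring_one_not_zero[OF local_presheafD(2)[OF irr_spaceD(1)[OF Y] y]] by simp
  qed
  then show thesis using that \<delta>y Qp by blast
qed

end

section \<open>Two morphisms that agree on a dense set\<close>

context fibre_square
begin

text \<open>The pair of \<open>f\<close> and \<open>f'\<close> is lifted to a map \<open>E\<close>
  into the fibre product. Continuity of \<open>E\<close> suffices: its values on the dense set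
  \<open>W\<close> lie on the closed diagonal, hence all values do, and points of the diagonal have
  equal coordinates.\<close>

lemma separated_base_eq:
  fixes Z :: "('p, 'r, 'm) ringed_space_scheme" and f f' :: "('p, 'r, 'q, 's) rs_mor"
  assumes sep: "separated k Y" and Z: "local_presheaf Z" and f: "lrs_mor Z Y f" and f': "lrs_mor Z Y f'"
    and sc: "\<And>c. c \<in> carrier k \<Longrightarrow>
      pull f (points Y) (scalar k Y (points Y) c) = pull f' (points Y) (scalar k Y (points Y) c)"
    and W: "\<And>A. openin (topo Z) A \<Longrightarrow> A \<noteq> {} \<Longrightarrow> A \<inter> W \<noteq> {}"
    and eqW: "\<And>w. w \<in> W \<Longrightarrow> w \<in> points Z \<Longrightarrow> base f w = base f' w"
    and eqG: "\<And>w V s. w \<in> W \<Longrightarrow> w \<in> points Z \<Longrightarrow> openin (topo Y) V \<Longrightarrow> base f w \<in> V \<Longrightarrow> s \<in> carrier (sect Y V) \<Longrightarrow>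
      germ Z w (preimg Z f V) (pull f V s) = germ Z w (preimg Z f' V) (pull f' V s)"
    and z: "z \<in> points Z"
  shows "base f z = base f' z"
proof -
  note pZ = local_presheafD(1)[OF Z] and lZ = local_presheafD(2)[OF Z]
  note psf = lrs_mor_ps_mor[OF f] and psf' = lrs_mor_ps_mor[OF f']
  define u where "u z = stalk_map Z f z" for z
  define v where "v z = stalk_map Z f' z" for z
  have fz: "base f z \<in> points Y" "base f' z \<in> points Y" if "z \<in> points Z" for z
    using ps_mor_base[OF psf that] ps_mor_base[OF psf' that] .
  have u: "u z \<in> ring_hom (stalk Y (base f z)) (stalk Z z)" and v: "v z \<in> ring_hom (stalk Y (base f' z)) (stalk Z z)"
    if "z \<in> points Z" for z
    unfolding u_def v_def using stalk_map_hom[OF pZ pY psf that] stalk_map_hom[OF pZ pY psf' that] .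
  have ug: "u z (germ Y (base f z) V s) = germ Z z (preimg Z f V) (pull f V s)"
    if "z \<in> points Z" "openin (topo Y) V" "base f z \<in> V" "s \<in> carrier (sect Y V)" for z V s
    unfolding u_def using stalk_map_germ[OF pZ pY psf that] .
  have vg: "v z (germ Y (base f' z) V s) = germ Z z (preimg Z f' V) (pull f' V s)"
    if "z \<in> points Z" "openin (topo Y) V" "base f' z \<in> V" "s \<in> carrier (sect Y V)" for z V s
    unfolding v_def using stalk_map_germ[OF pZ pY psf' that] .
  \<comment> \<open>The universal property joins the two stalk maps at \<open>z\<close>; they agree
    on scalars by \<open>sc\<close>. The third coordinate of \<open>E z\<close> is the inverse image
    of the maximal ideal under this \<tau>.\<close>
  have ex: "\<exists>\<tau>. \<tau> \<in> ring_hom (TT (base f z) (base f' z)) (stalk Z z) \<and>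
      (\<forall>a\<in>carrier (stalk Y (base f z)). \<forall>b\<in>carrier (stalk Y (base f' z)).
        \<tau> (cl (base f z) (base f' z) (frag_of (a, b))) = u z a \<otimes>\<^bsub>stalk Z z\<^esub> v z b)" if z: "z \<in> points Z" for z
  proof -
    interpret tensor_data k "stalk Y (base f z)" "scalar_stalk k Y (base f z)" "stalk Y (base f' z)" "scalar_stalk k Y (base f' z)"
      using td[OF fz[OF z]] .
    have uv: "u z (scalar_stalk k Y (base f z) c) = v z (scalar_stalk k Y (base f' z) c)" if c: "c \<in> carrier k" for c
    proof -
      have "preimg Z f (points Y) = points Z" "preimg Z f' (points Y) = points Z"
        using fz unfolding preimg_def by auto
      then show ?thesis
        unfolding scalar_stalk_def using ug[OF z openin_topspace fz(1)[OF z] scalar_facts(2)[OF Y c]]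
          vg[OF z openin_topspace fz(2)[OF z] scalar_facts(2)[OF Y c]] sc[OF c] by simp
    qed
    show ?thesis
      by (rule tensor_universal[OF stalk_cring[OF pZ z] u[OF z] v[OF z] uv]) blast+
  qed
  have "\<forall>z\<in>points Z. \<exists>\<tau>. \<tau> \<in> ring_hom (TT (base f z) (base f' z)) (stalk Z z) \<and>
      (\<forall>a\<in>carrier (stalk Y (base f z)). \<forall>b\<in>carrier (stalk Y (base f' z)).
        \<tau> (cl (base f z) (base f' z) (frag_of (a, b))) = u z a \<otimes>\<^bsub>stalk Z z\<^esub> v z b)" using ex by (rule ballI)
  then obtain \<tau> where "\<forall>z\<in>points Z. \<tau> z \<in> ring_hom (TT (base f z) (base f' z)) (stalk Z z) \<and>
      (\<forall>a\<in>carrier (stalk Y (base f z)). \<forall>b\<in>carrier (stalk Y (base f' z)).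
        \<tau> z (cl (base f z) (base f' z) (frag_of (a, b))) = u z a \<otimes>\<^bsub>stalk Z z\<^esub> v z b)" by (rule bchoice[elim_format]) blast
  then have \<tau>: "\<And>z. z \<in> points Z \<Longrightarrow> \<tau> z \<in> ring_hom (TT (base f z) (base f' z)) (stalk Z z)"
    and \<tau>g: "\<And>z a b. z \<in> points Z \<Longrightarrow> a \<in> carrier (stalk Y (base f z)) \<Longrightarrow> b \<in> carrier (stalk Y (base f' z)) \<Longrightarrow>
        \<tau> z (cl (base f z) (base f' z) (frag_of (a, b))) = u z a \<otimes>\<^bsub>stalk Z z\<^esub> v z b"
    by blast+
  define Q where "Q z = {C \<in> carrier (TT (base f z) (base f' z)). \<tau> z C \<in> max_ideal (stalk Z z)}" for z
  define E where "E z = (base f z, base f' z, Q z)" for z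
  have Qp: "primeideal (Q z) (TT (base f z) (base f' z))" if z: "z \<in> points Z" for z
  proof -
    interpret tensor_data k "stalk Y (base f z)" "scalar_stalk k Y (base f z)" "stalk Y (base f' z)" "scalar_stalk k Y (base f' z)"
      using td[OF fz[OF z]] .
    interpret S: cring "stalk Z z" using stalk_cring[OF pZ z] .
    interpret \<tau>: ring_hom_ring T "stalk Z z" "\<tau> z"
      using ring_hom_ringI2[OF T.ring_axioms S.ring_axioms \<tau>[OF z]] .
    show ?thesis
      unfolding Q_def using \<tau>.primeideal_vimage[OF T.cring_axioms S.maximalideal_prime[OF local_ring_max_ideal[OF lZ[OF z]]]] .
  qed
  \<comment> \<open>Locality of \<open>f\<close> is used here: it makes the prime lie over the
    maximal ideal of the first stalk, as \<open>prod_points\<close> demands.\<close>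
  have Qa: "cl (base f z) (base f' z) (frag_of (a, \<one>\<^bsub>stalk Y (base f' z)\<^esub>)) \<in> Q z \<longleftrightarrow> a \<in> max_ideal (stalk Y (base f z))"
    if z: "z \<in> points Z" and a: "a \<in> carrier (stalk Y (base f z))" for z a
  proof -
    interpret tensor_data k "stalk Y (base f z)" "scalar_stalk k Y (base f z)" "stalk Y (base f' z)" "scalar_stalk k Y (base f' z)"
      using td[OF fz[OF z]] .
    interpret S: cring "stalk Z z" using stalk_cring[OF pZ z] .
    obtain V s where V: "openin (topo Y) V" "base f z \<in> V" "s \<in> carrier (sect Y V)" "a = germ Y (base f z) V s"
      using a by (rule in_stalkE)
    have "\<tau> z (cls (frag_of (a, \<one>\<^bsub>stalk Y (base f' z)\<^esub>))) = u z a"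
      using \<tau>g[OF z a B.one_closed] ring_hom_one[OF v[OF z]] ring_hom_closed[OF u[OF z] a] by simp
    moreover have "u z a \<in> max_ideal (stalk Z z) \<longleftrightarrow> a \<in> max_ideal (stalk Y (base f z))"
      using f z V ug[OF z V(1-3)] unfolding lrs_mor_def by simp
    moreover have "cls (frag_of (a, \<one>\<^bsub>stalk Y (base f' z)\<^esub>)) \<in> carrier T"
      using ring_hom_closed[OF inl_hom a] .
    ultimately show ?thesis unfolding Q_def by simp
  qed
  have Qb: "cl (base f z) (base f' z) (frag_of (\<one>\<^bsub>stalk Y (base f z)\<^esub>, b)) \<in> Q z \<longleftrightarrow> b \<in> max_ideal (stalk Y (base f' z))"
    if z: "z \<in> points Z" and b: "b \<in> carrier (stalk Y (base f' z))" for z b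
  proof -
    interpret tensor_data k "stalk Y (base f z)" "scalar_stalk k Y (base f z)" "stalk Y (base f' z)" "scalar_stalk k Y (base f' z)"
      using td[OF fz[OF z]] .
    interpret S: cring "stalk Z z" using stalk_cring[OF pZ z] .
    obtain V s where V: "openin (topo Y) V" "base f' z \<in> V" "s \<in> carrier (sect Y V)" "b = germ Y (base f' z) V s"
      using b by (rule in_stalkE)
    have "\<tau> z (cls (frag_of (\<one>\<^bsub>stalk Y (base f z)\<^esub>, b))) = v z b"
      using \<tau>g[OF z A.one_closed b] ring_hom_one[OF u[OF z]] ring_hom_closed[OF v[OF z] b] by simp
    moreover have "v z b \<in> max_ideal (stalk Z z) \<longleftrightarrow> b \<in> max_ideal (stalk Y (base f' z))"
      using f' z V vg[OF z V(1-3)] unfolding lrs_mor_def by simp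
    moreover have "cls (frag_of (\<one>\<^bsub>stalk Y (base f z)\<^esub>, b)) \<in> carrier T"
      using cls_simps(1)[OF frag_in_P[OF A.one_closed b] frag_in_P[OF A.one_closed b]] .
    ultimately show ?thesis unfolding Q_def by simp
  qed
  have Ep: "E z \<in> prod_points k Y Y" if "z \<in> points Z" for z
    unfolding E_def prod_points_def using fz[OF that] Qp[OF that] Qa[OF that] Qb[OF that] by auto
  \<comment> \<open>A tensor of sections pulls back to one section \<open>r\<close> that serves at
    all points of the intersection. The points where the tensor avoids \<open>Q z\<close> are then
    those near which \<open>r\<close> is invertible, and they form an open set.\<close>
  have \<mu>: "\<exists>r\<in>carrier (sect Z (preimg Z f U \<inter> preimg Z f' V)). \<forall>z\<in>preimg Z f U \<inter> preimg Z f' V.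
      \<tau> z (germ_tensor k Y Y U V h (base f z) (base f' z)) = germ Z z (preimg Z f U \<inter> preimg Z f' V) r"
    if UV: "openin (topo Y) U" "openin (topo Y) V" and h: "Poly_Mapping.keys h \<subseteq> carrier (sect Y U) \<times> carrier (sect Y V)" for U V h
    using h
  proof (induction rule: frag_keys_induct)
    let ?O = "preimg Z f U \<inter> preimg Z f' V"
    have O: "openin (topo Z) ?O" using ps_mor_preimg[OF psf UV(1)] ps_mor_preimg[OF psf' UV(2)] by auto
    interpret O: cring "sect Z ?O" using presheaf_cring[OF pZ O] .
    have zO: "z \<in> points Z" "base f z \<in> U" "base f' z \<in> V" if "z \<in> ?O" for z using that by (auto simp: in_preimg)
    {
      case zero
      show ?case
      proof (intro bexI[of _ "\<zero>\<^bsub>sect Z ?O\<^esub>"] ballI)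
        fix z assume z: "z \<in> ?O"
        note z' = zO[OF z]
        interpret tensor_data k "stalk Y (base f z)" "scalar_stalk k Y (base f z)" "stalk Y (base f' z)" "scalar_stalk k Y (base f' z)"
          using td[OF fz[OF z'(1)]] .
        interpret S: cring "stalk Z z" using stalk_cring[OF pZ z'(1)] .
        show "\<tau> z (germ_tensor k Y Y U V 0 (base f z) (base f' z)) = germ Z z ?O \<zero>\<^bsub>sect Z ?O\<^esub>"
          unfolding germ_tensor_def germ_zero[OF pZ O z]
          using ring_hom_zero[OF \<tau>[OF z'(1)] T.ring_axioms S.ring_axioms] cls_simps(5)[OF P.zero_closed P.zero_closed] by simp
      qed simp
    next
      case (one x)
      obtain s t where x: "x = (s, t)" and s: "s \<in> carrier (sect Y U)" and t: "t \<in> carrier (sect Y V)" using one by auto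
      let ?s = "restr Z (preimg Z f U) ?O (pull f U s)" and ?t = "restr Z (preimg Z f' V) ?O (pull f' V t)"
      have c: "?s \<in> carrier (sect Z ?O)" "?t \<in> carrier (sect Z ?O)"
        using restr_closed[OF pZ ps_mor_preimg[OF psf UV(1)] O inf_le1 ps_mor_pull[OF psf UV(1) s]]
          restr_closed[OF pZ ps_mor_preimg[OF psf' UV(2)] O inf_le2 ps_mor_pull[OF psf' UV(2) t]] .
      show ?case
      proof (intro bexI[of _ "?s \<otimes>\<^bsub>sect Z ?O\<^esub> ?t"] ballI)
        fix z assume z: "z \<in> ?O"
        note z' = zO[OF z]
        have "\<tau> z (germ_tensor k Y Y U V (frag_of x) (base f z) (base f' z)) =
          germ Z z (preimg Z f U) (pull f U s) \<otimes>\<^bsub>stalk Z z\<^esub> germ Z z (preimg Z f' V) (pull f' V t)"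
          unfolding germ_tensor_def x
          using \<tau>g[OF z'(1) germ_in_stalk[OF UV(1) z'(2) s] germ_in_stalk[OF UV(2) z'(3) t]]
            ug[OF z'(1) UV(1) z'(2) s] vg[OF z'(1) UV(2) z'(3) t] by simp
        also have "\<dots> = germ Z z ?O ?s \<otimes>\<^bsub>stalk Z z\<^esub> germ Z z ?O ?t"
          using germ_restr[OF pZ ps_mor_preimg[OF psf UV(1)] ps_mor_pull[OF psf UV(1) s] O z inf_le1]
            germ_restr[OF pZ ps_mor_preimg[OF psf' UV(2)] ps_mor_pull[OF psf' UV(2) t] O z inf_le2] by simp
        also have "\<dots> = germ Z z ?O (?s \<otimes>\<^bsub>sect Z ?O\<^esub> ?t)"
          using ring_hom_mult[OF germ_hom[OF pZ O z] c] by simp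
        finally show "\<tau> z (germ_tensor k Y Y U V (frag_of x) (base f z) (base f' z)) = germ Z z ?O (?s \<otimes>\<^bsub>sect Z ?O\<^esub> ?t)" .
      qed (use c in simp)
    next
      case (diff g h)
      obtain r1 where r1: "r1 \<in> carrier (sect Z ?O)"
        "\<And>z. z \<in> ?O \<Longrightarrow> \<tau> z (germ_tensor k Y Y U V g (base f z) (base f' z)) = germ Z z ?O r1" using diff by blast
      obtain r2 where r2: "r2 \<in> carrier (sect Z ?O)"
        "\<And>z. z \<in> ?O \<Longrightarrow> \<tau> z (germ_tensor k Y Y U V h (base f z) (base f' z)) = germ Z z ?O r2" using diff by blast
      show ?case
      proof (intro bexI[of _ "r1 \<ominus>\<^bsub>sect Z ?O\<^esub> r2"] ballI)
        fix z assume z: "z \<in> ?O"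
        note z' = zO[OF z]
        interpret tensor_data k "stalk Y (base f z)" "scalar_stalk k Y (base f z)" "stalk Y (base f' z)" "scalar_stalk k Y (base f' z)"
          using td[OF fz[OF z'(1)]] .
        interpret S: cring "stalk Z z" using stalk_cring[OF pZ z'(1)] .
        interpret \<tau>: ring_hom_cring T "stalk Z z" "\<tau> z"
          using \<tau>[OF z'(1)] by (intro ring_hom_cring.intro T_cring S.cring_axioms ring_hom_cring_axioms.intro)
        interpret ge: ring_hom_cring "sect Z ?O" "stalk Z z" "germ Z z ?O"
          using germ_hom[OF pZ O z] by (intro ring_hom_cring.intro O.cring_axioms S.cring_axioms ring_hom_cring_axioms.intro)
        have gh: "G U V (base f z) (base f' z) g \<in> carrier P" "G U V (base f z) (base f' z) h \<in> carrier P"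
          using G_closed[OF UV z'(2,3), of g] G_closed[OF UV z'(2,3), of h] diff by auto
        have "germ_tensor k Y Y U V (g - h) (base f z) (base f' z) =
          germ_tensor k Y Y U V g (base f z) (base f' z) \<ominus>\<^bsub>T\<^esub> germ_tensor k Y Y U V h (base f z) (base f' z)"
          unfolding germ_tensor_def frag_extend_diff using cls_diff[OF gh] .
        then show "\<tau> z (germ_tensor k Y Y U V (g - h) (base f z) (base f' z)) = germ Z z ?O (r1 \<ominus>\<^bsub>sect Z ?O\<^esub> r2)"
          using cls_simps(1)[OF gh] cls_simps(1)[OF gh(2,1)] r1 r2 z
          by (simp add: T.minus_eq O.minus_eq germ_tensor_def)
      qed (use r1 r2 in simp)
    }
  qed
  have cont: "continuous_map (topo Z) (prod_topology k Y Y) E"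
    unfolding prod_topology_def
  proof (rule continuous_on_generated_topo)
    show "E ` points Z \<subseteq> \<Union> {{(x, y, Q) \<in> prod_points k Y Y. x \<in> U \<and> y \<in> V \<and> germ_tensor k Y Y U V h x y \<notin> Q} |U V h.
        openin (topo Y) U \<and> openin (topo Y) V \<and>
        h \<in> carrier (free_Abelian_group (carrier (sect Y U) \<times> carrier (sect Y V)))}"
      using Ep points_prod unfolding prod_topology_def topology_generated_by_topspace by auto
    fix B assume "B \<in> {{(x, y, Q) \<in> prod_points k Y Y. x \<in> U \<and> y \<in> V \<and> germ_tensor k Y Y U V h x y \<notin> Q} |U V h.
        openin (topo Y) U \<and> openin (topo Y) V \<and>
        h \<in> carrier (free_Abelian_group (carrier (sect Y U) \<times> carrier (sect Y V)))}"
    then obtain U V h where UV: "openin (topo Y) U" "openin (topo Y) V"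
      and h: "h \<in> carrier (free_Abelian_group (carrier (sect Y U) \<times> carrier (sect Y V)))"
      and Beq: "B = {(x, y, Q) \<in> prod_points k Y Y. x \<in> U \<and> y \<in> V \<and> germ_tensor k Y Y U V h x y \<notin> Q}" by blast
    let ?O = "preimg Z f U \<inter> preimg Z f' V"
    have O: "openin (topo Z) ?O" using ps_mor_preimg[OF psf UV(1)] ps_mor_preimg[OF psf' UV(2)] by auto
    obtain r where r: "r \<in> carrier (sect Z ?O)"
      "\<And>z. z \<in> ?O \<Longrightarrow> \<tau> z (germ_tensor k Y Y U V h (base f z) (base f' z)) = germ Z z ?O r"
      using \<mu>[OF UV h[unfolded carrier_free_Abelian_group_iff]] by blast
    have "E z \<in> B \<longleftrightarrow> inv_near Z z ?O r" if z: "z \<in> ?O" for z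
    proof -
      have z': "z \<in> points Z" "base f z \<in> U" "base f' z \<in> V" using z by (auto simp: in_preimg)
      interpret tensor_data k "stalk Y (base f z)" "scalar_stalk k Y (base f z)" "stalk Y (base f' z)" "scalar_stalk k Y (base f' z)"
        using td[OF fz[OF z'(1)]] .
      note c = G_closed[OF UV z'(2,3) h]
      have "E z \<in> B \<longleftrightarrow> germ_tensor k Y Y U V h (base f z) (base f' z) \<notin> Q z"
        using Ep[OF z'(1)] z' unfolding Beq E_def by auto
      also have "\<dots> \<longleftrightarrow> germ Z z ?O r \<notin> max_ideal (stalk Z z)"
        unfolding Q_def using cls_simps(1)[OF c c] r(2)[OF z] by (simp add: germ_tensor_def)
      also have "\<dots> \<longleftrightarrow> inv_near Z z ?O r" using germ_max_ideal_iff[OF pZ lZ[OF z'(1)] O z r(1)] by simp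
      finally show ?thesis .
    qed
    moreover have "z \<in> ?O" if "z \<in> points Z" "E z \<in> B" for z
      using that unfolding Beq E_def by (auto simp: in_preimg)
    moreover have "z \<in> points Z" if "z \<in> ?O" for z using that by (auto simp: in_preimg)
    ultimately have "E -` B \<inter> points Z = {z \<in> ?O. inv_near Z z ?O r}" unfolding vimage_def by blast
    also have "\<dots> = \<Union> {N. openin (topo Z) N \<and> N \<subseteq> ?O \<and> restr Z ?O N r \<in> Units (sect Z N)}"
      unfolding inv_near_def by blast
    also have "openin (topo Z) \<dots>" by (rule openin_Union) auto
    finally show "openin (topo Z) (E -` B \<inter> points Z)" .
  qed
  obtain \<delta> where \<delta>: "closed_immersion Y (fibre_prod k Y Y) \<delta>"
    and \<delta>1: "mor_eq Y Y (comp_mor (fibre_prod k Y Y) (prod_fst k Y Y) \<delta>) id_mor"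
    and \<delta>2: "mor_eq Y Y (comp_mor (fibre_prod k Y Y) (prod_snd k Y Y) \<delta>) id_mor"
    using sep unfolding separated_def by blast
  have ps\<delta>: "ps_mor Y (fibre_prod k Y Y) \<delta>" using \<delta> lrs_mor_ps_mor unfolding closed_immersion_def by auto
  let ?\<Delta> = "base \<delta> ` points Y"
  have cl\<Delta>: "closedin (prod_topology k Y Y) ?\<Delta>" using \<delta> unfolding closed_immersion_def topo_fibre by auto
  \<comment> \<open>Over \<open>W\<close> the two stalk maps coincide, so \<tau> kills the diagonal
    elements. The primes of \<open>E w\<close> and of the point of the diagonal lie over the same
    maximal ideal and are equal by \<open>diag_prime_eq\<close>.\<close>
  have onW: "E w \<in> ?\<Delta>" if w: "w \<in> W" "w \<in> points Z" for w
  proof -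
    let ?y = "base f w"
    have yy: "base f' w = ?y" using eqW[OF w] by simp
    obtain Q0 where Q0: "base \<delta> ?y = (?y, ?y, Q0)" "(?y, ?y, Q0) \<in> prod_points k Y Y"
      "\<And>a. a \<in> carrier (stalk Y ?y) \<Longrightarrow> cl ?y ?y (frag_of (a, \<one>\<^bsub>stalk Y ?y\<^esub>) - frag_of (\<one>\<^bsub>stalk Y ?y\<^esub>, a)) \<in> Q0"
      using diagonal_point[OF ps\<delta> \<delta>1 \<delta>2 fz(1)[OF w(2)]] by metis
    note tdw = td[OF fz(1)[OF w(2)] fz(1)[OF w(2)]]
    interpret tensor_data k "stalk Y ?y" "scalar_stalk k Y ?y" "stalk Y ?y" "scalar_stalk k Y ?y" using tdw .
    interpret S: cring "stalk Z w" using stalk_cring[OF pZ w(2)] .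
    have uv: "u w a = v w a" if a: "a \<in> carrier (stalk Y ?y)" for a
    proof -
      obtain V s where V: "openin (topo Y) V" "?y \<in> V" "s \<in> carrier (sect Y V)" "a = germ Y ?y V s"
        using a by (rule in_stalkE)
      show ?thesis using ug[OF w(2) V(1-3)] vg[OF w(2) V(1) _ V(3)] eqG[OF w V(1-3)] V yy by simp
    qed
    have "Q w = Q0"
    proof (rule diag_prime_eq[OF tdw])
      show "primeideal (Q w) T" using Qp[OF w(2)] unfolding yy .
      show "primeideal Q0 T" using Q0(2) unfolding prod_points_def by auto
      show "cls (frag_of (a, \<one>\<^bsub>stalk Y ?y\<^esub>)) \<in> Q w \<longleftrightarrow> a \<in> max_ideal (stalk Y ?y)" if "a \<in> carrier (stalk Y ?y)" for a
        using Qa[OF w(2) that] unfolding yy .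
      show "cls (frag_of (a, \<one>\<^bsub>stalk Y ?y\<^esub>)) \<in> Q0 \<longleftrightarrow> a \<in> max_ideal (stalk Y ?y)" if "a \<in> carrier (stalk Y ?y)" for a
        using Q0(2) that unfolding prod_points_def by auto
      fix a assume a: "a \<in> carrier (stalk Y ?y)"
      show "cls (frag_of (a, \<one>\<^bsub>stalk Y ?y\<^esub>) - frag_of (\<one>\<^bsub>stalk Y ?y\<^esub>, a)) \<in> Q0" using Q0(3)[OF a] .
      let ?l = "frag_of (a, \<one>\<^bsub>stalk Y ?y\<^esub>)" and ?r = "frag_of (\<one>\<^bsub>stalk Y ?y\<^esub>, a)"
      have lr: "?l \<in> carrier P" "?r \<in> carrier P" using frag_in_P[OF a A.one_closed] frag_in_P[OF A.one_closed a] .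
      note \<tau>w = \<tau>[OF w(2), unfolded yy] and \<tau>gw = \<tau>g[OF w(2), unfolded yy]
      interpret \<tau>: ring_hom_cring T "stalk Z w" "\<tau> w"
        using \<tau>w by (intro ring_hom_cring.intro T_cring S.cring_axioms ring_hom_cring_axioms.intro)
      have ua: "u w a \<in> carrier (stalk Z w)" using ring_hom_closed[OF u[OF w(2)] a] .
      have "\<tau> w (cls ?l) = u w a" "\<tau> w (cls ?r) = u w a"
        using \<tau>gw[OF a A.one_closed] \<tau>gw[OF A.one_closed a] ring_hom_one[OF u[OF w(2)]] ring_hom_one[OF v[OF w(2)]] ua uv[OF a]
          uv[OF A.one_closed] yy by simp_all
      then have "\<tau> w (cls (?l - ?r)) = \<zero>\<^bsub>stalk Z w\<^esub>"
        using cls_diff[OF lr] cls_simps(1)[OF lr] cls_simps(1)[OF lr(2,1)] ua by (simp add: T.minus_eq S.r_neg)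
      moreover have "\<zero>\<^bsub>stalk Z w\<^esub> \<in> max_ideal (stalk Z w)"
        using additive_subgroup.zero_closed[OF ideal.axioms(1)[OF maximalideal.axioms(1)[OF local_ring_max_ideal[OF lZ[OF w(2)]]]]] .
      moreover have "cls (?l - ?r) \<in> carrier T"
        using cls_diff[OF lr] cls_simps(1)[OF lr] cls_simps(1)[OF lr(2,1)] by simp
      ultimately show "cls (?l - ?r) \<in> Q w" unfolding Q_def yy by simp
    qed
    then have "E w = base \<delta> ?y" unfolding E_def Q0(1) yy by simp
    then show ?thesis using fz(1)[OF w(2)] by blast
  qed
  have "E z \<in> ?\<Delta>"
  proof (rule ccontr)
    assume n: "E z \<notin> ?\<Delta>"
    let ?A = "{z \<in> points Z. E z \<in> prod_points k Y Y - ?\<Delta>}"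
    have "openin (prod_topology k Y Y) (prod_points k Y Y - ?\<Delta>)"
      using cl\<Delta> unfolding closedin_def points_prod by auto
    then have "openin (topo Z) ?A" using openin_continuous_map_preimage[OF cont] by blast
    moreover have "z \<in> ?A" using z n Ep by auto
    ultimately have "?A \<inter> W \<noteq> {}" using W by blast
    then show False using onW by auto
  qed
  then obtain y where y: "y \<in> points Y" "E z = base \<delta> y" by auto
  then show ?thesis
    using diagonal_point[OF ps\<delta> \<delta>1 \<delta>2 y(1)] unfolding E_def by (metis prod.inject)
qed

end

text \<open>Both maps are restricted to \<open>U \<inter> U'\<close>, in which the set
  \<open>W\<close> of agreement is dense by irreducibility. Agreement of sections on
  \<open>W\<close> yields the equality of germs that \<open>separated_base_eq\<close> asks
  for.\<close>

lemma agree_separated: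
  assumes X: "irr_space k X" and Y: "irr_space k Y" and sep: "separated k Y"
    and r: "((U, f), (U', f')) \<in> rat_rel k X Y" and x: "x \<in> U" "x \<in> U'"
  shows "base f x = base f' x"
proof -
  interpret fibre_square k Y by (rule fibre_square.intro[OF Y])
  note pX = irr_spaceD(2)[OF X]
  obtain W where f: "pmor k X Y U f" and f': "pmor k X Y U' f'"
    and W: "openin (topo X) W" "W \<noteq> {}" "W \<subseteq> U \<inter> U'" "agree X Y W U f U' f'"
    using r unfolding rat_rel_iff[OF X Y] by auto
  define O' where "O' = U \<inter> U'"
  have O: "openin (topo X) O'" "O' \<subseteq> U" "O' \<subseteq> U'" "O' \<noteq> {}"
    unfolding O'_def using pmorD(1)[OF f] pmorD(1)[OF f'] x by auto
  let ?Z = "open_subspace X O'"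
  let ?f = "restr_mor (open_subspace X U) O' f" and ?f' = "restr_mor (open_subspace X U') O' f'"
  have m: "pmor k X Y O' ?f" "pmor k X Y O' ?f'"
    using pmor_restrict[OF X Y f O(1,2,4)] pmor_restrict[OF X Y f' O(1,3,4)] by auto
  note lZ = local_presheaf_sub[OF irr_spaceD(1)[OF X] O(1)]
  have l: "lrs_mor ?Z Y ?f" "lrs_mor ?Z Y ?f'"
    using lrs_mor_iff[OF lZ irr_spaceD(1)[OF Y]] pmorD(3,4)[OF m(1)] pmorD(3,4)[OF m(2)] by auto
  have bs: "base ?f = base f" "base ?f' = base f'"
    and pl: "pull ?f V s = restr X (pre X U f V) (pre X U f V \<inter> O') (pull f V s)"
      "pull ?f' V s = restr X (pre X U' f' V) (pre X U' f' V \<inter> O') (pull f' V s)" for V s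
    unfolding restr_mor_def by auto
  have pe: "pre X O' ?f V = pre X U f V \<inter> O'" "pre X O' ?f' V = pre X U' f' V \<inter> O'" for V
    using O by (auto simp: pmor_in_preimg[OF m(1)] pmor_in_preimg[OF m(2)] pmor_in_preimg[OF f] pmor_in_preimg[OF f'] bs)
  have sw: "germ (open_subspace X O') w (pre X O' ?f V) (pull ?f V s) = germ (open_subspace X O') w (pre X O' ?f' V) (pull ?f' V s)"
    if w: "w \<in> W" and V: "openin (topo Y) V" "base f w \<in> V" "s \<in> carrier (sect Y V)" for w V s
  proof -
    let ?B = "pre X U f V \<inter> W"
    note oV = pmor_preimg(1)[OF f V(1)] pmor_preimg(1)[OF f' V(1)]
    have B: "openin (topo X) ?B" "?B \<subseteq> W" "?B \<subseteq> pre X U f V" "?B \<subseteq> pre X U' f' V" "w \<in> ?B"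
    proof -
      show "openin (topo X) ?B" using oV W by auto
      have "?B = pre X U' f' V \<inter> W" by (rule pre_Int_eq[OF f f' W(3) agree_base[OF f W(3,4)]])
      then show "?B \<subseteq> pre X U' f' V" by blast
      show "w \<in> ?B" using w V W(3) by (auto simp: pmor_in_preimg[OF f])
    qed auto
    have e: "restr X (pre X U f V) ?B (pull f V s) = restr X (pre X U' f' V) ?B (pull f' V s)"
      using agree_restr[OF pX f f' W(1,3,4) V(1,3) B(1,2,3)] .
    have BO: "?B \<subseteq> pre X U f V \<inter> O'" "?B \<subseteq> pre X U' f' V \<inter> O'" using B W(3) unfolding O'_def by auto
    have oO: "openin (topo X) (pre X U f V \<inter> O')" "openin (topo X) (pre X U' f' V \<inter> O')" using oV O by auto
    have "restr X (pre X O' ?f V) ?B (pull ?f V s) = restr X (pre X O' ?f' V) ?B (pull ?f' V s)"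
      unfolding pe pl using e restr_restr[OF pX oV(1) oO(1) B(1) inf_le1 BO(1) pmor_pull[OF f V(1,3)]]
        restr_restr[OF pX oV(2) oO(2) B(1) inf_le1 BO(2) pmor_pull[OF f' V(1,3)]] by simp
    moreover have "openin (topo ?Z) ?B" using B(1,2) W(3) openin_sub[OF O(1)] unfolding O'_def by auto
    moreover have wm: "w \<in> pre X O' ?f V" "w \<in> pre X O' ?f' V"
      unfolding pe using B(5) BO by blast+
    moreover have "?B \<subseteq> pre X O' ?f V \<inter> pre X O' ?f' V" unfolding pe using BO by blast
    ultimately show ?thesis
      unfolding germ_eq_iff[OF local_presheafD(1)[OF lZ] ps_mor_preimg[OF pmorD(3)[OF m(1)] V(1)] wm(1) ps_mor_pull[OF pmorD(3)[OF m(1)] V(1,3)]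
          ps_mor_preimg[OF pmorD(3)[OF m(2)] V(1)] wm(2) ps_mor_pull[OF pmorD(3)[OF m(2)] V(1,3)]]
      using B(5) by (intro exI[of _ ?B]) simp
  qed
  have "base ?f x = base ?f' x"
  proof (rule separated_base_eq[OF sep lZ l, where W = W])
    show "pull ?f (points Y) (scalar k Y (points Y) c) = pull ?f' (points Y) (scalar k Y (points Y) c)" if "c \<in> carrier k" for c
      using pmor_scalar(1)[OF X Y m(1) that] pmor_scalar(1)[OF X Y m(2) that] by simp
    show "A \<inter> W \<noteq> {}" if "openin (topo ?Z) A" "A \<noteq> {}" for A
      using irr_space_Int[OF X _ that(2) W(1,2)] that(1) openin_sub[OF O(1)] by auto
    show "base ?f w = base ?f' w" if "w \<in> W" for w unfolding bs using agree_base[OF f W(3,4) that] .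
    show "germ ?Z w (preimg ?Z ?f V) (pull ?f V s) = germ ?Z w (preimg ?Z ?f' V) (pull ?f' V s)"
      if "w \<in> W" "openin (topo Y) V" "base ?f w \<in> V" "s \<in> carrier (sect Y V)" for w V s
      using sw that unfolding bs by auto
    show "x \<in> points ?Z" using x pmorD(6)[OF f] unfolding O'_def by auto
  qed
  then show ?thesis unfolding bs .
qed

text \<open>Representatives of one rational map are related, so they have equal values wherever both
  are defined. Applied to \<open>rat_inv\<close>, this also gives injectivity of the
  correspondence.\<close>

lemma iso_corr_unique:
  assumes X: "irr_space k X" and Y: "irr_space k Y" and sep: "separated k Y" and p: "\<phi> \<in> rational_maps k X Y"
    and c: "iso_corr k X Y \<phi> x y" "iso_corr k X Y \<phi> x y'"
  shows "y = y'"
proof -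
  obtain U f where 1: "(U, f) \<in> \<phi>" "x \<in> U" "base f x = y" using c(1) unfolding iso_corr_def by auto
  obtain U' f' where 2: "(U', f') \<in> \<phi>" "x \<in> U'" "base f' x = y'" using c(2) unfolding iso_corr_def by auto
  have "((U, f), (U', f')) \<in> rat_rel k X Y" using rational_map_mem(2)[OF X Y p 1(1)] 2(1) by auto
  then show ?thesis using agree_separated[OF X Y sep _ 1(2) 2(2)] 1 2 by simp
qed

section \<open>Noetherian affine opens\<close>

text \<open>Ideals of a subring \<open>B\<close>, kept inside \<open>R\<close>. Hilbert's basis
  theorem becomes an induction over subrings of one fixed ring, without polynomial rings and
  evaluation maps.\<close>

definition sub_ideal :: "('a, 'b) ring_scheme \<Rightarrow> 'a set \<Rightarrow> 'a set \<Rightarrow> bool" where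
  "sub_ideal R B J \<longleftrightarrow> J \<subseteq> B \<and> \<zero>\<^bsub>R\<^esub> \<in> J \<and> (\<forall>a\<in>J. \<forall>b\<in>J. a \<oplus>\<^bsub>R\<^esub> b \<in> J) \<and> (\<forall>a\<in>J. \<forall>b\<in>B. b \<otimes>\<^bsub>R\<^esub> a \<in> J)"

definition sub_acc :: "('a, 'b) ring_scheme \<Rightarrow> 'a set \<Rightarrow> bool" where
  "sub_acc R B \<longleftrightarrow> (\<forall>f. (\<forall>n::nat. sub_ideal R B (f n)) \<longrightarrow> (\<forall>n. f n \<subseteq> f (Suc n)) \<longrightarrow> (\<exists>N. \<forall>n\<ge>N. f n = f N))"

lemma sub_idealD:
  assumes "sub_ideal R B J"
  shows "J \<subseteq> B" "\<zero>\<^bsub>R\<^esub> \<in> J" "a \<in> J \<Longrightarrow> b \<in> J \<Longrightarrow> a \<oplus>\<^bsub>R\<^esub> b \<in> J" "a \<in> J \<Longrightarrow> c \<in> B \<Longrightarrow> c \<otimes>\<^bsub>R\<^esub> a \<in> J"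
  using assms unfolding sub_ideal_def by auto

section \<open>Hilbert's basis theorem inside a fixed ring\<close>

locale ring_ext = cring R for R (structure) +
  fixes B and x
  assumes B: "subring B R" and x: "x \<in> carrier R"
begin

lemma B_carrier: "b \<in> B \<Longrightarrow> b \<in> carrier R" using subringE(1)[OF B] by auto

lemmas B_closed = subringE(2,3,5,6,7)[OF B]

text \<open>The values at \<open>x\<close> of polynomials over \<open>B\<close> of degree less than
  \<open>n\<close>. With this strict bound \<open>P 0\<close> contains only zero, and an element of
  \<open>P (Suc n)\<close> splits off a multiple of \<open>x [^] n\<close>.\<close>

primrec P where
  "P 0 = {\<zero>}" | "P (Suc n) = {p \<oplus> b \<otimes> x [^] n |p b. p \<in> P n \<and> b \<in> B}"

lemma P_carrier: "P n \<subseteq> carrier R"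
  by (induction n) (use x B_carrier in auto)

lemma P_zero: "\<zero> \<in> P n"
proof (induction n)
  case (Suc n)
  have "\<zero> = \<zero> \<oplus> \<zero> \<otimes> x [^] n" using x by simp
  then show ?case using Suc B_closed(1) by auto
qed simp

lemma P_Suc: "P n \<subseteq> P (Suc n)"
proof
  fix p assume p: "p \<in> P n"
  then have "p = p \<oplus> \<zero> \<otimes> x [^] n" using P_carrier[of n] x by auto
  then show "p \<in> P (Suc n)" using p B_closed(1) by auto
qed

lemma P_mono: "m \<le> n \<Longrightarrow> P m \<subseteq> P n"
  by (rule lift_Suc_mono_le[of P]) (use P_Suc in auto)

lemma P_add: "p \<in> P n \<Longrightarrow> q \<in> P n \<Longrightarrow> p \<oplus> q \<in> P n"
proof (induction n arbitrary: p q)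
  case (Suc n)
  then obtain p' b q' c where pq: "p = p' \<oplus> b \<otimes> x [^] n" "q = q' \<oplus> c \<otimes> x [^] n" "p' \<in> P n" "q' \<in> P n" "b \<in> B" "c \<in> B"
    by auto
  have c: "p' \<in> carrier R" "q' \<in> carrier R" "b \<in> carrier R" "c \<in> carrier R" "x [^] n \<in> carrier R"
    using pq P_carrier[of n] B_carrier x by auto
  have "p \<oplus> q = (p' \<oplus> q') \<oplus> (b \<oplus> c) \<otimes> x [^] n"
    unfolding pq using c by (simp add: l_distr a_ac)
  then show ?case using Suc.IH[OF pq(3,4)] B_closed(5)[OF pq(5,6)] by auto
qed auto

lemma P_smult: "p \<in> P n \<Longrightarrow> b \<in> B \<Longrightarrow> b \<otimes> p \<in> P n"
proof (induction n arbitrary: p)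
  case (Suc n)
  then obtain p' c where p: "p = p' \<oplus> c \<otimes> x [^] n" "p' \<in> P n" "c \<in> B" by auto
  have c: "p' \<in> carrier R" "b \<in> carrier R" "c \<in> carrier R" "x [^] n \<in> carrier R"
    using p Suc P_carrier[of n] B_carrier x by auto
  have "b \<otimes> p = b \<otimes> p' \<oplus> (b \<otimes> c) \<otimes> x [^] n"
    unfolding p using c by (simp add: r_distr m_assoc)
  then show ?case using Suc.IH[OF p(2) Suc.prems(2)] B_closed(4)[OF Suc.prems(2) p(3)] by auto
qed (use B_carrier in auto)

lemma P_x: "p \<in> P n \<Longrightarrow> x \<otimes> p \<in> P (Suc n)"
proof (induction n arbitrary: p)
  case (Suc n)
  then obtain p' c where p: "p = p' \<oplus> c \<otimes> x [^] n" "p' \<in> P n" "c \<in> B" by auto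
  have c: "p' \<in> carrier R" "c \<in> carrier R" "x [^] n \<in> carrier R"
    using p P_carrier[of n] B_carrier x by auto
  have "x \<otimes> p = x \<otimes> p' \<oplus> c \<otimes> x [^] Suc n"
    unfolding p using c x by (simp add: r_distr m_ac)
  then show ?case using Suc.IH[OF p(2)] p(3) by auto
next
  case 0
  then show ?case using x P_zero[of 1] by simp
qed

definition ext where "ext = (\<Union>n. P n)"

lemma ext_common:
  assumes "p \<in> ext" "q \<in> ext"
  obtains n where "p \<in> P n" "q \<in> P n"
proof -
  obtain m n where "p \<in> P m" "q \<in> P n" using assms unfolding ext_def by auto
  then have "p \<in> P (max m n)" "q \<in> P (max m n)" using P_mono by (meson max.cobounded1 max.cobounded2 subsetD)+
  then show thesis using that by blast
qed

lemma ext_pow: "p \<in> P m \<Longrightarrow> x [^] n \<otimes> p \<in> P (m + n)"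
proof (induction n)
  case (Suc n)
  have "x [^] Suc n \<otimes> p = x \<otimes> (x [^] n \<otimes> p)"
    using x Suc.prems P_carrier[of m] by (auto simp: m_ac)
  then show ?case using P_x[OF Suc.IH[OF Suc.prems]] by simp
next
  case 0
  then have "p \<in> carrier R" using P_carrier by blast
  then show ?case using 0 by simp
qed

text \<open>Induction on the bound of the first factor, peeling off its top term, so that only
  products with powers of \<open>x\<close> and with scalars from \<open>B\<close> remain.\<close>

lemma ext_mult: "p \<in> P m \<Longrightarrow> q \<in> P n \<Longrightarrow> p \<otimes> q \<in> ext"
proof (induction m arbitrary: p)
  case 0
  then have "q \<in> carrier R" "p = \<zero>" using P_carrier[of n] by auto
  then have "p \<otimes> q \<in> P 0" by simp
  then show ?case unfolding ext_def by blast
next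
  case (Suc m)
  then obtain p' b where p: "p = p' \<oplus> b \<otimes> x [^] m" "p' \<in> P m" "b \<in> B" by auto
  have c: "p' \<in> carrier R" "b \<in> carrier R" "q \<in> carrier R" using p Suc.prems P_carrier B_carrier by auto
  have e: "p \<otimes> q = p' \<otimes> q \<oplus> b \<otimes> (x [^] m \<otimes> q)" unfolding p using c x by (simp add: l_distr m_assoc)
  have 1: "b \<otimes> (x [^] m \<otimes> q) \<in> ext" using P_smult[OF ext_pow[OF Suc.prems(2)] p(3)] unfolding ext_def by blast
  obtain N where "p' \<otimes> q \<in> P N" "b \<otimes> (x [^] m \<otimes> q) \<in> P N" using ext_common[OF Suc.IH[OF p(2) Suc.prems(2)] 1] .
  then show ?case unfolding e ext_def using P_add by blast
qed

lemma ext_B: "B \<subseteq> ext"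
proof
  fix b assume b: "b \<in> B"
  then have "b = \<zero> \<oplus> b \<otimes> x [^] (0::nat)" using B_carrier by simp
  then have "b \<in> P 1" using b by auto
  then show "b \<in> ext" unfolding ext_def by blast
qed

lemma ext_x: "x \<in> ext"
proof -
  have "x = x \<otimes> \<one>" using x by simp
  moreover obtain n where "\<one> \<in> P n" using ext_B B_closed(2) unfolding ext_def by blast
  ultimately show ?thesis using P_x unfolding ext_def by (metis UN_I UNIV_I)
qed

lemma ext_subring: "subring ext R"
proof (rule subringI)
  show "ext \<subseteq> carrier R" unfolding ext_def using P_carrier by auto
  show "\<one> \<in> ext" using ext_B B_closed(2) by auto
  show "\<ominus> p \<in> ext" if p: "p \<in> ext" for p
  proof -
    obtain n where n: "p \<in> P n" using p unfolding ext_def by auto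
    have "\<ominus> p = (\<ominus> \<one>) \<otimes> p" using n P_carrier[of n] by (auto simp: l_minus)
    then show ?thesis using P_smult[OF n B_closed(3)[OF B_closed(2)]] unfolding ext_def by auto
  qed
  show "p \<otimes> q \<in> ext" if "p \<in> ext" "q \<in> ext" for p q
    using that ext_mult unfolding ext_def by blast
  show "p \<oplus> q \<in> ext" if pq: "p \<in> ext" "q \<in> ext" for p q
  proof -
    obtain n where "p \<in> P n" "q \<in> P n" using ext_common[OF pq] .
    then show ?thesis unfolding ext_def using P_add by blast
  qed
qed

lemma ext_generate: "ext = generate_ring R (insert x B)"
proof
  have s: "insert x B \<subseteq> carrier R" using x B_carrier by auto
  show "generate_ring R (insert x B) \<subseteq> ext"
    using generate_ring_min_subring1[OF s ext_subring] ext_B ext_x by auto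
  have "P n \<subseteq> generate_ring R (insert x B)" for n
  proof (induction n)
    case 0
    then show ?case using zero_in_generate by auto
  next
    case (Suc n)
    have pw: "x [^] n \<in> generate_ring R (insert x B)"
    proof (induction n)
      case 0
      show ?case using generate_ring.one by simp
    next
      case (Suc n)
      then show ?case using generate_ring.eng_mult[OF Suc generate_ring.incl[of x "insert x B" R]] by simp
    qed
    show ?case
    proof
      fix p assume "p \<in> P (Suc n)"
      then obtain p' b where p: "p = p' \<oplus> b \<otimes> x [^] n" "p' \<in> P n" "b \<in> B" by auto
      then show "p \<in> generate_ring R (insert x B)"
        using Suc generate_ring.eng_add[of p' R "insert x B"] generate_ring.eng_mult[OF generate_ring.incl[of b "insert x B" R] pw]
        by auto
    qed
  qed
  then show "ext \<subseteq> generate_ring R (insert x B)" unfolding ext_def by auto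
qed

text \<open>The leading coefficient ideals of Hilbert's basis theorem. As \<open>x\<close> may be algebraic over \<open>B\<close>, an
  element of \<open>J\<close> can contribute to several of them in the same degree.\<close>

definition lead where "lead n J = {b \<in> B. \<exists>p\<in>P n. p \<oplus> b \<otimes> x [^] n \<in> J}"

lemma lead_ideal:
  assumes J: "sub_ideal R ext J"
  shows "sub_ideal R B (lead n J)"
  unfolding sub_ideal_def
proof (intro conjI ballI)
  note j = sub_idealD[OF J]
  have xn: "x [^] n \<in> carrier R" using x by simp
  show "lead n J \<subseteq> B" unfolding lead_def by auto
  have "\<zero> \<oplus> \<zero> \<otimes> x [^] n \<in> J" using j(2) x by simp
  then show "\<zero> \<in> lead n J" unfolding lead_def using B_closed(1) P_zero by blast
  fix a assume "a \<in> lead n J"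
  then obtain p where a: "a \<in> B" "p \<in> P n" "p \<oplus> a \<otimes> x [^] n \<in> J" unfolding lead_def by auto
  have ac: "a \<in> carrier R" "p \<in> carrier R" using a B_carrier P_carrier by auto
  show "b \<otimes> a \<in> lead n J" if b: "b \<in> B" for b
  proof -
    have "b \<otimes> (p \<oplus> a \<otimes> x [^] n) = b \<otimes> p \<oplus> (b \<otimes> a) \<otimes> x [^] n"
      using ac B_carrier[OF b] xn by (simp add: r_distr m_assoc)
    moreover have "b \<otimes> (p \<oplus> a \<otimes> x [^] n) \<in> J" using j(4)[OF a(3)] ext_B b by auto
    ultimately show ?thesis unfolding lead_def using P_smult[OF a(2) b] B_closed(4)[OF b a(1)] by auto
  qed
  show "a \<oplus> b \<in> lead n J" if "b \<in> lead n J" for b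
  proof -
    obtain q where b: "b \<in> B" "q \<in> P n" "q \<oplus> b \<otimes> x [^] n \<in> J" using \<open>b \<in> lead n J\<close> unfolding lead_def by auto
    have bc: "b \<in> carrier R" "q \<in> carrier R" using b B_carrier P_carrier by auto
    have "(p \<oplus> a \<otimes> x [^] n) \<oplus> (q \<oplus> b \<otimes> x [^] n) = (p \<oplus> q) \<oplus> (a \<oplus> b) \<otimes> x [^] n"
      using ac bc xn by (simp add: l_distr a_ac)
    then show ?thesis unfolding lead_def using j(3)[OF a(3) b(3)] P_add[OF a(2) b(2)] B_closed(5)[OF a(1) b(1)] by auto
  qed
qed

text \<open>Multiplication by \<open>x\<close> raises the degree and keeps the coefficient.\<close>

lemma lead_Suc:
  assumes J: "sub_ideal R ext J"
  shows "lead n J \<subseteq> lead (Suc n) J"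
proof
  fix a assume "a \<in> lead n J"
  then obtain p where a: "a \<in> B" "p \<in> P n" "p \<oplus> a \<otimes> x [^] n \<in> J" unfolding lead_def by auto
  have ac: "a \<in> carrier R" "p \<in> carrier R" using a B_carrier P_carrier by auto
  have "x \<otimes> (p \<oplus> a \<otimes> x [^] n) = x \<otimes> p \<oplus> a \<otimes> x [^] Suc n"
    using ac x by (simp add: r_distr m_ac)
  moreover have "x \<otimes> (p \<oplus> a \<otimes> x [^] n) \<in> J" using sub_idealD(4)[OF J a(3) ext_x] .
  ultimately show "a \<in> lead (Suc n) J" unfolding lead_def using a P_x[OF a(2)] by auto
qed

lemma lead_mono: "J \<subseteq> J' \<Longrightarrow> lead n J \<subseteq> lead n J'"
  unfolding lead_def by auto

text \<open>Induction on the degree bound: subtracting an element of \<open>J\<close> with the same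
  coefficient of \<open>x [^] n\<close> leaves an element of \<open>J'\<close> of smaller
  degree.\<close>

lemma lead_determines:
  assumes J: "sub_ideal R ext J" and J': "sub_ideal R ext J'" and s: "J \<subseteq> J'"
    and l: "\<And>n. lead n J' \<subseteq> lead n J"
  shows "J' \<subseteq> J"
proof -
  have "f \<in> P n \<Longrightarrow> f \<in> J' \<Longrightarrow> f \<in> J" for f n
  proof (induction n arbitrary: f)
    case 0
    then show ?case using sub_idealD(2)[OF J] by simp
  next
    case (Suc n)
    then obtain p b where f: "f = p \<oplus> b \<otimes> x [^] n" "p \<in> P n" "b \<in> B" by auto
    then have "b \<in> lead n J" using l Suc.prems unfolding lead_def by auto
    then obtain q where q: "q \<in> P n" "q \<oplus> b \<otimes> x [^] n \<in> J" unfolding lead_def by auto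
    let ?g = "q \<oplus> b \<otimes> x [^] n"
    have c: "p \<in> carrier R" "q \<in> carrier R" "b \<in> carrier R" "x [^] n \<in> carrier R" using f q P_carrier B_carrier x by auto
    \<comment> \<open>\<open>sub_ideal\<close> provides sums and multiples, so subtraction is
      addition of the multiple by minus one.\<close>
    have m1: "\<ominus> \<one> \<in> B" "\<ominus> \<one> \<in> ext" using B_closed(2,3) ext_B by auto
    have "(\<ominus> \<one>) \<otimes> ?g \<in> J" using sub_idealD(4)[OF J q(2) m1(2)] .
    have d: "f \<oplus> (\<ominus> \<one>) \<otimes> ?g = p \<oplus> (\<ominus> \<one>) \<otimes> q"
      unfolding f(1) using c by (simp add: l_minus r_distr minus_add a_ac r_neg1 r_neg2 r_neg)
    have "f \<oplus> (\<ominus> \<one>) \<otimes> ?g \<in> J'" using sub_idealD(3)[OF J' Suc.prems(2)] \<open>(\<ominus> \<one>) \<otimes> ?g \<in> J\<close> s by blast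
    moreover have "p \<oplus> (\<ominus> \<one>) \<otimes> q \<in> P n" using P_add[OF f(2) P_smult[OF q(1) m1(1)]] .
    ultimately have "f \<oplus> (\<ominus> \<one>) \<otimes> ?g \<in> J" using Suc.IH d by simp
    then have "(f \<oplus> (\<ominus> \<one>) \<otimes> ?g) \<oplus> ?g \<in> J" using sub_idealD(3)[OF J] q(2) by blast
    moreover have "(f \<oplus> (\<ominus> \<one>) \<otimes> ?g) \<oplus> ?g = f"
      unfolding f(1) using c by (simp add: l_minus a_assoc l_neg)
    ultimately show ?case by simp
  qed
  then show ?thesis using sub_idealD(1)[OF J'] unfolding ext_def by blast
qed

lemma mono_stabilizes:
  fixes f :: "nat \<Rightarrow> 'c set"
  assumes "\<And>n. f n \<subseteq> f (Suc n)" "m \<le> n"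
  shows "f m \<subseteq> f n"
  using lift_Suc_mono_le[of f m n] assms by auto

text \<open>Coefficient ideals grow both with the degree and with the index of the chain. The
  diagonal chain becomes constant at \<open>N\<close>, which settles all degrees from
  \<open>N\<close> on; the finitely many lower degrees become constant separately.\<close>

lemma ext_acc:
  assumes a: "sub_acc R B"
  shows "sub_acc R ext"
  unfolding sub_acc_def
proof (intro allI impI)
  fix J assume J: "\<forall>n::nat. sub_ideal R ext (J n)" and up: "\<forall>n. J n \<subseteq> J (Suc n)"
  have Jm: "J m \<subseteq> J n" if "m \<le> n" for m n using mono_stabilizes[of J] up that by auto
  have lm: "lead i (J m) \<subseteq> lead j (J n)" if "i \<le> j" "m \<le> n" for i j m n
    using mono_stabilizes[of "\<lambda>i. lead i (J m)" i j] lead_Suc J that lead_mono[OF Jm[OF that(2)], of j] by blast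
  have "\<exists>N. \<forall>n\<ge>N. lead n (J n) = lead N (J N)"
    using a[unfolded sub_acc_def, rule_format, of "\<lambda>n. lead n (J n)"] lead_ideal J lm by auto
  then obtain N where N: "\<And>n. n \<ge> N \<Longrightarrow> lead n (J n) = lead N (J N)" by blast
  have "\<exists>M. \<forall>n\<ge>M. lead i (J n) = lead i (J M)" for i
    using a[unfolded sub_acc_def, rule_format, of "\<lambda>n. lead i (J n)"] lead_ideal J lm by auto
  then obtain M where M: "\<And>i n. n \<ge> M i \<Longrightarrow> lead i (J n) = lead i (J (M i))" by metis
  define L where "L = Max (insert N (M ` {..<N}))"
  have L: "N \<le> L" "\<And>i. i < N \<Longrightarrow> M i \<le> L" unfolding L_def by auto
  have "J n = J L" if n: "n \<ge> L" for n
  proof -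
    have "lead i (J n) \<subseteq> lead i (J L)" for i
    proof (cases "i < N")
      case True
      then show ?thesis using M[of i n] M[of i L] L(2)[OF True] n by auto
    next
      case False
      \<comment> \<open>Both indices are raised to the diagonal position \<open>?m\<close>, where
        the diagonal chain is already constant because \<open>i\<close> is at least
        \<open>N\<close>.\<close>
      let ?m = "max i n"
      have "lead i (J n) \<subseteq> lead ?m (J ?m)" using lm by auto
      also have "\<dots> = lead N (J N)" using N[of ?m] False by auto
      also have "\<dots> \<subseteq> lead i (J L)" using lm False L by auto
      finally show ?thesis .
    qed
    then show ?thesis using lead_determines[OF _ _ Jm[OF n]] J Jm[OF n] by blast
  qed
  then show "\<exists>N. \<forall>n\<ge>N. J n = J N" by blast
qed

end

text \<open>Generators are adjoined one at a time, each step being \<open>ext_acc\<close> over the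
  subring generated so far.\<close>

lemma (in cring) generate_acc:
  assumes K: "subring K R" "sub_acc R K" and S: "finite S" "S \<subseteq> carrier R"
  shows "sub_acc R (generate_ring R (K \<union> S))"
  using S
proof (induction S rule: finite_induct)
  case empty
  have "generate_ring R K = K"
    using generate_ring_min_subring1[OF subringE(1)[OF K(1)] K(1)] generate_ring.incl[of _ K R] by auto
  then show ?case using K(2) by simp
next
  case (insert x S)
  let ?B = "generate_ring R (K \<union> S)"
  have s: "K \<union> S \<subseteq> carrier R" "K \<union> insert x S \<subseteq> carrier R" using subringE(1)[OF K(1)] insert.prems by auto
  interpret ring_ext R ?B x
    using generate_ring_is_subring[OF s(1)] insert.prems
    by (intro ring_ext.intro ring_ext_axioms.intro cring_axioms) auto
  have "generate_ring R (insert x ?B) = generate_ring R (K \<union> insert x S)"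
  proof
    have "?B \<subseteq> generate_ring R (K \<union> insert x S)"
      using generate_ring_min_subring1[OF s(1) generate_ring_is_subring[OF s(2)]] generate_ring.incl[of _ "K \<union> insert x S" R] by auto
    then show "generate_ring R (insert x ?B) \<subseteq> generate_ring R (K \<union> insert x S)"
      using generate_ring_min_subring1[of "insert x ?B", OF _ generate_ring_is_subring[OF s(2)]]
        generate_ring_incl[OF s(1)] insert.prems generate_ring.incl[of x "K \<union> insert x S" R] by auto
    have c: "insert x ?B \<subseteq> carrier R" using generate_ring_incl[OF s(1)] insert.prems by auto
    show "generate_ring R (K \<union> insert x S) \<subseteq> generate_ring R (insert x ?B)"
      using generate_ring_min_subring1[OF s(2) generate_ring_is_subring[OF c]]
        generate_ring.incl[of _ "insert x ?B" R] generate_ring.incl[of _ "K \<union> S" R] by auto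
  qed
  then show ?case using ext_acc insert.IH insert.prems unfolding ext_generate by simp
qed

text \<open>A nonzero element of the image comes from a unit of \<open>k\<close>, so an ideal of the
  image is zero or everything, and a chain can jump only once.\<close>

lemma field_image_acc:
  assumes k: "field k" and R: "cring R" and h: "h \<in> ring_hom k R"
  shows "sub_acc R (h ` carrier k)"
  unfolding sub_acc_def
proof (intro allI impI)
  interpret k: field k by fact
  interpret R: cring R by fact
  fix f assume f: "\<forall>n::nat. sub_ideal R (h ` carrier k) (f n)" and up: "\<forall>n. f n \<subseteq> f (Suc n)"
  have dich: "f n = {\<zero>\<^bsub>R\<^esub>} \<or> f n = h ` carrier k" for n
  proof (rule disjCI)
    note j = sub_idealD[OF f[rule_format, of n]]
    assume "f n \<noteq> h ` carrier k"
    have "a = \<zero>\<^bsub>R\<^esub>" if a: "a \<in> f n" for a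
    proof (rule ccontr)
      assume nz: "a \<noteq> \<zero>\<^bsub>R\<^esub>"
      obtain c where c: "c \<in> carrier k" "a = h c" using j(1) a by auto
      have "c \<noteq> \<zero>\<^bsub>k\<^esub>" using nz c ring_hom_zero[OF h k.ring_axioms R.ring_axioms] by auto
      then have u: "c \<in> Units k" using c k.field_Units by auto
      have "b \<in> f n" if b: "b \<in> h ` carrier k" for b
      proof -
        obtain d where d: "d \<in> carrier k" "b = h d" using b by auto
        have "h (d \<otimes>\<^bsub>k\<^esub> inv\<^bsub>k\<^esub> c) \<otimes>\<^bsub>R\<^esub> a \<in> f n" using j(4)[OF a] d u by auto
        moreover have "h (d \<otimes>\<^bsub>k\<^esub> inv\<^bsub>k\<^esub> c) \<otimes>\<^bsub>R\<^esub> a = b"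
          using ring_hom_mult[OF h, of "d \<otimes>\<^bsub>k\<^esub> inv\<^bsub>k\<^esub> c" c] d c u by (simp add: k.m_assoc)
        ultimately show ?thesis by simp
      qed
      then show False using j(1) \<open>f n \<noteq> h ` carrier k\<close> by auto
    qed
    then show "f n = {\<zero>\<^bsub>R\<^esub>}" using j(2) by blast
  qed
  have mono: "f m \<subseteq> f n" if "m \<le> n" for m n using lift_Suc_mono_le[of f m n] up that by auto
  show "\<exists>N. \<forall>n\<ge>N. f n = f N"
  proof (cases "\<exists>N. f N = h ` carrier k")
    case True
    then obtain N where N: "f N = h ` carrier k" by auto
    have "f n = f N" if "n \<ge> N" for n
      using mono[OF that] sub_idealD(1)[OF f[rule_format, of n]] N by auto
    then show ?thesis by auto
  next
    case False
    have "f n = {\<zero>\<^bsub>R\<^esub>}" for n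
      using False dich[of n] by blast
    then show ?thesis by simp
  qed
qed

section \<open>The spectrum and its distinguished open sets\<close>

lemma Spec_simps:
  "topo (Spec A) = topology_generated_by {{P. primeideal P A \<and> a \<notin> P} |a. a \<in> carrier A}"
  "s \<otimes>\<^bsub>sect (Spec A) W\<^esub> t = (\<lambda>p\<in>W. s p \<otimes>\<^bsub>localization A p\<^esub> t p)"
  "s \<oplus>\<^bsub>sect (Spec A) W\<^esub> t = (\<lambda>p\<in>W. s p \<oplus>\<^bsub>localization A p\<^esub> t p)"
  "\<one>\<^bsub>sect (Spec A) W\<^esub> = (\<lambda>p\<in>W. \<one>\<^bsub>localization A p\<^esub>)"
  "restr (Spec A) W W' s = restrict s W'"
  unfolding Spec_def locally_in_space_def by auto

lemma Spec_basic_open: "a \<in> carrier A \<Longrightarrow> openin (topo (Spec A)) {P. primeideal P A \<and> a \<notin> P}"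
  unfolding Spec_simps by (rule topology_generated_by_Basis) blast

text \<open>\<open>topology_generated_by\<close> makes the distinguished open sets a subbasis. They
  form a basis because those of \<open>a\<close> and \<open>b\<close> intersect in that of the
  product.\<close>

lemma Spec_basis:
  assumes A: "cring A" and O: "openin (topo (Spec A)) V" and P: "P \<in> V"
  shows "\<exists>a\<in>carrier A. a \<notin> P \<and> {P. primeideal P A \<and> a \<notin> P} \<subseteq> V"
proof -
  interpret cring A by fact
  have "generate_topology_on {{P. primeideal P A \<and> a \<notin> P} |a. a \<in> carrier A} V"
    using O unfolding Spec_simps openin_topology_generated_by_iff .
  then have "\<forall>P\<in>V. primeideal P A \<longrightarrow> (\<exists>a\<in>carrier A. a \<notin> P \<and> {P. primeideal P A \<and> a \<notin> P} \<subseteq> V)"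
  proof (induction rule: generate_topology_on.induct)
    case (Int U V)
    show ?case
    proof (intro ballI impI)
      fix P assume P: "P \<in> U \<inter> V" "primeideal P A"
      obtain a where a: "a \<in> carrier A" "a \<notin> P" "{P. primeideal P A \<and> a \<notin> P} \<subseteq> U" using Int P by blast
      obtain b where b: "b \<in> carrier A" "b \<notin> P" "{P. primeideal P A \<and> b \<notin> P} \<subseteq> V" using Int P by blast
      have "a \<otimes>\<^bsub>A\<^esub> b \<notin> P" using primeideal.I_prime[OF P(2) a(1) b(1)] a b by auto
      moreover have "{P. primeideal P A \<and> a \<otimes>\<^bsub>A\<^esub> b \<notin> P} \<subseteq> U \<inter> V"
      proof
        fix P' assume "P' \<in> {P. primeideal P A \<and> a \<otimes>\<^bsub>A\<^esub> b \<notin> P}"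
        then have P': "primeideal P' A" "a \<otimes>\<^bsub>A\<^esub> b \<notin> P'" by auto
        then have "a \<notin> P'" "b \<notin> P'"
          using ideal.I_l_closed[OF primeideal.axioms(1)[OF P'(1)] _ a(1), of b]
            ideal.I_r_closed[OF primeideal.axioms(1)[OF P'(1)] _ b(1), of a] by auto
        then show "P' \<in> U \<inter> V" using a(3) b(3) P'(1) by auto
      qed
      ultimately show "\<exists>a\<in>carrier A. a \<notin> P \<and> {P. primeideal P A \<and> a \<notin> P} \<subseteq> U \<inter> V" using a b by blast
    qed
  next
    case (UN K)
    show ?case
    proof (intro ballI impI)
      fix P assume "P \<in> \<Union>K" "primeideal P A"
      then obtain U where "U \<in> K" "P \<in> U" by auto
      then show "\<exists>a\<in>carrier A. a \<notin> P \<and> {P. primeideal P A \<and> a \<notin> P} \<subseteq> \<Union>K"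
        using UN[OF \<open>U \<in> K\<close>] \<open>primeideal P A\<close> by blast
    qed
  qed auto
  moreover have "primeideal P A" using openin_subset[OF O] P unfolding points_Spec by auto
  ultimately show ?thesis using P by blast
qed

lemma Spec_const_hom:
  assumes k: "cring k"
  shows "(\<lambda>c. \<lambda>P\<in>points (Spec k). frac k P c \<one>\<^bsub>k\<^esub>) \<in> ring_hom k (sect (Spec k) (points (Spec k)))"
proof (rule ring_hom_memI)
  interpret cring k by fact
  have pr: "prime_localization P k" if "P \<in> points (Spec k)" for P
    using that unfolding points_Spec prime_localization_def by simp
  show "(\<lambda>P\<in>points (Spec k). frac k P c \<one>\<^bsub>k\<^esub>) \<in> carrier (sect (Spec k) (points (Spec k)))" if "c \<in> carrier k" for c
    using Spec_const[OF that] .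
  show "(\<lambda>P\<in>points (Spec k). frac k P \<one>\<^bsub>k\<^esub> \<one>\<^bsub>k\<^esub>) = \<one>\<^bsub>sect (Spec k) (points (Spec k))\<^esub>"
    unfolding Spec_simps(2-5) localization_def by simp
  fix c d assume c: "c \<in> carrier k" and d: "d \<in> carrier k"
  show "(\<lambda>P\<in>points (Spec k). frac k P (c \<otimes>\<^bsub>k\<^esub> d) \<one>\<^bsub>k\<^esub>) =
    (\<lambda>P\<in>points (Spec k). frac k P c \<one>\<^bsub>k\<^esub>) \<otimes>\<^bsub>sect (Spec k) (points (Spec k))\<^esub> (\<lambda>P\<in>points (Spec k). frac k P d \<one>\<^bsub>k\<^esub>)"
    unfolding Spec_simps(2-5)
  proof (rule restrict_ext)
    fix P assume P: "P \<in> points (Spec k)"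
    interpret prime_localization P k using pr[OF P] .
    show "frac k P (c \<otimes>\<^bsub>k\<^esub> d) \<one>\<^bsub>k\<^esub> = (\<lambda>P\<in>points (Spec k). frac k P c \<one>\<^bsub>k\<^esub>) P \<otimes>\<^bsub>localization k P\<^esub> (\<lambda>P\<in>points (Spec k). frac k P d \<one>\<^bsub>k\<^esub>) P"
      using frac_mult[OF c one_notin d one_notin] P by simp
  qed
  show "(\<lambda>P\<in>points (Spec k). frac k P (c \<oplus>\<^bsub>k\<^esub> d) \<one>\<^bsub>k\<^esub>) =
    (\<lambda>P\<in>points (Spec k). frac k P c \<one>\<^bsub>k\<^esub>) \<oplus>\<^bsub>sect (Spec k) (points (Spec k))\<^esub> (\<lambda>P\<in>points (Spec k). frac k P d \<one>\<^bsub>k\<^esub>)"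
    unfolding Spec_simps(2-5)
  proof (rule restrict_ext)
    fix P assume P: "P \<in> points (Spec k)"
    interpret prime_localization P k using pr[OF P] .
    show "frac k P (c \<oplus>\<^bsub>k\<^esub> d) \<one>\<^bsub>k\<^esub> = (\<lambda>P\<in>points (Spec k). frac k P c \<one>\<^bsub>k\<^esub>) P \<oplus>\<^bsub>localization k P\<^esub> (\<lambda>P\<in>points (Spec k). frac k P d \<one>\<^bsub>k\<^esub>) P"
      using frac_add_one[OF c d] P by simp
  qed
qed

lemma scalar_hom:
  assumes k: "cring k" and X: "irr_space k X" and U: "openin (topo X) U"
  shows "scalar k X U \<in> ring_hom k (sect X U)"
proof -
  have o: "openin (topo (Spec k)) (points (Spec k))" "openin (topo X) (points X)" by auto
  have e: "preimg X (str X) (points (Spec k)) = points X"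
    using ps_mor_base[OF irr_spaceD(3)[OF X]] unfolding preimg_def by auto
  have "restr X (points X) U \<circ> (pull (str X) (points (Spec k)) \<circ> (\<lambda>c. \<lambda>P\<in>points (Spec k). frac k P c \<one>\<^bsub>k\<^esub>)) \<in> ring_hom k (sect X U)"
    by (rule ring_hom_trans[OF ring_hom_trans[OF Spec_const_hom[OF k] ps_morD(2)[OF irr_spaceD(3)[OF X] o(1), unfolded e]]
          restr_hom[OF irr_spaceD(2)[OF X] o(2) U openin_subset[OF U]]])
  moreover have "restr X (points X) U \<circ> (pull (str X) (points (Spec k)) \<circ> (\<lambda>c. \<lambda>P\<in>points (Spec k). frac k P c \<one>\<^bsub>k\<^esub>)) = scalar k X U"
    unfolding scalar_def by auto
  ultimately show ?thesis by simp
qed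

lemma finite_type_acc:
  assumes k: "field k" and X: "irr_space k X" and U: "openin (topo X) U" and S: "finite S" "S \<subseteq> carrier (sect X U)"
    and g: "generate_ring (sect X U) (scalar k X U ` carrier k \<union> S) = carrier (sect X U)"
  shows "sub_acc (sect X U) (carrier (sect X U))"
proof -
  interpret k: field k by fact
  interpret R: cring "sect X U" using presheaf_cring[OF irr_spaceD(2)[OF X] U] .
  note h = scalar_hom[OF k.cring_axioms X U]
  interpret h: ring_hom_ring k "sect X U" "scalar k X U"
    using ring_hom_ringI2[OF k.ring_axioms R.ring_axioms h] .
  have "subring (scalar k X U ` carrier k) (sect X U)"
    by (rule R.subringI) (auto intro!: imageI simp flip: h.hom_one h.hom_a_inv h.hom_mult h.hom_add)
  then show ?thesis
    using R.generate_acc[OF _ field_image_acc[OF k R.cring_axioms h] S] unfolding g by simp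
qed

section \<open>Chains of closed sets in an affine open set\<close>

lemma affine_openE:
  fixes X :: "('p, 'r, 'm) ringed_space_scheme"
  assumes "affine_open X U"
  obtains A :: "'r ring" and f g where "cring A" "ps_mor (open_subspace X U) (Spec A) f" "ps_mor (Spec A) (open_subspace X U) g"
    "mutually_inverse (open_subspace X U) (Spec A) f g"
proof -
  obtain A :: "'r ring" and f where A: "cring A" and i: "lrs_iso (open_subspace X U) (Spec A) f"
    using assms unfolding affine_open_def by (elim conjE exE)
  obtain g where f: "lrs_mor (open_subspace X U) (Spec A) f" and g: "lrs_mor (Spec A) (open_subspace X U) g"
    and m: "mutually_inverse (open_subspace X U) (Spec A) f g"
    using i unfolding lrs_iso_def mutually_inverse_def by (elim conjE exE) simp
  show thesis by (rule that[OF A lrs_mor_ps_mor[OF f] lrs_mor_ps_mor[OF g] m])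
qed

text \<open>Distinguished open sets, described by sections over \<open>U\<close> and
  \<open>inv_near\<close>. This works directly in the section ring of \<open>U\<close>, which is the
  ring whose chain condition is known, and bypasses its comparison with \<open>A\<close>.\<close>

lemma affine_open_basis:
  fixes X :: "('p, 'r, 'k) over_space"
  assumes X: "irr_space k X" and U: "affine_open X U" and V: "openin (topo X) V" "V \<subseteq> U" "x \<in> V"
  shows "\<exists>s\<in>carrier (sect X U). inv_near X x U s \<and> (\<forall>y\<in>U. inv_near X y U s \<longrightarrow> y \<in> V)"
proof -
  note pX = irr_spaceD(2)[OF X]
  have oU: "openin (topo X) U" using U unfolding affine_open_def by auto
  obtain A :: "'r ring" and f g where A: "cring A" and f: "ps_mor (open_subspace X U) (Spec A) f" and g: "ps_mor (Spec A) (open_subspace X U) g"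
    and i: "mutually_inverse (open_subspace X U) (Spec A) f g"
    by (rule affine_openE[OF U])
  note i' = i[unfolded mutually_inverse_sym[of "open_subspace X U"]]
  interpret A: cring A by fact
  let ?O = "points (Spec A)"
  have oO: "openin (topo (Spec A)) ?O" by auto
  have ptU: "points (open_subspace X U) = U" using openin_subset[OF oU] by auto
  have pfO: "pre X U f ?O = U" using ps_mor_base[OF f] ptU unfolding preimg_def by auto
  have pgU: "preimg (Spec A) g U = ?O" using ps_mor_base[OF g] ptU unfolding preimg_def by auto
  let ?V = "preimg (Spec A) g V"
  have oV: "openin (topo (Spec A)) ?V" using ps_mor_preimg[OF g] V openin_sub[OF oU] by auto
  have xU: "x \<in> U" using V by auto
  have fx: "base f x \<in> ?V"
    unfolding in_preimg using ps_mor_base[OF f, of x] mutually_inverseD(1)[OF i, of x] xU V unfolding ptU by auto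
  obtain a where a: "a \<in> carrier A" "a \<notin> base f x" "{P. primeideal P A \<and> a \<notin> P} \<subseteq> ?V"
    using Spec_basis[OF A oV fx] by blast
  let ?c = "\<lambda>P\<in>?O. frac A P a \<one>\<^bsub>A\<^esub>"
  \<comment> \<open>\<open>s\<close> is the function \<open>a/1\<close> transported to
    \<open>U\<close>. It is invertible near \<open>y\<close> exactly when \<open>a\<close> is
    outside the prime \<open>base f y\<close>: in that case \<open>1/a\<close> is an inverse on the
    distinguished open set, and conversely an inverse can be evaluated at that prime.\<close>
  define s where "s = pull f ?O ?c"
  have cc: "?c \<in> carrier (sect (Spec A) ?O)" using Spec_const[OF a(1)] .
  have s: "s \<in> carrier (sect X U)" unfolding s_def using ps_mor_pull[OF f oO cc] pfO by simp
  have gs: "pull g U s = ?c"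
    using mutually_inverseD(2)[OF i' oO cc] unfolding s_def pfO .
  have pl: "prime_localization P A" if "P \<in> ?O" for P
    using that unfolding points_Spec prime_localization_def by simp
  have iff: "inv_near X y U s \<longleftrightarrow> a \<notin> base f y" if y: "y \<in> U" for y
  proof
    have fy: "base f y \<in> ?O" using ps_mor_base[OF f] y ptU by auto
    assume "a \<notin> base f y"
    define N where "N = {P. primeideal P A \<and> a \<notin> P}"
    have N: "openin (topo (Spec A)) N" "N \<subseteq> ?O" unfolding N_def using Spec_basic_open[OF a(1)] by (auto simp: points_Spec)
    have fN: "base f y \<in> N" using fy \<open>a \<notin> base f y\<close> unfolding N_def points_Spec by auto
    let ?t = "\<lambda>P\<in>N. frac A P \<one>\<^bsub>A\<^esub> a"
    have t: "?t \<in> carrier (sect (Spec A) N)"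
      unfolding Spec_def[of A, THEN arg_cong[of _ _ sect]]
    proof (rule locally_in_space_section)
      show "openin (topology_generated_by {{P. primeideal P A \<and> a \<notin> P} |a. a \<in> carrier A}) N"
        using N(1) unfolding Spec_simps .
      show "frac A P \<one>\<^bsub>A\<^esub> a \<in> carrier (localization A P)" if "P \<in> N" for P
        using that a(1) unfolding N_def localization_def by auto
      show "(\<lambda>P. frac A P \<one>\<^bsub>A\<^esub> a) \<in> {\<lambda>P. frac A P a b |a b. a \<in> carrier A \<and> b \<in> carrier A \<and> (\<forall>P\<in>N. b \<notin> P)}"
        using a(1) unfolding N_def by blast
    qed
    have p: "restr (Spec A) ?O N ?c \<otimes>\<^bsub>sect (Spec A) N\<^esub> ?t = \<one>\<^bsub>sect (Spec A) N\<^esub>"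
      unfolding Spec_simps(2-5)
    proof (rule restrict_ext)
      fix P assume P: "P \<in> N"
      interpret prime_localization P A using pl P N by auto
      show "restrict ?c N P \<otimes>\<^bsub>localization A P\<^esub> ?t P = \<one>\<^bsub>localization A P\<^esub>"
        using frac_inverse[of a] a(1) P N(2) unfolding N_def by auto
    qed
    have rc: "restr (Spec A) ?O N ?c \<in> carrier (sect (Spec A) N)"
    proof -
      have "restr (Spec A) ?O N ?c = (\<lambda>P\<in>N. frac A P a \<one>\<^bsub>A\<^esub>)"
        unfolding Spec_simps(5) using N(2) by (intro ext) (auto simp: restrict_def)
      also have "\<dots> \<in> carrier (sect (Spec A) N)"
        unfolding Spec_def[of A, THEN arg_cong[of _ _ sect]]
      proof (rule locally_in_space_section)
        show "openin (topology_generated_by {{P. primeideal P A \<and> a \<notin> P} |a. a \<in> carrier A}) N"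
          using N(1) unfolding Spec_simps .
        show "frac A P a \<one>\<^bsub>A\<^esub> \<in> carrier (localization A P)" if "P \<in> N" for P
          using that a(1) primeideal_one[of P A] unfolding N_def localization_def by auto
        show "(\<lambda>P. frac A P a \<one>\<^bsub>A\<^esub>) \<in> {\<lambda>P. frac A P a b |a b. a \<in> carrier A \<and> b \<in> carrier A \<and> (\<forall>P\<in>N. b \<notin> P)}"
          using a(1) primeideal_one unfolding N_def by blast
      qed
      finally show ?thesis .
    qed
    let ?N = "pre X U f N"
    have oN: "openin (topo X) ?N" "?N \<subseteq> U" using ps_mor_preimg[OF f N(1)] openin_sub[OF oU] by auto
    interpret N: cring "sect X ?N" using presheaf_cring[OF pX oN(1)] .
    note hN = ps_morD(2)[OF f N(1), simplified]
    have "pull f N (restr (Spec A) ?O N ?c) \<in> Units (sect X ?N)"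
      using N.Units_memI[OF ring_hom_closed[OF hN rc] ring_hom_closed[OF hN t]] ring_hom_mult[OF hN rc t] p ring_hom_one[OF hN] by simp
    moreover have "pull f N (restr (Spec A) ?O N ?c) = restr X U ?N s"
      using ps_morD(3)[OF f oO N(1,2) cc] pfO unfolding s_def by simp
    ultimately show "inv_near X y U s" unfolding inv_near_def
      using oN fN y ptU by (auto simp: in_preimg)
  next
    have fy: "base f y \<in> ?O" using ps_mor_base[OF f] y ptU by auto
    assume "inv_near X y U s"
    then obtain N t where N: "openin (topo X) N" "y \<in> N" "N \<subseteq> U" and t: "t \<in> carrier (sect X N)"
      "restr X U N s \<in> carrier (sect X N)" "restr X U N s \<otimes>\<^bsub>sect X N\<^esub> t = \<one>\<^bsub>sect X N\<^esub>" unfolding inv_near_def Units_def by auto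
    have oN: "openin (topo (open_subspace X U)) N" "openin (topo (open_subspace X U)) U" using N oU openin_sub[OF oU] by auto
    note hN = ps_morD(2)[OF g oN(1), simplified]
    let ?N = "preimg (Spec A) g N"
    have "base f y \<in> ?N" unfolding in_preimg using fy mutually_inverseD(1)[OF i, of y] y N unfolding ptU by auto
    have "pull g N (restr X U N s) = restrict ?c ?N"
      using ps_morD(3)[OF g oN(2,1) N(3), of s] s gs unfolding pgU by (simp add: Spec_simps(5))
    then have "restrict ?c ?N \<otimes>\<^bsub>sect (Spec A) ?N\<^esub> pull g N t = \<one>\<^bsub>sect (Spec A) ?N\<^esub>"
      using ring_hom_mult[OF hN t(2,1)] ring_hom_one[OF hN] t(3) by simp
    then have "(restrict ?c ?N \<otimes>\<^bsub>sect (Spec A) ?N\<^esub> pull g N t) (base f y) = \<one>\<^bsub>sect (Spec A) ?N\<^esub> (base f y)" by simp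
    then have e: "frac A (base f y) a \<one>\<^bsub>A\<^esub> \<otimes>\<^bsub>localization A (base f y)\<^esub> pull g N t (base f y) = \<one>\<^bsub>localization A (base f y)\<^esub>"
      unfolding Spec_simps(2-5) using \<open>base f y \<in> ?N\<close> fy by simp
    interpret prime_localization "base f y" A using pl[OF fy] .
    have "pull g N t \<in> carrier (sect (Spec A) ?N)" using ring_hom_closed[OF hN t(1)] .
    then have "pull g N t (base f y) \<in> carrier (localization A (base f y))"
      using \<open>base f y \<in> ?N\<close> unfolding Spec_def locally_in_space_def by auto
    then show "a \<notin> base f y" using frac_unit_notin[OF a(1) _ e] by simp
  qed
  have "y \<in> V" if y: "y \<in> U" "inv_near X y U s" for y
  proof -
    have "base f y \<in> {P. primeideal P A \<and> a \<notin> P}"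
      using iff[OF y(1)] y ps_mor_base[OF f, of y] ptU unfolding points_Spec by auto
    then have "base g (base f y) \<in> V" using a(3) by (auto simp: in_preimg)
    then show ?thesis using mutually_inverseD(1)[OF i, of y] y unfolding ptU by auto
  qed
  then show ?thesis using s iff[OF xU] a(2) by (intro bexI[of _ s]) auto
qed

text \<open>Points of \<open>U\<close> are primes of \<open>A\<close>, and an element lying in only
  one of two primes defines an open set that separates them.\<close>

lemma affine_open_T0:
  fixes X :: "('p, 'r, 'k) over_space"
  assumes X: "irr_space k X" and U: "affine_open X U" and x: "x \<in> U" "y \<in> U" "x \<noteq> y"
  shows "\<exists>V. openin (topo X) V \<and> V \<subseteq> U \<and> (x \<in> V \<longleftrightarrow> y \<notin> V)"
proof -
  have oU: "openin (topo X) U" using U unfolding affine_open_def by auto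
  obtain A :: "'r ring" and f g where A: "cring A" and f: "ps_mor (open_subspace X U) (Spec A) f" and g: "ps_mor (Spec A) (open_subspace X U) g"
    and i: "mutually_inverse (open_subspace X U) (Spec A) f g"
    by (rule affine_openE[OF U])
  have ptU: "points (open_subspace X U) = U" using openin_subset[OF oU] by auto
  have "base f x \<noteq> base f y" using mutually_inverseD(1)[OF i, of x] mutually_inverseD(1)[OF i, of y] x unfolding ptU by metis
  moreover have p: "primeideal (base f x) A" "primeideal (base f y) A"
    using ps_mor_base[OF f, of x] ps_mor_base[OF f, of y] x ptU unfolding points_Spec by auto
  moreover have "base f x \<subseteq> carrier A" "base f y \<subseteq> carrier A"
    using ideal.Icarr[OF primeideal.axioms(1)[OF p(1)]] ideal.Icarr[OF primeideal.axioms(1)[OF p(2)]] by auto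
  ultimately obtain a where a: "a \<in> carrier A" "a \<in> base f x \<longleftrightarrow> a \<notin> base f y" by blast
  let ?V = "pre X U f {P. primeideal P A \<and> a \<notin> P}"
  have "openin (topo X) ?V" "?V \<subseteq> U" using ps_mor_preimg[OF f Spec_basic_open[OF a(1)]] openin_sub[OF oU] by auto
  moreover have "x \<in> ?V \<longleftrightarrow> y \<notin> ?V" using a(2) p x ptU by (auto simp: in_preimg)
  ultimately show ?thesis by blast
qed

text \<open>Closed sets are sent to their vanishing ideals in the section ring, and each is
  recovered from its ideal. Descending chains of closed sets thus become ascending chains of
  ideals.\<close>

lemma affine_open_dcc:
  assumes X: "irr_space k X" and U: "affine_open X U" and acc: "sub_acc (sect X U) (carrier (sect X U))"
    and Z: "\<And>n::nat. closedin (subtopology (topo X) U) (Z n)" "\<And>n. Z (Suc n) \<subseteq> Z n"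
  shows "\<exists>N. \<forall>n\<ge>N. Z n = Z N"
proof -
  note pX = irr_spaceD(2)[OF X]
  have oU: "openin (topo X) U" using U unfolding affine_open_def by auto
  have Us: "U \<subseteq> points X" using openin_subset[OF oU] .
  interpret R: cring "sect X U" using presheaf_cring[OF pX oU] .
  define I where "I Z = {s \<in> carrier (sect X U). \<forall>y\<in>Z. germ X y U s \<in> max_ideal (stalk X y)}" for Z
  have ZU: "Z n \<subseteq> U" for n using closedin_subset[OF Z(1)[of n]] by auto
  have "sub_ideal (sect X U) (carrier (sect X U)) (I (Z n))" for n
    unfolding sub_ideal_def
  proof (intro conjI ballI)
    show "I (Z n) \<subseteq> carrier (sect X U)" unfolding I_def by auto
    have id: "ideal (max_ideal (stalk X y)) (stalk X y)" and h: "germ X y U \<in> ring_hom (sect X U) (stalk X y)" if "y \<in> Z n" for y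
      using local_ring_max_ideal[OF local_presheafD(2)[OF irr_spaceD(1)[OF X]]] maximalideal.axioms(1)
        germ_hom[OF pX oU] that ZU[of n] Us by blast+
    show "\<zero>\<^bsub>sect X U\<^esub> \<in> I (Z n)"
      unfolding I_def using germ_zero[OF pX oU] additive_subgroup.zero_closed[OF ideal.axioms(1)[OF id]] ZU[of n] by auto
    show "a \<oplus>\<^bsub>sect X U\<^esub> b \<in> I (Z n)" if "a \<in> I (Z n)" "b \<in> I (Z n)" for a b
      using that ring_hom_add[OF h] additive_subgroup.a_closed[OF ideal.axioms(1)[OF id]] unfolding I_def by auto
    show "b \<otimes>\<^bsub>sect X U\<^esub> a \<in> I (Z n)" if "a \<in> I (Z n)" "b \<in> carrier (sect X U)" for a b
      using that ring_hom_mult[OF h] ideal.I_l_closed[OF id _ ring_hom_closed[OF h]] unfolding I_def by auto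
  qed
  moreover have "I (Z n) \<subseteq> I (Z (Suc n))" for n unfolding I_def using Z(2)[of n] by auto
  ultimately obtain N where N: "\<And>n. n \<ge> N \<Longrightarrow> I (Z n) = I (Z N)"
    using acc[unfolded sub_acc_def, rule_format, of "\<lambda>n. I (Z n)"] by blast
  \<comment> \<open>A point of \<open>Z m\<close> outside \<open>Z n\<close> has a distinguished
    neighbourhood that avoids \<open>Z n\<close>; the section defining it lies in the ideal of
    \<open>Z n\<close> but not in that of \<open>Z m\<close>.\<close>
  have sub: "Z m \<subseteq> Z n" if "I (Z n) \<subseteq> I (Z m)" for m n
  proof (rule ccontr)
    assume "\<not> Z m \<subseteq> Z n"
    then obtain x where x: "x \<in> Z m" "x \<notin> Z n" by auto
    have o: "openin (topo X) (U - Z n)"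
    proof -
      have "openin (subtopology (topo X) U) (topspace (subtopology (topo X) U) - Z n)" using Z(1)[of n] unfolding closedin_def by auto
      then show ?thesis using openin_sub[OF oU] Us by (simp add: Int_absorb1)
    qed
    obtain s where s: "s \<in> carrier (sect X U)" "inv_near X x U s" "\<And>y. y \<in> U \<Longrightarrow> inv_near X y U s \<Longrightarrow> y \<in> U - Z n"
      using affine_open_basis[OF X U o _, of x] x ZU[of m] by blast
    have mi: "germ X y U s \<in> max_ideal (stalk X y) \<longleftrightarrow> \<not> inv_near X y U s" if "y \<in> U" for y
      using germ_max_ideal_iff[OF pX local_presheafD(2)[OF irr_spaceD(1)[OF X]] oU that s(1)] that Us by auto
    have "s \<in> I (Z n)" unfolding I_def using s mi ZU[of n] by blast
    moreover have "s \<notin> I (Z m)" unfolding I_def using s(2) mi x(1) ZU[of m] by blast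
    ultimately show False using that by auto
  qed
  have "Z n = Z N" if "n \<ge> N" for n using sub[of n N] sub[of N n] N[OF that] by auto
  then show ?thesis by blast
qed

text \<open>Noetherian induction: the chain condition makes strict inclusion of closed sets
  well-founded, and a nonempty reducible closed set is the union of two strictly smaller
  ones.\<close>

lemma irreducible_decomposition:
  assumes dcc: "\<And>Z. (\<And>n::nat. closedin T (Z n)) \<Longrightarrow> (\<And>n. Z (Suc n) \<subseteq> Z n) \<Longrightarrow> \<exists>N. \<forall>n\<ge>N. Z n = Z N"
    and Z: "closedin T Z"
  shows "\<exists>\<C>. finite \<C> \<and> \<Union>\<C> = Z \<and> (\<forall>C\<in>\<C>. closedin T C \<and> irreducible_subset T C)"
proof -
  define r where "r = {(A, B). closedin T A \<and> closedin T B \<and> A \<subset> B}"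
  have "wf r"
    unfolding wf_iff_no_infinite_down_chain
  proof
    assume "\<exists>f. \<forall>i. (f (Suc i), f i) \<in> r"
    then obtain f where fr: "\<forall>i. (f (Suc i), f i) \<in> r" by (elim exE)
    have f: "closedin T (f i)" "f (Suc i) \<subset> f i" for i using fr[rule_format, of i] unfolding r_def by simp_all
    obtain N where N: "\<forall>n\<ge>N. f n = f N" using dcc[of f] f by blast
    have "f (Suc N) = f N" using N[rule_format, of "Suc N"] by simp
    then show False using f(2)[of N] by auto
  qed
  then show ?thesis
    using Z
  proof (induction Z rule: wf_induct_rule)
    case (less Z)
    show ?case
    proof (cases "Z = {} \<or> irreducible_subset T Z")
      case True
      then show ?thesis
      proof
        assume "Z = {}"
        then show ?thesis by (intro exI[of _ "{}"]) auto
      next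
        assume "irreducible_subset T Z"
        then show ?thesis using less.prems by (intro exI[of _ "{Z}"]) auto
      qed
    next
      case False
      then obtain A B where AB: "closedin T A" "closedin T B" "Z \<subseteq> A \<union> B" "\<not> Z \<subseteq> A" "\<not> Z \<subseteq> B"
        using closedin_subset[OF less.prems] unfolding irreducible_subset_def by blast
      have c: "closedin T (Z \<inter> A)" "closedin T (Z \<inter> B)" using AB less.prems by auto
      have "(Z \<inter> A, Z) \<in> r" "(Z \<inter> B, Z) \<in> r" unfolding r_def using c less.prems AB by auto
      then obtain \<C> \<D> where "finite \<C>" "\<Union>\<C> = Z \<inter> A" "\<forall>C\<in>\<C>. closedin T C \<and> irreducible_subset T C"
        "finite \<D>" "\<Union>\<D> = Z \<inter> B" "\<forall>C\<in>\<D>. closedin T C \<and> irreducible_subset T C"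
        using less.IH c by metis
      then show ?thesis using AB(3) by (intro exI[of _ "\<C> \<union> \<D>"]) auto
    qed
  qed
qed

lemma irreducible_subset_Union:
  assumes "finite \<C>" "\<And>C. C \<in> \<C> \<Longrightarrow> closedin T C" "irreducible_subset T S" "S \<subseteq> \<Union>\<C>"
  shows "\<exists>C\<in>\<C>. S \<subseteq> C"
  using assms
proof (induction \<C> rule: finite_induct)
  case empty
  then show ?case unfolding irreducible_subset_def by auto
next
  case (insert C \<C>)
  have "closedin T (\<Union>\<C>)" using insert by (intro closedin_Union) auto
  then have "S \<subseteq> C \<or> S \<subseteq> \<Union>\<C>" using insert.prems unfolding irreducible_subset_def by auto
  then show ?case using insert by auto
qed

text \<open>A point of codimension 1 of a proper closed subset is generic in an irreducible component of it.\<close>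

lemma finite_codim_one:
  assumes X: "irr_space k X" and U: "affine_open X U" and acc: "sub_acc (sect X U) (carrier (sect X U))"
    and E: "closedin (topo X) E" "E \<noteq> points X"
  shows "finite {x \<in> E \<inter> U. codim (topo X) x = 1}"
proof (cases "U = {}")
  case False
  have oU: "openin (topo X) U" using U unfolding affine_open_def by auto
  have Us: "U \<subseteq> points X" using openin_subset[OF oU] .
  let ?T = "subtopology (topo X) U"
  have ptU: "topspace ?T = U" using Us by auto
  have cE: "closedin ?T (E \<inter> U)" using E(1) closedin_subtopology by blast
  \<comment> \<open>The complement of \<open>E\<close> is nonempty and open, so it meets
    \<open>U\<close>. This leaves \<open>U\<close> strictly above every component of
    \<open>E \<inter> U\<close>.\<close>
  have ne: "E \<inter> U \<noteq> U"
  proof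
    assume e: "E \<inter> U = U"
    have "openin (topo X) (points X - E)" "points X - E \<noteq> {}" using E closedin_subset[OF E(1)] unfolding closedin_def by auto
    then have "U \<inter> (points X - E) \<noteq> {}" using irr_space_Int[OF X oU False] by blast
    then show False using e by auto
  qed
  obtain \<C> where \<C>: "finite \<C>" "\<Union>\<C> = E \<inter> U" "\<And>C. C \<in> \<C> \<Longrightarrow> closedin ?T C" "\<And>C. C \<in> \<C> \<Longrightarrow> irreducible_subset ?T C"
    using irreducible_decomposition[OF affine_open_dcc[OF X U acc] cE] by blast
  have Uirr: "irreducible_subset ?T U"
  proof -
    have "irreducible_subset (topo X) (points X)" using X unfolding irr_space_def by auto
    then have "irreducible_subset (topo X) (points X \<inter> U)" using irreducible_subset_open(2)[OF _ oU] False Us by blast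
    then show ?thesis unfolding irreducible_subset_subtopology using Us by (simp add: Int_absorb1)
  qed
  have cl: "?T closure_of {x} \<in> \<C>" if x: "x \<in> E \<inter> U" "codim (topo X) x = 1" for x
  proof -
    let ?K = "?T closure_of {x}"
    have xK: "x \<in> ?K" using closure_of_subset[of "{x}" ?T] x Us by auto
    have "irreducible_subset ?T {x}" using x Us unfolding irreducible_subset_def by auto
    then have Ki: "irreducible_subset ?T ?K" by (rule irreducible_subset_closure)
    have "?K \<subseteq> E \<inter> U" using closure_of_minimal[OF _ cE, of "{x}"] x by auto
    then obtain C where C: "C \<in> \<C>" "?K \<subseteq> C" using irreducible_subset_Union[OF \<C>(1,3) Ki] \<C>(2) by blast
    have CU: "C \<subset> U" using \<C>(2) C(1) ne by blast
    have "?K = C"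
    proof (rule ccontr)
      assume "?K \<noteq> C"
      then have KC: "?K \<subset> C" using C by auto
      \<comment> \<open>If the closure of \<open>x\<close> were smaller than the component
        \<open>C\<close>, it would start a chain of length two ending in \<open>U\<close>, against
        codimension one.\<close>
      let ?D = "\<lambda>i::nat. if i = 0 then ?K else if i = 1 then C else U"
      have "closedin ?T U" using closedin_topspace[of ?T] unfolding ptU .
      then have "irr_chain ?T 2 ?D"
        unfolding irr_chain_def using Ki \<C>(3,4)[OF C(1)] Uirr KC CU by (auto simp: less_2_cases_iff)
      then have "enat 2 \<le> codim ?T x" unfolding codim_def by (intro Sup_upper) auto
      then have "enat 2 \<le> 1" using codim_open_subspace[OF oU, of x] x by simp
      then show False by (simp add: one_enat_def)
    qed
    then show ?thesis using C(1) by simp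
  qed
  \<comment> \<open>Each component is counted for at most one point, since points of an affine open
    set with the same closure coincide.\<close>
  have inj: "inj_on (\<lambda>x. ?T closure_of {x}) {x \<in> E \<inter> U. codim (topo X) x = 1}"
  proof (rule inj_onI)
    fix x y assume xy: "x \<in> {x \<in> E \<inter> U. codim (topo X) x = 1}" "y \<in> {x \<in> E \<inter> U. codim (topo X) x = 1}"
      and e: "?T closure_of {x} = ?T closure_of {y}"
    have U': "x \<in> U" "y \<in> U" using xy by auto
    have "x \<in> ?T closure_of {y}" "y \<in> ?T closure_of {x}"
      using closure_of_subset[of "{x}" ?T] closure_of_subset[of "{y}" ?T] U' Us e by auto
    then have "x \<in> V \<longleftrightarrow> y \<in> V" if "openin (topo X) V" "V \<subseteq> U" for V
      using that openin_sub[OF oU] unfolding in_closure_of by auto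
    then show "x = y" using affine_open_T0[OF X U U'] by blast
  qed
  have "(\<lambda>x. ?T closure_of {x}) ` {x \<in> E \<inter> U. codim (topo X) x = 1} \<subseteq> \<C>" using cl by auto
  then show ?thesis using finite_imageD[OF finite_subset[OF _ \<C>(1)] inj] by blast
qed simp

section \<open>Additivity\<close>

definition prime_div :: "('p, 'r, 'k) over_space \<Rightarrow> 'p set" where
  "prime_div X = {x \<in> points X. codim (topo X) x = 1}"

text \<open>The isomorphism locus is a union of domains of representatives, so its complement is
  closed, and it is proper by \<open>birational_iso_somewhere\<close>. A finite cover by affine open
  sets of finite type reduces the claim to \<open>finite_codim_one\<close>.\<close>

lemma finite_exceptional:
  assumes k: "field k" and X: "k_variety k X" and Y: "k_variety k Y" and b: "birational_map k X Y \<phi>"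
  shows "finite {x \<in> prime_div X. \<not> (\<exists>y. iso_corr k X Y \<phi> x y)}"
proof -
  note iX = k_variety_irr_space[OF X] and iY = k_variety_irr_space[OF Y]
  define E where "E = {x \<in> points X. \<not> (\<exists>y. iso_corr k X Y \<phi> x y)}"
  have e: "E = points X - \<Union> {U. \<exists>f V g. (U, f) \<in> \<phi> \<and> inv_pair k X Y U f V g}"
    unfolding E_def iso_corr_def by blast
  have "openin (topo X) (\<Union> {U. \<exists>f V g. (U, f) \<in> \<phi> \<and> inv_pair k X Y U f V g})"
  proof (rule openin_Union)
    fix U assume "U \<in> {U. \<exists>f V g. (U, f) \<in> \<phi> \<and> inv_pair k X Y U f V g}"
    then obtain f V g where i: "inv_pair k X Y U f V g" by (elim CollectE exE conjE)
    show "openin (topo X) U" by (rule pmorD(1)[OF inv_pairD(1)[OF i]])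
  qed
  then have E: "closedin (topo X) E" unfolding e by (rule closedin_diff[OF closedin_topspace])
  obtain x y where xy: "iso_corr k X Y \<phi> x y" using birational_iso_somewhere[OF iX iY b] by blast
  then have "x \<in> points X - E" using iso_corr_points(1)[OF xy] unfolding E_def by auto
  then have En: "E \<noteq> points X" by auto
  obtain \<U> where \<U>: "finite \<U>" "\<Union>\<U> = points X"
    and a: "\<And>U. U \<in> \<U> \<Longrightarrow> affine_open X U \<and> (\<exists>S. finite S \<and> S \<subseteq> carrier (sect X U) \<and>
           generate_ring (sect X U) (scalar k X U ` carrier k \<union> S) = carrier (sect X U))"
  proof -
    have "finite_type k X" using X unfolding k_variety_def by simp
    then obtain \<U> where u: "finite \<U>" "\<Union>\<U> = points X"
      and a: "\<forall>U\<in>\<U>. affine_open X U \<and> (\<exists>S. finite S \<and> S \<subseteq> carrier (sect X U) \<and>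
           generate_ring (sect X U) (scalar k X U ` carrier k \<union> S) = carrier (sect X U))"
      unfolding finite_type_def by (elim conjE exE)
    show thesis by (rule that[OF u bspec[OF a]])
  qed
  have "finite {x \<in> E \<inter> U. codim (topo X) x = 1}" if U: "U \<in> \<U>" for U
  proof -
    have af: "affine_open X U" using a[OF U] by (rule conjunct1)
    obtain S where S: "finite S" "S \<subseteq> carrier (sect X U)"
      "generate_ring (sect X U) (scalar k X U ` carrier k \<union> S) = carrier (sect X U)" using a[OF U] by auto
    show ?thesis by (rule finite_codim_one[OF iX af finite_type_acc[OF k iX af[unfolded affine_open_def, THEN conjunct1] S] E En])
  qed
  then have "finite (\<Union>U\<in>\<U>. {x \<in> E \<inter> U. codim (topo X) x = 1})" using \<U>(1) by blast
  moreover have "{x \<in> prime_div X. \<not> (\<exists>y. iso_corr k X Y \<phi> x y)} \<subseteq> (\<Union>U\<in>\<U>. {x \<in> E \<inter> U. codim (topo X) x = 1})"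
    unfolding prime_div_def E_def using \<U>(2) by auto
  ultimately show ?thesis by (rule finite_subset[rotated])
qed

text \<open>\<open>R\<close> is a partial bijection, and the finite sets \<open>D1\<close>,
  \<open>D2\<close> contain all unmatched elements and are compatible with \<open>R\<close>. Matched
  elements of \<open>D1\<close> and \<open>D2\<close> are in bijection with equal weights and cancel
  in the difference, which leaves the unmatched ones.\<close>

lemma sum_exceptional_difference:
  fixes w1 :: "'a \<Rightarrow> 'g::ab_group_add" and w2 :: "'b \<Rightarrow> 'g"
  assumes fin: "finite D1" "finite D2" and sub: "D1 \<subseteq> S1" "D2 \<subseteq> S2"
    and bad: "{x \<in> S1. \<not> (\<exists>y. R x y)} \<subseteq> D1" "{y \<in> S2. \<not> (\<exists>x. R x y)} \<subseteq> D2"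
    and RD: "\<And>x y. R x y \<Longrightarrow> x \<in> D1 \<longleftrightarrow> y \<in> D2"
    and fn: "\<And>x y y'. R x y \<Longrightarrow> R x y' \<Longrightarrow> y = y'" and inj: "\<And>x x' y. R x y \<Longrightarrow> R x' y \<Longrightarrow> x = x'"
    and w: "\<And>x y. R x y \<Longrightarrow> w2 y = w1 x"
  shows "sum w2 {y \<in> S2. \<not> (\<exists>x. R x y)} - sum w1 {x \<in> S1. \<not> (\<exists>y. R x y)} = sum w2 D2 - sum w1 D1"
proof -
  let ?B1 = "{x \<in> S1. \<not> (\<exists>y. R x y)}" and ?B2 = "{y \<in> S2. \<not> (\<exists>x. R x y)}"
  define h where "h x = (THE y. R x y)" for x
  have h: "h x = y" if "R x y" for x y unfolding h_def using that fn by blast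
  have "bij_betw h (D1 - ?B1) (D2 - ?B2)"
    unfolding bij_betw_def
  proof
    show "inj_on h (D1 - ?B1)"
    proof (rule inj_onI)
      fix x x' assume "x \<in> D1 - ?B1" "x' \<in> D1 - ?B1" and e: "h x = h x'"
      then obtain y y' where "R x y" "R x' y'" using sub by blast
      then show "x = x'" using h e inj by metis
    qed
    show "h ` (D1 - ?B1) = D2 - ?B2"
    proof (intro equalityI subsetI)
      fix y assume "y \<in> h ` (D1 - ?B1)"
      then obtain x where x: "x \<in> D1 - ?B1" "y = h x" by auto
      then obtain y' where "R x y'" using sub by blast
      then show "y \<in> D2 - ?B2" using h RD x by auto
    next
      fix y assume y: "y \<in> D2 - ?B2"
      then obtain x where "R x y" using sub by blast
      then show "y \<in> h ` (D1 - ?B1)" using h RD y by (intro image_eqI[of _ _ x]) auto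
    qed
  qed
  then have "sum w2 (D2 - ?B2) = sum (\<lambda>x. w2 (h x)) (D1 - ?B1)" by (rule sum.reindex_bij_betw[symmetric])
  also have "\<dots> = sum w1 (D1 - ?B1)"
  proof (rule sum.cong[OF refl])
    fix x assume "x \<in> D1 - ?B1"
    then obtain y where "R x y" using sub by blast
    then show "w2 (h x) = w1 x" using h w by simp
  qed
  finally have "sum w2 (D2 - ?B2) = sum w1 (D1 - ?B1)" .
  moreover have "sum w2 D2 = sum w2 (D2 - ?B2) + sum w2 ?B2" "sum w1 D1 = sum w1 (D1 - ?B1) + sum w1 ?B1"
    using sum.subset_diff[OF bad(2) fin(2), of w2] sum.subset_diff[OF bad(1) fin(1), of w1] by auto
  ultimately show ?thesis by simp
qed

text \<open>A pair corresponds under \<open>rat_inv\<close> exactly when the reversed pair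
  corresponds under \<phi>, so both sums can be written with the one relation
  \<open>iso_corr k X Y \<phi>\<close>.\<close>

lemma c_inv_eq:
  assumes X: "irr_space k X" and Y: "irr_space k Y" and b: "birational_map k X Y \<phi>"
  shows "c_inv k n X Y \<phi> =
    (\<Sum>y\<in>{y \<in> prime_div Y. \<not> (\<exists>x. iso_corr k X Y \<phi> x y)}. frag_of (residue_class k (int n - 1) Y y)) -
    (\<Sum>x\<in>{x \<in> prime_div X. \<not> (\<exists>y. iso_corr k X Y \<phi> x y)}. frag_of (residue_class k (int n - 1) X x))"
proof -
  note bd = birational_mapD[OF X Y b]
  have q: "rat_inv k X Y \<phi> \<in> rational_maps k Y X" using bd(3) unfolding rat_inverse_of_def by auto
  have "iso_corr k Y X (rat_inv k X Y \<phi>) y x \<longleftrightarrow> iso_corr k X Y \<phi> x y" for x y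
    using iso_corr_inv[OF X Y b] iso_corr_inv[OF Y X bd(4)] unfolding bd(5) by blast
  then have "{y \<in> Ex_locus Y X (rat_inv k X Y \<phi>). codim (topo Y) y = 1} = {y \<in> prime_div Y. \<not> (\<exists>x. iso_corr k X Y \<phi> x y)}"
    unfolding Ex_locus_def prime_div_def iso_at_iff[OF Y X q] by auto
  moreover have "{x \<in> Ex_locus X Y \<phi>. codim (topo X) x = 1} = {x \<in> prime_div X. \<not> (\<exists>y. iso_corr k X Y \<phi> x y)}"
    unfolding Ex_locus_def prime_div_def iso_at_iff[OF X Y bd(1)] by auto
  ultimately show ?thesis unfolding c_inv_def by simp
qed

theorem lemma2p2:
  fixes k :: "'k ring" and n :: nat
    and X1 :: "('p1, 'r1, 'k) over_space"
    and X2 :: "('p2, 'r2, 'k) over_space"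
    and X3 :: "('p3, 'r3, 'k) over_space"
    and \<phi> :: "('p1, 'r1, 'p2, 'r2) rat_map"
    and \<psi> :: "('p2, 'r2, 'p3, 'r3) rat_map"
  assumes "field k"
    and "k_variety k X1" and "k_variety k X2" and "k_variety k X3"
    and "krull_dim (topo X1) = enat n"
    and "birational_map k X1 X2 \<phi>" and "birational_map k X2 X3 \<psi>"
  shows "c_inv k n X1 X3 (rat_comp k X1 X2 X3 \<psi> \<phi>) = c_inv k n X1 X2 \<phi> + c_inv k n X2 X3 \<psi>"
proof -
  note k = assms(1) and V1 = assms(2) and V2 = assms(3) and V3 = assms(4)
  note X1 = k_variety_irr_space[OF V1] and X2 = k_variety_irr_space[OF V2] and X3 = k_variety_irr_space[OF V3]
  have s: "separated k X1" "separated k X2" "separated k X3" using V1 V2 V3 unfolding k_variety_def by auto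
  note b12 = assms(6) and b23 = assms(7)
  let ?\<chi> = "rat_comp k X1 X2 X3 \<psi> \<phi>"
  note b13 = birational_comp(1)[OF X1 X2 X3 b12 b23]
  note d12 = birational_mapD[OF X1 X2 b12] and d23 = birational_mapD[OF X2 X3 b23] and d13 = birational_mapD[OF X1 X3 b13]
  have i12: "rat_inv k X1 X2 \<phi> \<in> rational_maps k X2 X1" "dominant X1 (rat_inv k X1 X2 \<phi>)"
    and i23: "rat_inv k X2 X3 \<psi> \<in> rational_maps k X3 X2" "dominant X2 (rat_inv k X2 X3 \<psi>)"
      "rat_comp k X2 X3 X2 (rat_inv k X2 X3 \<psi>) \<psi> = rat_id k X2"
    and i13: "rat_inv k X1 X3 ?\<chi> \<in> rational_maps k X3 X1"
    using d12(3) d23(3) d13(3) unfolding rat_inverse_of_def by auto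
  let ?R12 = "iso_corr k X1 X2 \<phi>" and ?R23 = "iso_corr k X2 X3 \<psi>" and ?R13 = "iso_corr k X1 X3 ?\<chi>"
  have fn: "?R12 x y \<Longrightarrow> ?R12 x y' \<Longrightarrow> y = y'" "?R23 y z \<Longrightarrow> ?R23 y z' \<Longrightarrow> z = z'" "?R13 x z \<Longrightarrow> ?R13 x z' \<Longrightarrow> z = z'"
    for x y z y' z'
    using iso_corr_unique[OF X1 X2 s(2) d12(1)] iso_corr_unique[OF X2 X3 s(3) d23(1)] iso_corr_unique[OF X1 X3 s(3) d13(1)] by blast+
  have inj: "?R12 x y \<Longrightarrow> ?R12 x' y \<Longrightarrow> x = x'" "?R23 y z \<Longrightarrow> ?R23 y' z \<Longrightarrow> y = y'" "?R13 x z \<Longrightarrow> ?R13 x' z \<Longrightarrow> x = x'"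
    for x y z x' y'
    using iso_corr_unique[OF X2 X1 s(1) i12(1) iso_corr_inv[OF X1 X2 b12] iso_corr_inv[OF X1 X2 b12]]
      iso_corr_unique[OF X3 X2 s(2) i23(1) iso_corr_inv[OF X2 X3 b23] iso_corr_inv[OF X2 X3 b23]]
      iso_corr_unique[OF X3 X1 s(1) i13 iso_corr_inv[OF X1 X3 b13] iso_corr_inv[OF X1 X3 b13]] by blast+
  have t13: "?R13 x z" if "?R12 x y" "?R23 y z" for x y z
    using iso_corr_comp[OF X1 X2 X3 d12(1,2) d23(1) that] .
  \<comment> \<open>By \<open>rat_comp_cancel\<close>, \<psi> is the composite map after the inverse
    of \<phi>: the correspondence goes from \<open>y\<close> back to \<open>x\<close> and on to
    \<open>z\<close>.\<close>
  have t23: "?R23 y z" if "?R12 x y" "?R13 x z" for x y z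
    using iso_corr_comp[OF X2 X1 X3 i12 d13(1) iso_corr_inv[OF X1 X2 b12 that(1)] that(2)]
    unfolding rat_comp_cancel[OF X1 X2 X3 b12 d23(1,2)] .
  \<comment> \<open>In the same way \<phi> is the composite map followed by the inverse of \<psi>,
    which supplies the remaining case of the two-out-of-three rule.\<close>
  have "rat_comp k X1 X3 X2 (rat_inv k X2 X3 \<psi>) ?\<chi> = \<phi>"
    using rat_comp_assoc[OF X1 X2 X3 X2 d12(1,2) d23(1,2) i23(1)] rat_comp_id_left[OF X1 X2 d12(1,2)] i23(3) by simp
  then have t12: "?R12 x y" if "?R13 x z" "?R23 y z" for x y z
    using iso_corr_comp[OF X1 X3 X2 d13(1,2) i23(1) that(1) iso_corr_inv[OF X2 X3 b23 that(2)]] by simp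
  have S: "?R12 x y \<Longrightarrow> x \<in> prime_div X1 \<longleftrightarrow> y \<in> prime_div X2" "?R23 y z \<Longrightarrow> y \<in> prime_div X2 \<longleftrightarrow> z \<in> prime_div X3"
    "?R13 x z \<Longrightarrow> x \<in> prime_div X1 \<longleftrightarrow> z \<in> prime_div X3" for x y z
    using iso_corr_codim[OF X1 X2] iso_corr_codim[OF X2 X3] iso_corr_codim[OF X1 X3] iso_corr_points
    unfolding prime_div_def by (metis (mono_tags, lifting) mem_Collect_eq)+
  define M where "M x y z \<longleftrightarrow> ?R12 x y \<and> ?R23 y z \<and> ?R13 x z" for x y z
  define D1 where "D1 = {x \<in> prime_div X1. \<not> (\<exists>y z. M x y z)}"
  define D2 where "D2 = {y \<in> prime_div X2. \<not> (\<exists>x z. M x y z)}"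
  define D3 where "D3 = {z \<in> prime_div X3. \<not> (\<exists>x y. M x y z)}"
  have swap: "iso_corr k X2 X1 (rat_inv k X1 X2 \<phi>) y x \<longleftrightarrow> ?R12 x y"
    "iso_corr k X3 X2 (rat_inv k X2 X3 \<psi>) z y \<longleftrightarrow> ?R23 y z"
    "iso_corr k X3 X1 (rat_inv k X1 X3 ?\<chi>) z x \<longleftrightarrow> ?R13 x z" for x y z
    using iso_corr_inv[OF X1 X2 b12, of x y] iso_corr_inv[OF X2 X1 d12(4), of y x]
      iso_corr_inv[OF X2 X3 b23, of y z] iso_corr_inv[OF X3 X2 d23(4), of z y]
      iso_corr_inv[OF X1 X3 b13, of x z] iso_corr_inv[OF X3 X1 d13(4), of z x]
    unfolding d12(5) d23(5) d13(5) by blast+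
  note fin = finite_exceptional[OF k V1 V2 b12] finite_exceptional[OF k V2 V1 d12(4)]
    finite_exceptional[OF k V2 V3 b23] finite_exceptional[OF k V3 V2 d23(4)]
    finite_exceptional[OF k V1 V3 b13] finite_exceptional[OF k V3 V1 d13(4)]
  note fin = fin[unfolded swap]
  \<comment> \<open>A divisor matched by both maps that start at it lies in a triple of
    \<open>M\<close>, since the third relation follows. Hence \<open>D1\<close> is covered by two
    finite exceptional sets; \<open>D2\<close> and \<open>D3\<close> are treated alike.\<close>
  have "D1 \<subseteq> {x \<in> prime_div X1. \<not> (\<exists>y. ?R12 x y)} \<union> {x \<in> prime_div X1. \<not> (\<exists>z. ?R13 x z)}"
    unfolding D1_def M_def using t23 by blast
  then have fD1: "finite D1" using fin by (meson finite_UnI finite_subset)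
  have "D2 \<subseteq> {y \<in> prime_div X2. \<not> (\<exists>x. ?R12 x y)} \<union> {y \<in> prime_div X2. \<not> (\<exists>z. ?R23 y z)}"
    unfolding D2_def M_def using t13 by blast
  then have fD2: "finite D2" using fin by (meson finite_UnI finite_subset)
  have "D3 \<subseteq> {z \<in> prime_div X3. \<not> (\<exists>x. ?R13 x z)} \<union> {z \<in> prime_div X3. \<not> (\<exists>y. ?R23 y z)}"
    unfolding D3_def M_def using t12 by blast
  then have fD3: "finite D3" using fin by (meson finite_UnI finite_subset)
  \<comment> \<open>By \<open>fn\<close> and \<open>inj\<close>, any triple through \<open>x\<close>
    or through \<open>y\<close> must contain the matched pair, so \<open>x\<close> belongs to a
    triple exactly when \<open>y\<close> does.\<close>
  have r12: "x \<in> D1 \<longleftrightarrow> y \<in> D2" if r: "?R12 x y" for x y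
    using S(1)[OF r] fn(1)[OF r] inj(1)[OF r] r unfolding D1_def D2_def M_def by blast
  have r23: "y \<in> D2 \<longleftrightarrow> z \<in> D3" if r: "?R23 y z" for y z
    using S(2)[OF r] fn(2)[OF r] inj(2)[OF r] r unfolding D2_def D3_def M_def by blast
  have r13: "x \<in> D1 \<longleftrightarrow> z \<in> D3" if r: "?R13 x z" for x z
    using S(3)[OF r] fn(3)[OF r] inj(3)[OF r] r unfolding D1_def D3_def M_def by blast
  let ?w1 = "\<lambda>x. frag_of (residue_class k (int n - 1) X1 x)" and ?w2 = "\<lambda>y. frag_of (residue_class k (int n - 1) X2 y)"
    and ?w3 = "\<lambda>z. frag_of (residue_class k (int n - 1) X3 z)"
  have "c_inv k n X1 X2 \<phi> = sum ?w2 D2 - sum ?w1 D1"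
    unfolding c_inv_eq[OF X1 X2 b12]
    by (rule sum_exceptional_difference[OF fD1 fD2])
      (use r12 fn(1) inj(1) iso_corr_residue_class[OF X1 X2] in \<open>auto simp: D1_def D2_def M_def\<close>)
  moreover have "c_inv k n X2 X3 \<psi> = sum ?w3 D3 - sum ?w2 D2"
    unfolding c_inv_eq[OF X2 X3 b23]
    by (rule sum_exceptional_difference[OF fD2 fD3])
      (use r23 fn(2) inj(2) iso_corr_residue_class[OF X2 X3] in \<open>auto simp: D2_def D3_def M_def\<close>)
  moreover have "c_inv k n X1 X3 ?\<chi> = sum ?w3 D3 - sum ?w1 D1"
    unfolding c_inv_eq[OF X1 X3 b13]
    by (rule sum_exceptional_difference[OF fD1 fD3])
      (use r13 fn(3) inj(3) iso_corr_residue_class[OF X1 X3] in \<open>auto simp: D1_def D3_def M_def\<close>)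
  ultimately show ?thesis by simp
qed

end
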